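(* Let $\sigma\in\{\mathbf i,\mathbf e\}$. The Bergman operator $\mathcal B_{\mathcal M}^\sigma$ projects the Hilbert space $L^2(\mathbb B^\sigma,\mathcal A_2)$ orthogonally onto the subspace $\operatorname{Vec}\mathcal M^\sigma$. Thus, for $f\in L^2(\mathbb B^\sigma,\mathcal A_2)$, $\mathcal B_{\mathcal M}^\sigma[f]=f$ if and only if $f\in\operatorname{Vec}\mathcal M^\sigma$. If $f\in L^2(\mathbb B^\sigma,\mathcal A_2)$ is harmonic, then $\mathcal B_{\mathcal M}^\sigma[f]=0$ if and only if $f\in\mathcal N^\sigma$.
   Context: $\mathbb B^{\mathbf i}=\{x\in\mathbb R^3: |x|<1\}$, $\mathbb B^{\mathbf e}=\{x\in\mathbb R^3:|x|>1\}$; $J^{\mathbf i}=\{n\in\mathbb Z:n\ge0\}$, $J^{\mathbf e}=\{n\in\mathbb Z:n\le-2\}$. Write $x=(x_0,x_1,x_2)=(\rho\cos\theta,\rho\sin\theta\cos\phi,\rho\sin\theta\sin\phi)$. Spherical harmonics: $U_{n,m}^{\pm}(x)=\rho^nP_n^m(\cos\theta)\Phi_m^{\pm}(\phi)$, $\Phi_m^+(\phi)=\cos(m\phi)$, $\Phi_m^-(\phi)=\sin(m\phi)$, $m\ge0$. For $n\ge0$, $P_n^m(t)=(-1)^m(1-t^2)^{m/2}\frac{d^m}{dt^m}P_n(t)$ ($P_n$ the Legendre polynomial); for $n<0$, $P_n^m=P_{-n-1}^m$. $\mathcal A=\{a_0+a_1e_1+a_2e_2: a_i\in\mathbb R\}$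 is the real subspace of the quaternions with zero $e_3$-component, with conjugation $\overline{a_0+a_1e_1+a_2e_2}=a_0-a_1e_1-a_2e_2$; $\mathcal A_2=\mathbb Re_1+\mathbb Re_2\subseteq\mathcal A$. For $f=f_0+f_1e_1+f_2e_2$, $\operatorname{Vec}f=f_1e_1+f_2e_2$. Let $\overline\partial=\frac{\partial}{\partial x_0}+e_1\frac{\partial}{\partial x_1}+e_2\frac{\partial}{\partial x_2}$ and $\partial=\frac{\partial}{\partial x_0}-e_1\frac{\partial}{\partial x_1}-e_2\frac{\partial}{\partial x_2}$. A smooth $\mathcal A$-valued $f$ is monogenic if $\overline\partial f=0$. $\mathcal M^\sigma$ is the space of $\mathcal A$-valued monogenic functions in $L^2(\mathbb B^\sigma)$, $\overline{\mathcal M}^\sigma=\{\overline f:f\in\mathcal M^\sigma\}$, and $\operatorname{Vec}\mathcal M^\sigma=\{\operatorname{Vec}f:f\in\mathcal M^\sigma\}$. The inner product is $\langle f,g\rangle_\sigma=\int_{\mathbb B^\sigma}(f_0g_0+f_1g_1+f_2g_2)\,dV$. $\mathcal N^\sigma$ is the space of contragenic functions: $\mathcal A$-valued harmonic (componentwise) functions in $L^2(\mathbb B^\sigma)$ orthogonal to all of $\mathcal M^\sigma+\overline{\mathcal M}^\sigma$. Let $X_{n,m}^\pm=\partial U_{n+1,m}^\pm$ for $n\in J^\sigma$ and $0\le m\le n+1$ ($\sigma=\mathbf i$), respectively $0\le m\le -n-2$ ($\sigma=\mathbf e$), the superscript "$-$" being excluded when $m=0$. Let $\{\psi_k\}$ be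 the family of all normalized functions $\operatorname{Vec}X_{n,m}^\pm/\|\operatorname{Vec}X_{n,m}^\pm\|_\sigma$ on $\mathbb B^\sigma$ over these indices, omitting those with $\operatorname{Vec}X_{n,m}^\pm=0$. Write $\psi_k=\psi_{1,k}e_1+\psi_{2,k}e_2$. For $f=f_1e_1+f_2e_2\in L^2(\mathbb B^\sigma,\mathcal A_2)$ and $x\in\mathbb B^\sigma$ define $$\mathcal B_{\mathcal M}^\sigma[f](x)=\sum_{i=1}^2\left(\int_{\mathbb B^\sigma}\sum_{j=1}^2 B_{ij}(x,y)f_j(y)\,dV_y\right)e_i,\qquad B_{ij}(x,y)=\sum_k\psi_{i,k}(x)\psi_{j,k}(y).$$ *)

theory Defs
  imports "HOL-Analysis.Analysis" "HOL-Computational_Algebra.Polynomial"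
begin

section \<open>Quaternions and the reduced quaternions\<close>

text \<open>
  Coordinates are numbered from 0: the index types 3 and 4 are integers modulo 3 and 4, so that
  \<open>0 = 3\<close> in type 3 and \<open>0 = 4\<close> in type 4 (library facts such as \<open>UNIV_3\<close> enumerate \<open>1, 2, 3\<close>).
  A quaternion \<open>q\<close> is \<open>q$0 + q$1 e1 + q$2 e2 + q$3 e3\<close>.
\<close>

type_synonym quat = "real^4"

abbreviation unitq :: "4 \<Rightarrow> quat" where
  "unitq i \<equiv> axis i 1"

definition quat :: "real \<Rightarrow> real \<Rightarrow> real \<Rightarrow> real \<Rightarrow> quat" where
  "quat a b c d = a *\<^sub>R unitq 0 + b *\<^sub>R unitq 1 + c *\<^sub>R unitq 2 + d *\<^sub>R unitq 3"

definition qmult :: "quat \<Rightarrow> quat \<Rightarrow> quat" (infixl \<open>\<star>\<close> 70) where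
  "p \<star> q = quat
     (p$0 * q$0 - p$1 * q$1 - p$2 * q$2 - p$3 * q$3)
     (p$0 * q$1 + p$1 * q$0 + p$2 * q$3 - p$3 * q$2)
     (p$0 * q$2 - p$1 * q$3 + p$2 * q$0 + p$3 * q$1)
     (p$0 * q$3 + p$1 * q$2 - p$2 * q$1 + p$3 * q$0)"

definition reduced_quat :: "quat set" where
  "reduced_quat = {q. q$3 = 0}"

definition reduced_vec :: "quat set" where
  "reduced_vec = {a *\<^sub>R unitq 1 + b *\<^sub>R unitq 2 | a b. True}"

definition qconj :: "quat \<Rightarrow> quat" where
  "qconj q = quat (q$0) (- q$1) (- q$2) (- q$3)"

definition qvec :: "quat \<Rightarrow> quat" where
  "qvec q = q$1 *\<^sub>R unitq 1 + q$2 *\<^sub>R unitq 2"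

lemma quat_nth [simp]:
  "quat a b c d $ 0 = a" "quat a b c d $ 1 = b" "quat a b c d $ 2 = c" "quat a b c d $ 3 = d"
  by (simp_all add: quat_def axis_def)

lemma quat_eq_iff: "p = q \<longleftrightarrow> p$0 = q$0 \<and> p$1 = q$1 \<and> p$2 = q$2 \<and> p$3 = (q$3 :: real)"
  for p q :: quat
proof -
  have "r$4 = r$0" for r :: quat
    by (rule arg_cong[where f = "($) r"]) simp
  then show ?thesis by (auto simp: vec_eq_iff forall_4)
qed

lemma qmult_units:
  "unitq 1 \<star> unitq 1 = - unitq 0" "unitq 2 \<star> unitq 2 = - unitq 0" "unitq 3 \<star> unitq 3 = - unitq 0"
  "unitq 1 \<star> unitq 2 = unitq 3" "unitq 2 \<star> unitq 3 = unitq 1" "unitq 3 \<star> unitq 1 = unitq 2"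
  "unitq 2 \<star> unitq 1 = - unitq 3" "unitq 3 \<star> unitq 2 = - unitq 1" "unitq 1 \<star> unitq 3 = - unitq 2"
  "unitq 0 \<star> q = q" "q \<star> unitq 0 = q"
  by (simp_all add: qmult_def quat_eq_iff) (simp_all add: axis_def)


section \<open>Partial derivatives, monogenic and harmonic functions\<close>

definition partial :: "3 \<Rightarrow> (real^3 \<Rightarrow> 'a::real_normed_vector) \<Rightarrow> real^3 \<Rightarrow> 'a" where
  "partial i f x = vector_derivative (\<lambda>t. f (x + t *\<^sub>R axis i 1)) (at 0)"

text \<open>Class \<open>C\<^sup>k\<close>; meaningful for open \<open>S\<close>, as partial derivatives are not taken within \<open>S\<close>.\<close>

fun cont_diff_on :: "nat \<Rightarrow> (real^3) set \<Rightarrow> (real^3 \<Rightarrow> 'a::real_normed_vector) \<Rightarrow> bool" where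
  "cont_diff_on 0 S f \<longleftrightarrow> continuous_on S f"
| "cont_diff_on (Suc k) S f \<longleftrightarrow> continuous_on S f \<and>
     (\<forall>i. (\<forall>x\<in>S. (\<lambda>t. f (x + t *\<^sub>R axis i 1)) differentiable (at 0)) \<and>
          cont_diff_on k S (partial i f))"

definition smooth_on :: "(real^3) set \<Rightarrow> (real^3 \<Rightarrow> 'a::real_normed_vector) \<Rightarrow> bool" where
  "smooth_on S f \<longleftrightarrow> (\<forall>k. cont_diff_on k S f)"

definition harmonic_on :: "(real^3) set \<Rightarrow> (real^3 \<Rightarrow> 'a::real_normed_vector) \<Rightarrow> bool" where
  "harmonic_on S f \<longleftrightarrow> cont_diff_on 2 S f \<and> (\<forall>x\<in>S. (\<Sum>i\<in>UNIV. partial i (partial i f) x) = 0)"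

definition dbar :: "(real^3 \<Rightarrow> quat) \<Rightarrow> real^3 \<Rightarrow> quat" where
  "dbar f x = partial 0 f x + unitq 1 \<star> partial 1 f x + unitq 2 \<star> partial 2 f x"

definition dconj :: "(real^3 \<Rightarrow> quat) \<Rightarrow> real^3 \<Rightarrow> quat" where
  "dconj f x = partial 0 f x - unitq 1 \<star> partial 1 f x - unitq 2 \<star> partial 2 f x"

definition monogenic_on :: "(real^3) set \<Rightarrow> (real^3 \<Rightarrow> quat) \<Rightarrow> bool" where
  "monogenic_on S f \<longleftrightarrow>
     (\<forall>x\<in>S. f x \<in> reduced_quat) \<and> smooth_on S f \<and> (\<forall>x\<in>S. dbar f x = 0)"


section \<open>Function spaces on the ball and its exterior\<close>

text \<open>
  Functions are total on \<open>real^3\<close>, but only their values on \<open>dom3 \<sigma>\<close> matter.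
  Elements of \<open>L\<^sup>2\<close> are represented by functions; equality in \<open>L\<^sup>2\<close> is \<open>eq_L2\<close>.
\<close>

datatype side = Interior | Exterior

fun dom3 :: "side \<Rightarrow> (real^3) set" where
  "dom3 Interior = {x. norm x < 1}"
| "dom3 Exterior = {x. norm x > 1}"

definition L2_space :: "side \<Rightarrow> quat set \<Rightarrow> (real^3 \<Rightarrow> quat) set" where
  "L2_space \<sigma> A = {f. (\<forall>x\<in>dom3 \<sigma>. f x \<in> A) \<and> f \<in> borel_measurable (lebesgue_on (dom3 \<sigma>)) \<and>
     integrable (lebesgue_on (dom3 \<sigma>)) (\<lambda>x. (norm (f x))\<^sup>2)}"

definition eq_L2 :: "side \<Rightarrow> (real^3 \<Rightarrow> quat) \<Rightarrow> (real^3 \<Rightarrow> quat) \<Rightarrow> bool" where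
  "eq_L2 \<sigma> f g \<longleftrightarrow> (AE x in lebesgue_on (dom3 \<sigma>). f x = g x)"

definition mem_L2 :: "side \<Rightarrow> (real^3 \<Rightarrow> quat) \<Rightarrow> (real^3 \<Rightarrow> quat) set \<Rightarrow> bool" where
  "mem_L2 \<sigma> f V \<longleftrightarrow> (\<exists>g\<in>V. eq_L2 \<sigma> f g)"

definition inner_L2 :: "side \<Rightarrow> (real^3 \<Rightarrow> quat) \<Rightarrow> (real^3 \<Rightarrow> quat) \<Rightarrow> real" where
  "inner_L2 \<sigma> f g =
     (LINT x|lebesgue_on (dom3 \<sigma>). f x $ 0 * g x $ 0 + f x $ 1 * g x $ 1 + f x $ 2 * g x $ 2)"

definition norm_L2 :: "side \<Rightarrow> (real^3 \<Rightarrow> quat) \<Rightarrow> real" where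
  "norm_L2 \<sigma> f = sqrt (inner_L2 \<sigma> f f)"

definition monogenic_space :: "side \<Rightarrow> (real^3 \<Rightarrow> quat) set" where
  "monogenic_space \<sigma> = {f \<in> L2_space \<sigma> reduced_quat. monogenic_on (dom3 \<sigma>) f}"

definition conj_monogenic_space :: "side \<Rightarrow> (real^3 \<Rightarrow> quat) set" where
  "conj_monogenic_space \<sigma> = {\<lambda>x. qconj (f x) | f. f \<in> monogenic_space \<sigma>}"

definition vec_monogenic_space :: "side \<Rightarrow> (real^3 \<Rightarrow> quat) set" where
  "vec_monogenic_space \<sigma> = {\<lambda>x. qvec (f x) | f. f \<in> monogenic_space \<sigma>}"

definition contragenic_space :: "side \<Rightarrow> (real^3 \<Rightarrow> quat) set" where
  "contragenic_space \<sigma> = {f \<in> L2_space \<sigma> reduced_quat. harmonic_on (dom3 \<sigma>) f \<and>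
     (\<forall>g\<in>monogenic_space \<sigma>. \<forall>h\<in>conj_monogenic_space \<sigma>. inner_L2 \<sigma> f (\<lambda>x. g x + h x) = 0)}"

definition orthogonal_projection_onto ::
    "side \<Rightarrow> (real^3 \<Rightarrow> quat) set \<Rightarrow> (real^3 \<Rightarrow> quat) set \<Rightarrow> ((real^3 \<Rightarrow> quat) \<Rightarrow> real^3 \<Rightarrow> quat) \<Rightarrow> bool"
  where
  "orthogonal_projection_onto \<sigma> H V P \<longleftrightarrow>
     V \<subseteq> H \<and> (\<forall>u\<in>V. \<forall>v\<in>V. \<forall>a b. (\<lambda>x. a *\<^sub>R u x + b *\<^sub>R v x) \<in> V) \<and>
     (\<forall>f\<in>H. P f \<in> H \<and> mem_L2 \<sigma> (P f) V \<and> (\<forall>v\<in>V. inner_L2 \<sigma> (\<lambda>x. f x - P f x) v = 0)) \<and>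
     (\<forall>v\<in>V. \<exists>f\<in>H. eq_L2 \<sigma> (P f) v)"


section \<open>Solid spherical harmonics\<close>

text \<open>Rodrigues' formula.\<close>

definition legendre_poly :: "nat \<Rightarrow> real poly" where
  "legendre_poly n = smult (1 / (2 ^ n * fact n)) ((pderiv ^^ n) ([:-1, 0, 1:] ^ n))"

text \<open>\<open>sqrt (1 - t\<^sup>2) ^ m\<close> is \<open>(1 - t\<^sup>2)\<close> to the power \<open>m/2\<close>; with \<open>powr\<close> it would be 0 for \<open>t\<^sup>2 = 1\<close>, \<open>m = 0\<close>.\<close>

definition assoc_legendre :: "int \<Rightarrow> nat \<Rightarrow> real \<Rightarrow> real" where
  "assoc_legendre n m t = (-1) ^ m * sqrt (1 - t\<^sup>2) ^ m *
     poly ((pderiv ^^ m) (legendre_poly (nat (if n \<ge> 0 then n else - n - 1)))) t"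

datatype parity = Plus | Minus

fun azimuthal :: "nat \<Rightarrow> parity \<Rightarrow> real \<Rightarrow> real" where
  "azimuthal m Plus \<phi> = cos (real m * \<phi>)"
| "azimuthal m Minus \<phi> = sin (real m * \<phi>)"

text \<open>
  Here \<open>cos \<theta> = x$0 / norm x\<close>. The values chosen on the axis and at the origin,
  where the angles are not determined, are the ones that \<open>solid_harmonic_spherical\<close> requires.
\<close>

definition solid_harmonic :: "int \<Rightarrow> nat \<Rightarrow> parity \<Rightarrow> real^3 \<Rightarrow> real" where
  "solid_harmonic n m s x =
     norm x powi n * assoc_legendre n m (x$0 / norm x) * azimuthal m s (Arg (Complex (x$1) (x$2)))"

lemma norm_real3: "norm x = sqrt ((x$0)\<^sup>2 + (x$1)\<^sup>2 + (x$2)\<^sup>2)" for x :: "real^3"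
proof -
  have "x$3 = x$0"
    by (rule arg_cong[where f = "($) x"]) simp
  then show ?thesis by (simp add: norm_vec_def L2_set_def sum_3 add_ac)
qed

lemma solid_harmonic_spherical:
  fixes x :: "real^3"
  assumes "\<rho> \<ge> 0" "0 \<le> \<theta>" "\<theta> \<le> pi"
    and x: "x$0 = \<rho> * cos \<theta>" "x$1 = \<rho> * sin \<theta> * cos \<phi>" "x$2 = \<rho> * sin \<theta> * sin \<phi>"
  shows "solid_harmonic n m s x = \<rho> powi n * assoc_legendre n m (cos \<theta>) * azimuthal m s \<phi>"
proof -
  have "(x$0)\<^sup>2 + (x$1)\<^sup>2 + (x$2)\<^sup>2 =
      \<rho>\<^sup>2 * ((cos \<theta>)\<^sup>2 + (sin \<theta>)\<^sup>2 * ((cos \<phi>)\<^sup>2 + (sin \<phi>)\<^sup>2))"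
    unfolding x by (simp only: power_mult_distrib distrib_left mult.assoc add.assoc)
  then have norm: "norm x = \<rho>"
    using \<open>\<rho> \<ge> 0\<close> by (simp add: norm_real3)
  have azim0: "azimuthal 0 s a = azimuthal 0 s b" for a b
    by (cases s) auto
  have assoc0: "assoc_legendre 0 k t = (if k = 0 then 1 else 0)" for k t
  proof -
    have "(pderiv ^^ k) [:1::real:] = (if k = 0 then [:1:] else 0)"
      by (induction k) (auto simp: pderiv_pCons)
    then show ?thesis by (simp add: assoc_legendre_def legendre_poly_def one_pCons)
  qed
  consider "\<rho> = 0" | "\<rho> > 0" "sin \<theta> = 0" | "\<rho> > 0" "sin \<theta> > 0"
    using assms(1-3) sin_ge_zero[of \<theta>] by fastforce
  then show ?thesis
  proof cases
    case 1
    then show ?thesis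
      using norm azim0 by (cases "n = 0") (auto simp: solid_harmonic_def assoc0)
  next
    case 2
    then have "(cos \<theta>)\<^sup>2 = 1"
      using sin_cos_squared_add[of \<theta>] by simp
    then have "m \<noteq> 0 \<Longrightarrow> assoc_legendre n m (cos \<theta>) = 0"
      by (simp add: assoc_legendre_def)
    then show ?thesis
      using 2 norm x(1) azim0 by (cases "m = 0") (auto simp: solid_harmonic_def)
  next
    case 3
    define z where "z = Complex (x$1) (x$2)"
    have z: "z = rcis (\<rho> * sin \<theta>) \<phi>"
      by (simp add: z_def complex_eq_iff x)
    then have "cis (Arg z) = cis \<phi>"
      using 3 by (simp add: cis_Arg rcis_def sgn_eq norm_mult)
    then have "cis (real m * Arg z) = cis (real m * \<phi>)"
      by (metis Complex.DeMoivre)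
    then have "azimuthal m s (Arg z) = azimuthal m s \<phi>"
      by (cases s) (auto simp: complex_eq_iff)
    then show ?thesis
      using 3 norm x(1) by (simp add: solid_harmonic_def z_def)
  qed
qed


section \<open>The Bergman operator\<close>

definition monogenic_basis :: "int \<Rightarrow> nat \<Rightarrow> parity \<Rightarrow> real^3 \<Rightarrow> quat" where
  "monogenic_basis n m s = dconj (\<lambda>x. solid_harmonic (n + 1) m s x *\<^sub>R unitq 0)"

fun degree_set :: "side \<Rightarrow> int set" where
  "degree_set Interior = {n. n \<ge> 0}"
| "degree_set Exterior = {n. n \<le> -2}"

fun max_order :: "side \<Rightarrow> int \<Rightarrow> int" where
  "max_order Interior n = n + 1"
| "max_order Exterior n = - n - 2"

definition basis_index :: "side \<Rightarrow> (int \<times> nat \<times> parity) set" where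
  "basis_index \<sigma> = {(n, m, s). n \<in> degree_set \<sigma> \<and> int m \<le> max_order \<sigma> n \<and> \<not> (m = 0 \<and> s = Minus) \<and>
     (\<exists>x\<in>dom3 \<sigma>. qvec (monogenic_basis n m s x) \<noteq> 0)}"

fun vec_basis :: "side \<Rightarrow> int \<times> nat \<times> parity \<Rightarrow> real^3 \<Rightarrow> quat" where
  "vec_basis \<sigma> (n, m, s) x =
     (1 / norm_L2 \<sigma> (\<lambda>y. qvec (monogenic_basis n m s y))) *\<^sub>R qvec (monogenic_basis n m s x)"

definition bergman_kernel :: "side \<Rightarrow> 4 \<Rightarrow> 4 \<Rightarrow> real^3 \<Rightarrow> real^3 \<Rightarrow> real" where
  "bergman_kernel \<sigma> i j x y = (\<Sum>\<^sub>\<infinity>k\<in>basis_index \<sigma>. vec_basis \<sigma> k x $ i * vec_basis \<sigma> k y $ j)"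

definition bergman_op :: "side \<Rightarrow> (real^3 \<Rightarrow> quat) \<Rightarrow> real^3 \<Rightarrow> quat" where
  "bergman_op \<sigma> f x =
     (\<Sum>i\<in>{1, 2}.
       (LINT y|lebesgue_on (dom3 \<sigma>). (\<Sum>j\<in>{1, 2}. bergman_kernel \<sigma> i j x y * f y $ j)) *\<^sub>R unitq i)"

definition bergman_well_defined :: "side \<Rightarrow> bool" where
  "bergman_well_defined \<sigma> \<longleftrightarrow>
     (\<forall>x\<in>dom3 \<sigma>. \<forall>i\<in>{1, 2}.
        (\<forall>y\<in>dom3 \<sigma>. \<forall>j\<in>{1, 2}. (\<lambda>k. vec_basis \<sigma> k x $ i * vec_basis \<sigma> k y $ j) summable_on basis_index \<sigma>) \<and>
        (\<forall>f\<in>L2_space \<sigma> reduced_vec.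
           integrable (lebesgue_on (dom3 \<sigma>)) (\<lambda>y. \<Sum>j\<in>{1, 2}. bergman_kernel \<sigma> i j x y * f y $ j)))"

end

theory Submission
  imports Defs
begin

text \<open>
  A reduced-quaternion-valued \<open>f\<close> is monogenic iff the field \<open>F = (f\<^sub>0, - f\<^sub>1, - f\<^sub>2)\<close> is curl-free and
  divergence-free (\<open>monogenic_iff_grad_field\<close>), that is, locally the gradient of a harmonic function.
  The functions \<open>X = \<partial> U\<close> correspond to the gradients of the solid harmonics \<open>U\<close>. Once their normalized
  vector parts are known to be a complete orthonormal system in the space \<open>V\<close> of vector parts, with
  expansions that stay inside \<open>V\<close>, the theorem is the usual fact about reproducing kernels: the operator
  sends \<open>f\<close> to \<open>\<Sum>\<^sub>k \<langle>f, \<psi>\<^sub>k\<rangle> \<psi>\<^sub>k\<close>. For \<open>f\<close> with values in the vector parts one has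
  \<open>\<langle>f, g + conj w\<rangle> = \<langle>f, Vec g\<rangle> - \<langle>f, Vec w\<rangle>\<close>, so a harmonic \<open>f\<close> is contragenic iff it is orthogonal
  to \<open>V\<close>, that is, iff the projection annihilates it. Three facts about \<open>V\<close> have to be established.

  \<^emph>\<open>Orthogonality.\<close> Integration by parts on the domain, for homogeneous harmonic \<open>p\<close> and \<open>q\<close> of degrees \<open>n\<close>
  and \<open>n'\<close>, gives \<open>\<integral> \<nabla>p \<bullet> \<nabla>q = n' (n + n' + 3) \<integral> p q\<close> (\<open>green_homogeneous\<close>); the left side is symmetric, so
  different degrees are orthogonal. Different orders and parities are separated by rotations about and
  reflections along the axis of \<open>x\<^sub>0\<close>, which preserve the two forms \<open>\<integral> \<partial>\<^sub>0U \<partial>\<^sub>0V\<close> and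
  \<open>\<integral> \<partial>\<^sub>1U \<partial>\<^sub>1V + \<partial>\<^sub>2U \<partial>\<^sub>2V\<close> (\<open>solid_forms_orthogonal\<close>). Hence scalar parts, vector parts and the full
  functions are orthogonal families at the same time.

  \<^emph>\<open>Expansions stay in the space.\<close> With \<open>n = n'\<close> the same identity, applied to the components of \<open>\<nabla>U\<close>,
  turns the pointwise inequality \<open>|\<nabla>F\<^sub>0|\<^sup>2 \<le> 2 (|\<nabla>F\<^sub>1|\<^sup>2 + |\<nabla>F\<^sub>2|\<^sup>2)\<close> into
  \<open>\<parallel>Sc X\<parallel>\<^sup>2 \<le> 2 \<parallel>Vec X\<parallel>\<^sup>2\<close> (\<open>scalar_part_bound\<close>; constants are treated separately). So a
  square-summable combination of the \<open>\<psi>\<^sub>k\<close> lifts to a square-integrable combination of whole monogenic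
  functions. It is smooth and may be differentiated
  termwise because the point evaluations of harmonic functions and of their derivatives are bounded in
  \<open>L\<^sup>2\<close> (\<open>harm_sup_L2\<close>, \<open>locally_l2_partial\<close>, \<open>synthesis_monogenic\<close>).

  \<^emph>\<open>Completeness\<close> (\<open>gradient_field_complete\<close>). Let \<open>F\<close> be an \<open>L\<^sup>2\<close> gradient field whose components \<open>F\<^sub>1, F\<^sub>2\<close>
  are orthogonal to those of every \<open>\<nabla>U\<close>. The dilated field \<open>F(r \<cdot>)\<close> extends beyond the boundary; integrating
  it along rays gives a harmonic potential (on the exterior, of a difference of two dilations, one of
  which turns out to be negligible). This potential is approximated on a sphere outside the domain by
  combinations of solid harmonics (Stone-Weierstrass). The maximum principle and the interior gradient
  estimate carry the approximation to the gradients on the domain (\<open>gradient_approximation\<close>). So the vector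
  part \<open>v\<close> of \<open>F\<close> is orthogonal to its dilations \<open>v\<^sub>r\<close>, and Fatou's lemma as \<open>r\<close> tends to \<open>1\<close> gives
  \<open>4 \<parallel>v\<parallel>\<^sup>2 \<le> liminf \<parallel>v + v\<^sub>r\<parallel>\<^sup>2 \<le> 2 \<parallel>v\<parallel>\<^sup>2\<close>, whence \<open>v = 0\<close>.
\<close>

section \<open>Partial derivatives and smooth functions\<close>

text \<open>
  The relational form carries existence along with the value, which the total function \<open>partial\<close> does not.
\<close>

definition has_partial :: "3 \<Rightarrow> (real^3 \<Rightarrow> 'a::real_normed_vector) \<Rightarrow> 'a \<Rightarrow> real^3 \<Rightarrow> bool" where
  "has_partial i f d x \<longleftrightarrow> ((\<lambda>t. f (x + t *\<^sub>R axis i 1)) has_vector_derivative d) (at 0)"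

lemma UNIV_3': "(UNIV :: 3 set) = {0, 1, 2}"
proof -
  have "(3::3) = 0" by simp
  then show ?thesis using UNIV_3 by (metis insert_commute)
qed

lemma exhaust_directions: "i = 0 \<or> i = 1 \<or> i = 2" for i :: 3
  using UNIV_3' by (metis UNIV_I insert_iff singletonD)

lemma distinct_3: "(0::3) \<noteq> 1" "(0::3) \<noteq> 2" "(1::3) \<noteq> 2" by simp_all

lemma sum_UNIV_3: "(\<Sum>i\<in>(UNIV::3 set). f i) = f 0 + f 1 + (f 2 :: 'a::comm_monoid_add)"
proof -
  have "(\<Sum>i\<in>(UNIV::3 set). f i) = (\<Sum>i\<in>{0,1,2}. f i)" by (simp only: UNIV_3')
  also have "\<dots> = f 0 + f 1 + f 2"
    using distinct_3 by (subst sum.insert; simp add: add.assoc)+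
  finally show ?thesis .
qed

lemma has_partial_imp: "has_partial i f d x \<Longrightarrow> partial i f x = d"
  unfolding has_partial_def partial_def by (rule vector_derivative_at)

lemma has_partial_unique: "has_partial i f d x \<Longrightarrow> has_partial i f e x \<Longrightarrow> d = e"
  by (metis has_partial_imp)

lemma differentiable_iff_has_partial:
  "(\<lambda>t. f (x + t *\<^sub>R axis i 1)) differentiable (at 0) \<longleftrightarrow> has_partial i f (partial i f x) x"
  unfolding has_partial_def partial_def
  using differentiableI_vector vector_derivative_works by blast

lemma has_partial_from_derivative:
  assumes "(f has_derivative D) (at x)"
  shows "has_partial i f (D (axis i 1)) x"
proof -
  interpret D: bounded_linear D using assms by (rule has_derivative_bounded_linear)
  have "((\<lambda>t. x + t *\<^sub>R axis i 1) has_derivative (\<lambda>t. t *\<^sub>R axis i 1)) (at (0::real))"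
    by (auto intro!: derivative_eq_intros)
  then have "((\<lambda>t. f (x + t *\<^sub>R axis i 1)) has_derivative (\<lambda>t. D (t *\<^sub>R axis i 1))) (at 0)"
    by (rule has_derivative_compose) (simp add: assms)
  then show ?thesis
    by (simp add: has_partial_def has_vector_derivative_def D.scaleR)
qed

lemma has_partial_line:
  assumes "has_partial i f d (x + t *\<^sub>R axis i 1)"
  shows "((\<lambda>s. f (x + s *\<^sub>R axis i 1)) has_vector_derivative d) (at t)"
proof -
  have *: "((\<lambda>s. s - t) has_vector_derivative 1) (at t)"
    by (auto intro!: derivative_eq_intros)
  have "((\<lambda>s. f ((x + t *\<^sub>R axis i 1) + s *\<^sub>R axis i 1)) has_vector_derivative d) (at (t - t))"
    using assms by (simp add: has_partial_def)
  from vector_diff_chain_at[OF * this]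
  show ?thesis
    by (simp add: o_def scaleR_diff_left)
qed

lemma has_partial_line_real:
  assumes "has_partial i f d (x + t *\<^sub>R axis i 1)"
  shows "((\<lambda>s. f (x + s *\<^sub>R axis i 1)) has_real_derivative d) (at t)"
  using has_partial_line[OF assms] by (simp add: has_real_derivative_iff_has_vector_derivative)

lemma eventually_line_in_open:
  fixes x :: "real^3"
  assumes "open S" "x \<in> S"
  shows "eventually (\<lambda>t. x + t *\<^sub>R axis i 1 \<in> S) (nhds (0::real))"
proof -
  have "((\<lambda>t. x + t *\<^sub>R axis i 1) \<longlongrightarrow> x + 0 *\<^sub>R axis i 1) (nhds (0::real))"
    by (rule isCont_tendsto_compose[of 0 "\<lambda>t. x + t *\<^sub>R axis i 1"]) (auto intro!: continuous_intros filterlim_ident)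
  then show ?thesis
    using assms by (auto simp: tendsto_def)
qed

lemma has_partial_cong_open:
  assumes "open S" "x \<in> S" "\<And>y. y \<in> S \<Longrightarrow> f y = g y" "has_partial i f d x"
  shows "has_partial i g d x"
proof -
  have "eventually (\<lambda>t. f (x + t *\<^sub>R axis i 1) = g (x + t *\<^sub>R axis i 1)) (nhds 0)"
    using eventually_line_in_open[OF assms(1,2), of i] by eventually_elim (rule assms(3))
  then show ?thesis
    using assms(4) unfolding has_partial_def
    by (subst (asm) has_vector_derivative_cong_ev[where g = "\<lambda>t. g (x + t *\<^sub>R axis i 1)"])
      (auto simp: assms(2,3) elim: eventually_mono)
qed

lemma has_partial_iff_cong:
  assumes "open S" "x \<in> S" "\<And>y. y \<in> S \<Longrightarrow> f y = g y"
  shows "has_partial i f d x \<longleftrightarrow> has_partial i g d x"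
  using has_partial_cong_open[OF assms(1,2)] assms(3) by metis

lemma partial_cong_open:
  assumes "open S" "x \<in> S" "\<And>y. y \<in> S \<Longrightarrow> f y = g y"
  shows "partial i f x = partial i g x"
proof -
  have "has_partial i f d x \<longleftrightarrow> has_partial i g d x" for d
    by (rule has_partial_iff_cong[OF assms(1,2)]) (rule assms(3))
  then show ?thesis
    unfolding partial_def vector_derivative_def has_partial_def by simp
qed

lemma cont_diff_on_Suc_iff:
  "cont_diff_on (Suc k) S f \<longleftrightarrow> continuous_on S f \<and>
     (\<forall>i. (\<forall>x\<in>S. has_partial i f (partial i f x) x) \<and> cont_diff_on k S (partial i f))"
  by (simp add: differentiable_iff_has_partial)

declare cont_diff_on.simps(2) [simp del]

lemma cont_diff_on_cong:
  assumes "open S" "\<And>y. y \<in> S \<Longrightarrow> f y = g y"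
  shows "cont_diff_on k S f \<longleftrightarrow> cont_diff_on k S g"
  using assms(2)
proof (induction k arbitrary: f g)
  case 0 then show ?case by (auto cong: continuous_on_cong)
next
  case (Suc k)
  have 1: "partial i f y = partial i g y" if "y \<in> S" for i y
    using partial_cong_open[OF assms(1) that] Suc.prems by blast
  have 2: "cont_diff_on k S (partial i f) \<longleftrightarrow> cont_diff_on k S (partial i g)" for i
    by (rule Suc.IH) (rule 1)
  have 3: "has_partial i f (partial i f x) x \<longleftrightarrow> has_partial i g (partial i g x) x" if "x \<in> S" for i x
    using has_partial_iff_cong[OF assms(1) that Suc.prems] 1[OF that] by simp
  have 4: "continuous_on S f \<longleftrightarrow> continuous_on S g"
    using Suc.prems by (auto cong: continuous_on_cong)
  show ?case
    unfolding cont_diff_on_Suc_iff using 2 3 4 by blast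
qed

lemma cont_diff_on_continuous: "cont_diff_on k S f \<Longrightarrow> continuous_on S f"
  by (cases k) (auto simp: cont_diff_on_Suc_iff)

lemma cont_diff_on_SucD: "cont_diff_on (Suc k) S f \<Longrightarrow> cont_diff_on k S f"
  by (induction k arbitrary: f) (auto simp: cont_diff_on_Suc_iff)

lemma cont_diff_on_has_partial:
  "cont_diff_on (Suc k) S f \<Longrightarrow> x \<in> S \<Longrightarrow> has_partial i f (partial i f x) x"
  by (auto simp: cont_diff_on_Suc_iff)

lemma cont_diff_on_partial: "cont_diff_on (Suc k) S f \<Longrightarrow> cont_diff_on k S (partial i f)"
  by (auto simp: cont_diff_on_Suc_iff)

lemma cont_diff_on_SucI:
  assumes "open S" "continuous_on S f" "\<And>i x. x \<in> S \<Longrightarrow> has_partial i f (g i x) x"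
    "\<And>i. cont_diff_on k S (g i)"
  shows "cont_diff_on (Suc k) S f"
proof -
  have "partial i f x = g i x" if "x \<in> S" for i x
    using assms(3)[OF that] by (rule has_partial_imp)
  then have "cont_diff_on k S (partial i f)" for i
    using cont_diff_on_cong[OF assms(1), of "partial i f" "g i" k] assms(4) by simp
  then show ?thesis
    using assms(2,3) \<open>\<And>x i. x \<in> S \<Longrightarrow> partial i f x = g i x\<close> by (simp add: cont_diff_on_Suc_iff)
qed

lemma smooth_on_cont_diff: "smooth_on S f \<Longrightarrow> cont_diff_on k S f"
  by (simp add: smooth_on_def)

lemma smooth_on_has_partial: "smooth_on S f \<Longrightarrow> x \<in> S \<Longrightarrow> has_partial i f (partial i f x) x"
  by (rule cont_diff_on_has_partial[of 0 S]) (auto simp: smooth_on_def)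

lemma smooth_on_partial: "smooth_on S f \<Longrightarrow> smooth_on S (partial i f)"
  unfolding smooth_on_def by (intro allI cont_diff_on_partial) simp

lemma smooth_on_continuous: "smooth_on S f \<Longrightarrow> continuous_on S f"
  by (rule cont_diff_on_continuous[of 0]) (simp only: smooth_on_def)

lemma smooth_on_cong:
  assumes "open S" "\<And>y. y \<in> S \<Longrightarrow> f y = g y"
  shows "smooth_on S f \<longleftrightarrow> smooth_on S g"
  using cont_diff_on_cong[OF assms] by (auto simp: smooth_on_def)

lemma smooth_onI:
  assumes "open S" "continuous_on S f" "\<And>i x. x \<in> S \<Longrightarrow> has_partial i f (g i x) x"
    "\<And>i. smooth_on S (g i)"
  shows "smooth_on S f"
  unfolding smooth_on_def
proof
  fix k show "cont_diff_on k S f"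
    using cont_diff_on_SucI[OF assms(1-3), of k] assms(4) cont_diff_on_SucD
    by (auto simp: smooth_on_def)
qed

lemma cont_diff_on_subset: "cont_diff_on k S f \<Longrightarrow> T \<subseteq> S \<Longrightarrow> cont_diff_on k T f"
  by (induction k arbitrary: f) (auto simp: cont_diff_on_Suc_iff intro: continuous_on_subset)

lemma smooth_on_subset: "smooth_on S f \<Longrightarrow> T \<subseteq> S \<Longrightarrow> smooth_on T f"
  by (auto simp: smooth_on_def intro: cont_diff_on_subset)

lemma has_partial_const: "has_partial i (\<lambda>x. c) 0 x"
  by (simp add: has_partial_def)

lemma has_partial_coord: "has_partial i (\<lambda>x. x $ j) (if i = j then 1 else 0 :: real) x"
  unfolding has_partial_def by (auto intro!: derivative_eq_intros simp: axis_def)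

lemma has_partial_add: "has_partial i f a x \<Longrightarrow> has_partial i g b x \<Longrightarrow> has_partial i (\<lambda>x. f x + g x) (a + b) x"
  unfolding has_partial_def by (rule has_vector_derivative_add)

lemma has_partial_mult:
  fixes f g :: "real^3 \<Rightarrow> real"
  shows "has_partial i f a x \<Longrightarrow> has_partial i g b x \<Longrightarrow> has_partial i (\<lambda>x. f x * g x) (a * g x + f x * b) x"
  unfolding has_partial_def
  by (drule (1) has_vector_derivative_mult) (simp add: add.commute)

lemma has_partial_bounded_linear:
  assumes "bounded_linear L" "has_partial i f a x"
  shows "has_partial i (\<lambda>x. L (f x)) (L a) x"
  using bounded_linear.has_vector_derivative[OF assms(1)] assms(2) unfolding has_partial_def by blast

lemma cont_diff_on_const: "cont_diff_on k S (\<lambda>x. c)"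
proof (induction k arbitrary: c)
  case (Suc k)
  have "partial i (\<lambda>x. c) = (\<lambda>x. 0)" for i
    by (rule ext, rule has_partial_imp, rule has_partial_const)
  then show ?case
    using Suc by (auto simp: cont_diff_on_Suc_iff has_partial_const)
qed simp

lemma cont_diff_on_coord: "cont_diff_on k S (\<lambda>x. x $ j :: real)"
proof (cases k)
  case (Suc l)
  have "partial i (\<lambda>x. x $ j :: real) = (\<lambda>x. if i = j then 1 else 0)" for i
    by (rule ext, rule has_partial_imp, rule has_partial_coord)
  then show ?thesis
    using Suc cont_diff_on_const has_partial_coord
    by (auto simp: cont_diff_on_Suc_iff intro!: continuous_intros)
qed (auto intro!: continuous_intros)

lemma cont_diff_on_add:
  assumes "open S"
  shows "cont_diff_on k S f \<Longrightarrow> cont_diff_on k S g \<Longrightarrow> cont_diff_on k S (\<lambda>x. f x + g x)"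
proof (induction k arbitrary: f g)
  case (Suc k)
  show ?case
    by (rule cont_diff_on_SucI[where g = "\<lambda>i x. partial i f x + partial i g x"])
      (use Suc assms in \<open>auto simp: cont_diff_on_Suc_iff intro!: continuous_intros has_partial_add\<close>)
qed (auto intro!: continuous_intros)

lemma cont_diff_on_mult:
  fixes f g :: "real^3 \<Rightarrow> real"
  assumes "open S"
  shows "cont_diff_on k S f \<Longrightarrow> cont_diff_on k S g \<Longrightarrow> cont_diff_on k S (\<lambda>x. f x * g x)"
proof (induction k arbitrary: f g)
  case (Suc k)
  show ?case
  proof (rule cont_diff_on_SucI[where g = "\<lambda>i x. partial i f x * g x + f x * partial i g x"])
    show "cont_diff_on k S (\<lambda>x. partial i f x * g x + f x * partial i g x)" for i
      using Suc.prems by (intro cont_diff_on_add assms Suc.IH) (auto intro: cont_diff_on_partial cont_diff_on_SucD)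
  qed (use Suc assms in \<open>auto simp: cont_diff_on_Suc_iff intro!: continuous_intros has_partial_mult\<close>)
qed (auto intro!: continuous_intros)

lemma cont_diff_on_bounded_linear:
  assumes "open S" "bounded_linear L"
  shows "cont_diff_on k S f \<Longrightarrow> cont_diff_on k S (\<lambda>x. L (f x))"
proof (induction k arbitrary: f)
  case 0 then show ?case
    by (simp add: bounded_linear.continuous_on[OF assms(2), of S f])
next
  case (Suc k)
  show ?case
  proof (rule cont_diff_on_SucI[where g = "\<lambda>i x. L (partial i f x)"])
    show "continuous_on S (\<lambda>x. L (f x))"
      by (rule bounded_linear.continuous_on[OF assms(2) cont_diff_on_continuous[OF Suc.prems]])
    show "has_partial i (\<lambda>x. L (f x)) (L (partial i f x)) x" if "x \<in> S" for i x
      by (rule has_partial_bounded_linear[OF assms(2) cont_diff_on_has_partial[OF Suc.prems that]])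
    show "cont_diff_on k S (\<lambda>x. L (partial i f x))" for i
      by (rule Suc.IH[OF cont_diff_on_partial[OF Suc.prems]])
  qed (rule assms(1))
qed

lemma smooth_on_const: "smooth_on S (\<lambda>x. c)"
  by (simp add: smooth_on_def cont_diff_on_const)
lemma smooth_on_coord: "smooth_on S (\<lambda>x. x $ j :: real)"
  by (simp add: smooth_on_def cont_diff_on_coord)
lemma smooth_on_add: "open S \<Longrightarrow> smooth_on S f \<Longrightarrow> smooth_on S g \<Longrightarrow> smooth_on S (\<lambda>x. f x + g x)"
  unfolding smooth_on_def by (intro allI cont_diff_on_add) auto
lemma smooth_on_mult:
  fixes f g :: "real^3 \<Rightarrow> real"
  shows "open S \<Longrightarrow> smooth_on S f \<Longrightarrow> smooth_on S g \<Longrightarrow> smooth_on S (\<lambda>x. f x * g x)"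
  unfolding smooth_on_def by (intro allI cont_diff_on_mult) auto
lemma smooth_on_bounded_linear: "open S \<Longrightarrow> bounded_linear L \<Longrightarrow> smooth_on S f \<Longrightarrow> smooth_on S (\<lambda>x. L (f x))"
  unfolding smooth_on_def using cont_diff_on_bounded_linear[of S L _ f] by simp
lemma smooth_on_cmult:
  fixes f :: "real^3 \<Rightarrow> real"
  shows "open S \<Longrightarrow> smooth_on S f \<Longrightarrow> smooth_on S (\<lambda>x. c * f x)"
  by (intro smooth_on_mult smooth_on_const)
lemma smooth_on_diff:
  fixes f :: "real^3 \<Rightarrow> real"
  assumes "open S" "smooth_on S f" "smooth_on S g" shows "smooth_on S (\<lambda>x. f x - g x)"
  using smooth_on_add[OF assms(1,2) smooth_on_cmult[OF assms(1,3), of "-1"]] by simp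
lemma smooth_on_sum:
  assumes "open S"
  shows "(\<And>a. a \<in> A \<Longrightarrow> smooth_on S (f a)) \<Longrightarrow> smooth_on S (\<lambda>x. \<Sum>a\<in>A. f a x)"
  by (induction A rule: infinite_finite_induct) (auto intro: smooth_on_const smooth_on_add[OF assms])

lemma has_partial_cmult: "has_partial i f a x \<Longrightarrow> has_partial i (\<lambda>x. c * f x) (c * a :: real) x"
  using has_partial_mult[OF has_partial_const] by fastforce
lemma has_partial_diff: "has_partial i f a x \<Longrightarrow> has_partial i g b x \<Longrightarrow> has_partial i (\<lambda>x. f x - g x) (a - b) x"
  unfolding has_partial_def by (rule has_vector_derivative_diff)
lemma has_partial_sum:
  "(\<And>a. a \<in> A \<Longrightarrow> has_partial i (f a) (d a) x) \<Longrightarrow> has_partial i (\<lambda>x. \<Sum>a\<in>A. f a x) (\<Sum>a\<in>A. d a) x"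
  by (induction A rule: infinite_finite_induct) (auto intro: has_partial_const has_partial_add)

lemma partial_add:
  "smooth_on S f \<Longrightarrow> smooth_on S g \<Longrightarrow> x \<in> S \<Longrightarrow> partial i (\<lambda>x. f x + g x) x = partial i f x + partial i g x"
  by (intro has_partial_imp has_partial_add smooth_on_has_partial)
lemma partial_diff:
  "smooth_on S f \<Longrightarrow> smooth_on S g \<Longrightarrow> x \<in> S \<Longrightarrow> partial i (\<lambda>x. f x - g x) x = partial i f x - partial i g x"
  by (intro has_partial_imp has_partial_diff smooth_on_has_partial)
lemma partial_cmult:
  "smooth_on S f \<Longrightarrow> x \<in> S \<Longrightarrow> partial i (\<lambda>x. c * f x) x = c * (partial i f x :: real)"
  by (rule has_partial_imp, rule has_partial_cmult, rule smooth_on_has_partial)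
lemma partial_mult:
  fixes f g :: "real^3 \<Rightarrow> real"
  shows "smooth_on S f \<Longrightarrow> smooth_on S g \<Longrightarrow> x \<in> S \<Longrightarrow> partial i (\<lambda>x. f x * g x) x = partial i f x * g x + f x * partial i g x"
  by (intro has_partial_imp has_partial_mult smooth_on_has_partial)
lemma partial_sum:
  "(\<And>a. a \<in> A \<Longrightarrow> smooth_on S (f a)) \<Longrightarrow> x \<in> S \<Longrightarrow>
    partial i (\<lambda>x. \<Sum>a\<in>A. f a x) x = (\<Sum>a\<in>A. partial i (f a) x)"
  by (intro has_partial_imp has_partial_sum smooth_on_has_partial)
lemma partial_bounded_linear:
  "bounded_linear L \<Longrightarrow> smooth_on S f \<Longrightarrow> x \<in> S \<Longrightarrow> partial i (\<lambda>x. L (f x)) x = L (partial i f x)"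
  using has_partial_imp[OF has_partial_bounded_linear[of L i f "partial i f x" x]] smooth_on_has_partial[of S f x i] by simp

lemma open_dom3: "open (dom3 \<sigma>)"
proof -
  have "open {x::real^3. norm x < 1}" "open {x::real^3. norm x > 1}"
    by (auto intro!: open_Collect_less continuous_intros)
  then show ?thesis by (cases \<sigma>) auto
qed

lemma mvt_line:
  fixes f :: "real^3 \<Rightarrow> real"
  assumes "\<And>t. \<bar>t\<bar> \<le> \<bar>h\<bar> \<Longrightarrow> has_partial i f (g (x + t *\<^sub>R axis i 1)) (x + t *\<^sub>R axis i 1)"
  shows "\<exists>t. \<bar>t\<bar> \<le> \<bar>h\<bar> \<and> f (x + h *\<^sub>R axis i 1) - f x = h * g (x + t *\<^sub>R axis i 1)"
proof -
  let ?F = "\<lambda>t. f (x + t *\<^sub>R axis i 1)"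
  have D: "(?F has_real_derivative g (x + t *\<^sub>R axis i 1)) (at t)" if "\<bar>t\<bar> \<le> \<bar>h\<bar>" for t
    by (rule has_partial_line_real) (rule assms[OF that])
  consider "h = 0" | "h > 0" | "h < 0" by linarith
  then show ?thesis
  proof cases
    case 1 then show ?thesis by (intro exI[of _ 0]) simp
  next
    case 2
    then obtain z where "0 < z" "z < h" "?F h - ?F 0 = (h - 0) * g (x + z *\<^sub>R axis i 1)"
      using MVT2[of 0 h ?F "\<lambda>t. g (x + t *\<^sub>R axis i 1)"] D by auto
    then show ?thesis by (intro exI[of _ z]) auto
  next
    case 3
    then obtain z where "h < z" "z < 0" "?F 0 - ?F h = (0 - h) * g (x + z *\<^sub>R axis i 1)"
      using MVT2[of h 0 ?F "\<lambda>t. g (x + t *\<^sub>R axis i 1)"] D by auto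
    then show ?thesis by (intro exI[of _ z]) (auto simp: algebra_simps)
  qed
qed

section \<open>The differential and the symmetry of second derivatives\<close>

text \<open>
  Continuous partial derivatives imply differentiability: the increment is split into three steps
  parallel to the axes, and the mean value theorem is applied to each.
\<close>

lemma C1_has_derivative:
  fixes f :: "real^3 \<Rightarrow> real"
  assumes "open S" "x \<in> S" "cont_diff_on (Suc k) S f"
  shows "(f has_derivative (\<lambda>h. \<Sum>i\<in>UNIV. h $ i * partial i f x)) (at x)"
proof (rule has_derivativeI)
  show "bounded_linear (\<lambda>h. \<Sum>i\<in>UNIV. h $ i * partial i f x)"
    by (intro bounded_linear_sum bounded_linear_mult_const bounded_linear_vec_nth)
  have cont: "continuous_on S (partial i f)" for i
    using assms(3) cont_diff_on_continuous cont_diff_on_partial by blast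
  show "((\<lambda>y. (f y - f x - (\<Sum>i\<in>UNIV. (y - x) $ i * partial i f x)) /\<^sub>R norm (y - x)) \<longlongrightarrow> 0) (at x)"
  proof (rule LIM_I)
    fix e :: real assume "e > 0"
    have "\<exists>d>0. \<forall>y. dist y x < d \<longrightarrow> y \<in> S \<and> (\<forall>i. \<bar>partial i f y - partial i f x\<bar> < e / 6)"
    proof -
      have "\<forall>\<^sub>F y in nhds x. y \<in> S \<and> (\<forall>i\<in>UNIV. \<bar>partial i f y - partial i f x\<bar> < e / 6)"
      proof (rule eventually_conj)
        show "\<forall>\<^sub>F y in nhds x. y \<in> S" using assms(1,2) by (auto intro: eventually_nhds_in_open)
        show "\<forall>\<^sub>F y in nhds x. \<forall>i\<in>UNIV. \<bar>partial i f y - partial i f x\<bar> < e / 6"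
        proof (rule eventually_ball_finite)
          show "\<forall>i\<in>UNIV. \<forall>\<^sub>F y in nhds x. \<bar>partial i f y - partial i f x\<bar> < e / 6"
          proof
            fix i
            have "isCont (partial i f) x"
              using cont assms(1,2) continuous_on_eq_continuous_at by blast
            then have "(partial i f \<longlongrightarrow> partial i f x) (nhds x)"
              by (simp add: continuous_within tendsto_at_iff_tendsto_nhds)
            from tendstoD[OF this, of "e/6"] \<open>e > 0\<close>
            show "\<forall>\<^sub>F y in nhds x. \<bar>partial i f y - partial i f x\<bar> < e / 6"
              by (simp add: dist_real_def)
          qed
        qed simp
      qed
      then show ?thesis by (auto simp: eventually_nhds_metric)
    qed
    then obtain d where "d > 0" and d: "\<And>y. dist y x < d \<Longrightarrow> y \<in> S"
      "\<And>y i. dist y x < d \<Longrightarrow> \<bar>partial i f y - partial i f x\<bar> < e / 6" by blast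
    \<comment> \<open>the mean value theorem along one axis, where the partial derivative is within \<open>e / 6\<close> of its value at \<open>x\<close>\<close>
    have key: "\<bar>f (z + h *\<^sub>R axis i 1) - f z - h * partial i f x\<bar> \<le> \<bar>h\<bar> * (e/6)"
      if z: "dist z x + \<bar>h\<bar> < d" for z h i
    proof -
      have near: "dist (z + t *\<^sub>R axis i 1) x < d" if "\<bar>t\<bar> \<le> \<bar>h\<bar>" for t
      proof -
        have "dist (z + t *\<^sub>R axis i 1) x \<le> dist (z + t *\<^sub>R axis i 1) z + dist z x" by (rule dist_triangle)
        also have "dist (z + t *\<^sub>R axis i 1) z = \<bar>t\<bar>" by (simp add: dist_norm)
        finally show ?thesis using z that by linarith
      qed
      obtain t where t: "\<bar>t\<bar> \<le> \<bar>h\<bar>" "f (z + h *\<^sub>R axis i 1) - f z = h * partial i f (z + t *\<^sub>R axis i 1)"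
        using mvt_line[of h i f "partial i f" z] near d(1) assms(3) cont_diff_on_has_partial by blast
      have "\<bar>f (z + h *\<^sub>R axis i 1) - f z - h * partial i f x\<bar> = \<bar>h\<bar> * \<bar>partial i f (z + t *\<^sub>R axis i 1) - partial i f x\<bar>"
        by (simp add: t(2) abs_mult flip: right_diff_distrib)
      also have "\<dots> \<le> \<bar>h\<bar> * (e/6)"
        using d(2)[OF near[OF t(1)]] by (intro mult_left_mono) (auto intro: less_imp_le)
      finally show ?thesis .
    qed
    show "\<exists>s>0. \<forall>y. y \<noteq> x \<and> norm (y - x) < s \<longrightarrow>
        norm ((f y - f x - (\<Sum>i\<in>UNIV. (y - x) $ i * partial i f x)) /\<^sub>R norm (y - x) - 0) < e"
    proof (intro exI conjI allI impI)
      show "d / 4 > 0" using \<open>d > 0\<close> by simp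
      fix y assume y: "y \<noteq> x \<and> norm (y - x) < d / 4"
      define h where "h = y - x"
      have hi: "\<bar>h $ i\<bar> \<le> norm h" for i by (rule component_le_norm_cart)
      define z1 where "z1 = x + h $ 0 *\<^sub>R axis 0 1"
      define z2 where "z2 = z1 + h $ 1 *\<^sub>R axis 1 1"
      have y_eq: "y = z2 + h $ 2 *\<^sub>R axis 2 1"
      proof -
        have "h $ i = (h $ 0 *\<^sub>R axis 0 1 + h $ 1 *\<^sub>R axis 1 1 + h $ 2 *\<^sub>R axis 2 1) $ i" for i
        proof -
          have "i = 0 \<or> i = 1 \<or> i = 2" by (rule exhaust_directions)
          then show ?thesis by (elim disjE) (simp_all add: axis_def)
        qed
        then have "h = h $ 0 *\<^sub>R axis 0 1 + h $ 1 *\<^sub>R axis 1 1 + h $ 2 *\<^sub>R axis 2 1" unfolding vec_eq_iff by (rule allI)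
        then show ?thesis unfolding z2_def z1_def h_def by (simp add: algebra_simps)
      qed
      have d1: "dist z1 x \<le> norm h" using hi[of 0] by (simp add: z1_def dist_norm)
      have d2: "dist z2 x \<le> 2 * norm h"
      proof -
        have "dist z2 x \<le> dist z2 z1 + dist z1 x" by (rule dist_triangle)
        also have "dist z2 z1 \<le> norm h" using hi[of 1] by (simp add: z2_def dist_norm)
        finally show ?thesis using d1 by linarith
      qed
      have nrm: "norm (X /\<^sub>R norm h) = \<bar>X\<bar> / norm h" for X :: real
        by (simp add: divide_inverse mult.commute abs_mult)
      have nh: "norm h < d / 4" "norm h > 0" using y by (auto simp: h_def)
      have "\<bar>f z1 - f x - h $ 0 * partial 0 f x\<bar> \<le> \<bar>h $ 0\<bar> * (e/6)"
        unfolding z1_def using hi[of 0] nh by (intro key) auto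
      moreover have "\<bar>f z2 - f z1 - h $ 1 * partial 1 f x\<bar> \<le> \<bar>h $ 1\<bar> * (e/6)"
        unfolding z2_def using hi[of 1] nh d1 by (intro key) auto
      moreover have "\<bar>f y - f z2 - h $ 2 * partial 2 f x\<bar> \<le> \<bar>h $ 2\<bar> * (e/6)"
        unfolding y_eq using hi[of 2] nh d2 by (intro key) auto
      moreover have hie: "\<bar>h $ i\<bar> * (e/6) \<le> norm h * (e/6)" for i
        using hi \<open>e > 0\<close> by (intro mult_right_mono) auto
      moreover have "f y - f x - (\<Sum>i\<in>UNIV. h $ i * partial i f x) =
         (f z1 - f x - h $ 0 * partial 0 f x) + (f z2 - f z1 - h $ 1 * partial 1 f x) + (f y - f z2 - h $ 2 * partial 2 f x)"
        by (simp add: sum_UNIV_3)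
      ultimately have "\<bar>f y - f x - (\<Sum>i\<in>UNIV. h $ i * partial i f x)\<bar> \<le> 3 * (norm h * (e/6))"
        using hie[of 0] hie[of 1] hie[of 2] by linarith
      also have "\<dots> = norm h * (e/2)" by simp
      finally have "\<bar>f y - f x - (\<Sum>i\<in>UNIV. h $ i * partial i f x)\<bar> / norm h \<le> e / 2"
        using nh by (simp add: divide_le_eq mult.commute)
      then have "\<bar>f y - f x - (\<Sum>i\<in>UNIV. h $ i * partial i f x)\<bar> / norm h < e"
        using \<open>e > 0\<close> by linarith
      then show "norm ((f y - f x - (\<Sum>i\<in>UNIV. (y - x) $ i * partial i f x)) /\<^sub>R norm (y - x) - 0) < e"
        unfolding h_def[symmetric] diff_0_right nrm .
    qed
  qed
qed

text \<open>
  Two applications of the mean value theorem to the mixed second difference, in direction \<open>i\<close> and then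
  in direction \<open>j\<close>. The quotient is symmetric in \<open>i\<close> and \<open>j\<close>, so both mixed derivatives are its limit.
\<close>

lemma C2_second_difference:
  fixes f :: "real^3 \<Rightarrow> real"
  assumes "open S" "x \<in> S" "cont_diff_on 2 S f" "e > 0"
  shows "\<exists>d>0. \<forall>h. 0 < h \<and> h < d \<longrightarrow>
    \<bar>(f (x + h *\<^sub>R axis i 1 + h *\<^sub>R axis j 1) - f (x + h *\<^sub>R axis i 1) - f (x + h *\<^sub>R axis j 1) + f x) / h^2
       - partial j (partial i f) x\<bar> < e"
proof -
  have C2: "cont_diff_on (Suc (Suc 0)) S f" using assms(3) by (simp add: numeral_2_eq_2)
  have C1: "cont_diff_on (Suc 0) S (partial i f)" using C2 by (rule cont_diff_on_partial)
  have "continuous_on S (partial j (partial i f))"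
    using C1 cont_diff_on_continuous cont_diff_on_partial by blast
  then have "isCont (partial j (partial i f)) x"
    using assms(1,2) continuous_on_eq_continuous_at by blast
  then have "\<forall>\<^sub>F y in nhds x. \<bar>partial j (partial i f) y - partial j (partial i f) x\<bar> < e"
    using tendstoD[of "partial j (partial i f)" _ "nhds x" e] assms(4)
    by (simp add: continuous_within tendsto_at_iff_tendsto_nhds dist_real_def)
  moreover have "\<forall>\<^sub>F y in nhds x. y \<in> S" using assms(1,2) by (auto intro: eventually_nhds_in_open)
  ultimately have "\<forall>\<^sub>F y in nhds x. y \<in> S \<and> \<bar>partial j (partial i f) y - partial j (partial i f) x\<bar> < e"
    by (rule eventually_conj[rotated])
  then obtain d where "d > 0" and d: "\<And>y. dist y x < d \<Longrightarrow> y \<in> S"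
    "\<And>y. dist y x < d \<Longrightarrow> \<bar>partial j (partial i f) y - partial j (partial i f) x\<bar> < e"
    by (auto simp: eventually_nhds_metric)
  have near: "dist (x + s *\<^sub>R axis i 1 + t *\<^sub>R axis j 1) x < d" if "\<bar>s\<bar> \<le> h" "\<bar>t\<bar> \<le> h" "h < d / 2" for s t h
  proof -
    have "dist (x + s *\<^sub>R axis i 1 + t *\<^sub>R axis j 1) x = norm (s *\<^sub>R axis i 1 + t *\<^sub>R (axis j 1 :: real^3))"
      by (simp add: dist_norm algebra_simps)
    also have "\<dots> \<le> \<bar>s\<bar> + \<bar>t\<bar>" by (rule order_trans[OF norm_triangle_ineq]) simp
    finally show ?thesis using that by linarith
  qed
  show ?thesis
  proof (intro exI conjI allI impI)
    show "d / 2 > 0" using \<open>d > 0\<close> by simp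
    fix h :: real assume h: "0 < h \<and> h < d / 2"
    define G where "G = (\<lambda>y. f (y + h *\<^sub>R axis j 1) - f y)"
    have "has_partial i G (partial i f (y + h *\<^sub>R axis j 1) - partial i f y) y"
      if "y + h *\<^sub>R axis j 1 \<in> S" "y \<in> S" for y
    proof -
      have "has_partial i (\<lambda>y. f (y + h *\<^sub>R axis j 1)) (partial i f (y + h *\<^sub>R axis j 1)) y"
        using cont_diff_on_has_partial[OF C2 that(1), of i] unfolding has_partial_def by (simp add: algebra_simps)
      then show ?thesis unfolding G_def
        by (rule has_partial_diff) (rule cont_diff_on_has_partial[OF C2 that(2)])
    qed
    note GD = this
    have "\<exists>t. \<bar>t\<bar> \<le> \<bar>h\<bar> \<and> G (x + h *\<^sub>R axis i 1) - G x = h *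
        (\<lambda>y. partial i f (y + h *\<^sub>R axis j 1) - partial i f y) (x + t *\<^sub>R axis i 1)"
    proof (rule mvt_line)
      fix t assume "\<bar>t\<bar> \<le> \<bar>h\<bar>"
      then have "x + t *\<^sub>R axis i 1 + h *\<^sub>R axis j 1 \<in> S" "x + t *\<^sub>R axis i 1 + 0 *\<^sub>R axis j 1 \<in> S"
        using h by (intro d(1) near[of t h h] near[of t h 0]; simp)+
      then show "has_partial i G (partial i f (x + t *\<^sub>R axis i 1 + h *\<^sub>R axis j 1) - partial i f (x + t *\<^sub>R axis i 1)) (x + t *\<^sub>R axis i 1)"
        by (intro GD) auto
    qed
    then obtain t where t: "\<bar>t\<bar> \<le> h" "G (x + h *\<^sub>R axis i 1) - G x = h *
        (partial i f (x + t *\<^sub>R axis i 1 + h *\<^sub>R axis j 1) - partial i f (x + t *\<^sub>R axis i 1))"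
      using h by auto
    have "\<exists>s. \<bar>s\<bar> \<le> \<bar>h\<bar> \<and> partial i f (x + t *\<^sub>R axis i 1 + h *\<^sub>R axis j 1) - partial i f (x + t *\<^sub>R axis i 1)
       = h * partial j (partial i f) (x + t *\<^sub>R axis i 1 + s *\<^sub>R axis j 1)"
    proof (rule mvt_line)
      fix s assume "\<bar>s\<bar> \<le> \<bar>h\<bar>"
      then have "x + t *\<^sub>R axis i 1 + s *\<^sub>R axis j 1 \<in> S"
        using h t(1) by (intro d(1) near[of t h s]) auto
      then show "has_partial j (partial i f) (partial j (partial i f) (x + t *\<^sub>R axis i 1 + s *\<^sub>R axis j 1)) (x + t *\<^sub>R axis i 1 + s *\<^sub>R axis j 1)"
        by (rule cont_diff_on_has_partial[OF C1])
    qed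
    then obtain s where s: "\<bar>s\<bar> \<le> h" "partial i f (x + t *\<^sub>R axis i 1 + h *\<^sub>R axis j 1) - partial i f (x + t *\<^sub>R axis i 1)
       = h * partial j (partial i f) (x + t *\<^sub>R axis i 1 + s *\<^sub>R axis j 1)" using h by auto
    have "f (x + h *\<^sub>R axis i 1 + h *\<^sub>R axis j 1) - f (x + h *\<^sub>R axis i 1) - f (x + h *\<^sub>R axis j 1) + f x
       = G (x + h *\<^sub>R axis i 1) - G x"
      by (simp add: G_def)
    also have "\<dots> = h^2 * partial j (partial i f) (x + t *\<^sub>R axis i 1 + s *\<^sub>R axis j 1)"
      using t(2) s(2) by (simp add: power2_eq_square)
    finally have eq: "(f (x + h *\<^sub>R axis i 1 + h *\<^sub>R axis j 1) - f (x + h *\<^sub>R axis i 1) - f (x + h *\<^sub>R axis j 1) + f x) / h^2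
       = partial j (partial i f) (x + t *\<^sub>R axis i 1 + s *\<^sub>R axis j 1)" using h by simp
    show "\<bar>(f (x + h *\<^sub>R axis i 1 + h *\<^sub>R axis j 1) - f (x + h *\<^sub>R axis i 1) - f (x + h *\<^sub>R axis j 1) + f x) / h^2
       - partial j (partial i f) x\<bar> < e"
      unfolding eq using h t(1) s(1) by (intro d(2) near[of t h s]) auto
  qed
qed

lemma partial_commute:
  fixes f :: "real^3 \<Rightarrow> real"
  assumes "open S" "x \<in> S" "cont_diff_on 2 S f"
  shows "partial i (partial j f) x = partial j (partial i f) x"
proof (rule ccontr)
  assume ne: "partial i (partial j f) x \<noteq> partial j (partial i f) x"
  define e where "e = \<bar>partial i (partial j f) x - partial j (partial i f) x\<bar> / 2"
  have "e > 0" using ne by (simp add: e_def)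
  obtain d1 where d1: "d1 > 0" "\<And>h. 0 < h \<Longrightarrow> h < d1 \<Longrightarrow>
    \<bar>(f (x + h *\<^sub>R axis i 1 + h *\<^sub>R axis j 1) - f (x + h *\<^sub>R axis i 1) - f (x + h *\<^sub>R axis j 1) + f x) / h^2
       - partial j (partial i f) x\<bar> < e"
    using C2_second_difference[OF assms \<open>e > 0\<close>, of i j] by blast
  obtain d2 where d2: "d2 > 0" "\<And>h. 0 < h \<Longrightarrow> h < d2 \<Longrightarrow>
    \<bar>(f (x + h *\<^sub>R axis j 1 + h *\<^sub>R axis i 1) - f (x + h *\<^sub>R axis j 1) - f (x + h *\<^sub>R axis i 1) + f x) / h^2
       - partial i (partial j f) x\<bar> < e"
    using C2_second_difference[OF assms \<open>e > 0\<close>, of j i] by blast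
  define h where "h = min d1 d2 / 2"
  have h: "0 < h" "h < d1" "h < d2" using d1(1) d2(1) by (auto simp: h_def)
  have "x + h *\<^sub>R axis j 1 + h *\<^sub>R axis i 1 = x + h *\<^sub>R axis i 1 + h *\<^sub>R axis j 1" by simp
  then have "\<bar>(f (x + h *\<^sub>R axis i 1 + h *\<^sub>R axis j 1) - f (x + h *\<^sub>R axis i 1) - f (x + h *\<^sub>R axis j 1) + f x) / h^2
       - partial i (partial j f) x\<bar> < e"
    using d2(2)[OF h(1,3)] by (simp add: algebra_simps)
  with d1(2)[OF h(1,2)] have "\<bar>partial i (partial j f) x - partial j (partial i f) x\<bar> < 2 * e"
    by linarith
  then show False by (simp add: e_def)
qed

section \<open>Integration by parts on the ball and its exterior\<close>

lemma dom3_borel [measurable, simp]: "dom3 \<sigma> \<in> sets borel"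
  by (simp add: open_dom3)

lemma dom3_lebesgue [simp]: "dom3 \<sigma> \<in> sets lebesgue"
  by (simp add: open_dom3 borel_open)

lemma integrable_dom3_iff:
  fixes f :: "real^3 \<Rightarrow> real"
  shows "integrable (lebesgue_on (dom3 \<sigma>)) f \<longleftrightarrow> integrable lebesgue (\<lambda>x. indicator (dom3 \<sigma>) x * f x)"
  by (subst integrable_restrict_space) (simp_all)

lemma integral_dom3_eq:
  fixes f :: "real^3 \<Rightarrow> real"
  shows "(LINT x|lebesgue_on (dom3 \<sigma>). f x) = (LINT x|lebesgue. indicator (dom3 \<sigma>) x * f x)"
  by (subst integral_restrict_space) (simp_all)

lemma borel_dom3_continuous:
  fixes f :: "real^3 \<Rightarrow> 'a::{real_normed_vector,second_countable_topology}"
  assumes "continuous_on (dom3 \<sigma>) f"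
  shows "f \<in> borel_measurable (lebesgue_on (dom3 \<sigma>))"
  by (rule continuous_imp_measurable_on_sets_lebesgue[OF assms]) simp

lemma continuous_compact_support_integrable:
  fixes f :: "real^3 \<Rightarrow> real"
  assumes "continuous_on UNIV f" "\<And>x. norm x > B \<Longrightarrow> f x = 0"
  shows "integrable lborel f"
proof -
  have "integrable lborel (\<lambda>x. indicator (cball 0 B) x *\<^sub>R f x)"
    by (rule borel_integrable_compact) (auto intro: continuous_on_subset[OF assms(1)])
  moreover have "(\<lambda>x. indicator (cball 0 B) x *\<^sub>R f x) = f"
    using assms(2) by (auto simp: fun_eq_iff indicator_def)
  ultimately show ?thesis by simp
qed

text \<open>
  The integral of a difference quotient vanishes because Lebesgue measure is translation invariant; the
  mean value theorem supplies the bound for dominated convergence.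
\<close>

lemma integral_partial_compact_support:
  fixes \<phi> :: "real^3 \<Rightarrow> real"
  assumes d: "\<And>x. has_partial i \<phi> (\<phi>' x) x" and c: "continuous_on UNIV \<phi>" and c': "continuous_on UNIV \<phi>'"
    and B: "\<And>x. norm x > B \<Longrightarrow> \<phi> x = 0"
  shows "\<And>x. norm x > B \<Longrightarrow> \<phi>' x = 0" "integrable lborel \<phi>'" "(LINT x|lborel. \<phi>' x) = 0"
proof -
  show B': "\<phi>' x = 0" if "norm x > B" for x
  proof -
    have "open {x::real^3. norm x > B}" by (auto intro!: open_Collect_less continuous_intros)
    then have "has_partial i (\<lambda>x. 0) (\<phi>' x) x"
      by (rule has_partial_cong_open[where f = \<phi>]) (use that B d in auto)
    then show ?thesis using has_partial_const has_partial_unique by blast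
  qed
  show int': "integrable lborel \<phi>'"
    by (rule continuous_compact_support_integrable[OF c' B'])
  have int: "integrable lborel \<phi>"
    by (rule continuous_compact_support_integrable[OF c B])
  obtain M where M: "\<And>x. \<bar>\<phi>' x\<bar> \<le> M"
  proof -
    have "bounded (\<phi>' ` cball 0 B)"
      by (intro compact_imp_bounded compact_continuous_image continuous_on_subset[OF c']) auto
    then obtain M where "\<forall>x\<in>cball 0 B. \<bar>\<phi>' x\<bar> \<le> M" by (auto simp: bounded_iff)
    then have "\<And>x. norm x \<le> B \<Longrightarrow> \<bar>\<phi>' x\<bar> \<le> M" by simp
    then have "\<bar>\<phi>' x\<bar> \<le> max M 0" for x
      using B'[of x] \<open>\<And>x. norm x \<le> B \<Longrightarrow> \<bar>\<phi>' x\<bar> \<le> M\<close>[of x] by (cases "norm x > B") linarith+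
    then show ?thesis by (rule that)
  qed
  have M0: "M \<ge> 0" using M[of 0] by linarith
  define h where "h n = inverse (real (Suc n))" for n
  have h: "0 < h n" "h n \<le> 1" for n by (auto simp: h_def inverse_eq_divide)
  have h0: "h \<longlonglongrightarrow> 0" unfolding h_def by (rule LIMSEQ_inverse_real_of_nat)
  define Dn where "Dn n x = (\<phi> (x + h n *\<^sub>R axis i 1) - \<phi> x) / h n" for n x
  have shift: "integrable lborel (\<lambda>x. \<phi> (x + v))" "(LINT x|lborel. \<phi> (x + v)) = (LINT x|lborel. \<phi> x)" for v
  proof -
    have m: "\<phi> \<in> borel_measurable borel" using int by (auto dest: borel_measurable_integrable)
    have "integrable (distr lborel borel ((+) v)) \<phi>" by (simp add: lborel_distr_plus int)
    then have "integrable lborel (\<lambda>x. \<phi> (v + x))" by (rule integrable_distr[rotated]) simp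
    then show "integrable lborel (\<lambda>x. \<phi> (x + v))" by (simp add: add.commute)
    have "(LINT x|distr lborel borel ((+) v). \<phi> x) = (LINT x|lborel. \<phi> (v + x))"
      by (rule integral_distr) (use m in simp_all)
    then show "(LINT x|lborel. \<phi> (x + v)) = (LINT x|lborel. \<phi> x)"
      by (simp add: lborel_distr_plus add.commute)
  qed
  have Dn0: "(LINT x|lborel. Dn n x) = 0" for n
    unfolding Dn_def using shift int by simp
  have "(\<lambda>n. LINT x|lborel. Dn n x) \<longlonglongrightarrow> (LINT x|lborel. \<phi>' x)"
  proof (rule integral_dominated_convergence[where w = "\<lambda>x. indicator (cball 0 (B + 1)) x *\<^sub>R M"])
    show "\<phi>' \<in> borel_measurable lborel" using int' by auto
    show "Dn n \<in> borel_measurable lborel" for n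
      unfolding Dn_def using shift(1)[of "h n *\<^sub>R axis i 1"] int by (auto dest!: borel_measurable_integrable)
    show "integrable lborel (\<lambda>x. indicator (cball 0 (B + 1)) x *\<^sub>R M)"
      by (rule borel_integrable_compact) auto
    show "AE x in lborel. (\<lambda>n. Dn n x) \<longlonglongrightarrow> \<phi>' x"
    proof (rule AE_I2)
      fix x
      have "((\<lambda>t. \<phi> (x + t *\<^sub>R axis i 1)) has_real_derivative \<phi>' x) (at 0)"
        using has_partial_line_real[of i \<phi> "\<phi>' x" x 0] d by simp
      then have "((\<lambda>t. (\<phi> (x + t *\<^sub>R axis i 1) - \<phi> x) / t) \<longlongrightarrow> \<phi>' x) (at 0)"
        by (simp add: DERIV_def)
      moreover have "filterlim h (at 0) sequentially"
        using h0 h(1) by (auto simp: filterlim_at less_imp_neq[symmetric] intro!: always_eventually)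
      ultimately show "(\<lambda>n. Dn n x) \<longlonglongrightarrow> \<phi>' x"
        unfolding Dn_def by (rule filterlim_compose)
    qed
    show "AE x in lborel. norm (Dn n x) \<le> indicator (cball 0 (B + 1)) x *\<^sub>R M" for n
    proof (rule AE_I2)
      fix x
      obtain t where t: "\<bar>t\<bar> \<le> \<bar>h n\<bar>" "\<phi> (x + h n *\<^sub>R axis i 1) - \<phi> x = h n * \<phi>' (x + t *\<^sub>R axis i 1)"
        using mvt_line[of "h n" i \<phi> \<phi>' x] d by blast
      then have eq: "Dn n x = \<phi>' (x + t *\<^sub>R axis i 1)" using h[of n] by (simp add: Dn_def)
      show "norm (Dn n x) \<le> indicator (cball 0 (B + 1)) x *\<^sub>R M"
      proof (cases "norm x \<le> B + 1")
        case True then show ?thesis using M by (simp add: eq)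
      next
        case False
        have "norm x \<le> norm (x + t *\<^sub>R axis i 1) + norm (t *\<^sub>R (axis i 1 :: real^3))"
          by (metis add_diff_cancel norm_triangle_ineq4)
        then have "norm (x + t *\<^sub>R axis i 1) > B" using False t(1) h[of n] by simp
        then show ?thesis using False B' by (simp add: eq)
      qed
    qed
  qed
  then show "(LINT x|lborel. \<phi>' x) = 0"
    unfolding Dn0 using LIMSEQ_unique tendsto_const by blast
qed

text \<open>
  Truncated powers serve as building blocks of all cutoffs and bumps: they are as smooth as needed
  and have elementary derivatives.
\<close>

lemma has_real_derivative_truncated_power:
  "((\<lambda>u. max 0 u ^ Suc (Suc n)) has_real_derivative (real (Suc (Suc n)) * max 0 u ^ Suc n)) (at (u::real))"
proof -
  consider "u < 0" | "u > 0" | "u = 0" by linarith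
  then show ?thesis
  proof cases
    case 1
    have "((\<lambda>u. 0) has_real_derivative 0) (at u)" by simp
    moreover have "\<forall>\<^sub>F v in nhds u. max 0 v ^ Suc (Suc n) = 0"
      using eventually_nhds_in_open[of "{..<0}" u] 1 by (auto elim!: eventually_mono)
    ultimately have "((\<lambda>u. max 0 u ^ Suc (Suc n)) has_real_derivative 0) (at u)"
      by (subst DERIV_cong_ev[OF refl _ refl])
    then show ?thesis using 1 by simp
  next
    case 2
    have "((\<lambda>u. u ^ Suc (Suc n)) has_real_derivative (real (Suc (Suc n)) * u ^ Suc n)) (at u)"
      using DERIV_pow[of "Suc (Suc n)" u UNIV] by simp
    moreover have "\<forall>\<^sub>F v in nhds u. max 0 v ^ Suc (Suc n) = v ^ Suc (Suc n)"
      using eventually_nhds_in_open[of "{0<..}" u] 2 by (auto elim!: eventually_mono)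
    ultimately have "((\<lambda>u. max 0 u ^ Suc (Suc n)) has_real_derivative (real (Suc (Suc n)) * u ^ Suc n)) (at u)"
      by (subst DERIV_cong_ev[OF refl _ refl])
    then show ?thesis using 2 by simp
  next
    case 3
    have "((\<lambda>h. max 0 h ^ Suc (Suc n) / h) \<longlongrightarrow> 0) (at (0::real))"
    proof (rule tendsto_rabs_zero_cancel, rule tendsto_sandwich[of "\<lambda>_. 0"])
      show "\<forall>\<^sub>F h in at (0::real). \<bar>max 0 h ^ Suc (Suc n) / h\<bar> \<le> \<bar>h\<bar> ^ Suc n"
      proof (intro always_eventually allI)
        fix h :: real
        show "\<bar>max 0 h ^ Suc (Suc n) / h\<bar> \<le> \<bar>h\<bar> ^ Suc n"
        proof (cases "h > 0")
          case True then show ?thesis by (simp add: abs_mult power_abs)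
        next
          case False
          then have "max 0 h = 0" by (simp only: not_less max_absorb1)
          then have "max 0 h ^ Suc (Suc n) / h = 0" by (metis power_Suc mult_zero_left div_0)
          then show ?thesis by (metis abs_zero abs_ge_zero zero_le_power)
        qed
      qed
      show "((\<lambda>h. \<bar>h\<bar> ^ Suc n) \<longlongrightarrow> 0) (at (0::real))"
        by (auto intro!: tendsto_eq_intros)
    qed auto
    then show ?thesis using 3 by (simp add: DERIV_def)
  qed
qed

text \<open>
  A \<open>C\<^sup>1\<close> transition from \<open>0\<close> on \<open>u \<le> 0\<close> to \<open>1\<close> on \<open>u \<ge> 1\<close>, quadratic on each half of the unit interval.
\<close>

definition step :: "real \<Rightarrow> real" where
  "step u = 2 * max 0 u ^ 2 - 4 * max 0 (u - 1/2) ^ 2 + 2 * max 0 (u - 1) ^ 2"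
definition step' :: "real \<Rightarrow> real" where
  "step' u = 4 * max 0 u - 8 * max 0 (u - 1/2) + 4 * max 0 (u - 1)"

lemma step_deriv: "(step has_real_derivative step' u) (at u)"
proof -
  have *: "((\<lambda>u. max 0 u ^ 2) has_real_derivative 2 * max 0 u) (at u)" for u :: real
    using has_real_derivative_truncated_power[of 0 u] by (simp add: numeral_2_eq_2)
  have **: "((\<lambda>u. max 0 (u - c) ^ 2) has_real_derivative 2 * max 0 (u - c)) (at u)" for c
  proof -
    have "((\<lambda>u. u - c) has_real_derivative 1) (at u)" by (auto intro!: derivative_eq_intros)
    from DERIV_chain2[where f = "\<lambda>u. max 0 u ^ 2" and g = "\<lambda>u. u - c" and x = u and Db = 1 and s = UNIV, OF *[of "u - c"] this]
    show ?thesis by simp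
  qed
  show ?thesis unfolding step_def[abs_def] step'_def
    by (rule derivative_eq_intros * ** refl)+ simp
qed

lemma step_props:
  "u \<le> 0 \<Longrightarrow> step u = 0" "u \<ge> 1 \<Longrightarrow> step u = 1" "u \<le> 0 \<or> u \<ge> 1 \<Longrightarrow> step' u = 0"
  "\<bar>step' u\<bar> \<le> 2" "isCont step' u"
  by (auto simp: step_def step'_def max_def power2_eq_square algebra_simps intro!: continuous_intros)
    (simp add: step'_def[abs_def] continuous_intros)

lemma step_bound: "\<bar>step u\<bar> \<le> 1"
proof -
  consider "u \<le> 0" | "0 \<le> u" "u \<le> 1/2" | "1/2 \<le> u" "u \<le> 1" | "u \<ge> 1" by linarith
  then show ?thesis
  proof cases
    case 2
    have "u * u \<le> 1/2 * (1/2)" using 2 by (intro mult_mono) auto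
    moreover have "step u = 2 * (u * u)" using 2 by (simp add: step_def power2_eq_square)
    ultimately show ?thesis by (auto simp: abs_le_iff)
  next
    case 3
    have "(1 - u) * (1 - u) \<le> 1/2 * (1/2)" using 3 by (intro mult_mono) auto
    moreover have "step u = 1 - 2 * ((1 - u) * (1 - u))"
      using 3 by (auto simp: step_def max_def power2_eq_square field_simps)
    ultimately show ?thesis by (auto simp: abs_le_iff)
  qed (auto simp: step_props)
qed

text \<open>
  The argument \<open>s\<close> stands for the squared norm. The first factor vanishes where the distance of \<open>s\<close> from \<open>1\<close>
  is below \<open>1/n\<close>, the second one, needed on the unbounded domain only, where \<open>s \<ge> 2 n\<close>.
\<close>

fun cutoff :: "side \<Rightarrow> real \<Rightarrow> real \<Rightarrow> real" where
  "cutoff Interior n s = step (n * (1 - s) - 1)"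
| "cutoff Exterior n s = step (n * (s - 1) - 1) * step (2 - s / n)"
fun cutoff' :: "side \<Rightarrow> real \<Rightarrow> real \<Rightarrow> real" where
  "cutoff' Interior n s = - n * step' (n * (1 - s) - 1)"
| "cutoff' Exterior n s = n * step' (n * (s - 1) - 1) * step (2 - s / n) - step (n * (s - 1) - 1) * step' (2 - s / n) / n"

lemma cutoff_deriv:
  assumes "n > 0" shows "(cutoff \<sigma> n has_real_derivative cutoff' \<sigma> n s) (at s)"
proof (cases \<sigma>)
  case Interior
  have "((\<lambda>s. step (n * (1 - s) - 1)) has_real_derivative step' (n * (1 - s) - 1) * (- n)) (at s)"
    by (rule DERIV_chain2[OF step_deriv]) (auto intro!: derivative_eq_intros)
  moreover have "cutoff \<sigma> n = (\<lambda>s. step (n * (1 - s) - 1))" using Interior by auto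
  ultimately show ?thesis using Interior by (simp add: mult.commute)
next
  case Exterior
  have 1: "((\<lambda>s. step (n * (s - 1) - 1)) has_real_derivative step' (n * (s - 1) - 1) * n) (at s)"
    by (rule DERIV_chain2[OF step_deriv]) (auto intro!: derivative_eq_intros)
  have 2: "((\<lambda>s. step (2 - s / n)) has_real_derivative step' (2 - s / n) * (- (1/n))) (at s)"
    by (rule DERIV_chain2[OF step_deriv]) (use assms in \<open>auto intro!: derivative_eq_intros\<close>)
  have "cutoff \<sigma> n = (\<lambda>s. step (n * (s - 1) - 1) * step (2 - s / n))" using Exterior by auto
  then show ?thesis using DERIV_mult[OF 1 2] Exterior by (simp add: algebra_simps)
qed

lemma cutoff_cont: "continuous_on A (cutoff' \<sigma> n)" if "n > 0"
proof -
  have s': "continuous_on UNIV step'" using step_props(5) by (simp add: continuous_on_eq_continuous_at)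
  have s: "continuous_on UNIV step" using step_deriv DERIV_isCont by (auto simp: continuous_on_eq_continuous_at)
  have "continuous_on A (\<lambda>s. cutoff' \<sigma> n s)"
    by (cases \<sigma>) (use that in \<open>auto intro!: continuous_intros continuous_on_compose2[OF s] continuous_on_compose2[OF s']\<close>)
  then show ?thesis by simp
qed

lemma cutoff_bound: "\<bar>cutoff \<sigma> n s\<bar> \<le> 1"
  using step_bound by (cases \<sigma>) (auto simp: abs_mult intro: mult_le_one)

text \<open>
  The derivative is of order \<open>n\<close> only where \<open>|1 - s|\<close> is of order \<open>1/n\<close>, and of order \<open>1/n\<close> only where \<open>s\<close>
  is of order \<open>n\<close>; so the weight \<open>1 - s\<close> makes it bounded uniformly in \<open>n\<close>.
\<close>

lemma cutoff'_bound:
  assumes "n \<ge> 1"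
  shows "\<bar>cutoff' \<sigma> n s * (1 - s)\<bar> \<le> 8"
proof -
  have A: "\<bar>n * step' (n * u - 1) * u\<bar> \<le> 4" for u
  proof (cases "n * u - 1 \<le> 0 \<or> n * u - 1 \<ge> 1")
    case False
    then have "\<bar>n * u\<bar> \<le> 2" by auto
    then have "\<bar>n * u\<bar> * \<bar>step' (n * u - 1)\<bar> \<le> 2 * 2" using step_props(4) by (intro mult_mono) auto
    then show ?thesis by (simp add: abs_mult ac_simps)
  qed (use step_props(3) in auto)
  show ?thesis
  proof (cases \<sigma>)
    case Interior
    then show ?thesis using A[of "1 - s"] by simp
  next
    case Exterior
    have 1: "\<bar>n * step' (n * (s - 1) - 1) * (s - 1) * step (2 - s / n)\<bar> \<le> 4 * 1"
      unfolding abs_mult[of _ "step _"] by (rule mult_mono[OF A step_bound]) auto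
    have 2: "\<bar>step (n * (s - 1) - 1) * (step' (2 - s / n) * ((s - 1) / n))\<bar> \<le> 1 * 4"
      unfolding abs_mult[of "step _"]
    proof (rule mult_mono[OF step_bound])
      show "\<bar>step' (2 - s / n) * ((s - 1) / n)\<bar> \<le> 4"
      proof (cases "2 - s / n \<le> 0 \<or> 2 - s / n \<ge> 1")
        case False
        then have "s / n < 2" "1 < s / n" by auto
        then have "s < 2 * n" "n < s" using assms by (auto simp: field_simps)
        then have "\<bar>(s - 1) / n\<bar> \<le> 2" using assms by (auto simp: field_simps)
        then have "\<bar>step' (2 - s / n)\<bar> * \<bar>(s - 1) / n\<bar> \<le> 2 * 2" using step_props(4) by (intro mult_mono) auto
        then show ?thesis by (simp add: abs_mult)
      qed (use step_props(3) in auto)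
    qed auto
    have "cutoff' \<sigma> n s * (1 - s) = - (n * step' (n * (s - 1) - 1) * (s - 1) * step (2 - s / n))
        + step (n * (s - 1) - 1) * (step' (2 - s / n) * ((s - 1) / n))"
      using Exterior assms by (simp add: field_simps)
    then show ?thesis using 1 2 by linarith
  qed
qed

lemma cutoff_eventually:
  fixes x :: "real^3"
  assumes "x \<in> dom3 \<sigma>"
  shows "\<forall>\<^sub>F n in sequentially. cutoff \<sigma> (real (Suc n)) ((norm x)\<^sup>2) = 1 \<and> cutoff' \<sigma> (real (Suc n)) ((norm x)\<^sup>2) = 0"
proof -
  define s where "s = (norm x)\<^sup>2"
  have lim: "filterlim (\<lambda>n. real (Suc n)) at_top sequentially"
    by (rule filterlim_compose[OF filterlim_real_sequentially filterlim_Suc])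
  have ev: "\<forall>\<^sub>F n in sequentially. real (Suc n) \<ge> c" for c
    using lim by (simp add: filterlim_at_top)
  show ?thesis
  proof (cases \<sigma>)
    case Interior
    then have "s < 1" using assms by (simp add: s_def power_less_one_iff)
    show ?thesis
      using ev[of "2 / (1 - s)"]
    proof eventually_elim
      case (elim n)
      then have "real (Suc n) * (1 - s) - 1 \<ge> 1" using \<open>s < 1\<close> by (simp add: field_simps)
      then show ?case using step_props(2,3) Interior by (simp add: s_def)
    qed
  next
    case Exterior
    then have "s > 1" using assms by (simp add: s_def one_less_power)
    show ?thesis
      using ev[of "2 / (s - 1)"] ev[of s]
    proof eventually_elim
      case (elim n)
      then have "real (Suc n) * (s - 1) - 1 \<ge> 1" "2 - s / real (Suc n) \<ge> 1" using \<open>s > 1\<close> by (simp_all add: field_simps)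
      then show ?case using step_props(2,3) Exterior by (simp add: s_def)
    qed
  qed
qed

lemma cutoff_support:
  assumes "n \<ge> 1"
  obtains V :: "(real^3) set" where "open V" "- dom3 \<sigma> \<subseteq> V" "\<And>x. x \<in> V \<Longrightarrow> cutoff \<sigma> n ((norm x)\<^sup>2) = 0"
    "\<And>x::real^3. norm x > 2 * n \<Longrightarrow> cutoff \<sigma> n ((norm x)\<^sup>2) = 0"
proof (cases \<sigma>)
  case Interior
  have "cutoff \<sigma> n ((norm x)\<^sup>2) = 0" if "(norm x)\<^sup>2 > 1 - 1/n" for x :: "real^3"
  proof -
    have "n * (norm x)\<^sup>2 > n - 1"
      using mult_strict_left_mono[OF that, of n] assms by (simp add: right_diff_distrib)
    then show ?thesis using Interior by (simp add: step_props algebra_simps)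
  qed
  moreover have "open {x::real^3. (norm x)\<^sup>2 > 1 - 1/n}" by (auto intro!: open_Collect_less continuous_intros)
  moreover have "(norm x)\<^sup>2 > 1 - 1/n" if "norm x \<ge> 1" for x :: "real^3"
  proof -
    have "(norm x)\<^sup>2 \<ge> 1" using that by simp
    then show ?thesis using assms by (smt (verit) divide_pos_pos)
  qed
  ultimately show ?thesis using Interior assms by (intro that[of "{x::real^3. (norm x)\<^sup>2 > 1 - 1/n}"]) auto
next
  case Exterior
  have "cutoff \<sigma> n ((norm x)\<^sup>2) = 0" if "(norm x)\<^sup>2 < 1 + 1/n" for x :: "real^3"
  proof -
    have "n * (norm x)\<^sup>2 < n + 1"
      using mult_strict_left_mono[OF that, of n] assms by (simp add: distrib_left)
    then show ?thesis using Exterior by (simp add: step_props algebra_simps)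
  qed
  moreover have "open {x::real^3. (norm x)\<^sup>2 < 1 + 1/n}" by (auto intro!: open_Collect_less continuous_intros)
  moreover have "(norm x)\<^sup>2 < 1 + 1/n" if "norm x \<le> 1" for x :: "real^3"
  proof -
    have "(norm x)\<^sup>2 \<le> 1" using that by (simp add: power_le_one_iff)
    then show ?thesis using assms by (smt (verit) divide_pos_pos)
  qed
  moreover have "cutoff \<sigma> n ((norm x)\<^sup>2) = 0" if "norm x > 2 * n" for x :: "real^3"
  proof -
    have "2 * n * 1 \<le> norm x * norm x" using that assms by (intro mult_mono) auto
    then have "2 - (norm x)\<^sup>2 / n \<le> 0" using assms by (simp add: field_simps power2_eq_square)
    then show ?thesis using Exterior by (simp add: step_props)
  qed
  ultimately show ?thesis using Exterior by (intro that[of "{x::real^3. (norm x)\<^sup>2 < 1 + 1/n}"]) auto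
qed

lemma has_partial_norm_sq: "has_partial i (\<lambda>x. (norm x)\<^sup>2) (2 * x $ i) (x :: real^3)"
proof -
  have "((\<lambda>x. x \<bullet> x) has_derivative (\<lambda>h. x \<bullet> h + h \<bullet> x)) (at x)"
    by (rule has_derivative_inner) (rule has_derivative_ident)+
  from has_partial_from_derivative[OF this, of i]
  show ?thesis by (simp add: power2_norm_eq_inner inner_axis inner_commute)
qed

lemma has_partial_radial:
  assumes "(e has_real_derivative d) (at ((norm x)\<^sup>2))"
  shows "has_partial i (\<lambda>x. e ((norm x)\<^sup>2)) (d * (2 * x $ i)) (x :: real^3)"
proof -
  have "((\<lambda>t. (norm (x + t *\<^sub>R axis i 1))\<^sup>2) has_real_derivative 2 * x $ i) (at 0)"
    using has_partial_line_real[of i "\<lambda>x. (norm x)\<^sup>2" "2 * x $ i" x 0] has_partial_norm_sq by simp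
  from DERIV_chain2[of e d "\<lambda>t. (norm (x + t *\<^sub>R axis i 1))\<^sup>2" 0, OF _ this] assms
  show ?thesis by (simp add: has_partial_def has_real_derivative_iff_has_vector_derivative)
qed

text \<open>
  The divergence theorem for a field whose normal component vanishes on the sphere, without boundary
  values: \<open>W\<close> is multiplied by cutoffs. Their gradients are radial, so they meet \<open>W\<close> only through \<open>x \<bullet> W\<close>, and
  hypothesis \<open>normal\<close> compensates the growth of the gradients near the sphere (and near infinity).
  Dominated convergence then removes the cutoffs.
\<close>

lemma divergence_dom3:
  fixes W D :: "3 \<Rightarrow> real^3 \<Rightarrow> real" and g :: "real^3 \<Rightarrow> real"
  assumes W: "\<And>i x. x \<in> dom3 \<sigma> \<Longrightarrow> has_partial i (W i) (D i x) x"
    and cW: "\<And>i. continuous_on (dom3 \<sigma>) (W i)" and cD: "\<And>i. continuous_on (dom3 \<sigma>) (D i)"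
    and intD: "integrable (lebesgue_on (dom3 \<sigma>)) (\<lambda>x. \<Sum>i\<in>UNIV. D i x)"
    and intg: "integrable (lebesgue_on (dom3 \<sigma>)) g"
    and normal: "\<And>x. x \<in> dom3 \<sigma> \<Longrightarrow> \<bar>\<Sum>i\<in>UNIV. x $ i * W i x\<bar> \<le> \<bar>1 - (norm x)\<^sup>2\<bar> * g x"
  shows "(LINT x|lebesgue_on (dom3 \<sigma>). (\<Sum>i\<in>UNIV. D i x)) = 0"
proof -
  define c where "c n x = cutoff \<sigma> (real (Suc n)) ((norm x)\<^sup>2)" for n and x :: "real^3"
  define c' where "c' n x = cutoff' \<sigma> (real (Suc n)) ((norm x)\<^sup>2)" for n and x :: "real^3"
  define \<phi> where "\<phi> n i x = (if x \<in> dom3 \<sigma> then c n x * W i x else 0)" for n i x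
  define \<phi>' where "\<phi>' n i x = (if x \<in> dom3 \<sigma> then c' n x * (2 * x $ i) * W i x + c n x * D i x else 0)" for n i x
  have cd: "has_partial i (c n) (c' n x * (2 * x $ i)) x" for n i x
    unfolding c_def c'_def by (rule has_partial_radial) (rule cutoff_deriv, simp)
  have cc: "continuous_on UNIV (c n)" "continuous_on UNIV (c' n)" for n
  proof -
    have "continuous_on UNIV (cutoff \<sigma> (real (Suc n)))"
      using cutoff_deriv[of "real (Suc n)"] DERIV_isCont by (fastforce simp: continuous_on_eq_continuous_at)
    then show "continuous_on UNIV (c n)" unfolding c_def
      by (rule continuous_on_compose2) (auto intro!: continuous_intros)
    show "continuous_on UNIV (c' n)" unfolding c'_def
      by (rule continuous_on_compose2[OF cutoff_cont[of "real (Suc n)" UNIV]]) (auto intro!: continuous_intros)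
  qed
  \<comment> \<open>the truncated components are continuously differentiable on the whole space, with compact support\<close>
  have zero: "(LINT x|lborel. \<phi>' n i x) = 0" and intphi: "integrable lborel (\<phi>' n i)" for n i
  proof -
    obtain V :: "(real^3) set" where V: "open V" "- dom3 \<sigma> \<subseteq> V" "\<And>x. x \<in> V \<Longrightarrow> c n x = 0"
      "\<And>x::real^3. norm x > 2 * real (Suc n) \<Longrightarrow> c n x = 0"
      using cutoff_support[of "real (Suc n)" \<sigma>] unfolding c_def by auto
    have c'V: "c' n x * (2 * x $ j) = 0" if "x \<in> V" for x j
    proof -
      have "has_partial j (\<lambda>x. 0) (c' n x * (2 * x $ j)) x"
        by (rule has_partial_cong_open[OF V(1) that _ cd[of j n x]]) (rule V(3))
      then show ?thesis using has_partial_const has_partial_unique by blast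
    qed
    have pV: "\<phi> n i x = 0" "\<phi>' n i x = 0" if "x \<in> V" for x
      using V(3)[OF that] c'V[OF that] by (auto simp: \<phi>_def \<phi>'_def)
    have un: "UNIV = dom3 \<sigma> \<union> V" using V(2) by auto
    have cont: "continuous_on UNIV F" if "continuous_on (dom3 \<sigma>) F" "\<And>x. x \<in> V \<Longrightarrow> F x = 0" for F :: "real^3 \<Rightarrow> real"
    proof -
      have "continuous_on V F" using that(2) by (simp cong: continuous_on_cong)
      then show ?thesis unfolding un using that(1) open_dom3 V(1) by (intro continuous_on_open_Un)
    qed
    have 1: "has_partial i (\<phi> n i) (\<phi>' n i x) x" for x
    proof (cases "x \<in> dom3 \<sigma>")
      case True
      have "has_partial i (\<lambda>x. c n x * W i x) (c' n x * (2 * x $ i) * W i x + c n x * D i x) x"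
        by (rule has_partial_mult[OF cd W[OF True]])
      then show ?thesis
        using has_partial_cong_open[OF open_dom3 True, of "\<lambda>x. c n x * W i x" "\<phi> n i"] True by (simp add: \<phi>_def \<phi>'_def)
    next
      case False
      then have "x \<in> V" using V(2) by auto
      have "has_partial i (\<phi> n i) 0 x"
        by (rule has_partial_cong_open[OF V(1) \<open>x \<in> V\<close> _ has_partial_const]) (simp add: pV)
      then show ?thesis using pV \<open>x \<in> V\<close> by simp
    qed
    have 2: "continuous_on UNIV (\<phi> n i)"
    proof (rule cont)
      have "continuous_on (dom3 \<sigma>) (\<lambda>x. c n x * W i x)"
        by (intro continuous_intros continuous_on_subset[OF cc(1)] cW) auto
      then show "continuous_on (dom3 \<sigma>) (\<phi> n i)" by (rule continuous_on_eq) (simp add: \<phi>_def)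
    qed (rule pV)
    have 3: "continuous_on UNIV (\<phi>' n i)"
    proof (rule cont)
      have "continuous_on (dom3 \<sigma>) (\<lambda>x. c' n x * (2 * x $ i) * W i x + c n x * D i x)"
        by (intro continuous_intros continuous_on_subset[OF cc(1)] continuous_on_subset[OF cc(2)] cW cD) auto
      then show "continuous_on (dom3 \<sigma>) (\<phi>' n i)" by (rule continuous_on_eq) (simp add: \<phi>'_def)
    qed (rule pV)
    have 4: "\<phi> n i x = 0" if "norm x > 2 * real (Suc n)" for x
      using V(4)[OF that] by (simp add: \<phi>_def)
    show "(LINT x|lborel. \<phi>' n i x) = 0" "integrable lborel (\<phi>' n i)"
      using integral_partial_compact_support(2,3)[OF 1 2 3 4] by auto
  qed
  define G where "G n x = (\<Sum>i\<in>UNIV. \<phi>' n i x)" for n x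
  have Gint: "integrable lborel (G n)" for n unfolding G_def using intphi by simp
  have G0: "(LINT x|lebesgue. G n x) = 0" for n
  proof -
    have "(LINT x|lebesgue. G n x) = (LINT x|lborel. G n x)"
      by (rule integral_completion) (use Gint in auto)
    also have "\<dots> = 0" unfolding G_def using intphi zero by (subst Bochner_Integration.integral_sum) auto
    finally show ?thesis .
  qed
  \<comment> \<open>in the divergence of the truncated field only the normal component of \<open>W\<close> meets the derivative of the cutoff\<close>
  have Geq: "G n x = indicator (dom3 \<sigma>) x * (2 * c' n x * (\<Sum>i\<in>UNIV. x $ i * W i x) + c n x * (\<Sum>i\<in>UNIV. D i x))" for n x
    unfolding G_def \<phi>'_def
    by (simp add: sum.distrib sum_distrib_left indicator_def ac_simps)
  let ?L = "\<lambda>x. indicator (dom3 \<sigma>) x * (\<Sum>i\<in>UNIV. D i x)"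
  have iL: "integrable lebesgue ?L" using intD by (simp add: integrable_dom3_iff)
  have ig: "integrable lebesgue (\<lambda>x. indicator (dom3 \<sigma>) x * g x)" using intg by (simp add: integrable_dom3_iff)
  have "(\<lambda>n. LINT x|lebesgue. G n x) \<longlonglongrightarrow> (LINT x|lebesgue. ?L x)"
  proof (rule integral_dominated_convergence[where w = "\<lambda>x. \<bar>?L x\<bar> + 16 * (indicator (dom3 \<sigma>) x * g x)"])
    show "?L \<in> borel_measurable lebesgue" using iL by auto
    show "G n \<in> borel_measurable lebesgue" for n
      using Gint[of n] by (auto intro: measurable_completion)
    show "integrable lebesgue (\<lambda>x. \<bar>?L x\<bar> + 16 * (indicator (dom3 \<sigma>) x * g x))"
      using iL ig by auto
    show "AE x in lebesgue. (\<lambda>n. G n x) \<longlonglongrightarrow> ?L x"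
    proof (rule AE_I2)
      fix x :: "real^3"
      show "(\<lambda>n. G n x) \<longlonglongrightarrow> ?L x"
      proof (cases "x \<in> dom3 \<sigma>")
        case True
        have "\<forall>\<^sub>F n in sequentially. G n x = ?L x"
          using cutoff_eventually[OF True] by eventually_elim (simp add: Geq c_def c'_def)
        then show ?thesis by (rule tendsto_eventually)
      qed (simp add: Geq)
    qed
    show "AE x in lebesgue. norm (G n x) \<le> \<bar>?L x\<bar> + 16 * (indicator (dom3 \<sigma>) x * g x)" for n
    proof (rule AE_I2)
      fix x :: "real^3"
      show "norm (G n x) \<le> \<bar>?L x\<bar> + 16 * (indicator (dom3 \<sigma>) x * g x)"
      proof (cases "x \<in> dom3 \<sigma>")
        case True
        let ?N = "\<Sum>i\<in>UNIV. x $ i * W i x" and ?D = "\<Sum>i\<in>UNIV. D i x"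
        have g0: "0 \<le> \<bar>1 - (norm x)\<^sup>2\<bar> * g x" using normal[OF True] by linarith
        have "norm x \<noteq> 1" using True by (cases \<sigma>) auto
        then have "(norm x)\<^sup>2 \<noteq> 1" by (simp add: power2_eq_1_iff) (metis norm_ge_zero neg_0_le_iff_le not_one_le_zero)
        then have g0: "0 \<le> g x" using g0 by (simp add: zero_le_mult_iff)
        have "\<bar>c' n x * ?N\<bar> \<le> \<bar>c' n x\<bar> * (\<bar>1 - (norm x)\<^sup>2\<bar> * g x)"
          unfolding abs_mult by (intro mult_left_mono normal[OF True]) auto
        also have "\<dots> = \<bar>c' n x * (1 - (norm x)\<^sup>2)\<bar> * g x" by (simp add: abs_mult)
        also have "\<dots> \<le> 8 * g x"
          unfolding c'_def using g0 by (intro mult_right_mono cutoff'_bound) auto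
        finally have 1: "\<bar>c' n x * ?N\<bar> \<le> 8 * g x" .
        have 2: "\<bar>c n x * ?D\<bar> \<le> 1 * \<bar>?D\<bar>"
          unfolding abs_mult c_def by (intro mult_right_mono cutoff_bound) auto
        have "G n x = 2 * (c' n x * ?N) + c n x * ?D" using True by (simp add: Geq)
        then show ?thesis using 1 2 True by (simp add: abs_le_iff)
      qed (simp add: Geq)
    qed
  qed
  then have "(LINT x|lebesgue. ?L x) = 0"
    unfolding G0 using LIMSEQ_unique tendsto_const by blast
  then show ?thesis by (simp add: integral_dom3_eq)
qed

section \<open>Mean values and interior estimates for harmonic functions\<close>

definition smooth_harmonic :: "(real^3) set \<Rightarrow> (real^3 \<Rightarrow> real) \<Rightarrow> bool" where
  "smooth_harmonic S h \<longleftrightarrow> smooth_on S h \<and> (\<forall>x\<in>S. (\<Sum>i\<in>UNIV. partial i (partial i h) x) = 0)"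

lemma harm_smooth: "smooth_harmonic S h \<Longrightarrow> smooth_on S h" by (simp add: smooth_harmonic_def)
lemma harm_laplace: "smooth_harmonic S h \<Longrightarrow> x \<in> S \<Longrightarrow> (\<Sum>i\<in>UNIV. partial i (partial i h) x) = 0" by (simp add: smooth_harmonic_def)
lemma harm_subset: "smooth_harmonic S h \<Longrightarrow> T \<subseteq> S \<Longrightarrow> smooth_harmonic T h"
  by (auto simp: smooth_harmonic_def intro: smooth_on_subset)

lemma partial_partial_cong:
  assumes "open S" "x \<in> S" "\<And>y. y \<in> S \<Longrightarrow> f y = g y"
  shows "partial i (partial j f) x = partial i (partial j g) x"
  by (rule partial_cong_open[OF assms(1,2)], rule partial_cong_open[OF assms(1)]) (use assms in auto)

lemma harm_partial:
  assumes "open S" "smooth_harmonic S h" shows "smooth_harmonic S (partial j h)"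
  unfolding smooth_harmonic_def
proof (intro conjI ballI)
  have s: "smooth_on S h" using assms(2) by (rule harm_smooth)
  show "smooth_on S (partial j h)" by (rule smooth_on_partial[OF s])
  fix x assume x: "x \<in> S"
  have c: "partial i (partial k f) y = partial k (partial i f) y" if "y \<in> S" "smooth_on S f" for f :: "real^3 \<Rightarrow> real" and i k y
    by (rule partial_commute[OF assms(1) that(1)]) (rule smooth_on_cont_diff[OF that(2)])
  have "partial i (partial i (partial j h)) x = partial j (partial i (partial i h)) x" for i
  proof -
    have "partial i (partial i (partial j h)) x = partial i (partial j (partial i h)) x"
      by (rule partial_cong_open[OF assms(1) x]) (rule c[OF _ s])
    also have "\<dots> = partial j (partial i (partial i h)) x"
      by (rule c[OF x smooth_on_partial[OF s]])
    finally show ?thesis .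
  qed
  then have "(\<Sum>i\<in>UNIV. partial i (partial i (partial j h)) x) = (\<Sum>i\<in>UNIV. partial j (partial i (partial i h)) x)"
    by simp
  also have "\<dots> = partial j (\<lambda>x. \<Sum>i\<in>UNIV. partial i (partial i h) x) x"
    by (rule partial_sum[symmetric, OF _ x]) (intro smooth_on_partial s)
  also have "\<dots> = partial j (\<lambda>x. 0) x"
    by (rule partial_cong_open[OF assms(1) x]) (rule harm_laplace[OF assms(2)])
  also have "\<dots> = 0" by (rule has_partial_imp[OF has_partial_const])
  finally show "(\<Sum>i\<in>UNIV. partial i (partial i (partial j h)) x) = 0" .
qed

lemma harm_add: "open S \<Longrightarrow> smooth_harmonic S f \<Longrightarrow> smooth_harmonic S g \<Longrightarrow> smooth_harmonic S (\<lambda>x. f x + g x)"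
proof -
  assume o: "open S" and f: "smooth_harmonic S f" and g: "smooth_harmonic S g"
  have "partial i (partial i (\<lambda>x. f x + g x)) x = partial i (partial i f) x + partial i (partial i g) x" if x: "x \<in> S" for i x
  proof -
    have "partial i (partial i (\<lambda>x. f x + g x)) x = partial i (\<lambda>x. partial i f x + partial i g x) x"
      by (rule partial_cong_open[OF o x]) (rule partial_add[OF harm_smooth[OF f] harm_smooth[OF g]])
    also have "\<dots> = partial i (partial i f) x + partial i (partial i g) x"
      by (rule partial_add[OF smooth_on_partial[OF harm_smooth[OF f]] smooth_on_partial[OF harm_smooth[OF g]] x])
    finally show ?thesis .
  qed
  then show ?thesis
    using f g o by (auto simp: smooth_harmonic_def sum.distrib intro!: smooth_on_add)
qed

lemma harm_cmult: "open S \<Longrightarrow> smooth_harmonic S f \<Longrightarrow> smooth_harmonic S (\<lambda>x. c * f x)"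
proof -
  assume o: "open S" and f: "smooth_harmonic S f"
  have "partial i (partial i (\<lambda>x. c * f x)) x = c * partial i (partial i f) x" if x: "x \<in> S" for i x
  proof -
    have "partial i (partial i (\<lambda>x. c * f x)) x = partial i (\<lambda>x. c * partial i f x) x"
      by (rule partial_cong_open[OF o x]) (rule partial_cmult[OF harm_smooth[OF f]])
    also have "\<dots> = c * partial i (partial i f) x"
      by (rule partial_cmult[OF smooth_on_partial[OF harm_smooth[OF f]] x])
    finally show ?thesis .
  qed
  then show ?thesis
    using f o by (auto simp: smooth_harmonic_def sum_distrib_left[symmetric] intro!: smooth_on_cmult)
qed

lemma harm_diff: "open S \<Longrightarrow> smooth_harmonic S f \<Longrightarrow> smooth_harmonic S g \<Longrightarrow> smooth_harmonic S (\<lambda>x. f x - g x)"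
  using harm_add[of S f "\<lambda>x. -1 * g x"] harm_cmult[of S g "-1"] by simp

lemma harm_const: "open S \<Longrightarrow> smooth_harmonic S (\<lambda>x. c)"
proof -
  assume o: "open S"
  have "partial i (partial i (\<lambda>x. c)) x = (0::real)" if x: "x \<in> S" for i x
  proof -
    have "partial i (\<lambda>x. c::real) = (\<lambda>x. 0)" by (rule ext, rule has_partial_imp, rule has_partial_const)
    then show ?thesis by (simp add: has_partial_imp[OF has_partial_const])
  qed
  then show ?thesis by (simp add: smooth_harmonic_def smooth_on_const)
qed

lemma harm_sum:
  assumes "open S" "\<And>a. a \<in> A \<Longrightarrow> smooth_harmonic S (f a)"
  shows "smooth_harmonic S (\<lambda>x. \<Sum>a\<in>A. f a x)"
  using assms(2) by (induction A rule: infinite_finite_induct) (auto intro: harm_const harm_add assms(1))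

lemma has_partial_affine:
  assumes "has_partial i g d (a + c *\<^sub>R x)"
  shows "has_partial i (\<lambda>y. g (a + c *\<^sub>R y)) (c *\<^sub>R d) x"
proof -
  have *: "((\<lambda>s. c * s) has_vector_derivative c) (at 0)"
    by (auto intro!: derivative_eq_intros)
  have "((\<lambda>s. g ((a + c *\<^sub>R x) + s *\<^sub>R axis i 1)) has_vector_derivative d) (at (c * 0))"
    using assms by (simp add: has_partial_def)
  from vector_diff_chain_at[OF * this]
  show ?thesis
    by (simp add: o_def has_partial_def scaleR_add_right add.assoc)
qed

lemma open_affine_vimage:
  fixes S :: "(real^3) set"
  assumes "open S" shows "open {y. a + c *\<^sub>R y \<in> S}"
proof -
  have "open ((\<lambda>y. a + c *\<^sub>R y) -` S)" by (rule open_vimage[OF assms]) (intro continuous_intros)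
  then show ?thesis by (simp add: vimage_def)
qed

lemma smooth_on_affine:
  fixes f :: "real^3 \<Rightarrow> real"
  assumes "open S" "smooth_on S f" shows "smooth_on {y. a + c *\<^sub>R y \<in> S} (\<lambda>y. f (a + c *\<^sub>R y))"
proof -
  have "cont_diff_on k {y. a + c *\<^sub>R y \<in> S} (\<lambda>y. f (a + c *\<^sub>R y))" if "smooth_on S f" for k f
    using that
  proof (induction k arbitrary: f)
    case 0
    then show ?case
      by (auto intro!: continuous_on_compose2[OF smooth_on_continuous[OF 0]] continuous_intros)
  next
    case (Suc k)
    show ?case
    proof (rule cont_diff_on_SucI[where g = "\<lambda>i y. c *\<^sub>R partial i f (a + c *\<^sub>R y)"])
      show "open {y. a + c *\<^sub>R y \<in> S}" by (rule open_affine_vimage[OF assms(1)])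
      show "continuous_on {y. a + c *\<^sub>R y \<in> S} (\<lambda>y. f (a + c *\<^sub>R y))"
        by (auto intro!: continuous_on_compose2[OF smooth_on_continuous[OF Suc.prems]] continuous_intros)
      show "has_partial i (\<lambda>y. f (a + c *\<^sub>R y)) (c *\<^sub>R partial i f (a + c *\<^sub>R x)) x"
        if "x \<in> {y. a + c *\<^sub>R y \<in> S}" for i x
        by (rule has_partial_affine) (use that smooth_on_has_partial[OF Suc.prems] in simp)
      show "cont_diff_on k {y. a + c *\<^sub>R y \<in> S} (\<lambda>y. c *\<^sub>R partial i f (a + c *\<^sub>R y))" for i
        by (rule cont_diff_on_bounded_linear[OF open_affine_vimage[OF assms(1)] bounded_linear_scaleR_right])
          (rule Suc.IH[OF smooth_on_partial[OF Suc.prems]])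
    qed
  qed
  from this[OF assms(2)] show ?thesis unfolding smooth_on_def by (rule allI)
qed

lemma partial_affine:
  fixes f :: "real^3 \<Rightarrow> real"
  assumes "smooth_on S f" "a + c *\<^sub>R x \<in> S"
  shows "partial i (\<lambda>y. f (a + c *\<^sub>R y)) x = c * partial i f (a + c *\<^sub>R x)"
  using has_partial_imp[OF has_partial_affine[OF smooth_on_has_partial[OF assms]]] by simp

lemma lborel_affine_integral:
  fixes F :: "real^3 \<Rightarrow> real"
  assumes F: "integrable lborel F" and d: "d > 0"
  shows "integrable lborel (\<lambda>y. F (a + d *\<^sub>R y))" "(LINT y|lborel. F (a + d *\<^sub>R y)) = (LINT y|lborel. F y) / d ^ 3"
proof -
  have [measurable]: "F \<in> borel_measurable borel" using F by (auto dest: borel_measurable_integrable)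
  let ?T = "\<lambda>y::real^3. a + d *\<^sub>R y"
  have L: "lborel = density (distr lborel borel ?T) (\<lambda>_. ennreal (d ^ 3))"
    using lborel_affine[of d a] d by simp
  have "integrable (density (distr lborel borel ?T) (\<lambda>_. ennreal (d ^ 3))) F" using F L by simp
  then have "integrable (distr lborel borel ?T) (\<lambda>y. d ^ 3 *\<^sub>R F y)"
    by (subst (asm) integrable_density) (use d in auto)
  then have "integrable (distr lborel borel ?T) F" using d by simp
  then show "integrable lborel (\<lambda>y. F (a + d *\<^sub>R y))" by (rule integrable_distr[rotated]) simp
  have "(LINT y|lborel. F y) = (LINT y|density (distr lborel borel ?T) (\<lambda>_. ennreal (d ^ 3)). F y)" using L by simp
  also have "\<dots> = (LINT y|distr lborel borel ?T. d ^ 3 *\<^sub>R F y)"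
    by (subst integral_density) (use d in auto)
  also have "\<dots> = d ^ 3 * (LINT y|distr lborel borel ?T. F y)" by simp
  also have "(LINT y|distr lborel borel ?T. F y) = (LINT y|lborel. F (a + d *\<^sub>R y))"
    by (rule integral_distr) auto
  finally show "(LINT y|lborel. F (a + d *\<^sub>R y)) = (LINT y|lborel. F y) / d ^ 3" using d by simp
qed

lemma integrable_product_L2:
  fixes f g :: "'a \<Rightarrow> real"
  assumes [measurable]: "f \<in> borel_measurable M" "g \<in> borel_measurable M"
    and "integrable M (\<lambda>x. (f x)\<^sup>2)" "integrable M (\<lambda>x. (g x)\<^sup>2)"
  shows "integrable M (\<lambda>x. f x * g x)"
proof (rule Bochner_Integration.integrable_bound)
  show "integrable M (\<lambda>x. (f x)\<^sup>2 + (g x)\<^sup>2)" using assms by simp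
  show "AE x in M. norm (f x * g x) \<le> norm ((f x)\<^sup>2 + (g x)\<^sup>2)"
  proof (rule AE_I2)
    fix x
    have "0 \<le> (\<bar>f x\<bar> - \<bar>g x\<bar>)\<^sup>2" by simp
    then have "2 * (\<bar>f x\<bar> * \<bar>g x\<bar>) \<le> (f x)\<^sup>2 + (g x)\<^sup>2" by (simp add: power2_diff)
    moreover have "0 \<le> \<bar>f x\<bar> * \<bar>g x\<bar>" by (rule mult_nonneg_nonneg) auto
    ultimately have "\<bar>f x\<bar> * \<bar>g x\<bar> \<le> (f x)\<^sup>2 + (g x)\<^sup>2" by linarith
    then show "norm (f x * g x) \<le> norm ((f x)\<^sup>2 + (g x)\<^sup>2)" by (simp add: abs_mult)
  qed
qed simp

lemma quadratic_nonneg_discriminant: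
  fixes a b c :: real
  assumes "\<And>t. 0 \<le> a + 2 * t * b + t\<^sup>2 * c"
  shows "b\<^sup>2 \<le> a * c"
proof (cases "c = 0")
  case True
  have "b = 0"
  proof (rule ccontr)
    assume "b \<noteq> 0"
    have "0 \<le> a + 2 * (- (a + 1) / (2 * b)) * b" using assms[of "- (a + 1) / (2 * b)"] True by simp
    also have "\<dots> = -1" using \<open>b \<noteq> 0\<close> by (simp add: field_simps)
    finally show False by simp
  qed
  then show ?thesis using True by simp
next
  case False
  have "0 \<le> c"
  proof (rule ccontr)
    assume "\<not> 0 \<le> c"
    define t where "t = max 1 (- (a + 2 * \<bar>b\<bar> + 1) / c)"
    have t: "t \<ge> 1" "t * c \<le> - (a + 2 * \<bar>b\<bar> + 1)"
      using \<open>\<not> 0 \<le> c\<close> by (auto simp: t_def max_def field_simps)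
    have "a \<ge> 0" using assms[of 0] by simp
    have "t * (t * c) \<le> t * (- (a + 2 * \<bar>b\<bar> + 1))" using t by (intro mult_left_mono) auto
    moreover have "2 * t * b \<le> 2 * t * \<bar>b\<bar>" using t by (intro mult_left_mono) auto
    moreover have "t * a \<ge> a" using t \<open>a \<ge> 0\<close> by (simp add: mult_le_cancel_right1)
    ultimately have "a + 2 * t * b + t\<^sup>2 * c \<le> - t" by (simp add: power2_eq_square algebra_simps)
    then show False using assms[of t] t by linarith
  qed
  then have c: "c > 0" using False by simp
  have "0 \<le> c * (a + 2 * (- b / c) * b + (- b / c)\<^sup>2 * c)"
    by (intro mult_nonneg_nonneg assms less_imp_le[OF c])
  also have "\<dots> = a * c - b\<^sup>2" using c by (simp add: field_simps power2_eq_square)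
  finally show ?thesis by simp
qed

lemma Cauchy_Schwarz_integral:
  fixes f g :: "'a \<Rightarrow> real"
  assumes "f \<in> borel_measurable M" "g \<in> borel_measurable M"
    and "integrable M (\<lambda>x. (f x)\<^sup>2)" "integrable M (\<lambda>x. (g x)\<^sup>2)"
  shows "(LINT x|M. f x * g x)\<^sup>2 \<le> (LINT x|M. (f x)\<^sup>2) * (LINT x|M. (g x)\<^sup>2)"
proof (rule quadratic_nonneg_discriminant)
  fix t
  note int = integrable_product_L2[OF assms]
  have "0 \<le> (LINT x|M. (f x + t * g x)\<^sup>2)" by simp
  also have "\<dots> = (LINT x|M. (f x)\<^sup>2 + 2 * t * (f x * g x) + t\<^sup>2 * (g x)\<^sup>2)"
    by (rule Bochner_Integration.integral_cong) (auto simp: power2_eq_square algebra_simps)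
  also have "\<dots> = (LINT x|M. (f x)\<^sup>2) + 2 * t * (LINT x|M. f x * g x) + t\<^sup>2 * (LINT x|M. (g x)\<^sup>2)"
    using assms int by simp
  finally show "0 \<le> (LINT x|M. (f x)\<^sup>2) + 2 * t * (LINT x|M. f x * g x) + t\<^sup>2 * (LINT x|M. (g x)\<^sup>2)" .
qed

text \<open>
  For \<open>n \<ge> 2\<close> these are \<open>C\<^sup>1\<close> weights supported in the unit ball; the gradient of \<open>bump n\<close> is
  \<open>- 2 n y\<close> times \<open>bump (n - 1)\<close>.
\<close>

definition bump :: "nat \<Rightarrow> real^3 \<Rightarrow> real" where
  "bump n y = max 0 (1 - (norm y)\<^sup>2) ^ n"

lemma bump_zero: "norm y \<ge> 1 \<Longrightarrow> n > 0 \<Longrightarrow> bump n y = 0"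
  by (simp add: bump_def)

lemma bump_continuous: "continuous_on A (bump n)"
  unfolding bump_def by (intro continuous_intros)

lemma bump_nonneg: "0 \<le> bump n y" by (simp add: bump_def)

lemma bump_partial: "has_partial i (bump (Suc (Suc n))) (- 2 * real (Suc (Suc n)) * y $ i * bump (Suc n) y) y"
proof -
  have "((\<lambda>s. 1 - s) has_real_derivative -1) (at ((norm y)\<^sup>2))" by (auto intro!: derivative_eq_intros)
  then have "((\<lambda>s. max 0 (1 - s) ^ Suc (Suc n)) has_real_derivative
      (real (Suc (Suc n)) * max 0 (1 - (norm y)\<^sup>2) ^ Suc n) * -1) (at ((norm y)\<^sup>2))"
    by (rule DERIV_chain2[where f = "\<lambda>u. max 0 u ^ Suc (Suc n)" and g = "\<lambda>s. 1 - s", rotated])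
      (rule has_real_derivative_truncated_power)
  from has_partial_radial[OF this, of i]
  have "has_partial i (bump (Suc (Suc n))) (real (Suc (Suc n)) * max 0 (1 - (norm y)\<^sup>2) ^ Suc n * -1 * (2 * y $ i)) y"
    unfolding bump_def .
  moreover have "real (Suc (Suc n)) * max 0 (1 - (norm y)\<^sup>2) ^ Suc n * -1 * (2 * y $ i)
      = - 2 * real (Suc (Suc n)) * y $ i * bump (Suc n) y"
    unfolding bump_def by (simp only: mult_ac mult_minus_left mult_minus_right mult_1)
  ultimately show ?thesis by simp
qed

lemma bump_integrable: "n > 0 \<Longrightarrow> integrable lborel (bump n)"
  by (rule continuous_compact_support_integrable[where B = 1]) (auto intro: bump_continuous bump_zero)

lemma bump_integral_pos: "(LINT y|lborel. bump 2 y) > 0"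
proof -
  let ?B = "ball (0::real^3) (1/2)"
  have fin: "emeasure lborel ?B < \<infinity>" by (rule emeasure_lborel_ball_finite)
  have "0 < measure lborel ?B" by (simp add: content_ball_pos)
  then have "0 < (LINT y|lborel. indicator ?B y * (9/16::real) :: real)" by simp
  also have "\<dots> \<le> (LINT y|lborel. bump 2 y)"
  proof (rule integral_mono)
    show "integrable lborel (\<lambda>y. indicator ?B y * (9/16) :: real)"
      using fin by (intro integrable_mult_left) (simp add: integrable_indicator_iff)
    show "integrable lborel (bump 2)" by (rule bump_integrable) simp
    fix y :: "real^3"
    show "indicator ?B y * (9/16) \<le> bump 2 y"
    proof (cases "norm y < 1/2")
      case True
      then have "(norm y)\<^sup>2 \<le> (1/2)\<^sup>2" by (intro power_mono) auto
      then have "(norm y)\<^sup>2 \<le> 1/4" by (simp add: power2_eq_square)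
      then have "3/4 \<le> max 0 (1 - (norm y)\<^sup>2)" by linarith
      have "(3/4)\<^sup>2 \<le> bump 2 y" unfolding bump_def by (rule power_mono[OF \<open>3/4 \<le> max 0 (1 - (norm y)\<^sup>2)\<close>]) simp
      then show ?thesis using True by (simp add: power2_eq_square)
    qed (simp add: bump_nonneg)
  qed
  finally show ?thesis .
qed

lemma continuous_extend_zero:
  fixes F :: "real^3 \<Rightarrow> real"
  assumes "open S" "cball 0 1 \<subseteq> S" "continuous_on S F" "\<And>y. norm y \<ge> 1 \<Longrightarrow> F y = 0"
  shows "continuous_on UNIV F"
proof -
  have o: "open {y::real^3. norm y > 1}" by (auto intro!: open_Collect_less continuous_intros)
  have "continuous_on {y. norm y > 1} F"
    by (rule continuous_on_eq[of _ "\<lambda>_. 0"]) (use assms(4) in auto)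
  then have "continuous_on (S \<union> {y. norm y > 1}) F"
    using assms(1,3) o by (intro continuous_on_open_Un)
  moreover have "S \<union> {y. norm y > 1} = UNIV" using assms(2) by (auto simp: subset_iff) (meson not_less)
  ultimately show ?thesis by simp
qed

lemma bump_product:
  fixes F :: "real^3 \<Rightarrow> real"
  assumes "open S" "cball 0 1 \<subseteq> S" "continuous_on S F" "continuous_on UNIV b" "\<And>y. norm y \<ge> 1 \<Longrightarrow> b y = (0::real)"
  shows "continuous_on UNIV (\<lambda>y. F y * b y)" "integrable lborel (\<lambda>y. F y * b y)"
proof -
  show *: "continuous_on UNIV (\<lambda>y. F y * b y)"
    by (rule continuous_extend_zero[OF assms(1,2)])
      (auto intro!: continuous_intros assms(3,5) continuous_on_subset[OF assms(4)])
  show "integrable lborel (\<lambda>y. F y * b y)"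
    by (rule continuous_compact_support_integrable[OF *, of 1]) (simp add: assms(5))
qed

lemma integration_by_parts_ball:
  fixes F F' b b' :: "real^3 \<Rightarrow> real"
  assumes S: "open S" "cball 0 1 \<subseteq> S"
    and F: "\<And>y. y \<in> S \<Longrightarrow> has_partial i F (F' y) y" "continuous_on S F" "continuous_on S F'"
    and b: "\<And>y. has_partial i b (b' y) y" "continuous_on UNIV b" "continuous_on UNIV b'"
    and z: "\<And>y. norm y \<ge> 1 \<Longrightarrow> b y = 0" "\<And>y. norm y \<ge> 1 \<Longrightarrow> b' y = 0"
  shows "(LINT y|lborel. F' y * b y) = - (LINT y|lborel. F y * b' y)"
proof -
  have c1: "continuous_on UNIV (\<lambda>y. F y * b y)"
    by (rule bump_product(1)[OF S F(2) b(2) z(1)])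
  have c2: "continuous_on UNIV (\<lambda>y. F' y * b y + F y * b' y)"
    by (intro continuous_on_add bump_product(1)[OF S F(3) b(2) z(1)] bump_product(1)[OF S F(2) b(3) z(2)])
  have o: "open {y::real^3. norm y > 1}" by (auto intro!: open_Collect_less continuous_intros)
  have "(LINT y|lborel. F' y * b y + F y * b' y) = 0"
  proof (rule integral_partial_compact_support(3)[OF _ c1 c2, where B = 1])
    show "has_partial i (\<lambda>y. F y * b y) (F' y * b y + F y * b' y) y" for y
    proof (cases "y \<in> S")
      case True then show ?thesis by (intro has_partial_mult F(1) b(1))
    next
      case False
      then have "norm y > 1" using S(2) by (auto simp: subset_iff not_le[symmetric])
      then show ?thesis
        using has_partial_cong_open[OF o, of y "\<lambda>y. 0" "\<lambda>y. F y * b y" i 0] has_partial_const z by auto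
    qed
  qed (simp add: z)
  moreover have "(LINT y|lborel. F' y * b y + F y * b' y) = (LINT y|lborel. F' y * b y) + (LINT y|lborel. F y * b' y)"
    by (intro Bochner_Integration.integral_add bump_product(2)[OF S F(3) b(2) z(1)] bump_product(2)[OF S F(2) b(3) z(2)])
  ultimately show ?thesis by simp
qed

lemma cball_affine_subset: "cball x d \<subseteq> S \<Longrightarrow> 0 \<le> t \<Longrightarrow> t \<le> d \<Longrightarrow> cball 0 1 \<subseteq> {y::real^3. x + t *\<^sub>R y \<in> S}"
proof safe
  fix y :: "real^3" assume a: "cball x d \<subseteq> S" "0 \<le> t" "t \<le> d" "y \<in> cball 0 1"
  then have "norm (t *\<^sub>R y) \<le> d * 1" unfolding norm_scaleR by (intro mult_mono) auto
  then have "x + t *\<^sub>R y \<in> cball x d" by (simp add: dist_norm)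
  then show "x + t *\<^sub>R y \<in> S" using a by blast
qed

text \<open>
  The mean value property for the radial weight \<open>(1 - |y|\<^sup>2)\<^sup>2\<close>. The weighted mean over the ball of radius \<open>t\<close>
  is constant in \<open>t\<close>: its derivative is \<open>\<integral> y \<bullet> \<nabla>h(x + t y) bump 2 y\<close>, where \<open>- 6 y bump 2\<close> is the gradient of
  \<open>bump 3\<close>, so integration by parts produces \<open>t \<integral> \<Delta>h bump 3 / 6 = 0\<close>.
\<close>

lemma mean_value_bump:
  assumes S: "open S" "cball x d \<subseteq> S" "0 \<le> d" and h: "smooth_harmonic S h"
  shows "(LINT y|lborel. h (x + d *\<^sub>R y) * bump 2 y) = h x * (LINT y|lborel. bump 2 y)"
proof -
  have sm: "smooth_on S h" using h by (rule harm_smooth)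
  define g where "g t y = (\<Sum>i\<in>UNIV. y $ i * partial i h (x + t *\<^sub>R y))" for t and y :: "real^3"
  have ph: "continuous_on S (partial i h)" for i by (intro smooth_on_continuous smooth_on_partial sm)
  have chain: "((\<lambda>t. h (x + t *\<^sub>R y)) has_vector_derivative g t y) (at t within A)"
    if "x + t *\<^sub>R y \<in> S" for t y A
  proof -
    have D: "(h has_derivative (\<lambda>v. \<Sum>i\<in>UNIV. v $ i * partial i h (x + t *\<^sub>R y))) (at (x + t *\<^sub>R y))"
      by (rule C1_has_derivative[OF S(1) that]) (rule smooth_on_cont_diff[OF sm])
    have "((\<lambda>t. x + t *\<^sub>R y) has_derivative (\<lambda>s. s *\<^sub>R y)) (at t within A)"
      by (auto intro!: derivative_eq_intros)
    from has_derivative_compose[OF this D]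
    show ?thesis by (simp add: has_vector_derivative_def g_def sum_distrib_left mult.assoc)
  qed
  let ?f = "\<lambda>t y. h (x + t *\<^sub>R y) * bump 2 y" and ?f' = "\<lambda>t y. g t y * bump 2 y"
  let ?C = "cbox (- One) One :: (real^3) set"
  have b2: "bump 2 y = 0" "bump 3 y = 0" if "norm y \<ge> 1" for y using that by (auto intro: bump_zero)
  \<comment> \<open>differentiation under the integral sign is carried out over a box containing the support\<close>
  have C: "(F has_integral (LINT y|lborel. F y)) ?C" if F: "integrable lborel F" "\<And>y. norm y \<ge> 1 \<Longrightarrow> F y = 0"
    for F :: "real^3 \<Rightarrow> real"
  proof -
    have sub: "F y = 0" if "y \<notin> ?C" for y
    proof -
      have "norm y \<ge> 1"
      proof (rule ccontr)
        assume "\<not> norm y \<ge> 1"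
        then have *: "\<bar>y \<bullet> b\<bar> \<le> 1" if "b \<in> Basis" for b using Basis_le_norm[OF that, of y] by linarith
        have "y \<in> ?C" unfolding mem_box
        proof
          fix b :: "real^3" assume b: "b \<in> Basis"
          then show "(- One) \<bullet> b \<le> y \<bullet> b \<and> y \<bullet> b \<le> One \<bullet> b" using *[OF b] by (auto simp: abs_le_iff)
        qed
        then show False using that by simp
      qed
      then show ?thesis using F(2) by simp
    qed
    have "((\<lambda>y. if y \<in> ?C then F y else 0) has_integral (LINT y|lborel. F y)) UNIV"
      using has_integral_integral_lborel[OF F(1)] by (rule has_integral_eq[rotated]) (use sub in auto)
    then show ?thesis by (simp only: has_integral_restrict_UNIV)
  qed
  have oS: "open {y. x + t *\<^sub>R y \<in> S}" for t by (rule open_affine_vimage[OF S(1)])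
  have cS: "cball 0 1 \<subseteq> {y. x + t *\<^sub>R y \<in> S}" if "t \<in> {0..d}" for t
    using cball_affine_subset[OF S(2), of t] that by auto
  have contg: "continuous_on {y. x + t *\<^sub>R y \<in> S} (\<lambda>y. f (x + t *\<^sub>R y))" if "continuous_on S f" for t and f :: "real^3 \<Rightarrow> real"
    by (auto intro!: continuous_on_compose2[OF that] continuous_intros)
  have contG: "continuous_on {y. x + t *\<^sub>R y \<in> S} (g t)" for t
    unfolding g_def by (intro continuous_intros contg ph)
  have If: "integrable lborel (?f t)" if "t \<in> {0..d}" for t
    by (rule bump_product(2)[OF oS cS[OF that] contg[OF smooth_on_continuous[OF sm]] bump_continuous b2(1)])
  have If': "integrable lborel (?f' t)" if "t \<in> {0..d}" for t
    by (rule bump_product(2)[OF oS cS[OF that] contG bump_continuous b2(1)])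
  \<comment> \<open>the derivative in \<open>t\<close> of the weighted mean vanishes: integration by parts leaves the Laplacian of \<open>h\<close>\<close>
  have zero: "(LINT y|lborel. ?f' t y) = 0" if t: "t \<in> {0..d}" for t
  proof -
    have pp: "continuous_on S (partial i (partial i h))" for i by (intro smooth_on_continuous smooth_on_partial sm)
    have i1: "integrable lborel (\<lambda>y. partial i h (x + t *\<^sub>R y) * (- 6 * y $ i * bump 2 y))" for i
      by (rule bump_product(2)[OF oS cS[OF t] contg[OF ph]]) (auto intro!: continuous_intros bump_continuous simp: b2)
    have i2: "integrable lborel (\<lambda>y. t * partial i (partial i h) (x + t *\<^sub>R y) * bump 3 y)" for i
      by (rule bump_product(2)[OF oS cS[OF t]]) (auto intro!: continuous_intros contg pp bump_continuous simp: b2)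
    have ibp: "(LINT y|lborel. t * partial i (partial i h) (x + t *\<^sub>R y) * bump 3 y)
        = - (LINT y|lborel. partial i h (x + t *\<^sub>R y) * (- 6 * y $ i * bump 2 y))" for i
    proof (rule integration_by_parts_ball[OF oS cS[OF t]])
      show "has_partial i (\<lambda>y. partial i h (x + t *\<^sub>R y)) (t * partial i (partial i h) (x + t *\<^sub>R y)) y"
        if "y \<in> {y. x + t *\<^sub>R y \<in> S}" for y
        using has_partial_affine[OF smooth_on_has_partial[OF smooth_on_partial[OF sm]], of x t y i i] that by simp
      show "has_partial i (bump 3) (- 6 * y $ i * bump 2 y) y" for y
        using bump_partial[of i 1 y] by (simp add: numeral_3_eq_3 numeral_2_eq_2)
    qed (auto intro!: continuous_intros contg pp ph bump_continuous simp: b2)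
    have "6 * (LINT y|lborel. ?f' t y) = (LINT y|lborel. (\<Sum>i\<in>UNIV. - (partial i h (x + t *\<^sub>R y) * (- 6 * y $ i * bump 2 y))))"
      unfolding g_def
      by (subst integral_mult_right_zero[symmetric], rule Bochner_Integration.integral_cong)
        (simp_all add: sum_distrib_left sum_distrib_right mult_ac)
    also have "\<dots> = (\<Sum>i\<in>UNIV. - (LINT y|lborel. partial i h (x + t *\<^sub>R y) * (- 6 * y $ i * bump 2 y)))"
      using i1 by (subst Bochner_Integration.integral_sum) auto
    also have "\<dots> = (\<Sum>i\<in>UNIV. (LINT y|lborel. t * partial i (partial i h) (x + t *\<^sub>R y) * bump 3 y))"
      by (simp only: ibp)
    also have "\<dots> = (LINT y|lborel. (\<Sum>i\<in>UNIV. t * partial i (partial i h) (x + t *\<^sub>R y) * bump 3 y))"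
      using i2 by (subst Bochner_Integration.integral_sum) auto
    also have "\<dots> = (LINT y|(lborel :: (real^3) measure). 0)"
    proof (rule Bochner_Integration.integral_cong)
      fix y :: "real^3"
      show "(\<Sum>i\<in>UNIV. t * partial i (partial i h) (x + t *\<^sub>R y) * bump 3 y) = 0"
      proof (cases "norm y \<ge> 1")
        case False
        then have "x + t *\<^sub>R y \<in> S" using cS[OF t] by (auto simp: subset_iff)
        from harm_laplace[OF h this] show ?thesis
          by (simp add: sum_distrib_left[symmetric] sum_distrib_right[symmetric])
      qed (simp add: b2)
    qed simp
    finally show ?thesis by simp
  qed
  have D: "((\<lambda>t. integral ?C (?f t)) has_vector_derivative integral ?C (?f' t)) (at t within {0..d})" if "t \<in> {0..d}" for t
  proof (rule leibniz_rule_vector_derivative[OF _ _ _ that])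
    show "((\<lambda>t. ?f t y) has_vector_derivative ?f' t y) (at t within {0..d})" if t: "t \<in> {0..d}" for t y
    proof (cases "norm y \<ge> 1")
      case True then show ?thesis by (simp add: b2)
    next
      case False
      then have "x + t *\<^sub>R y \<in> S" using cS[OF t] by (auto simp: subset_iff)
      from bounded_linear.has_vector_derivative[OF bounded_linear_mult_left chain[OF this]]
      show ?thesis .
    qed
    show "?f t integrable_on ?C" if "t \<in> {0..d}" for t
      using C[OF If[OF that]] b2 by (auto simp: integrable_on_def)
    show "continuous_on ({0..d} \<times> ?C) (\<lambda>(t, y). g t y * bump 2 y)"
    proof -
      let ?A = "{p::real \<times> (real^3). x + fst p *\<^sub>R snd p \<in> S}" and ?B = "{p::real \<times> (real^3). norm (snd p) > 1}"
      have oA: "open ?A"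
      proof -
        have "open ((\<lambda>p::real \<times> (real^3). x + fst p *\<^sub>R snd p) -` S)"
          by (rule open_vimage[OF S(1)]) (intro continuous_intros)
        then show ?thesis by (simp add: vimage_def)
      qed
      have oB: "open ?B" by (auto intro!: open_Collect_less continuous_intros)
      have cA: "continuous_on ?A (\<lambda>p. g (fst p) (snd p) * bump 2 (snd p))"
        unfolding g_def
        by (intro continuous_intros continuous_on_compose2[OF ph] continuous_on_compose2[OF bump_continuous[of UNIV]]) auto
      have cB: "continuous_on ?B (\<lambda>p. g (fst p) (snd p) * bump 2 (snd p))"
        by (rule continuous_on_eq[of _ "\<lambda>_. 0"]) (auto simp: b2)
      have "continuous_on (?A \<union> ?B) (\<lambda>p. g (fst p) (snd p) * bump 2 (snd p))"
        by (rule continuous_on_open_Un[OF oA oB cA cB])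
      moreover have "{0..d} \<times> ?C \<subseteq> ?A \<union> ?B"
      proof
        fix p assume p: "p \<in> {0..d} \<times> ?C"
        then have "fst p \<in> {0..d}" by auto
        from cS[OF this] show "p \<in> ?A \<union> ?B" by (cases "norm (snd p) \<le> 1") (auto simp: subset_iff)
      qed
      ultimately show ?thesis by (auto simp: case_prod_beta intro: continuous_on_subset)
    qed
  qed auto
  have D0: "((\<lambda>t. integral ?C (?f t)) has_derivative (\<lambda>h. 0)) (at t within {0..d})" if "t \<in> {0..d}" for t
  proof -
    have "integral ?C (?f' t) = 0"
      using C[OF If'[OF that]] zero[OF that] b2 by (auto dest: integral_unique)
    then show ?thesis using D[OF that] by (simp add: has_vector_derivative_def)
  qed
  obtain c where c: "\<And>t. t \<in> {0..d} \<Longrightarrow> integral ?C (?f t) = c"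
    using has_derivative_zero_constant[OF _ D0] by auto
  have eq: "(LINT y|lborel. ?f t y) = c" if "t \<in> {0..d}" for t
    using C[OF If[OF that]] c[OF that] b2 by (auto dest: integral_unique)
  have "(LINT y|lborel. ?f d y) = (LINT y|lborel. ?f 0 y)" using eq[of d] eq[of 0] S(3) by simp
  then show ?thesis by simp
qed

definition sup_const :: real where
  "sup_const = (LINT y|lborel. (bump 2 y)\<^sup>2) / (LINT y|lborel. bump 2 y)\<^sup>2"

text \<open>Cauchy-Schwarz applied to the mean value property.\<close>

lemma harm_sup_L2:
  assumes S: "open S" "cball x d \<subseteq> S" "0 < d" and h: "smooth_harmonic S h"
    and int: "integrable lebesgue (\<lambda>y. indicator S y * (h y)\<^sup>2)"
  shows "(h x)\<^sup>2 \<le> sup_const / d ^ 3 * (LINT y|lebesgue. indicator S y * (h y)\<^sup>2)"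
proof -
  have cS: "cball 0 1 \<subseteq> {y. x + d *\<^sub>R y \<in> S}" using cball_affine_subset[OF S(2), of d] S(3) by auto
  have ch: "continuous_on S h" using h by (intro smooth_on_continuous harm_smooth)
  define f where "f y = indicator (cball 0 1) y *\<^sub>R h (x + d *\<^sub>R y)" for y
  define G where "G z = indicator (cball x d) z *\<^sub>R (h z)\<^sup>2" for z
  have Gi: "integrable lborel G" unfolding G_def
    by (rule borel_integrable_compact) (auto intro!: continuous_intros continuous_on_subset[OF ch] S(2))
  have fG: "(f y)\<^sup>2 = G (x + d *\<^sub>R y)" for y
  proof -
    have "x + d *\<^sub>R y \<in> cball x d \<longleftrightarrow> y \<in> cball 0 1"
      using S(3) by (simp add: dist_norm)
    then show ?thesis by (simp add: f_def G_def indicator_def power2_eq_square)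
  qed
  have fm: "f \<in> borel_measurable lborel"
  proof -
    have "f \<in> borel_measurable borel" unfolding f_def
      by (rule borel_measurable_continuous_on_indicator)
        (use cS in \<open>auto intro!: continuous_on_compose2[OF ch] continuous_intros\<close>)
    then show ?thesis by simp
  qed
  have bm: "bump 2 \<in> borel_measurable lborel" using bump_integrable[of 2] by auto
  have f2: "integrable lborel (\<lambda>y. (f y)\<^sup>2)" "(LINT y|lborel. (f y)\<^sup>2) = (LINT y|lborel. G y) / d ^ 3"
    unfolding fG using lborel_affine_integral[OF Gi S(3)] by auto
  have b2: "integrable lborel (\<lambda>y. (bump 2 y)\<^sup>2)"
    by (rule continuous_compact_support_integrable[where B = 1]) (auto intro!: continuous_intros bump_continuous bump_zero)
  have "(LINT y|lborel. G y) = (LINT y|lebesgue. G y)"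
    by (rule integral_completion[symmetric]) (use Gi in auto)
  also have "\<dots> \<le> (LINT y|lebesgue. indicator S y * (h y)\<^sup>2)"
  proof (rule integral_mono)
    show "integrable lebesgue G" using Gi by (subst integrable_completion) auto
    show "G z \<le> indicator S z * (h z)\<^sup>2" for z using S(2) by (auto simp: G_def indicator_def)
  qed (rule int)
  finally have GS: "(LINT y|lborel. G y) \<le> (LINT y|lebesgue. indicator S y * (h y)\<^sup>2)" .
  have "h (x + d *\<^sub>R y) * bump 2 y = f y * bump 2 y" for y
    using bump_zero[of y 2] by (auto simp: f_def indicator_def)
  then have "(h x * (LINT y|lborel. bump 2 y))\<^sup>2 = (LINT y|lborel. f y * bump 2 y)\<^sup>2"
    using mean_value_bump[OF S(1,2) _ h] S(3) by (simp only: less_imp_le)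
  also have "\<dots> \<le> (LINT y|lborel. (f y)\<^sup>2) * (LINT y|lborel. (bump 2 y)\<^sup>2)"
    by (rule Cauchy_Schwarz_integral[OF fm bm f2(1) b2])
  also have "\<dots> \<le> (LINT y|lebesgue. indicator S y * (h y)\<^sup>2) / d ^ 3 * (LINT y|lborel. (bump 2 y)\<^sup>2)"
    unfolding f2(2) by (intro mult_right_mono divide_right_mono GS) (use S(3) in auto)
  finally have "(h x)\<^sup>2 * (LINT y|lborel. bump 2 y)\<^sup>2 \<le>
      (LINT y|lebesgue. indicator S y * (h y)\<^sup>2) / d ^ 3 * (LINT y|lborel. (bump 2 y)\<^sup>2)"
    by (simp only: power_mult_distrib)
  moreover have "(LINT y|lborel. bump 2 y)\<^sup>2 > 0" using bump_integral_pos by (intro zero_less_power)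
  ultimately have "(h x)\<^sup>2 \<le> (LINT y|lebesgue. indicator S y * (h y)\<^sup>2) / d ^ 3 * (LINT y|lborel. (bump 2 y)\<^sup>2) / (LINT y|lborel. bump 2 y)\<^sup>2"
    by (subst pos_le_divide_eq)
  then show ?thesis unfolding sup_const_def by (simp add: mult_ac)
qed

lemma sup_const_nonneg: "sup_const \<ge> 0" unfolding sup_const_def by simp

definition grad_const :: real where
  "grad_const = 4 * (LINT y|lborel. bump 1 y) / (LINT y|lborel. bump 2 y)"

lemma grad_const_nonneg: "grad_const \<ge> 0"
  unfolding grad_const_def using bump_integral_pos by (auto intro!: divide_nonneg_nonneg integral_nonneg simp: bump_nonneg)

text \<open>
  The mean value property of the harmonic function \<open>\<partial>\<^sub>jh\<close>, with the derivative moved to the weight.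
\<close>

lemma harm_gradient_bound:
  assumes S: "open S" "cball x d \<subseteq> S" "0 < d" and h: "smooth_harmonic S h"
    and A: "\<And>y. y \<in> cball x d \<Longrightarrow> \<bar>h y\<bar> \<le> A"
  shows "\<bar>partial j h x\<bar> \<le> grad_const / d * A"
proof -
  let ?c = "LINT y|lborel. bump 2 y"
  let ?T = "{y. x + d *\<^sub>R y \<in> S}"
  have sm: "smooth_on S h" using h by (rule harm_smooth)
  have cS: "cball 0 1 \<subseteq> ?T" using cball_affine_subset[OF S(2), of d] S(3) by auto
  have oS: "open ?T" by (rule open_affine_vimage[OF S(1)])
  have b: "bump 2 y = 0" "bump 1 y = 0" if "norm y \<ge> 1" for y using that by (auto intro: bump_zero)
  have contg: "continuous_on ?T (\<lambda>y. f (x + d *\<^sub>R y))" if "continuous_on S f" for f :: "real^3 \<Rightarrow> real"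
    by (auto intro!: continuous_on_compose2[OF that] continuous_intros)
  have "d * (partial j h x * ?c) = (LINT y|lborel. d * partial j h (x + d *\<^sub>R y) * bump 2 y)"
    using mean_value_bump[OF S(1,2) _ harm_partial[OF S(1) h], of j] S(3) by (simp add: mult.assoc)
  also have "\<dots> = - (LINT y|lborel. h (x + d *\<^sub>R y) * (- 4 * y $ j * bump 1 y))"
  proof (rule integration_by_parts_ball[OF oS cS])
    show "has_partial j (\<lambda>y. h (x + d *\<^sub>R y)) (d * partial j h (x + d *\<^sub>R y)) y" if "y \<in> ?T" for y
      using has_partial_affine[OF smooth_on_has_partial[OF sm], of x d y j] that by simp
    show "has_partial j (bump 2) (- 4 * y $ j * bump 1 y) y" for y
      using bump_partial[of j 0 y] by (simp add: numeral_2_eq_2)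
    show "continuous_on ?T (\<lambda>y. h (x + d *\<^sub>R y))" by (rule contg[OF smooth_on_continuous[OF sm]])
    show "continuous_on ?T (\<lambda>y. d * partial j h (x + d *\<^sub>R y))"
      by (intro continuous_intros contg smooth_on_continuous[OF smooth_on_partial[OF sm]])
    show "continuous_on UNIV (\<lambda>y. - 4 * y $ j * bump 1 y)" by (intro continuous_intros bump_continuous)
    show "- 4 * y $ j * bump 1 y = 0" if "norm y \<ge> 1" for y using b(2)[OF that] by simp
    show "bump 2 y = 0" if "norm y \<ge> 1" for y using b(1)[OF that] .
  qed (rule bump_continuous)
  finally have eq: "d * (partial j h x * ?c) = - (LINT y|lborel. h (x + d *\<^sub>R y) * (- 4 * y $ j * bump 1 y))" .
  have "\<bar>d * (partial j h x * ?c)\<bar> \<le> (LINT y|lborel. A * (4 * bump 1 y))"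
    unfolding eq abs_minus_cancel
  proof (rule integral_abs_bound[THEN order_trans], rule integral_mono)
    show "integrable lborel (\<lambda>y. \<bar>h (x + d *\<^sub>R y) * (- 4 * y $ j * bump 1 y)\<bar>)"
      by (rule integrable_abs, rule bump_product(2)[OF oS cS contg[OF smooth_on_continuous[OF sm]]])
        (auto intro!: continuous_intros bump_continuous simp: b(2)[unfolded One_nat_def])
    show "integrable lborel (\<lambda>y. A * (4 * bump 1 y))"
      using bump_integrable[of 1] by simp
    fix y :: "real^3"
    show "\<bar>h (x + d *\<^sub>R y) * (- 4 * y $ j * bump 1 y)\<bar> \<le> A * (4 * bump 1 y)"
    proof (cases "norm y \<ge> 1")
      case False
      then have "x + d *\<^sub>R y \<in> cball x d" using S(3) by (simp add: dist_norm)
      then have 1: "\<bar>h (x + d *\<^sub>R y)\<bar> \<le> A" by (rule A)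
      have "\<bar>y $ j\<bar> \<le> 1" using component_le_norm_cart[of y j] False by linarith
      then have "4 * (\<bar>y $ j\<bar> * bump 1 y) \<le> 4 * (1 * bump 1 y)"
        by (intro mult_left_mono mult_right_mono) (auto simp: bump_nonneg)
      then have 2: "\<bar>- 4 * y $ j * bump 1 y\<bar> \<le> 4 * bump 1 y" by (simp add: abs_mult bump_nonneg)
      show ?thesis unfolding abs_mult[of "h _"] using 1 2 by (intro mult_mono) auto
    qed (simp add: b(2)[unfolded One_nat_def])
  qed
  also have "\<dots> = A * (4 * (LINT y|lborel. bump 1 y))" by simp
  finally have "d * (\<bar>partial j h x\<bar> * ?c) \<le> A * (4 * (LINT y|lborel. bump 1 y))"
    using S(3) bump_integral_pos by (simp add: abs_mult)
  then show ?thesis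
    using S(3) bump_integral_pos by (simp add: grad_const_def field_simps)
qed

section \<open>The maximum principle\<close>

lemma local_max_second_derivative:
  fixes f f' :: "real \<Rightarrow> real"
  assumes "d > 0" and f: "\<And>t. \<bar>t\<bar> < d \<Longrightarrow> (f has_real_derivative f' t) (at t)"
    and f2: "(f' has_real_derivative D) (at 0)" and max: "\<And>t. \<bar>t\<bar> < d \<Longrightarrow> f t \<le> f 0"
  shows "D \<le> 0"
proof (rule ccontr)
  assume "\<not> D \<le> 0"
  then have "D > 0" by simp
  have "f' 0 = 0"
    by (rule DERIV_local_max[OF f[of 0] \<open>d > 0\<close>]) (use max \<open>d > 0\<close> in auto)
  obtain e where e: "e > 0" "\<And>h. 0 < h \<Longrightarrow> h < e \<Longrightarrow> f' 0 < f' (0 + h)"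
    using DERIV_pos_inc_right[OF f2 \<open>D > 0\<close>] by blast
  define h where "h = min d e / 2"
  have h: "0 < h" "h < d" "h < e" using \<open>d > 0\<close> e(1) by (auto simp: h_def)
  obtain z where z: "0 < z" "z < h" "f h - f 0 = (h - 0) * f' z"
    using MVT2[of 0 h f f'] f h by (metis abs_of_nonneg le_less_trans)
  have "f' z > 0" using e(2)[of z] z h \<open>f' 0 = 0\<close> by auto
  then have "f h > f 0" using z(3) h(1) by (simp add: algebra_simps)
  then show False using max[of h] h by auto
qed

text \<open>
  Perturbation by \<open>e |y|\<^sup>2\<close> makes the Laplacian positive, which excludes an interior maximum.
\<close>

lemma weak_maximum_principle:
  assumes K: "compact K" and c: "continuous_on K u" and h: "smooth_harmonic (interior K) u"
    and b: "\<And>x. x \<in> frontier K \<Longrightarrow> u x \<le> M" and x: "x \<in> K"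
  shows "u x \<le> (M::real)"
proof (rule ccontr)
  assume "\<not> u x \<le> M"
  then have gt: "u x > M" by simp
  obtain B where B: "B > 0" "\<And>y. y \<in> K \<Longrightarrow> (norm y)\<^sup>2 \<le> B"
  proof -
    obtain b where "b > 0" and b: "\<forall>y\<in>K. norm y \<le> b" using compact_imp_bounded[OF K] bounded_pos by blast
    have "(norm y)\<^sup>2 \<le> b\<^sup>2" if "y \<in> K" for y using b that by (intro power_mono) auto
    then show ?thesis using \<open>b > 0\<close> by (intro that[of "b\<^sup>2"]) auto
  qed
  \<comment> \<open>so small that the perturbation cannot move the maximum back to the frontier\<close>
  define e where "e = (u x - M) / (2 * B)"
  have e: "e > 0" using gt B by (simp add: e_def)
  define v where "v y = u y + e * (norm y)\<^sup>2" for y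
  have cv: "continuous_on K v" unfolding v_def by (intro continuous_intros c)
  obtain z where z: "z \<in> K" "\<And>y. y \<in> K \<Longrightarrow> v y \<le> v z"
    using continuous_attains_sup[OF K _ cv] x by blast
  have z_int: "z \<in> interior K"
  proof (rule ccontr)
    assume "z \<notin> interior K"
    then have "z \<in> frontier K" using z(1) closure_subset by (auto simp: frontier_def)
    then have "v z \<le> M + e * B"
      unfolding v_def using b[of z] B(2)[OF z(1)] e by (intro add_mono mult_left_mono) auto
    moreover have eB: "e * B = (u x - M) / 2" using B by (simp add: e_def)
    moreover have "u x \<le> v x" unfolding v_def using e by simp
    moreover have "v x \<le> v z" by (rule z(2)[OF x])
    ultimately have "u x \<le> M + (u x - M) / 2" unfolding eB by linarith
    then show False using gt by (simp add: field_simps)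
  qed
  have o: "open (interior K)" by simp
  have sm: "smooth_on (interior K) u" using h by (rule harm_smooth)
  have le: "partial i (partial i u) z + 2 * e \<le> 0" for i
  proof -
    have "\<forall>\<^sub>F t in nhds (0::real). z + t *\<^sub>R axis i 1 \<in> interior K"
      by (rule eventually_line_in_open[OF o z_int])
    then obtain d where d: "d > 0" "\<And>t. \<bar>t\<bar> < d \<Longrightarrow> z + t *\<^sub>R axis i 1 \<in> interior K"
      by (auto simp: eventually_nhds_metric dist_real_def)
    let ?w = "\<lambda>y. partial i u y + e * (2 * y $ i)"
    have v1: "has_partial i v (?w y) y" if "y \<in> interior K" for y
      unfolding v_def
      by (intro has_partial_add has_partial_cmult has_partial_norm_sq smooth_on_has_partial[OF sm that])
    have v2: "has_partial i ?w (partial i (partial i u) y + e * (2 * 1)) y" if "y \<in> interior K" for y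
      using has_partial_coord[of i i y]
      by (intro has_partial_add has_partial_cmult smooth_on_has_partial[OF smooth_on_partial[OF sm] that]) simp
    have "partial i (partial i u) z + e * (2 * 1) \<le> 0"
    proof (rule local_max_second_derivative[OF d(1)])
      show "((\<lambda>t. v (z + t *\<^sub>R axis i 1)) has_real_derivative ?w (z + t *\<^sub>R axis i 1)) (at t)" if "\<bar>t\<bar> < d" for t
        by (rule has_partial_line_real[OF v1[OF d(2)[OF that]]])
      show "((\<lambda>t. ?w (z + t *\<^sub>R axis i 1)) has_real_derivative partial i (partial i u) z + e * (2 * 1)) (at 0)"
        using has_partial_line_real[of i ?w _ z 0] v2[OF z_int] by simp
      show "v (z + t *\<^sub>R axis i 1) \<le> v (z + 0 *\<^sub>R axis i 1)" if "\<bar>t\<bar> < d" for t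
        using z(2) d(2)[OF that] interior_subset by auto
    qed
    then show ?thesis by simp
  qed
  have "(\<Sum>i\<in>UNIV. partial i (partial i u) z + 2 * e) \<le> (\<Sum>i\<in>(UNIV::3 set). 0)"
    by (rule sum_mono) (rule le)
  then have "(\<Sum>i\<in>UNIV. partial i (partial i u) z) + 6 * e \<le> 0"
    by (simp add: sum.distrib)
  then show False using harm_laplace[OF h z_int] e by simp
qed

lemma maximum_principle:
  assumes K: "compact K" and c: "continuous_on K u" and h: "smooth_harmonic (interior K) u"
    and b: "\<And>x. x \<in> frontier K \<Longrightarrow> \<bar>u x\<bar> \<le> M" and x: "x \<in> K"
  shows "\<bar>u x\<bar> \<le> (M::real)"
proof -
  have "u x \<le> M" by (rule weak_maximum_principle[OF K c h _ x]) (use b in \<open>auto simp: abs_le_iff\<close>)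
  moreover have "-1 * u x \<le> M"
    by (rule weak_maximum_principle[OF K _ harm_cmult[OF open_interior h] _ x])
      (use b in \<open>auto simp: abs_le_iff intro!: continuous_intros c\<close>)
  ultimately show ?thesis by (simp add: abs_le_iff)
qed

section \<open>Solid spherical harmonics are harmonic\<close>

definition lap :: "(real^3 \<Rightarrow> real) \<Rightarrow> real^3 \<Rightarrow> real" where
  "lap f x = (\<Sum>i\<in>UNIV. partial i (partial i f) x)"

lemma lap_mult:
  assumes o: "open S" and f: "smooth_on S f" and g: "smooth_on S g" and x: "x \<in> S"
  shows "lap (\<lambda>x. f x * g x) x = f x * lap g x + 2 * (\<Sum>i\<in>UNIV. partial i f x * partial i g x) + g x * lap f x"
proof -
  have "partial i (partial i (\<lambda>x. f x * g x)) x =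
      partial i (partial i f) x * g x + 2 * (partial i f x * partial i g x) + f x * partial i (partial i g) x" for i
  proof -
    have "partial i (partial i (\<lambda>x. f x * g x)) x = partial i (\<lambda>x. partial i f x * g x + f x * partial i g x) x"
      by (rule partial_cong_open[OF o x]) (rule partial_mult[OF f g])
    also have "\<dots> = (partial i (partial i f) x * g x + partial i f x * partial i g x)
        + (partial i f x * partial i g x + f x * partial i (partial i g) x)"
      by (intro has_partial_imp has_partial_add has_partial_mult smooth_on_has_partial[OF _ x] f g smooth_on_partial)
    finally show ?thesis by simp
  qed
  then show ?thesis by (simp add: lap_def sum.distrib sum_distrib_left mult_ac)
qed

lemma lap_sum_cmult:
  assumes o: "open S" and f: "\<And>a. a \<in> A \<Longrightarrow> smooth_on S (f a)" and x: "x \<in> S"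
  shows "lap (\<lambda>x. \<Sum>a\<in>A. c a * f a x) x = (\<Sum>a\<in>A. c a * lap (f a) x)"
proof -
  have "partial i (partial i (\<lambda>x. \<Sum>a\<in>A. c a * f a x)) x = (\<Sum>a\<in>A. c a * partial i (partial i (f a)) x)" for i
  proof -
    have "partial i (partial i (\<lambda>x. \<Sum>a\<in>A. c a * f a x)) x = partial i (\<lambda>x. \<Sum>a\<in>A. c a * partial i (f a) x) x"
      by (rule partial_cong_open[OF o x])
        (intro has_partial_imp has_partial_sum has_partial_cmult smooth_on_has_partial[OF f])
    also have "\<dots> = (\<Sum>a\<in>A. c a * partial i (partial i (f a)) x)"
      by (intro has_partial_imp has_partial_sum has_partial_cmult smooth_on_has_partial[OF _ x] smooth_on_partial f)
    finally show ?thesis .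
  qed
  then show ?thesis unfolding lap_def by (simp add: sum_distrib_left) (rule sum.swap)
qed

lemma lap_cong: "open S \<Longrightarrow> x \<in> S \<Longrightarrow> (\<And>y. y \<in> S \<Longrightarrow> f y = g y) \<Longrightarrow> lap f x = lap g x"
  unfolding lap_def by (intro sum.cong partial_partial_cong) auto

lemma harm_iff_lap: "smooth_harmonic S h \<longleftrightarrow> smooth_on S h \<and> (\<forall>x\<in>S. lap h x = 0)"
  by (simp add: smooth_harmonic_def lap_def)

fun az_poly :: "nat \<Rightarrow> parity \<Rightarrow> real^3 \<Rightarrow> real" where
  "az_poly m Plus x = Re (Complex (x $ 1) (x $ 2) ^ m)"
| "az_poly m Minus x = Im (Complex (x $ 1) (x $ 2) ^ m)"

lemma az_poly_Suc:
  "az_poly (Suc m) Plus x = x $ 1 * az_poly m Plus x - x $ 2 * az_poly m Minus x"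
  "az_poly (Suc m) Minus x = x $ 1 * az_poly m Minus x + x $ 2 * az_poly m Plus x"
  by simp_all

fun az_partial :: "3 \<Rightarrow> nat \<Rightarrow> parity \<Rightarrow> real^3 \<Rightarrow> real" where
  "az_partial i m Plus x = real m * (if i = 1 then az_poly (m - 1) Plus x else if i = 2 then - az_poly (m - 1) Minus x else 0)"
| "az_partial i m Minus x = real m * (if i = 1 then az_poly (m - 1) Minus x else if i = 2 then az_poly (m - 1) Plus x else 0)"

lemma az_poly_0: "az_poly 0 Plus = (\<lambda>x. 1)" "az_poly 0 Minus = (\<lambda>x. 0)" by auto

lemma az_poly_has_partial: "has_partial i (az_poly m s) (az_partial i m s x) x"
proof -
  have "has_partial i (az_poly m Plus) (az_partial i m Plus x) x \<and> has_partial i (az_poly m Minus) (az_partial i m Minus x) x"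
  proof (induction m)
    case 0 then show ?case unfolding az_poly_0 by (simp add: has_partial_const)
  next
    case (Suc m)
    have eq: "az_poly (Suc m) Plus = (\<lambda>x. x $ 1 * az_poly m Plus x - x $ 2 * az_poly m Minus x)"
      "az_poly (Suc m) Minus = (\<lambda>x. x $ 1 * az_poly m Minus x + x $ 2 * az_poly m Plus x)"
      by (auto simp: az_poly_Suc)
    have P: "has_partial i (az_poly (Suc m) Plus)
        (((if i = 1 then 1 else 0) * az_poly m Plus x + x $ 1 * az_partial i m Plus x)
         - ((if i = 2 then 1 else 0) * az_poly m Minus x + x $ 2 * az_partial i m Minus x)) x"
      unfolding eq using Suc by (intro has_partial_diff has_partial_mult has_partial_coord) auto
    have M: "has_partial i (az_poly (Suc m) Minus)
        (((if i = 1 then 1 else 0) * az_poly m Minus x + x $ 1 * az_partial i m Minus x)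
         + ((if i = 2 then 1 else 0) * az_poly m Plus x + x $ 2 * az_partial i m Plus x)) x"
      unfolding eq using Suc by (intro has_partial_add has_partial_mult has_partial_coord) auto
    have step: "x $ 1 * (real m * az_poly (m - 1) Plus x) - x $ 2 * (real m * az_poly (m - 1) Minus x) = real m * az_poly m Plus x"
      "x $ 1 * (real m * az_poly (m - 1) Minus x) + x $ 2 * (real m * az_poly (m - 1) Plus x) = real m * az_poly m Minus x"
      by (cases m; simp add: algebra_simps)+
    have p: "((if i = 1 then 1 else 0) * az_poly m Plus x + x $ 1 * az_partial i m Plus x)
         - ((if i = 2 then 1 else 0) * az_poly m Minus x + x $ 2 * az_partial i m Minus x) = az_partial i (Suc m) Plus x"
      and q: "((if i = 1 then 1 else 0) * az_poly m Minus x + x $ 1 * az_partial i m Minus x)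
         + ((if i = 2 then 1 else 0) * az_poly m Plus x + x $ 2 * az_partial i m Plus x) = az_partial i (Suc m) Minus x"
      using step by (auto simp: algebra_simps simp del: az_poly.simps)
    show ?case using P M unfolding p q by (rule conjI)
  qed
  then show ?thesis by (cases s) auto
qed

lemma smooth_on_power: "open S \<Longrightarrow> smooth_on S f \<Longrightarrow> smooth_on S (\<lambda>x. f x ^ n :: real)"
  by (induction n) (auto intro: smooth_on_const smooth_on_mult)

lemma smooth_az_poly: "smooth_on UNIV (az_poly m s)"
proof -
  have "smooth_on UNIV (az_poly m Plus) \<and> smooth_on UNIV (az_poly m Minus)"
  proof (induction m)
    case 0 then show ?case unfolding az_poly_0 using smooth_on_const by blast
  next
    case (Suc m)
    have eq: "az_poly (Suc m) Plus = (\<lambda>x. x $ 1 * az_poly m Plus x - x $ 2 * az_poly m Minus x)"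
      "az_poly (Suc m) Minus = (\<lambda>x. x $ 1 * az_poly m Minus x + x $ 2 * az_poly m Plus x)"
      by (auto simp: az_poly_Suc)
    show ?case unfolding eq using Suc
      by (intro conjI smooth_on_diff smooth_on_add smooth_on_mult smooth_on_coord) auto
  qed
  then show ?thesis by (cases s) auto
qed

lemma partial_az_poly: "partial i (az_poly m s) = az_partial i m s"
  by (rule ext, rule has_partial_imp, rule az_poly_has_partial)

lemma az_poly_euler: "x $ 1 * az_partial 1 m s x + x $ 2 * az_partial 2 m s x = real m * az_poly m s x"
  by (cases m; cases s; simp add: algebra_simps)

lemma az_partial_0: "az_partial 0 m s x = 0"
  by (cases s) (use distinct_3 in auto)

text \<open>
  Real and imaginary part of the holomorphic function \<open>(x\<^sub>1 + i x\<^sub>2)\<^sup>m\<close>.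
\<close>

lemma lap_az_poly: "lap (az_poly m s) x = 0"
proof -
  have 0: "partial 0 (az_partial 0 m s) x = 0"
    using has_partial_imp[OF has_partial_const, of 0 0 x] by (simp add: az_partial_0[abs_def])
  have 1: "partial 1 (az_partial 1 m s) x = real m * (real (m - 1) * az_poly (m - 2) s x)"
  proof -
    have "az_partial 1 m s = (\<lambda>x. real m * az_poly (m - 1) s x)" by (cases s) auto
    then show ?thesis
      using has_partial_imp[OF has_partial_cmult[OF az_poly_has_partial[of 1 "m - 1" s x]], of "real m"]
      by (cases s) (auto simp: numeral_2_eq_2)
  qed
  have 2: "partial 2 (az_partial 2 m s) x = - (real m * (real (m - 1) * az_poly (m - 2) s x))"
  proof (cases s)
    case Plus
    then have "az_partial 2 m s = (\<lambda>x. - real m * az_poly (m - 1) Minus x)" using distinct_3 by auto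
    then show ?thesis
      using has_partial_imp[OF has_partial_cmult[OF az_poly_has_partial[of 2 "m - 1" Minus x]], of "- real m"] Plus distinct_3
      by (auto simp: numeral_2_eq_2)
  next
    case Minus
    then have "az_partial 2 m s = (\<lambda>x. real m * az_poly (m - 1) Plus x)" using distinct_3 by auto
    then show ?thesis
      using has_partial_imp[OF has_partial_cmult[OF az_poly_has_partial[of 2 "m - 1" Plus x]], of "real m"] Minus distinct_3
      by (auto simp: numeral_2_eq_2)
  qed
  show ?thesis unfolding lap_def partial_az_poly sum_UNIV_3 0 1 2 by simp
qed

lemma has_partial_norm_powi:
  assumes "x \<noteq> (0 :: real^3)"
  shows "has_partial i (\<lambda>x. norm x powi q) (of_int q * (x $ i * norm x powi (q - 2))) x"
proof -
  have "has_partial i norm (axis i 1 \<bullet> sgn x) x"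
    by (rule has_partial_from_derivative[OF has_derivative_norm[OF assms]])
  then have "has_partial i norm (x $ i / norm x) x"
    by (simp add: inner_axis inner_commute sgn_div_norm divide_inverse mult.commute)
  then have "((\<lambda>t. norm (x + t *\<^sub>R axis i 1)) has_real_derivative (x $ i / norm x)) (at 0)"
    using has_partial_line_real[of i norm _ x 0] by simp
  then have "((\<lambda>t. norm (x + t *\<^sub>R axis i 1) powi q) has_real_derivative
      (of_int q * norm (x + 0 *\<^sub>R axis i 1) powi (q - 1) * (x $ i / norm x))) (at 0)"
    by (rule DERIV_power_int) (use assms in simp)
  moreover have "of_int q * norm (x + 0 *\<^sub>R axis i 1) powi (q - 1) * (x $ i / norm x) = of_int q * (x $ i * norm x powi (q - 2))"
    using power_int_diff[of "norm x" "q - 1" 1] assms by (simp add: field_simps)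
  ultimately show ?thesis
    by (simp add: has_partial_def has_real_derivative_iff_has_vector_derivative)
qed

lemma open_punctured: "open (- {0 :: real^3})" by (simp add: open_Compl)

lemma smooth_norm_powi: "smooth_on (- {0}) (\<lambda>x. norm x powi q)"
proof -
  have "cont_diff_on k (- {0}) (\<lambda>x. norm x powi q)" for k
  proof (induction k arbitrary: q)
    case 0 then show ?case by (auto intro!: continuous_intros)
  next
    case (Suc k)
    show ?case
    proof (rule cont_diff_on_SucI[OF open_punctured, where g = "\<lambda>i x. of_int q * (x $ i * norm x powi (q - 2))"])
      show "continuous_on (- {0}) (\<lambda>x::real^3. norm x powi q)" by (auto intro!: continuous_intros)
      show "cont_diff_on k (- {0}) (\<lambda>x. of_int q * (x $ i * norm x powi (q - 2)))" for i
        by (intro cont_diff_on_mult[OF open_punctured] cont_diff_on_const cont_diff_on_coord Suc)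
    qed (rule has_partial_norm_powi, simp)
  qed
  then show ?thesis by (simp add: smooth_on_def)
qed

lemma lap_norm_powi:
  assumes x: "x \<noteq> 0"
  shows "lap (\<lambda>x. norm x powi q) x = of_int q * (of_int q + 1) * norm x powi (q - 2)"
proof -
  have n: "norm x > 0" using x by simp
  have "partial i (partial i (\<lambda>x. norm x powi q)) x =
     of_int q * (norm x powi (q - 2) + x $ i * (of_int (q - 2) * (x $ i * norm x powi (q - 2 - 2))))" (is "_ = ?R i") for i
  proof -
    have "partial i (partial i (\<lambda>x. norm x powi q)) x = partial i (\<lambda>x. of_int q * (x $ i * norm x powi (q - 2))) x"
      by (rule partial_cong_open[OF open_punctured]) (use x in \<open>auto intro!: has_partial_imp has_partial_norm_powi\<close>)
    also have "\<dots> = of_int q * ((if i = i then 1 else 0) * norm x powi (q - 2) + x $ i * (of_int (q - 2) * (x $ i * norm x powi (q - 2 - 2))))"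
      by (intro has_partial_imp has_partial_cmult has_partial_mult has_partial_coord has_partial_norm_powi x)
    finally show ?thesis by simp
  qed
  then have "lap (\<lambda>x. norm x powi q) x = of_int q * (3 * norm x powi (q - 2) + of_int (q - 2) * ((\<Sum>i\<in>UNIV. (x $ i)\<^sup>2) * norm x powi (q - 2 - 2)))"
    unfolding lap_def sum_UNIV_3 by (simp only:) (simp add: algebra_simps power2_eq_square)
  also have "(\<Sum>i\<in>UNIV. (x $ i)\<^sup>2) = norm x powi 2"
    by (simp add: norm_real3 sum_UNIV_3)
  also have "norm x powi 2 * norm x powi (q - 2 - 2) = norm x powi (q - 2)"
    using n by (subst power_int_add[symmetric]) auto
  finally show ?thesis by (simp add: algebra_simps)
qed

lemma has_partial_x0_power: "has_partial i (\<lambda>x. (x $ 0) ^ j) (if i = 0 then real j * (x $ 0) ^ (j - 1) else 0) x"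
proof (induction j)
  case (Suc j)
  from has_partial_mult[OF has_partial_coord[of i 0 x] Suc]
  show ?case by (cases j) (auto simp: algebra_simps)
qed (simp add: has_partial_const)

lemma smooth_x0_power: "smooth_on S (\<lambda>x. (x $ 0) ^ j :: real)"
  by (rule smooth_on_subset[OF smooth_on_power[OF open_UNIV smooth_on_coord]]) simp

lemma lap_x0_power: "lap (\<lambda>x. (x $ 0) ^ j) x = real j * real (j - 1) * (x $ 0) ^ (j - 2)"
proof -
  have p: "partial i (\<lambda>x. (x $ 0) ^ j) = (\<lambda>x. (if i = 0 then real j else 0) * (x $ 0) ^ (j - 1))" for i
    by (rule ext, rule has_partial_imp) (use has_partial_x0_power[of i j] in \<open>auto split: if_splits\<close>)
  have "partial i (partial i (\<lambda>x. (x $ 0) ^ j)) x = (if i = 0 then real j else 0) * (if i = 0 then real (j - 1) * (x $ 0) ^ (j - 1 - 1) else 0)" for i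
    unfolding p by (intro has_partial_imp has_partial_cmult has_partial_x0_power)
  then show ?thesis by (simp add: lap_def sum_UNIV_3 distinct_3[symmetric] numeral_2_eq_2)
qed

text \<open>
  Away from the origin a solid harmonic is a combination of these, with one fixed total degree
  (\<open>solid_harmonic_axial\<close>); its Laplacian can then be computed term by term.
\<close>

definition axial_monomial :: "nat \<Rightarrow> int \<Rightarrow> nat \<Rightarrow> parity \<Rightarrow> real^3 \<Rightarrow> real" where
  "axial_monomial j q m s x = ((x $ 0) ^ j * norm x powi q) * az_poly m s x"

lemma smooth_axial_monomial: "smooth_on (- {0}) (axial_monomial j q m s)"
  unfolding axial_monomial_def[abs_def]
  by (intro smooth_on_mult open_punctured smooth_x0_power smooth_norm_powi smooth_on_subset[OF smooth_az_poly]) simp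

lemma lap_axial_monomial:
  assumes x: "x \<noteq> 0"
  shows "lap (axial_monomial j q m s) x =
    (real j * real (j - 1) * (x $ 0) ^ (j - 2) * norm x powi q
      + of_int q * (of_int q + 1 + 2 * real j + 2 * real m) * (x $ 0) ^ j * norm x powi (q - 2)) * az_poly m s x"
proof -
  have xS: "x \<in> - {0}" using x by simp
  let ?f = "\<lambda>x::real^3. (x $ 0) ^ j" and ?g = "\<lambda>x::real^3. norm x powi q"
  have sm: "smooth_on (- {0}) ?f" "smooth_on (- {0}) ?g" "smooth_on (- {0}) (az_poly m s)"
    by (intro smooth_x0_power smooth_norm_powi smooth_on_subset[OF smooth_az_poly]; simp)+
  have pf: "partial i ?f x = (if i = 0 then real j * (x $ 0) ^ (j - 1) else 0)" for i
    by (rule has_partial_imp[OF has_partial_x0_power])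
  have pg: "partial i ?g x = of_int q * (x $ i * norm x powi (q - 2))" for i
    by (rule has_partial_imp[OF has_partial_norm_powi[OF x]])
  have pfg: "partial i (\<lambda>x. ?f x * ?g x) x = partial i ?f x * ?g x + ?f x * partial i ?g x" for i
    by (rule partial_mult[OF sm(1,2) xS])
  have jj: "real j * (x $ 0) ^ (j - 1) * x $ 0 = real j * (x $ 0) ^ j"
    by (cases j) auto
  have 1: "(\<Sum>i\<in>UNIV. partial i ?f x * partial i ?g x) = real j * of_int q * (x $ 0) ^ j * norm x powi (q - 2)"
  proof -
    have "(\<Sum>i\<in>UNIV. partial i ?f x * partial i ?g x) = (real j * (x $ 0) ^ (j - 1) * x $ 0) * of_int q * norm x powi (q - 2)"
      unfolding pf pg sum_UNIV_3 using distinct_3 by simp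
    then show ?thesis unfolding jj by simp
  qed
  have 2: "(\<Sum>i\<in>UNIV. partial i (\<lambda>x. ?f x * ?g x) x * partial i (az_poly m s) x)
      = of_int q * real m * (x $ 0) ^ j * norm x powi (q - 2) * az_poly m s x"
  proof -
    have "(\<Sum>i\<in>UNIV. partial i (\<lambda>x. ?f x * ?g x) x * partial i (az_poly m s) x)
        = (x $ 0) ^ j * of_int q * norm x powi (q - 2) * (x $ 1 * az_partial 1 m s x + x $ 2 * az_partial 2 m s x)"
      unfolding pfg pf pg partial_az_poly sum_UNIV_3 az_partial_0 using distinct_3 by (simp add: algebra_simps)
    then show ?thesis unfolding az_poly_euler by simp
  qed
  have "lap (axial_monomial j q m s) x =
     (?f x * ?g x) * lap (az_poly m s) x + 2 * (\<Sum>i\<in>UNIV. partial i (\<lambda>x. ?f x * ?g x) x * partial i (az_poly m s) x)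
       + az_poly m s x * lap (\<lambda>x. ?f x * ?g x) x"
    unfolding axial_monomial_def[abs_def]
    by (rule lap_mult[OF open_punctured smooth_on_mult[OF open_punctured sm(1,2)] sm(3) xS])
  also have "lap (\<lambda>x. ?f x * ?g x) x = ?f x * lap ?g x + 2 * (\<Sum>i\<in>UNIV. partial i ?f x * partial i ?g x) + ?g x * lap ?f x"
    by (rule lap_mult[OF open_punctured sm(1,2) xS])
  finally show ?thesis
    unfolding 1 2 lap_az_poly lap_norm_powi[OF x] lap_x0_power by (simp add: algebra_simps)
qed

definition leg_coeff :: "nat \<Rightarrow> nat \<Rightarrow> nat \<Rightarrow> real" where
  "leg_coeff l m j = coeff ((pderiv ^^ m) (legendre_poly l)) j"

abbreviation rod_poly :: "nat \<Rightarrow> real poly" where "rod_poly l \<equiv> [:-1, 0, 1:] ^ l"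

text \<open>Comparison of coefficients in \<open>(t\<^sup>2 - 1) w' = c t w\<close>.\<close>

lemma recurrence_from_ode:
  fixes w :: "real poly"
  assumes "pCons 0 (pCons 0 (pderiv w)) - pderiv w = smult c (pCons 0 w)"
  shows "coeff w 1 = 0" "(real i + 2) * coeff w (i + 2) = (real i - c) * coeff w i"
proof -
  have eq: "coeff (pCons 0 (pCons 0 (pderiv w)) - pderiv w) n = coeff (smult c (pCons 0 w)) n" for n
    using assms by simp
  show "coeff w 1 = 0" using eq[of 0] by (simp add: coeff_pderiv)
  show "(real i + 2) * coeff w (i + 2) = (real i - c) * coeff w i"
    using eq[of "Suc i"] by (cases i) (simp_all add: coeff_pderiv algebra_simps)
qed

lemma rod_coeff: "coeff (rod_poly l) 1 = 0"
  "(real i + 2) * coeff (rod_poly l) (i + 2) = (real i - 2 * real l) * coeff (rod_poly l) i"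
proof -
  let ?q = "[:-1, 0, 1:] :: real poly"
  have "?q * pderiv (?q ^ l) = smult (2 * real l) (pCons 0 (?q ^ l))"
  proof (cases l)
    case (Suc k)
    have "pderiv ?q = [:0, 2:]" by (simp add: pderiv_pCons)
    then have "pderiv (?q ^ l) = smult (real l) (?q ^ k) * [:0, 2:]" unfolding Suc by (subst pderiv_power_Suc) simp
    then have "?q * pderiv (?q ^ l) = smult (real l) (?q ^ l) * [:0, 2:]" unfolding Suc by (simp only: mult_smult_left mult_smult_right power_Suc mult.assoc)
    also have "\<dots> = smult (2 * real l) (pCons 0 (?q ^ l))" by simp
    finally show ?thesis .
  qed simp
  moreover have qm: "?q * r = pCons 0 (pCons 0 r) - r" for r :: "real poly"
    by (simp add: mult_pCons_left)
  ultimately have "pCons 0 (pCons 0 (pderiv (?q ^ l))) - pderiv (?q ^ l) = smult (2 * real l) (pCons 0 (?q ^ l))"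
    by (simp only:)
  from recurrence_from_ode[OF this] show "coeff (rod_poly l) 1 = 0"
    "(real i + 2) * coeff (rod_poly l) (i + 2) = (real i - 2 * real l) * coeff (rod_poly l) i" .
qed

lemma rod_coeff_odd: "odd i \<Longrightarrow> coeff (rod_poly l) i = 0"
proof (induction i rule: less_induct)
  case (less i)
  show ?case
  proof (cases "i = 1")
    case True then show ?thesis by (simp only: rod_coeff(1))
  next
    case False
    then obtain k where k: "i = k + 2" using less.prems by (metis One_nat_def Suc_1 add.commute even_zero le_add_diff_inverse not_less_eq_eq numeral_2_eq_2 le_less_linear less_2_cases)
    have "coeff (rod_poly l) k = 0" using less k by auto
    then have "(real k + 2) * coeff (rod_poly l) (k + 2) = 0" using rod_coeff(2)[of k l] by simp
    then show ?thesis unfolding k by (simp add: add_eq_0_iff)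
  qed
qed

lemma rod_degree: "degree (rod_poly l) = 2 * l" "coeff (rod_poly l) (2 * l) = 1"
proof -
  show d: "degree (rod_poly l) = 2 * l" by (simp add: degree_power_eq)
  have "lead_coeff (rod_poly l) = lead_coeff [:-1, 0, 1::real:] ^ l" by (rule lead_coeff_power)
  then show "coeff (rod_poly l) (2 * l) = 1" unfolding d by simp
qed

lemma leg_coeff_eq:
  "fact j * leg_coeff l m j = (1 / (2 ^ l * fact l)) * fact (j + (m + l)) * coeff (rod_poly l) (j + (m + l))"
proof -
  have "(pderiv ^^ m) (legendre_poly l) = smult (1 / (2 ^ l * fact l)) ((pderiv ^^ (m + l)) (rod_poly l))"
    unfolding legendre_poly_def by (simp add: higher_pderiv_smult funpow_add)
  then have "leg_coeff l m j = (1 / (2 ^ l * fact l)) * (pochhammer (real (Suc j)) (m + l) * coeff (rod_poly l) (j + (m + l)))"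
    unfolding leg_coeff_def by (simp add: coeff_higher_pderiv)
  moreover have "fact j * pochhammer (real (Suc j)) (m + l) = fact (j + (m + l))"
    using pochhammer_product'[of "1::real" j "m + l"] by (simp add: pochhammer_fact add.commute)
  ultimately show ?thesis by (simp add: mult_ac)
qed

lemma leg_coeff_zero: assumes "m \<le> l" "odd (l - m - j) \<or> j > l - m" shows "leg_coeff l m j = 0"
proof -
  have "coeff (rod_poly l) (j + (m + l)) = 0"
  proof (cases "j > l - m")
    case True then show ?thesis using assms(1) by (intro coeff_eq_0) (simp add: rod_degree)
  next
    case False
    then have "odd (l - m - j)" using assms(2) by simp
    then have "odd (j + (m + l))" using False assms(1) by presburger
    then show ?thesis by (rule rod_coeff_odd)
  qed
  then show ?thesis using leg_coeff_eq[of j l m] by simp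
qed

lemma leg_coeff_top: assumes "m \<le> l" shows "leg_coeff l m (l - m) \<noteq> 0"
proof -
  have eq: "l - m + (m + l) = 2 * l" using assms by simp
  have "fact (l - m) * leg_coeff l m (l - m) = (1 / (2 ^ l * fact l)) * fact (2 * l)"
    using leg_coeff_eq[of "l - m" l m] unfolding eq rod_degree(2) by (simp only: mult_1_right)
  moreover have "(1 / (2 ^ l * fact l)) * fact (2 * l) \<noteq> (0::real)" by simp
  ultimately show ?thesis by (metis mult_zero_right)
qed

text \<open>
  Rodrigues' polynomial \<open>w = (t\<^sup>2 - 1)\<^sup>l\<close> satisfies \<open>(t\<^sup>2 - 1) w' = 2 l t w\<close>, hence a two-term recurrence for its
  coefficients; differentiating \<open>m + l\<close> times only shifts and rescales them.
\<close>

lemma leg_coeff_rec: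
  "(real j + 1) * (real j + 2) * leg_coeff l m (j + 2) = (real j + real m + real l + 1) * (real j + real m - real l) * leg_coeff l m j"
proof -
  let ?c = "1 / (2 ^ l * fact l) :: real" and ?n = "j + (m + l)"
  have "fact j * ((real j + 1) * (real j + 2) * leg_coeff l m (j + 2)) = fact (j + 2) * leg_coeff l m (j + 2)"
    by (simp add: numeral_2_eq_2 algebra_simps)
  also have "\<dots> = ?c * fact (?n + 2) * coeff (rod_poly l) (?n + 2)"
    unfolding leg_coeff_eq by (simp add: add.commute add.left_commute)
  also have "\<dots> = ?c * fact ?n * (real ?n + 1) * ((real ?n + 2) * coeff (rod_poly l) (?n + 2))"
  proof -
    have "fact (?n + 2) = (real ?n + 1) * (real ?n + 2) * fact ?n"
      by (simp add: numeral_2_eq_2 algebra_simps)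
    then show ?thesis by (simp only: mult_ac)
  qed
  also have "\<dots> = ?c * fact ?n * (real ?n + 1) * ((real ?n - 2 * real l) * coeff (rod_poly l) ?n)"
    by (simp only: rod_coeff(2))
  also have "\<dots> = (real ?n + 1) * (real ?n - 2 * real l) * (?c * fact ?n * coeff (rod_poly l) ?n)" by (simp only: mult_ac)
  also have "?c * fact ?n * coeff (rod_poly l) ?n = fact j * leg_coeff l m j" by (rule leg_coeff_eq[symmetric])
  finally have "fact j * ((real j + 1) * (real j + 2) * leg_coeff l m (j + 2)) =
     fact j * ((real j + real m + real l + 1) * (real j + real m - real l) * leg_coeff l m j)"
    by (simp add: algebra_simps)
  then show ?thesis by simp
qed

lemma leg_poly_sum: assumes "m \<le> l"
  shows "poly ((pderiv ^^ m) (legendre_poly l)) t = (\<Sum>j\<le>l - m. leg_coeff l m j * t ^ j)"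
proof -
  have "degree ((pderiv ^^ m) (legendre_poly l)) \<le> l - m"
    by (rule degree_le) (use leg_coeff_zero[OF assms] in \<open>auto simp: leg_coeff_def\<close>)
  then have "(\<Sum>j\<le>degree ((pderiv ^^ m) (legendre_poly l)). leg_coeff l m j * t ^ j) = (\<Sum>j\<le>l - m. leg_coeff l m j * t ^ j)"
    by (intro sum.mono_neutral_left) (auto simp: leg_coeff_def coeff_eq_0 not_le)
  then show ?thesis by (simp add: poly_altdef leg_coeff_def)
qed

text \<open>
  The Legendre polynomial used for degree \<open>N\<close>; negative degrees are reflected by \<open>N \<mapsto> - N - 1\<close>.
\<close>

definition leg_degree :: "int \<Rightarrow> nat" where
  "leg_degree N = nat (if N \<ge> 0 then N else - N - 1)"

definition solid_dom :: "int \<Rightarrow> (real^3) set" where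
  "solid_dom N = (if N \<ge> 0 then UNIV else - {0})"

lemma open_solid_dom: "open (solid_dom N)"
  by (simp add: solid_dom_def open_punctured)

lemma az_poly_polar:
  "az_poly m s x = cmod (Complex (x $ 1) (x $ 2)) ^ m * azimuthal m s (Arg (Complex (x $ 1) (x $ 2)))"
proof -
  let ?z = "Complex (x $ 1) (x $ 2)"
  have "?z ^ m = rcis (cmod ?z) (Arg ?z) ^ m" by (simp add: rcis_cmod_Arg)
  also have "\<dots> = rcis (cmod ?z ^ m) (real m * Arg ?z)" by (rule DeMoivre2)
  finally show ?thesis by (cases s) simp_all
qed

lemma solid_harmonic_axial:
  assumes x: "x \<noteq> 0" and m: "m \<le> leg_degree N"
  shows "solid_harmonic N m s x =
    (\<Sum>j\<le>leg_degree N - m. ((-1) ^ m * leg_coeff (leg_degree N) m j) * axial_monomial j (N - int m - int j) m s x)"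
proof -
  let ?r = "norm x" and ?z = "Complex (x $ 1) (x $ 2)" and ?l = "leg_degree N"
  have r: "?r > 0" using x by simp
  have "1 - (x $ 0 / ?r)\<^sup>2 = (?r\<^sup>2 - (x $ 0)\<^sup>2) / ?r\<^sup>2" using r by (simp add: field_simps)
  also have "?r\<^sup>2 - (x $ 0)\<^sup>2 = (cmod ?z)\<^sup>2" by (simp add: norm_real3 cmod_power2)
  finally have "sqrt (1 - (x $ 0 / ?r)\<^sup>2) = cmod ?z / ?r" using r by (simp add: real_sqrt_divide)
  then have "solid_harmonic N m s x = ?r powi N * ((-1) ^ m * (cmod ?z / ?r) ^ m *
      (\<Sum>j\<le>?l - m. leg_coeff ?l m j * (x $ 0 / ?r) ^ j)) * azimuthal m s (Arg ?z)"
    unfolding solid_harmonic_def assoc_legendre_def by (simp only: leg_degree_def[symmetric] leg_poly_sum[OF m])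
  also have "\<dots> = (\<Sum>j\<le>?l - m. ((-1) ^ m * leg_coeff ?l m j) * ((x $ 0) ^ j * (?r powi N / ?r ^ m / ?r ^ j) * (cmod ?z ^ m * azimuthal m s (Arg ?z))))"
    by (simp add: sum_distrib_left sum_distrib_right power_divide mult_ac)
  also have "\<dots> = (\<Sum>j\<le>?l - m. ((-1) ^ m * leg_coeff ?l m j) * axial_monomial j (N - int m - int j) m s x)"
  proof (rule sum.cong[OF refl])
    fix j
    have "?r powi (N - int m - int j) = ?r powi N / ?r ^ m / ?r ^ j"
      using r by (simp add: power_int_diff)
    then show "(-1) ^ m * leg_coeff ?l m j * ((x $ 0) ^ j * (?r powi N / ?r ^ m / ?r ^ j) * (cmod ?z ^ m * azimuthal m s (Arg ?z)))
       = (-1) ^ m * leg_coeff ?l m j * axial_monomial j (N - int m - int j) m s x"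
      unfolding axial_monomial_def az_poly_polar by simp
  qed
  finally show ?thesis .
qed

text \<open>
  Odd powers of \<open>|x|\<close> do not occur, since the coefficients of the other parity vanish; this is what makes
  the solid harmonics of nonnegative degree smooth at the origin.
\<close>

lemma solid_harmonic_polynomial:
  assumes m: "m \<le> l"
  shows "solid_harmonic (int l) m s x =
    (\<Sum>j\<le>l - m. ((-1) ^ m * leg_coeff l m j) * ((x $ 0) ^ j * ((norm x)\<^sup>2) ^ ((l - m - j) div 2) * az_poly m s x))"
proof (cases "x = 0")
  case False
  have l: "leg_degree (int l) = l" by (simp add: leg_degree_def)
  show ?thesis
    unfolding solid_harmonic_axial[OF False, of m "int l", unfolded l, OF m]
  proof (rule sum.cong[OF refl])
    fix j assume j: "j \<in> {..l - m}"
    show "(-1) ^ m * leg_coeff l m j * axial_monomial j (int l - int m - int j) m s x =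
      (-1) ^ m * leg_coeff l m j * ((x $ 0) ^ j * ((norm x)\<^sup>2) ^ ((l - m - j) div 2) * az_poly m s x)"
    proof (cases "odd (l - m - j)")
      case True then show ?thesis using leg_coeff_zero[OF m] by simp
    next
      case False
      have "int l - int m - int j = int (l - m - j)" using j m by auto
      then have "norm x powi (int l - int m - int j) = norm x ^ (2 * ((l - m - j) div 2))"
        using False by (simp only: power_int_of_nat) simp
      then show ?thesis by (simp add: axial_monomial_def power_mult)
    qed
  qed
next
  case True
  show ?thesis
  proof (cases "l = 0")
    case l0: True
    then have "m = 0" using m by simp
    have "legendre_poly 0 = 1" by (simp add: legendre_poly_def)
    then have "leg_coeff 0 0 0 = 1" by (simp add: leg_coeff_def)
    then show ?thesis using l0 \<open>m = 0\<close> True \<open>legendre_poly 0 = 1\<close>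
      by (cases s) (auto simp: solid_harmonic_def assoc_legendre_def)
  next
    case False
    have "((0::real) ^ j * 0 ^ ((l - m - j) div 2) * az_poly m s 0) = 0" if "even (l - m - j)" "j \<le> l - m" for j
    proof (cases "m = 0")
      case True
      then have "j \<noteq> 0 \<or> (l - m - j) div 2 \<noteq> 0" using False that by presburger
      then show ?thesis by auto
    next
      case False
      have "Complex 0 0 = 0" by (simp add: complex_eq_iff)
      then show ?thesis using False by (cases s) (auto simp: power_0_left)
    qed
    then have "(-1) ^ m * leg_coeff l m j * ((x $ 0) ^ j * ((norm x)\<^sup>2) ^ ((l - m - j) div 2) * az_poly m s x) = 0" if "j \<in> {..l - m}" for j
      using True leg_coeff_zero[OF m, of j] that by (cases "even (l - m - j)") auto
    then have "(\<Sum>j\<le>l - m. ((-1) ^ m * leg_coeff l m j) * ((x $ 0) ^ j * ((norm x)\<^sup>2) ^ ((l - m - j) div 2) * az_poly m s x)) = 0"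
      by (intro sum.neutral ballI)
    moreover have "solid_harmonic (int l) m s x = 0"
      using True False by (simp add: solid_harmonic_def power_0_left)
    ultimately show ?thesis by simp
  qed
qed

lemma smooth_norm_sq: "smooth_on UNIV (\<lambda>x::real^3. (norm x)\<^sup>2)"
proof -
  have "(\<lambda>x::real^3. (norm x)\<^sup>2) = (\<lambda>x. x $ 0 * x $ 0 + x $ 1 * x $ 1 + x $ 2 * x $ 2)"
    by (auto simp: norm_real3 power2_eq_square)
  then show ?thesis by (simp only:) (intro smooth_on_add smooth_on_mult smooth_on_coord open_UNIV)
qed

text \<open>
  Each axial monomial contributes a term lowering the power of \<open>x\<^sub>0\<close> by two and a term lowering the power
  of \<open>|x|\<close> by two. By the recurrence of the coefficients the first one of index \<open>j + 2\<close> cancels the second one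
  of index \<open>j\<close>.
\<close>

lemma lap_solid_axial:
  assumes x: "x \<noteq> 0" and m: "m \<le> leg_degree N"
  shows "lap (solid_harmonic N m s) x = 0"
proof -
  define l where "l = leg_degree N"
  define a where "a j = (-1) ^ m * leg_coeff l m j" for j
  have xS: "x \<in> - {0}" using x by simp
  have rec: "real (j + 2) * real (j + 1) * a (j + 2) = - (of_int (N - int m - int j) * of_int (N + int m + int j + 1)) * a j" for j
  proof -
    have "(real j + real m + real l + 1) * (real j + real m - real l) = - (of_int (N - int m - int j) * of_int (N + int m + int j + 1))"
      by (cases "N \<ge> 0") (auto simp: l_def leg_degree_def algebra_simps)
    moreover have "real (j + 2) * real (j + 1) * a (j + 2) = (real j + real m + real l + 1) * (real j + real m - real l) * a j"
      unfolding a_def using arg_cong[OF leg_coeff_rec[of j l m], of "\<lambda>z. (-1) ^ m * z"] by (simp add: algebra_simps)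
    ultimately show ?thesis by simp
  qed
  let ?r = "norm x"
  define T where "T j = a j * (real j * real (j - 1) * (x $ 0) ^ (j - 2) * ?r powi (N - int m - int j))" for j
  define V where "V j = a j * (of_int (N - int m - int j) * of_int (N + int m + int j + 1) * (x $ 0) ^ j * ?r powi (N - int m - int j - 2))" for j
  have TV: "T (j + 2) = - V j" for j
  proof -
    have "T (j + 2) = (real (j + 2) * real (j + 1) * a (j + 2)) * ((x $ 0) ^ j * ?r powi (N - int m - int j - 2))"
      unfolding T_def by (simp add: algebra_simps)
    then show ?thesis unfolding rec V_def by (simp add: algebra_simps)
  qed
  have a0: "a j = 0" if "j > l - m" for j
    using leg_coeff_zero[of m l j] that m by (simp add: a_def l_def)
  have "lap (solid_harmonic N m s) x = lap (\<lambda>x. \<Sum>j\<le>l - m. a j * axial_monomial j (N - int m - int j) m s x) x"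
    unfolding a_def l_def
    by (rule lap_cong[OF open_punctured xS]) (simp add: solid_harmonic_axial[OF _ m])
  also have "\<dots> = (\<Sum>j\<le>l - m. a j * lap (axial_monomial j (N - int m - int j) m s) x)"
    by (rule lap_sum_cmult[OF open_punctured _ xS]) (rule smooth_axial_monomial)
  also have "\<dots> = (\<Sum>j\<le>l - m. (T j + V j) * az_poly m s x)"
    unfolding lap_axial_monomial[OF x] T_def V_def by (intro sum.cong refl) (simp add: algebra_simps)
  also have "\<dots> = ((\<Sum>j\<le>l - m. T j) + (\<Sum>j\<le>l - m. V j)) * az_poly m s x"
    by (simp only: sum_distrib_right[symmetric] sum.distrib)
  also have "(\<Sum>j\<le>l - m. T j) = (\<Sum>j\<le>Suc (Suc (l - m)). T j)"
    by (rule sum.mono_neutral_left) (auto simp: T_def a0)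
  also have "\<dots> = (\<Sum>j\<le>l - m. T (j + 2))"
    unfolding sum.atMost_Suc_shift by (simp add: T_def)
  also have "\<dots> = - (\<Sum>j\<le>l - m. V j)" by (simp only: TV sum_negf)
  finally show ?thesis by simp
qed

theorem harm_solid_harmonic:
  assumes m: "m \<le> leg_degree N"
  shows "smooth_harmonic (solid_dom N) (solid_harmonic N m s)"
  unfolding harm_iff_lap
proof
  show sm: "smooth_on (solid_dom N) (solid_harmonic N m s)"
  proof (cases "N \<ge> 0")
    case True
    define l where "l = nat N"
    have N: "N = int l" and m': "m \<le> l" using True m by (auto simp: l_def leg_degree_def)
    have "solid_harmonic N m s = (\<lambda>x. \<Sum>j\<le>l - m. ((-1) ^ m * leg_coeff l m j) * ((x $ 0) ^ j * ((norm x)\<^sup>2) ^ ((l - m - j) div 2) * az_poly m s x))"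
      unfolding N by (rule ext) (rule solid_harmonic_polynomial[OF m'])
    then show ?thesis using True
      by (simp only: solid_dom_def if_True)
        (intro smooth_on_sum smooth_on_mult smooth_on_const smooth_x0_power smooth_on_power smooth_norm_sq smooth_az_poly open_UNIV)
  next
    case False
    have "smooth_on (- {0}) (\<lambda>x. \<Sum>j\<le>leg_degree N - m. ((-1) ^ m * leg_coeff (leg_degree N) m j) * axial_monomial j (N - int m - int j) m s x)"
      by (intro smooth_on_sum smooth_on_mult smooth_on_const smooth_axial_monomial open_punctured)
    then have "smooth_on (- {0}) (solid_harmonic N m s)"
      by (subst smooth_on_cong[OF open_punctured]) (auto simp: solid_harmonic_axial[OF _ m])
    then show ?thesis using False by (simp add: solid_dom_def)
  qed
  show "\<forall>x\<in>solid_dom N. lap (solid_harmonic N m s) x = 0"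
  proof
    fix x assume x: "x \<in> solid_dom N"
    show "lap (solid_harmonic N m s) x = 0"
    proof (cases "x = 0")
      case False then show ?thesis by (rule lap_solid_axial[OF _ m])
    next
      case True
      have "continuous_on (solid_dom N) (lap (solid_harmonic N m s))"
        unfolding lap_def[abs_def] by (intro continuous_intros smooth_on_continuous smooth_on_partial sm)
      then have "(lap (solid_harmonic N m s) \<longlongrightarrow> lap (solid_harmonic N m s) x) (at x)"
        using x open_solid_dom continuous_on_eq_continuous_at continuous_within by blast
      moreover have "\<forall>\<^sub>F y in at x. lap (solid_harmonic N m s) y = 0"
        unfolding eventually_at using lap_solid_axial[OF _ m] True by (intro exI[of _ 1]) auto
      then have "(lap (solid_harmonic N m s) \<longlongrightarrow> 0) (at x)" by (rule tendsto_eventually)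
      ultimately show ?thesis using tendsto_unique[OF trivial_limit_at] by blast
    qed
  qed
qed

lemma solid_harmonic_homogeneous:
  assumes "c > 0"
  shows "solid_harmonic N m s (c *\<^sub>R x) = c powi N * solid_harmonic N m s x"
proof -
  have "Complex (c * x $ 1) (c * x $ 2) = of_real c * Complex (x $ 1) (x $ 2)" by (simp add: complex_eq_iff)
  then have "Arg (Complex (c * x $ 1) (c * x $ 2)) = Arg (Complex (x $ 1) (x $ 2))"
    using assms by (simp add: Arg_times_of_real)
  then show ?thesis using assms by (simp add: solid_harmonic_def power_int_mult_distrib)
qed

section \<open>Homogeneous harmonic functions\<close>

text \<open>
  The cone over the domain: the functions of the exterior problem are homogeneous of negative degree and
  extend to all points but the origin.
\<close>

definition cone_dom :: "side \<Rightarrow> (real^3) set" where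
  "cone_dom \<sigma> = (case \<sigma> of Interior \<Rightarrow> UNIV | Exterior \<Rightarrow> - {0})"

lemma open_cone_dom: "open (cone_dom \<sigma>)"
  by (cases \<sigma>) (auto simp: cone_dom_def open_punctured)

lemma dom3_subset_cone: "dom3 \<sigma> \<subseteq> cone_dom \<sigma>"
  by (cases \<sigma>) (auto simp: cone_dom_def)

lemma cone_dom_scale: "x \<in> cone_dom \<sigma> \<Longrightarrow> c > 0 \<Longrightarrow> c *\<^sub>R x \<in> cone_dom \<sigma>"
  by (cases \<sigma>) (auto simp: cone_dom_def)

definition homog :: "side \<Rightarrow> int \<Rightarrow> (real^3 \<Rightarrow> real) \<Rightarrow> bool" where
  "homog \<sigma> n f \<longleftrightarrow> smooth_on (cone_dom \<sigma>) f \<and> (\<forall>x\<in>cone_dom \<sigma>. \<forall>c>0. f (c *\<^sub>R x) = c powi n * f x)"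

lemma homog_smooth: "homog \<sigma> n f \<Longrightarrow> smooth_on (cone_dom \<sigma>) f" by (simp add: homog_def)

lemma homog_scale: "homog \<sigma> n f \<Longrightarrow> x \<in> cone_dom \<sigma> \<Longrightarrow> c > 0 \<Longrightarrow> f (c *\<^sub>R x) = c powi n * f x"
  by (simp add: homog_def)

lemma homog_partial:
  assumes "homog \<sigma> n f" shows "homog \<sigma> (n - 1) (partial i f)"
  unfolding homog_def
proof (intro conjI ballI allI impI)
  have s: "smooth_on (cone_dom \<sigma>) f" by (rule homog_smooth[OF assms])
  show "smooth_on (cone_dom \<sigma>) (partial i f)" by (rule smooth_on_partial[OF s])
  fix x c assume x: "x \<in> cone_dom \<sigma>" and c: "(c::real) > 0"
  have "has_partial i (\<lambda>y. f (0 + c *\<^sub>R y)) (c *\<^sub>R partial i f (0 + c *\<^sub>R x)) x"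
    by (rule has_partial_affine, rule smooth_on_has_partial[OF s]) (use cone_dom_scale[OF x c] in simp)
  then have "has_partial i (\<lambda>y. f (c *\<^sub>R y)) (c * partial i f (c *\<^sub>R x)) x" by simp
  moreover have "has_partial i (\<lambda>y. f (c *\<^sub>R y)) (c powi n * partial i f x) x"
    by (rule has_partial_cong_open[OF open_cone_dom x _ has_partial_cmult[OF smooth_on_has_partial[OF s x]]])
      (simp add: homog_scale[OF assms _ c])
  ultimately have "c * partial i f (c *\<^sub>R x) = c powi n * partial i f x"
    by (rule has_partial_unique)
  then show "partial i f (c *\<^sub>R x) = c powi (n - 1) * partial i f x"
    using c by (simp add: power_int_diff field_simps)
qed

text \<open>
  Euler's identity, by differentiating \<open>f (t x) = t\<^sup>n f x\<close> at \<open>t = 1\<close>.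
\<close>

lemma homog_euler:
  assumes "homog \<sigma> n f" and x: "x \<in> cone_dom \<sigma>"
  shows "(\<Sum>i\<in>UNIV. x $ i * partial i f x) = of_int n * f x"
proof -
  have s: "smooth_on (cone_dom \<sigma>) f" by (rule homog_smooth[OF assms(1)])
  have D: "(f has_derivative (\<lambda>v. \<Sum>i\<in>UNIV. v $ i * partial i f x)) (at (1 *\<^sub>R x))"
    using C1_has_derivative[OF open_cone_dom x smooth_on_cont_diff[OF s]] by simp
  have "((\<lambda>t. t *\<^sub>R x) has_derivative (\<lambda>t. t *\<^sub>R x)) (at 1)"
    by (auto intro!: derivative_eq_intros)
  from has_derivative_compose[OF this D]
  have 1: "((\<lambda>t. f (t *\<^sub>R x)) has_real_derivative (\<Sum>i\<in>UNIV. x $ i * partial i f x)) (at 1)"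
  proof -
    have "(\<lambda>t. \<Sum>i\<in>UNIV. (t *\<^sub>R x) $ i * partial i f x) = (*) (\<Sum>i\<in>UNIV. x $ i * partial i f x)"
      by (rule ext) (simp add: sum_UNIV_3 algebra_simps)
    then show ?thesis using \<open>((\<lambda>t. f (t *\<^sub>R x)) has_derivative (\<lambda>t. \<Sum>i\<in>UNIV. (t *\<^sub>R x) $ i * partial i f x)) (at 1)\<close>
      by (simp add: has_field_derivative_def)
  qed
  have "((\<lambda>t. t powi n * f x) has_real_derivative of_int n * f x) (at 1)"
    by (auto intro!: derivative_eq_intros)
  moreover have "\<forall>\<^sub>F t in nhds 1. t powi n * f x = f (t *\<^sub>R x)"
    using eventually_nhds_in_open[of "{0<..}" "1::real"] by (auto elim!: eventually_mono simp: homog_scale[OF assms(1) x])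
  ultimately have 2: "((\<lambda>t. f (t *\<^sub>R x)) has_real_derivative of_int n * f x) (at 1)"
    by (subst (asm) DERIV_cong_ev[OF refl _ refl])
  show ?thesis by (rule DERIV_unique[OF 1 2])
qed

fun weight :: "side \<Rightarrow> real^3 \<Rightarrow> real" where
  "weight Interior x = 1"
| "weight Exterior x = 1 / (norm x)\<^sup>2"

text \<open>
  A convenient class of square-integrable functions: the weight is square-integrable on the domain, and
  on the exterior it is the decay of homogeneous functions of degree \<open>-2\<close>, the largest degree that occurs.
\<close>

definition dominated :: "side \<Rightarrow> (real^3 \<Rightarrow> real) \<Rightarrow> bool" where
  "dominated \<sigma> f \<longleftrightarrow> continuous_on (dom3 \<sigma>) f \<and> (\<exists>C. \<forall>x\<in>dom3 \<sigma>. \<bar>f x\<bar> \<le> C * weight \<sigma> x)"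

lemma integrable_shell:
  "integrable lborel (\<lambda>x::real^3. indicator {x. a < norm x \<and> norm x \<le> b} x * (1 / norm x ^ 4) :: real)" if "a > 0"
proof (rule Bochner_Integration.integrable_bound)
  show "integrable lborel (\<lambda>x::real^3. indicator (cball 0 b) x * (1 / a ^ 4) :: real)"
    by (intro integrable_mult_left) (use emeasure_lborel_cball_finite[of "0::real^3" b] in \<open>simp add: integrable_indicator_iff\<close>)
  show "(\<lambda>x::real^3. indicator {x. a < norm x \<and> norm x \<le> b} x * (1 / norm x ^ 4) :: real) \<in> borel_measurable lborel"
    by measurable
  show "AE x in lborel. norm (indicator {x. a < norm x \<and> norm x \<le> b} x * (1 / norm x ^ 4) :: real)
      \<le> norm (indicator (cball (0::real^3) b) x * (1 / a ^ 4) :: real)"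
  proof (rule AE_I2)
    fix x :: "real^3"
    show "norm (indicator {x. a < norm x \<and> norm x \<le> b} x * (1 / norm x ^ 4) :: real)
      \<le> norm (indicator (cball (0::real^3) b) x * (1 / a ^ 4) :: real)"
    proof (cases "a < norm x \<and> norm x \<le> b")
      case True
      then have "a ^ 4 \<le> norm x ^ 4" using that by (intro power_mono) auto
      then have "1 / norm x ^ 4 \<le> 1 / a ^ 4" using that by (intro divide_left_mono) (auto intro!: mult_pos_pos simp: True intro: order_less_trans)
      then show ?thesis using True that by simp
    qed simp
  qed
qed

text \<open>
  Scaling by \<open>2\<close> maps the shell of radii \<open>1\<close> to \<open>2\<^sup>n\<close> to that of radii \<open>2\<close> to \<open>2\<^sup>n\<^sup>+\<^sup>1\<close> and halves the
  integral. So \<open>a (n + 1) \<le> a 1 + a n / 2\<close>, which bounds the integrals over all shells.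
\<close>

lemma integrable_inverse_fourth_power:
  "integrable lborel (\<lambda>x::real^3. indicator {x. 1 < norm x} x * (1 / norm x ^ 4) :: real)"
proof -
  define F where "F n x = (indicator {x. 1 < norm x \<and> norm x \<le> 2 ^ n} x * (1 / norm x ^ 4) :: real)" for n and x :: "real^3"
  define a where "a n = (LINT x|lborel. F n x)" for n
  have int: "integrable lborel (F n)" for n unfolding F_def by (rule integrable_shell) simp
  have step: "a (Suc n) \<le> a 1 + a n / 2" for n
  proof -
    let ?G = "\<lambda>x::real^3. indicator {x. 2 < norm x \<and> norm x \<le> 2 ^ Suc n} x * (1 / norm x ^ 4) :: real"
    have G: "F n (0 + (1/2) *\<^sub>R x) = 16 * ?G x" for x
      by (auto simp: F_def indicator_def power_divide)
    have "16 * (LINT x|lborel. ?G x) = (LINT x|lborel. F n (0 + (1/2) *\<^sub>R x))" unfolding G by (rule integral_mult_right_zero[symmetric])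
    also have "\<dots> = a n / (1/2)^3" unfolding a_def by (rule lborel_affine_integral(2)[OF int]) simp
    finally have "16 * (LINT x|lborel. ?G x) = 8 * a n" by (simp only: power_divide) simp
    then have "(LINT x|lborel. ?G x) = a n / 2" by linarith
    moreover have "a (Suc n) \<le> (LINT x|lborel. F 1 x + ?G x)"
      unfolding a_def
    proof (rule integral_mono[OF int])
      show "integrable lborel (\<lambda>x. F 1 x + ?G x)" by (intro Bochner_Integration.integrable_add int integrable_shell) simp
      show "F (Suc n) x \<le> F 1 x + ?G x" for x by (auto simp: F_def indicator_def)
    qed
    moreover have "(LINT x|lborel. F 1 x + ?G x) = a 1 + (LINT x|lborel. ?G x)"
      unfolding a_def by (intro Bochner_Integration.integral_add int integrable_shell) simp
    ultimately show ?thesis by simp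
  qed
  have a_nonneg: "a n \<ge> 0" for n unfolding a_def by (rule Bochner_Integration.integral_nonneg) (simp add: F_def)
  have a0: "a 0 = 0"
  proof -
    have "F 0 x = 0" for x by (simp add: F_def indicator_def)
    then show ?thesis by (simp add: a_def)
  qed
  have bound: "a n \<le> 2 * a 1" for n
  proof (induction n)
    case 0 then show ?case using a_nonneg[of 1] by (simp add: a0)
  next
    case (Suc n) then show ?case using step[of n] by simp
  qed
  have mono: "F m x \<le> F n x" if "m \<le> n" for m n x
  proof -
    have "(2::real) ^ m \<le> 2 ^ n" using that by simp
    then have "norm x \<le> 2 ^ m \<Longrightarrow> norm x \<le> 2 ^ n" by linarith
    then show ?thesis by (auto simp: F_def indicator_def)
  qed
  have "incseq a" unfolding a_def incseq_def using mono int by (auto intro!: integral_mono)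
  then obtain L where L: "a \<longlonglongrightarrow> L" using incseq_convergent[of a "2 * a 1"] bound by metis
  show ?thesis
  proof (rule integrable_monotone_convergence[where f = F, OF int])
    show "AE x in lborel. mono (\<lambda>n. F n x)" using mono by (auto simp: mono_def)
    show "AE x in lborel. (\<lambda>n. F n x) \<longlonglongrightarrow> indicator {x. 1 < norm x} x * (1 / norm x ^ 4)"
    proof (rule AE_I2)
      fix x :: "real^3"
      obtain N where "norm x \<le> 2 ^ N" using real_arch_pow[of 2 "norm x"] by (auto intro: less_imp_le)
      then have "\<forall>\<^sub>F n in sequentially. norm x \<le> 2 ^ n"
        by (intro eventually_sequentiallyI[of N]) (meson le_less_trans less_le_not_le not_le one_le_numeral order_trans power_increasing)
      then have "\<forall>\<^sub>F n in sequentially. F n x = indicator {x. 1 < norm x} x * (1 / norm x ^ 4)"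
        by eventually_elim (auto simp: F_def indicator_def)
      then show "(\<lambda>n. F n x) \<longlonglongrightarrow> indicator {x. 1 < norm x} x * (1 / norm x ^ 4)" by (rule tendsto_eventually)
    qed
    show "(\<lambda>n. LINT x|lborel. F n x) \<longlonglongrightarrow> L" using L by (simp add: a_def[abs_def])
  qed measurable
qed

lemma integrable_weight: "integrable (lebesgue_on (dom3 \<sigma>)) (\<lambda>x. weight \<sigma> x * weight \<sigma> x)"
proof (cases \<sigma>)
  case Interior
  have "dom3 \<sigma> = ball 0 1" using Interior by (auto simp: dist_norm)
  moreover have "integrable lebesgue (\<lambda>x::real^3. indicator (ball 0 1) x * 1 :: real)"
    using emeasure_lborel_ball_finite[of "0::real^3" 1] by (simp add: integrable_indicator_iff)
  ultimately show ?thesis unfolding integrable_dom3_iff using Interior by simp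
next
  case Exterior
  have "(\<lambda>x. indicator (dom3 \<sigma>) x * (weight \<sigma> x * weight \<sigma> x)) = (\<lambda>x::real^3. indicator {x. 1 < norm x} x * (1 / norm x ^ 4) :: real)"
    using Exterior by (auto simp: fun_eq_iff numeral_eq_Suc)
  then show ?thesis unfolding integrable_dom3_iff using integrable_inverse_fourth_power
    by (simp only:) (subst integrable_completion; auto dest: borel_measurable_integrable)
qed

lemma dominated_mult_integrable:
  assumes "dominated \<sigma> f" "dominated \<sigma> g"
  shows "integrable (lebesgue_on (dom3 \<sigma>)) (\<lambda>x. f x * g x)"
proof -
  obtain C D where C: "\<And>x. x \<in> dom3 \<sigma> \<Longrightarrow> \<bar>f x\<bar> \<le> C * weight \<sigma> x" and D: "\<And>x. x \<in> dom3 \<sigma> \<Longrightarrow> \<bar>g x\<bar> \<le> D * weight \<sigma> x"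
    using assms unfolding dominated_def by blast
  show ?thesis
  proof (rule Bochner_Integration.integrable_bound)
    show "integrable (lebesgue_on (dom3 \<sigma>)) (\<lambda>x. (\<bar>C\<bar> * \<bar>D\<bar>) * (weight \<sigma> x * weight \<sigma> x))"
      by (rule integrable_mult_right) (rule integrable_weight)
    show "(\<lambda>x. f x * g x) \<in> borel_measurable (lebesgue_on (dom3 \<sigma>))"
      by (rule borel_dom3_continuous) (use assms in \<open>auto simp: dominated_def intro!: continuous_intros\<close>)
    show "AE x in lebesgue_on (dom3 \<sigma>). norm (f x * g x) \<le> norm ((\<bar>C\<bar> * \<bar>D\<bar>) * (weight \<sigma> x * weight \<sigma> x))"
    proof (rule AE_I2)
      fix x :: "real^3" assume "x \<in> space (lebesgue_on (dom3 \<sigma>))"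
      then have x: "x \<in> dom3 \<sigma>" by (simp add: space_restrict_space)
      have w: "weight \<sigma> x \<ge> 0" by (cases \<sigma>) auto
      have "\<bar>f x\<bar> \<le> \<bar>C\<bar> * weight \<sigma> x" using C[OF x] w by (meson abs_ge_self mult_right_mono order_trans)
      moreover have "\<bar>g x\<bar> \<le> \<bar>D\<bar> * weight \<sigma> x" using D[OF x] w by (meson abs_ge_self mult_right_mono order_trans)
      ultimately have "\<bar>f x\<bar> * \<bar>g x\<bar> \<le> (\<bar>C\<bar> * weight \<sigma> x) * (\<bar>D\<bar> * weight \<sigma> x)"
        using w by (intro mult_mono) auto
      then show "norm (f x * g x) \<le> norm ((\<bar>C\<bar> * \<bar>D\<bar>) * (weight \<sigma> x * weight \<sigma> x))"
        using w by (simp add: abs_mult mult_ac)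
    qed
  qed
qed

lemma homog_dominated:
  assumes f: "homog \<sigma> n f" and n: "\<sigma> = Exterior \<Longrightarrow> n \<le> -2"
  shows "dominated \<sigma> f"
proof -
  have cont: "continuous_on (cone_dom \<sigma>) f" by (intro smooth_on_continuous homog_smooth[OF f])
  have c: "continuous_on (dom3 \<sigma>) f" by (rule continuous_on_subset[OF cont dom3_subset_cone])
  have "\<exists>C. \<forall>x\<in>dom3 \<sigma>. \<bar>f x\<bar> \<le> C * weight \<sigma> x"
  proof (cases \<sigma>)
    case Interior
    have "compact (f ` cball 0 1)"
      by (rule compact_continuous_image[OF continuous_on_subset[OF cont]]) (auto simp: cone_dom_def Interior)
    then obtain C where "\<forall>x\<in>cball 0 1. \<bar>f x\<bar> \<le> C" by (auto dest!: compact_imp_bounded simp: bounded_iff)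
    then show ?thesis using Interior by (intro exI[of _ C]) auto
  next
    case Exterior
    have "compact (f ` sphere 0 1)"
      by (rule compact_continuous_image[OF continuous_on_subset[OF cont]]) (auto simp: cone_dom_def Exterior)
    then obtain C where C: "\<forall>x\<in>sphere 0 1. \<bar>f x\<bar> \<le> C" by (auto dest!: compact_imp_bounded simp: bounded_iff)
    have "\<bar>f x\<bar> \<le> C * weight \<sigma> x" if x: "x \<in> dom3 \<sigma>" for x
    proof -
      have n1: "norm x > 1" using x Exterior by simp
      let ?u = "(1 / norm x) *\<^sub>R x"
      have "x \<noteq> 0" using n1 by (metis norm_zero not_one_less_zero)
      have u: "?u \<in> sphere 0 1" "?u \<in> cone_dom \<sigma>" using n1 Exterior \<open>x \<noteq> 0\<close> by (auto simp: cone_dom_def)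
      have "f x = f (norm x *\<^sub>R ?u)" using \<open>x \<noteq> 0\<close> by simp
      also have "\<dots> = norm x powi n * f ?u" by (rule homog_scale[OF f u(2)]) (use n1 in linarith)
      finally have "\<bar>f x\<bar> = norm x powi n * \<bar>f ?u\<bar>" by (simp add: abs_mult)
      also have "\<dots> \<le> norm x powi (-2) * C"
      proof (rule mult_mono)
        show "norm x powi n \<le> norm x powi (-2)" using n[OF Exterior] n1 by (intro power_int_increasing) auto
        show "\<bar>f ?u\<bar> \<le> C" using C u by blast
      qed auto
      also have "norm x powi (-2) = weight \<sigma> x" using Exterior by (simp add: power_int_minus divide_inverse)
      finally show ?thesis by (simp add: mult.commute)
    qed
    then show ?thesis by blast
  qed
  then show ?thesis using c by (simp add: dominated_def)
qed

text \<open>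
  The divergence theorem for \<open>W = p \<nabla>q - n' p q x\<close>. Euler's identity gives \<open>x \<bullet> W = (1 - |x|\<^sup>2) n' p q\<close>, so the
  normal component vanishes on the sphere, and \<open>div W = \<nabla>p \<bullet> \<nabla>q - n' (n + n' + 3) p q\<close>.
\<close>

lemma green_homogeneous:
  assumes p: "homog \<sigma> n p" and q: "homog \<sigma> n' q" "smooth_harmonic (cone_dom \<sigma>) q"
    and n: "n \<in> degree_set \<sigma>" "n' \<in> degree_set \<sigma>"
  shows "(LINT x|lebesgue_on (dom3 \<sigma>). (\<Sum>i\<in>UNIV. partial i p x * partial i q x))
       = of_int n' * (of_int n + of_int n' + 3) * (LINT x|lebesgue_on (dom3 \<sigma>). p x * q x)"
proof -
  let ?M = "lebesgue_on (dom3 \<sigma>)"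
  have nE: "\<sigma> = Exterior \<Longrightarrow> n \<le> -2 \<and> n' \<le> -2" using n by (cases \<sigma>) auto
  have dp: "dominated \<sigma> p" "dominated \<sigma> q" "dominated \<sigma> (partial i p)" "dominated \<sigma> (partial i q)" for i
    using nE by (auto intro!: homog_dominated[OF p] homog_dominated[OF q(1)] homog_dominated[OF homog_partial[OF p]] homog_dominated[OF homog_partial[OF q(1)]])
  have sp: "smooth_on (dom3 \<sigma>) p" "smooth_on (dom3 \<sigma>) q"
    by (rule smooth_on_subset[OF homog_smooth dom3_subset_cone], rule p q)+
  \<comment> \<open>the second term makes the field tangential at the sphere\<close>
  define W where "W i x = p x * partial i q x - of_int n' * (x $ i * (p x * q x))" for i x
  define D where "D i x = (partial i p x * partial i q x + p x * partial i (partial i q) x)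
      - of_int n' * ((if i = i then 1 else 0) * (p x * q x) + x $ i * (partial i p x * q x + p x * partial i q x))" for i x
  have int1: "integrable ?M (\<lambda>x. \<Sum>i\<in>UNIV. partial i p x * partial i q x)"
    by (intro Bochner_Integration.integrable_sum dominated_mult_integrable dp)
  have int2: "integrable ?M (\<lambda>x. p x * q x)" by (intro dominated_mult_integrable dp)
  have Deq: "(\<Sum>i\<in>UNIV. D i x) = (\<Sum>i\<in>UNIV. partial i p x * partial i q x) - of_int n' * (of_int n + of_int n' + 3) * (p x * q x)"
    if x: "x \<in> dom3 \<sigma>" for x
  proof -
    have xc: "x \<in> cone_dom \<sigma>" using x dom3_subset_cone by blast
    have "(\<Sum>i\<in>UNIV. D i x) = (\<Sum>i\<in>UNIV. partial i p x * partial i q x) + p x * (\<Sum>i\<in>UNIV. partial i (partial i q) x)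
        - of_int n' * (3 * (p x * q x) + ((\<Sum>i\<in>UNIV. x $ i * partial i p x) * q x + p x * (\<Sum>i\<in>UNIV. x $ i * partial i q x)))"
      unfolding D_def sum_UNIV_3 by (simp add: algebra_simps)
    then show ?thesis
      unfolding harm_laplace[OF q(2) xc] homog_euler[OF p xc] homog_euler[OF q(1) xc] by (simp add: algebra_simps)
  qed
  have sp0: "\<And>i. smooth_on (dom3 \<sigma>) (partial i p)" "\<And>i. smooth_on (dom3 \<sigma>) (partial i q)"
      "\<And>i. smooth_on (dom3 \<sigma>) (partial i (partial i q))" by (intro smooth_on_partial sp)+
  have "(LINT x|?M. (\<Sum>i\<in>UNIV. D i x)) = 0"
  proof (rule divergence_dom3[where W = W and g = "\<lambda>x. \<bar>of_int n'\<bar> * \<bar>p x * q x\<bar>"])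
    show "has_partial i (W i) (D i x) x" if x: "x \<in> dom3 \<sigma>" for i x
      unfolding W_def D_def
      by (intro has_partial_diff has_partial_cmult has_partial_mult has_partial_coord smooth_on_has_partial[OF _ x] sp sp0)
    show "continuous_on (dom3 \<sigma>) (W i)" for i unfolding W_def
      by (intro continuous_intros smooth_on_continuous sp sp0)
    show "continuous_on (dom3 \<sigma>) (D i)" for i unfolding D_def
      by (intro continuous_intros smooth_on_continuous sp sp0)
    show "integrable ?M (\<lambda>x. \<Sum>i\<in>UNIV. D i x)"
    proof (subst Bochner_Integration.integrable_cong[OF refl])
      show "(\<Sum>i\<in>UNIV. D i x) = (\<Sum>i\<in>UNIV. partial i p x * partial i q x) - of_int n' * (of_int n + of_int n' + 3) * (p x * q x)"
        if "x \<in> space ?M" for x using Deq that by (simp add: space_restrict_space)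
    qed (intro Bochner_Integration.integrable_diff int1 integrable_mult_right int2)
    show "integrable ?M (\<lambda>x. \<bar>of_int n'\<bar> * \<bar>p x * q x\<bar>)" by (intro integrable_mult_right integrable_abs int2)
    show "\<bar>\<Sum>i\<in>UNIV. x $ i * W i x\<bar> \<le> \<bar>1 - (norm x)\<^sup>2\<bar> * (\<bar>of_int n'\<bar> * \<bar>p x * q x\<bar>)" if x: "x \<in> dom3 \<sigma>" for x
    proof -
      have xc: "x \<in> cone_dom \<sigma>" using x dom3_subset_cone by blast
      have "(\<Sum>i\<in>UNIV. x $ i * W i x) = p x * (\<Sum>i\<in>UNIV. x $ i * partial i q x) - of_int n' * ((x $ 0)\<^sup>2 + (x $ 1)\<^sup>2 + (x $ 2)\<^sup>2) * (p x * q x)"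
        unfolding W_def sum_UNIV_3 by (simp add: algebra_simps power2_eq_square)
      also have "(x $ 0)\<^sup>2 + (x $ 1)\<^sup>2 + (x $ 2)\<^sup>2 = (norm x)\<^sup>2" by (simp add: norm_real3)
      finally have "(\<Sum>i\<in>UNIV. x $ i * W i x) = (1 - (norm x)\<^sup>2) * (of_int n' * (p x * q x))"
        unfolding homog_euler[OF q(1) xc] by (simp add: algebra_simps)
      then show ?thesis by (simp add: abs_mult)
    qed
  qed
  moreover have "(LINT x|?M. (\<Sum>i\<in>UNIV. D i x)) = (LINT x|?M. (\<Sum>i\<in>UNIV. partial i p x * partial i q x) - of_int n' * (of_int n + of_int n' + 3) * (p x * q x))"
    by (rule Bochner_Integration.integral_cong) (simp_all add: space_restrict_space Deq)
  moreover have "\<dots> = (LINT x|?M. (\<Sum>i\<in>UNIV. partial i p x * partial i q x)) - of_int n' * (of_int n + of_int n' + 3) * (LINT x|?M. p x * q x)"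
    by (subst Bochner_Integration.integral_diff[OF int1 integrable_mult_right[OF int2]]) simp
  ultimately show ?thesis by simp
qed

text \<open>
  The left side of Green's identity is symmetric in \<open>p\<close> and \<open>q\<close>, while
  \<open>n (n + n' + 3) \<noteq> n' (n + n' + 3)\<close> for distinct admissible degrees.
\<close>

lemma homogeneous_harmonic_orthogonal:
  assumes p: "homog \<sigma> n p" "smooth_harmonic (cone_dom \<sigma>) p" and q: "homog \<sigma> n' q" "smooth_harmonic (cone_dom \<sigma>) q"
    and n: "n \<in> degree_set \<sigma>" "n' \<in> degree_set \<sigma>" "n \<noteq> n'"
  shows "(LINT x|lebesgue_on (dom3 \<sigma>). p x * q x) = 0"
proof -
  let ?I = "LINT x|lebesgue_on (dom3 \<sigma>). p x * q x"
  have "of_int n' * (of_int n + of_int n' + 3) * ?I = (LINT x|lebesgue_on (dom3 \<sigma>). (\<Sum>i\<in>UNIV. partial i p x * partial i q x))"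
    by (rule green_homogeneous[OF p(1) q n(1,2), symmetric])
  also have "\<dots> = (LINT x|lebesgue_on (dom3 \<sigma>). (\<Sum>i\<in>UNIV. partial i q x * partial i p x))" by (simp add: mult.commute)
  also have "\<dots> = of_int n * (of_int n' + of_int n + 3) * (LINT x|lebesgue_on (dom3 \<sigma>). q x * p x)"
    by (rule green_homogeneous[OF q(1) p n(2,1)])
  finally have "of_int ((n' - n) * (n + n' + 3)) * ?I = 0" by (simp add: algebra_simps)
  moreover have "(n' - n) * (n + n' + 3) \<noteq> 0" using n by (cases \<sigma>) auto
  ultimately show ?thesis by (metis mult_eq_0_iff of_int_eq_0_iff)
qed

lemma homogeneous_harmonic_gradient_norm:
  assumes p: "homog \<sigma> n p" "smooth_harmonic (cone_dom \<sigma>) p" and n: "n \<in> degree_set \<sigma>"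
  shows "(LINT x|lebesgue_on (dom3 \<sigma>). (\<Sum>i\<in>UNIV. (partial i p x)\<^sup>2))
       = of_int (n * (2 * n + 3)) * (LINT x|lebesgue_on (dom3 \<sigma>). (p x)\<^sup>2)"
  using green_homogeneous[OF p(1) p n n] by (simp add: power2_eq_square algebra_simps)

text \<open>
  The components of \<open>\<nabla>U\<close> are homogeneous harmonic of degree \<open>n\<close>, so their norms are those of their gradients
  up to the common factor \<open>n (2 n + 3)\<close>, which is positive in the admissible range except at \<open>n = 0\<close>. For the
  gradients the inequality holds pointwise: the mixed entries of the Hessian are shared, and
  \<open>\<partial>\<^sub>0\<partial>\<^sub>0U = - (\<partial>\<^sub>1\<partial>\<^sub>1U + \<partial>\<^sub>2\<partial>\<^sub>2U)\<close>.
\<close>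

lemma scalar_part_bound:
  assumes U: "homog \<sigma> (n + 1) U" "smooth_harmonic (cone_dom \<sigma>) U" and n: "n \<in> degree_set \<sigma>" "n \<noteq> 0"
  shows "(LINT x|lebesgue_on (dom3 \<sigma>). (partial 0 U x)\<^sup>2)
       \<le> 2 * (LINT x|lebesgue_on (dom3 \<sigma>). (partial 1 U x)\<^sup>2 + (partial 2 U x)\<^sup>2)"
proof -
  let ?M = "lebesgue_on (dom3 \<sigma>)"
  have h: "homog \<sigma> n (partial i U)" for i using homog_partial[OF U(1), of i] by simp
  have hh: "smooth_harmonic (cone_dom \<sigma>) (partial i U)" for i by (rule harm_partial[OF open_cone_dom U(2)])
  have nE: "\<sigma> = Exterior \<Longrightarrow> n \<le> -2" using n by auto
  have d: "dominated \<sigma> (partial i U)" "dominated \<sigma> (partial j (partial i U))" for i j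
    using nE by (auto intro!: homog_dominated[OF h] homog_dominated[OF homog_partial[OF h]])
  have i1: "integrable ?M (\<lambda>x. (partial i U x)\<^sup>2)" for i
    unfolding power2_eq_square by (intro dominated_mult_integrable d)
  have i2: "integrable ?M (\<lambda>x. \<Sum>j\<in>UNIV. (partial j (partial i U) x)\<^sup>2)" for i
    unfolding power2_eq_square by (intro Bochner_Integration.integrable_sum dominated_mult_integrable d)
  have pt: "(\<Sum>j\<in>UNIV. (partial j (partial 0 U) x)\<^sup>2)
      \<le> 2 * ((\<Sum>j\<in>UNIV. (partial j (partial 1 U) x)\<^sup>2) + (\<Sum>j\<in>UNIV. (partial j (partial 2 U) x)\<^sup>2))"
    if x: "x \<in> space ?M" for x
  proof -
    have xc: "x \<in> cone_dom \<sigma>" using x dom3_subset_cone by (auto simp: space_restrict_space)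
    have c: "partial i (partial j U) x = partial j (partial i U) x" for i j
      by (rule partial_commute[OF open_cone_dom xc smooth_on_cont_diff[OF harm_smooth[OF U(2)]]])
    have sq: "a\<^sup>2 \<le> 2 * (b\<^sup>2 + c\<^sup>2)" if "a = - (b + c)" for a b c :: real
      using zero_le_power2[of "b - c"] unfolding that by (simp add: power2_eq_square algebra_simps)
    have "partial 0 (partial 0 U) x = - (partial 1 (partial 1 U) x + partial 2 (partial 2 U) x)"
      using harm_laplace[OF U(2) xc] by (simp add: sum_UNIV_3)
    then have "(partial 0 (partial 0 U) x)\<^sup>2 \<le> 2 * ((partial 1 (partial 1 U) x)\<^sup>2 + (partial 2 (partial 2 U) x)\<^sup>2)"
      by (rule sq)
    then show ?thesis unfolding sum_UNIV_3 c[of 1 0] c[of 2 0]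
      using zero_le_power2[of "partial 0 (partial 1 U) x"] zero_le_power2[of "partial 0 (partial 2 U) x"]
        zero_le_power2[of "partial 1 (partial 2 U) x"] zero_le_power2[of "partial 2 (partial 1 U) x"] by argo
  qed
  let ?c = "of_int (n * (2 * n + 3)) :: real"
  have pos: "?c > 0"
  proof -
    have "n * (2 * n + 3) > 0" using n by (cases \<sigma>) (auto intro: mult_pos_pos mult_neg_neg)
    then show ?thesis by (simp only: of_int_0_less_iff)
  qed
  have "?c * (LINT x|?M. (partial 0 U x)\<^sup>2) = (LINT x|?M. (\<Sum>j\<in>UNIV. (partial j (partial 0 U) x)\<^sup>2))"
    by (rule homogeneous_harmonic_gradient_norm[OF h hh n(1), symmetric])
  also have "\<dots> \<le> (LINT x|?M. 2 * ((\<Sum>j\<in>UNIV. (partial j (partial 1 U) x)\<^sup>2) + (\<Sum>j\<in>UNIV. (partial j (partial 2 U) x)\<^sup>2)))"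
    by (rule integral_mono[OF i2 _ pt]) (intro integrable_mult_right Bochner_Integration.integrable_add i2)
  also have "\<dots> = 2 * ((LINT x|?M. (\<Sum>j\<in>UNIV. (partial j (partial 1 U) x)\<^sup>2)) + (LINT x|?M. (\<Sum>j\<in>UNIV. (partial j (partial 2 U) x)\<^sup>2)))"
    by (subst integral_mult_right_zero, subst Bochner_Integration.integral_add[OF i2 i2]) simp
  also have "\<dots> = ?c * (2 * ((LINT x|?M. (partial 1 U x)\<^sup>2) + (LINT x|?M. (partial 2 U x)\<^sup>2)))"
    unfolding homogeneous_harmonic_gradient_norm[OF h hh n(1)] by (simp add: algebra_simps)
  also have "(LINT x|?M. (partial 1 U x)\<^sup>2) + (LINT x|?M. (partial 2 U x)\<^sup>2) = (LINT x|?M. (partial 1 U x)\<^sup>2 + (partial 2 U x)\<^sup>2)"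
    by (rule Bochner_Integration.integral_add[OF i1 i1, symmetric])
  finally show ?thesis by (rule mult_left_le_imp_le[OF _ pos])
qed

section \<open>Orthogonality of the solid harmonics\<close>

lemma distr_orthogonal:
  fixes T :: "real^3 \<Rightarrow> real^3"
  assumes T: "orthogonal_transformation T"
  shows "distr lborel borel T = lborel"
proof (rule lborel_eqI[symmetric])
  have lin: "linear T" by (rule orthogonal_transformation_linear[OF T])
  have cont: "continuous_on UNIV T" by (rule linear_continuous_on[OF linear_conv_bounded_linear[THEN iffD1, OF lin]])
  have Tm: "T \<in> lborel \<rightarrow>\<^sub>M borel" using borel_measurable_continuous_onI[OF cont] by simp
  have invT: "orthogonal_transformation (inv T)" by (rule orthogonal_transformation_inv[OF T])
  fix l u :: "real^3" assume le: "\<And>b. b \<in> Basis \<Longrightarrow> l \<bullet> b \<le> u \<bullet> b"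
  have pre: "T -` box l u = inv T ` box l u"
    by (rule bij_vimage_eq_inv_image[OF orthogonal_transformation_bij[OF T]])
  have o: "open (T -` box l u)" by (rule open_vimage[OF open_box cont])
  have lm: "box l u \<in> lmeasurable" by simp
  have lm': "inv T ` box l u \<in> lmeasurable" by (rule measurable_linear_image[OF orthogonal_transformation_linear[OF invT] lm])
  have "emeasure (distr lborel borel T) (box l u) = emeasure lborel (T -` box l u)"
    by (subst emeasure_distr[OF Tm]) simp_all
  also have "\<dots> = emeasure lebesgue (inv T ` box l u)" unfolding pre[symmetric] using o by (simp add: borel_open)
  also have "\<dots> = ennreal (measure lebesgue (inv T ` box l u))"
    using lm' by (simp add: emeasure_eq_measure2)
  also have "measure lebesgue (inv T ` box l u) = measure lebesgue (box l u)"
    by (rule measure_orthogonal_image[OF invT lm])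
  also have "ennreal \<dots> = emeasure lborel (box l u)"
    using lm by (simp add: emeasure_eq_measure2)
  also have "\<dots> = (\<Prod>b\<in>Basis. (u - l) \<bullet> b)" using le by (simp add: emeasure_lborel_box_eq)
  finally show "emeasure (distr lborel borel T) (box l u) = (\<Prod>b\<in>Basis. (u - l) \<bullet> b)" .
qed simp

lemma integral_dom3_orthogonal:
  fixes f :: "real^3 \<Rightarrow> real"
  assumes T: "orthogonal_transformation T" and f: "continuous_on (dom3 \<sigma>) f"
  shows "(LINT x|lebesgue_on (dom3 \<sigma>). f (T x)) = (LINT x|lebesgue_on (dom3 \<sigma>). f x)"
proof -
  have lin: "linear T" by (rule orthogonal_transformation_linear[OF T])
  have cont: "continuous_on UNIV T" by (rule linear_continuous_on[OF linear_conv_bounded_linear[THEN iffD1, OF lin]])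
  have Tm: "T \<in> lborel \<rightarrow>\<^sub>M borel" using borel_measurable_continuous_onI[OF cont] by simp
  have nT: "norm (T x) = norm x" for x using T by (simp add: orthogonal_transformation)
  let ?g = "\<lambda>x. indicator (dom3 \<sigma>) x * f x"
  have g: "?g \<in> borel_measurable borel"
    using borel_measurable_continuous_on_indicator[OF dom3_borel f] by simp
  have "T x \<in> dom3 \<sigma> \<longleftrightarrow> x \<in> dom3 \<sigma>" for x using nT by (cases \<sigma>) auto
  then have gT: "indicator (dom3 \<sigma>) x * f (T x) = ?g (T x)" for x by (simp add: indicator_def)
  have gTm: "(\<lambda>x. ?g (T x)) \<in> borel_measurable lborel" by (rule measurable_compose[OF Tm g])
  have "(LINT x|lebesgue_on (dom3 \<sigma>). f (T x)) = (LINT x|lebesgue. ?g (T x))"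
    unfolding integral_dom3_eq gT ..
  also have "\<dots> = (LINT x|lborel. ?g (T x))" by (rule integral_completion[OF gTm])
  also have "\<dots> = (LINT x|distr lborel borel T. ?g x)" by (rule integral_distr[OF Tm g, symmetric])
  also have "\<dots> = (LINT x|lborel. ?g x)" by (simp only: distr_orthogonal[OF T])
  also have "\<dots> = (LINT x|lebesgue. ?g x)" by (rule integral_completion[symmetric]) (use g in simp)
  also have "\<dots> = (LINT x|lebesgue_on (dom3 \<sigma>). f x)" unfolding integral_dom3_eq ..
  finally show ?thesis .
qed

text \<open>
  The rotation with cosine \<open>c\<close> and sine \<open>s\<close> about the axis of \<open>x\<^sub>0\<close>, followed by the reflection \<open>x\<^sub>2 \<mapsto> e x\<^sub>2\<close>
  if \<open>e = -1\<close>.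
\<close>

definition axis_isometry :: "real \<Rightarrow> real \<Rightarrow> real \<Rightarrow> real^3 \<Rightarrow> real^3" where
  "axis_isometry c s e x = (\<chi> i. if i = 0 then x $ 0 else if i = 1 then c * x $ 1 - s * x $ 2 else e * (s * x $ 1 + c * x $ 2))"

lemma axis_isometry_nth:
  "axis_isometry c s e x $ 0 = x $ 0" "axis_isometry c s e x $ 1 = c * x $ 1 - s * x $ 2" "axis_isometry c s e x $ 2 = e * (s * x $ 1 + c * x $ 2)"
  using distinct_3 by (auto simp: axis_isometry_def)

lemma axis_isometry_orthogonal:
  assumes "c\<^sup>2 + s\<^sup>2 = 1" "e\<^sup>2 = 1" shows "orthogonal_transformation (axis_isometry c s e)"
  unfolding orthogonal_transformation
proof
  show "linear (axis_isometry c s e)"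
    by (rule linearI) (auto simp: axis_isometry_def vec_eq_iff algebra_simps)
  show "\<forall>x. norm (axis_isometry c s e x) = norm x"
  proof
    fix x :: "real^3"
    have "(c * x $ 1 - s * x $ 2)\<^sup>2 + (e * (s * x $ 1 + c * x $ 2))\<^sup>2 = (c\<^sup>2 + s\<^sup>2) * ((x $ 1)\<^sup>2 + (x $ 2)\<^sup>2)"
      unfolding power_mult_distrib[of e] assms(2) by (simp add: power2_eq_square algebra_simps)
    then show "norm (axis_isometry c s e x) = norm x" unfolding norm_real3 axis_isometry_nth assms(1) by simp
  qed
qed

lemma partial_axis_isometry:
  assumes T: "c\<^sup>2 + s\<^sup>2 = 1" "e\<^sup>2 = 1" and U: "smooth_on (cone_dom \<sigma>) U" and x: "x \<in> cone_dom \<sigma>"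
  defines "T \<equiv> axis_isometry c s e"
  shows "partial 0 (\<lambda>x. U (T x)) x = partial 0 U (T x)"
    "partial 1 (\<lambda>x. U (T x)) x = c * partial 1 U (T x) + e * s * partial 2 U (T x)"
    "partial 2 (\<lambda>x. U (T x)) x = - s * partial 1 U (T x) + e * c * partial 2 U (T x)"
proof -
  have orth: "orthogonal_transformation T" unfolding T_def by (rule axis_isometry_orthogonal[OF T])
  have lin: "linear T" by (rule orthogonal_transformation_linear[OF orth])
  have "norm (T x) = norm x" using orth by (simp add: orthogonal_transformation)
  then have Tx: "T x \<in> cone_dom \<sigma>" using x by (cases \<sigma>) (auto simp: cone_dom_def)
  have "(T has_derivative T) (at x)" by (rule linear_imp_has_derivative[OF lin])
  from has_derivative_compose[OF this C1_has_derivative[OF open_cone_dom Tx smooth_on_cont_diff[OF U]]]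
  have "partial i (\<lambda>x. U (T x)) x = (\<Sum>j\<in>UNIV. T (axis i 1) $ j * partial j U (T x))" for i
    by (intro has_partial_imp has_partial_from_derivative)
  then show "partial 0 (\<lambda>x. U (T x)) x = partial 0 U (T x)"
    "partial 1 (\<lambda>x. U (T x)) x = c * partial 1 U (T x) + e * s * partial 2 U (T x)"
    "partial 2 (\<lambda>x. U (T x)) x = - s * partial 1 U (T x) + e * c * partial 2 U (T x)"
    using distinct_3 by (auto simp: sum_UNIV_3 T_def axis_isometry_nth axis_def)
qed

text \<open>
  The scalar product of the scalar parts of \<open>\<partial>U\<close> and \<open>\<partial>V\<close>; the next form belongs to the vector parts.
\<close>

definition scalar_form :: "side \<Rightarrow> (real^3 \<Rightarrow> real) \<Rightarrow> (real^3 \<Rightarrow> real) \<Rightarrow> real" where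
  "scalar_form \<sigma> U V = (LINT x|lebesgue_on (dom3 \<sigma>). partial 0 U x * partial 0 V x)"
definition vector_form :: "side \<Rightarrow> (real^3 \<Rightarrow> real) \<Rightarrow> (real^3 \<Rightarrow> real) \<Rightarrow> real" where
  "vector_form \<sigma> U V = (LINT x|lebesgue_on (dom3 \<sigma>). partial 1 U x * partial 1 V x + partial 2 U x * partial 2 V x)"

lemma forms_axis_isometry:
  assumes T: "c\<^sup>2 + s\<^sup>2 = 1" "e\<^sup>2 = 1" and U: "smooth_on (cone_dom \<sigma>) U" and V: "smooth_on (cone_dom \<sigma>) V"
  shows "scalar_form \<sigma> (\<lambda>x. U (axis_isometry c s e x)) (\<lambda>x. V (axis_isometry c s e x)) = scalar_form \<sigma> U V"
    "vector_form \<sigma> (\<lambda>x. U (axis_isometry c s e x)) (\<lambda>x. V (axis_isometry c s e x)) = vector_form \<sigma> U V"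
proof -
  note orth = axis_isometry_orthogonal[OF T]
  have sm: "smooth_on (dom3 \<sigma>) (partial i U)" "smooth_on (dom3 \<sigma>) (partial i V)" for i
    using smooth_on_subset[OF smooth_on_partial[OF U] dom3_subset_cone] smooth_on_subset[OF smooth_on_partial[OF V] dom3_subset_cone] by auto
  have "scalar_form \<sigma> (\<lambda>x. U (axis_isometry c s e x)) (\<lambda>x. V (axis_isometry c s e x)) =
      (LINT x|lebesgue_on (dom3 \<sigma>). (\<lambda>x. partial 0 U x * partial 0 V x) (axis_isometry c s e x))"
    unfolding scalar_form_def
    by (rule Bochner_Integration.integral_cong)
      (use dom3_subset_cone in \<open>auto simp: space_restrict_space partial_axis_isometry(1)[OF T U] partial_axis_isometry(1)[OF T V] subset_iff\<close>)
  also have "\<dots> = scalar_form \<sigma> U V" unfolding scalar_form_def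
    by (rule integral_dom3_orthogonal[OF orth]) (intro continuous_intros smooth_on_continuous sm)
  finally show "scalar_form \<sigma> (\<lambda>x. U (axis_isometry c s e x)) (\<lambda>x. V (axis_isometry c s e x)) = scalar_form \<sigma> U V" .
  have alg: "(c * a + e * s * b) * (c * a' + e * s * b') + (- s * a + e * c * b) * (- s * a' + e * c * b') = a * a' + b * b'" for a b a' b'
  proof -
    have "(c * a + e * s * b) * (c * a' + e * s * b') + (- s * a + e * c * b) * (- s * a' + e * c * b')
        = (c\<^sup>2 + s\<^sup>2) * (a * a') + e\<^sup>2 * (c\<^sup>2 + s\<^sup>2) * (b * b')"
      by (simp add: power2_eq_square algebra_simps)
    then show ?thesis by (simp add: T)
  qed
  have "vector_form \<sigma> (\<lambda>x. U (axis_isometry c s e x)) (\<lambda>x. V (axis_isometry c s e x)) =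
      (LINT x|lebesgue_on (dom3 \<sigma>). (\<lambda>x. partial 1 U x * partial 1 V x + partial 2 U x * partial 2 V x) (axis_isometry c s e x))"
    unfolding vector_form_def
  proof (rule Bochner_Integration.integral_cong[OF refl])
    fix x assume "x \<in> space (lebesgue_on (dom3 \<sigma>))"
    then have x: "x \<in> cone_dom \<sigma>" using dom3_subset_cone by (auto simp: space_restrict_space)
    show "partial 1 (\<lambda>x. U (axis_isometry c s e x)) x * partial 1 (\<lambda>x. V (axis_isometry c s e x)) x
        + partial 2 (\<lambda>x. U (axis_isometry c s e x)) x * partial 2 (\<lambda>x. V (axis_isometry c s e x)) x
      = (\<lambda>x. partial 1 U x * partial 1 V x + partial 2 U x * partial 2 V x) (axis_isometry c s e x)"
      unfolding partial_axis_isometry(2,3)[OF T U x] partial_axis_isometry(2,3)[OF T V x] alg ..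
  qed
  also have "\<dots> = vector_form \<sigma> U V" unfolding vector_form_def
    by (rule integral_dom3_orthogonal[OF orth]) (intro continuous_intros smooth_on_continuous sm)
  finally show "vector_form \<sigma> (\<lambda>x. U (axis_isometry c s e x)) (\<lambda>x. V (axis_isometry c s e x)) = vector_form \<sigma> U V" .
qed

definition valid_index :: "side \<Rightarrow> int \<Rightarrow> nat \<Rightarrow> bool" where
  "valid_index \<sigma> n m \<longleftrightarrow> n \<in> degree_set \<sigma> \<and> int m \<le> max_order \<sigma> n"

lemma valid_solid:
  assumes "valid_index \<sigma> n m"
  shows "smooth_harmonic (cone_dom \<sigma>) (solid_harmonic (n + 1) m s)" "homog \<sigma> (n + 1) (solid_harmonic (n + 1) m s)"
proof -
  have eq: "cone_dom \<sigma> = solid_dom (n + 1)" and m: "m \<le> leg_degree (n + 1)"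
    using assms by (cases \<sigma>; auto simp: valid_index_def cone_dom_def solid_dom_def leg_degree_def)+
  show h: "smooth_harmonic (cone_dom \<sigma>) (solid_harmonic (n + 1) m s)" unfolding eq by (rule harm_solid_harmonic[OF m])
  show "homog \<sigma> (n + 1) (solid_harmonic (n + 1) m s)"
    unfolding homog_def using harm_smooth[OF h] solid_harmonic_homogeneous by blast
qed

lemma az_poly_rotation:
  fixes x :: "real^3"
  assumes y: "y $ 1 = cos a * x $ 1 - sin a * x $ 2" "y $ 2 = sin a * x $ 1 + cos a * x $ 2"
  shows "az_poly m Plus y = cos (real m * a) * az_poly m Plus x - sin (real m * a) * az_poly m Minus x"
    "az_poly m Minus y = sin (real m * a) * az_poly m Plus x + cos (real m * a) * az_poly m Minus x"
proof -
  have "Complex (y $ 1) (y $ 2) = cis a * Complex (x $ 1) (x $ 2)"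
    by (simp add: complex_eq_iff y)
  then have "Complex (y $ 1) (y $ 2) ^ m = cis (real m * a) * Complex (x $ 1) (x $ 2) ^ m"
    by (simp add: power_mult_distrib Complex.DeMoivre)
  then show "az_poly m Plus y = cos (real m * a) * az_poly m Plus x - sin (real m * a) * az_poly m Minus x"
    "az_poly m Minus y = sin (real m * a) * az_poly m Plus x + cos (real m * a) * az_poly m Minus x"
    by simp_all
qed

lemma az_poly_reflection:
  fixes x :: "real^3"
  assumes y: "y $ 1 = x $ 1" "y $ 2 = - x $ 2"
  shows "az_poly m Plus y = az_poly m Plus x" "az_poly m Minus y = - az_poly m Minus x"
proof -
  have "Complex (y $ 1) (y $ 2) = cnj (Complex (x $ 1) (x $ 2))" by (simp add: complex_eq_iff y)
  then have eq: "Complex (y $ 1) (y $ 2) ^ m = cnj (Complex (x $ 1) (x $ 2) ^ m)" by simp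
  show "az_poly m Plus y = az_poly m Plus x" "az_poly m Minus y = - az_poly m Minus x"
    unfolding az_poly.simps eq by (simp_all only: cnj.sel)
qed

text \<open>
  Norm and \<open>x\<^sub>0\<close> are invariant under the isometries about the axis, so a solid harmonic transforms
  like its azimuthal factor.
\<close>

lemma solid_harmonic_az:
  fixes x y :: "real^3"
  assumes m: "m \<le> leg_degree N" and x: "x \<noteq> 0"
  obtains w where "\<And>y s. norm y = norm x \<Longrightarrow> y $ 0 = x $ 0 \<Longrightarrow> solid_harmonic N m s y = w * az_poly m s y"
proof -
  define w where "w = (\<Sum>j\<le>leg_degree N - m. ((-1) ^ m * leg_coeff (leg_degree N) m j) * ((x $ 0) ^ j * norm x powi (N - int m - int j)))"
  have "solid_harmonic N m s y = w * az_poly m s y" if "norm y = norm x" "y $ 0 = x $ 0" for y s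
  proof -
    have "y \<noteq> 0" using that(1) x by auto
    then show ?thesis unfolding solid_harmonic_axial[OF \<open>y \<noteq> 0\<close> m] axial_monomial_def that w_def
      by (simp add: sum_distrib_right mult.assoc)
  qed
  then show ?thesis by (rule that)
qed

lemma solid_harmonic_0: assumes "N \<noteq> 0" shows "solid_harmonic N m s 0 = 0"
  using assms by (simp add: solid_harmonic_def power_int_0_left_if)

lemma axis_isometry_norm:
  assumes "c\<^sup>2 + s\<^sup>2 = 1" "e\<^sup>2 = 1" shows "norm (axis_isometry c s e x) = norm x" "axis_isometry c s e 0 = 0"
proof -
  show n: "norm (axis_isometry c s e x) = norm x" for x using axis_isometry_orthogonal[OF assms] by (simp add: orthogonal_transformation)
  show "axis_isometry c s e 0 = 0" using n[of 0] by simp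
qed

lemma solid_harmonic_rotation:
  assumes m: "m \<le> leg_degree N" and N: "N \<noteq> 0 \<or> x \<noteq> 0"
  shows "solid_harmonic N m Plus (axis_isometry (cos a) (sin a) 1 x) =
      cos (real m * a) * solid_harmonic N m Plus x - sin (real m * a) * solid_harmonic N m Minus x" (is ?P)
    "solid_harmonic N m Minus (axis_isometry (cos a) (sin a) 1 x) =
      sin (real m * a) * solid_harmonic N m Plus x + cos (real m * a) * solid_harmonic N m Minus x" (is ?M)
    "solid_harmonic N m Plus (axis_isometry 1 0 (-1) x) = solid_harmonic N m Plus x" (is ?RP)
    "solid_harmonic N m Minus (axis_isometry 1 0 (-1) x) = - solid_harmonic N m Minus x" (is ?RM)
proof -
  have T: "(cos a)\<^sup>2 + (sin a)\<^sup>2 = 1" "(1::real)\<^sup>2 = 1" "(1::real)\<^sup>2 + 0\<^sup>2 = 1" "(-1::real)\<^sup>2 = 1" by simp_all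
  have "?P \<and> ?M \<and> ?RP \<and> ?RM"
  proof (cases "x = 0")
    case True
    then have "N \<noteq> 0" using N by simp
    then show ?thesis using True axis_isometry_norm(2)[OF T(1,2)] axis_isometry_norm(2)[OF T(3,4)] by (simp add: solid_harmonic_0)
  next
    case False
    obtain w where w: "\<And>y s. norm y = norm x \<Longrightarrow> y $ 0 = x $ 0 \<Longrightarrow> solid_harmonic N m s y = w * az_poly m s y"
      using solid_harmonic_az[OF m False] by blast
    have 1: "solid_harmonic N m s (axis_isometry (cos a) (sin a) 1 x) = w * az_poly m s (axis_isometry (cos a) (sin a) 1 x)"
      "solid_harmonic N m s (axis_isometry 1 0 (-1) x) = w * az_poly m s (axis_isometry 1 0 (-1) x)" "solid_harmonic N m s x = w * az_poly m s x" for s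
      using axis_isometry_norm(1)[OF T(1,2)] axis_isometry_norm(1)[OF T(3,4)] by (auto intro!: w simp: axis_isometry_nth)
    have y: "axis_isometry (cos a) (sin a) 1 x $ 1 = cos a * x $ 1 - sin a * x $ 2" "axis_isometry (cos a) (sin a) 1 x $ 2 = sin a * x $ 1 + cos a * x $ 2"
      "axis_isometry 1 0 (-1) x $ 1 = x $ 1" "axis_isometry 1 0 (-1) x $ 2 = - x $ 2" by (simp_all add: axis_isometry_nth)
    show ?thesis unfolding 1 az_poly_rotation[OF y(1,2)] az_poly_reflection[OF y(3,4)] by (simp add: algebra_simps)
  qed
  then show ?P ?M ?RP ?RM by auto
qed

text \<open>
  The sum and the difference of the two values are reproduced by the factors \<open>cos ((m - m') t)\<close> and
  \<open>cos ((m + m') t)\<close>; some \<open>t\<close> makes these equal to \<open>-1\<close>.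
\<close>

lemma rotation_algebra:
  fixes a b :: real
  assumes a: "\<And>t. a = cos (real m * t) * cos (real m' * t) * a + sin (real m * t) * sin (real m' * t) * b"
    and b: "\<And>t. b = sin (real m * t) * sin (real m' * t) * a + cos (real m * t) * cos (real m' * t) * b"
    and ne: "m \<noteq> m'"
  shows "a = 0" "b = 0"
proof -
  have 1: "a + b = cos ((real m - real m') * t) * (a + b)" for t
    using a[of t] b[of t] by (simp add: cos_diff algebra_simps)
  have 2: "a - b = cos ((real m + real m') * t) * (a - b)" for t
    using a[of t] b[of t] by (simp add: cos_add algebra_simps)
  have "a + b = 0" using 1[of "pi / (real m - real m')"] ne by simp
  moreover have "a - b = 0" using 2[of "pi / (real m + real m')"] ne by (cases "m = 0 \<and> m' = 0") (auto simp: add_eq_0_iff)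
  ultimately show "a = 0" "b = 0" by auto
qed

lemma forms_bilinear:
  assumes U: "homog \<sigma> (n + 1) U" "homog \<sigma> (n + 1) V" and W: "homog \<sigma> (n' + 1) W"
    and n: "n \<in> degree_set \<sigma>" "n' \<in> degree_set \<sigma>"
  shows "scalar_form \<sigma> (\<lambda>x. c * U x + d * V x) W = c * scalar_form \<sigma> U W + d * scalar_form \<sigma> V W"
    "vector_form \<sigma> (\<lambda>x. c * U x + d * V x) W = c * vector_form \<sigma> U W + d * vector_form \<sigma> V W"
proof -
  have dom: "dominated \<sigma> (partial i F)" if "homog \<sigma> (k + 1) F" "k \<in> degree_set \<sigma>" for i F k
    using homog_dominated[OF homog_partial[OF that(1), of i]] that(2) by (cases \<sigma>) auto
  have int: "integrable (lebesgue_on (dom3 \<sigma>)) (\<lambda>x. partial i U x * partial i W x)"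
    "integrable (lebesgue_on (dom3 \<sigma>)) (\<lambda>x. partial i V x * partial i W x)" for i
    by (intro dominated_mult_integrable dom[OF _ n(1)] dom[OF _ n(2)] U W)+
  have p: "partial i (\<lambda>x. c * U x + d * V x) x = c * partial i U x + d * partial i V x" if "x \<in> dom3 \<sigma>" for i x
    using that dom3_subset_cone
    by (intro has_partial_imp has_partial_add has_partial_cmult smooth_on_has_partial[OF homog_smooth[OF U(1)]]
        smooth_on_has_partial[OF homog_smooth[OF U(2)]]) auto
  have "scalar_form \<sigma> (\<lambda>x. c * U x + d * V x) W = (LINT x|lebesgue_on (dom3 \<sigma>). c * (partial 0 U x * partial 0 W x) + d * (partial 0 V x * partial 0 W x))"
    unfolding scalar_form_def by (rule Bochner_Integration.integral_cong) (simp_all add: space_restrict_space p algebra_simps)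
  also have "\<dots> = c * scalar_form \<sigma> U W + d * scalar_form \<sigma> V W"
    unfolding scalar_form_def using int by simp
  finally show "scalar_form \<sigma> (\<lambda>x. c * U x + d * V x) W = c * scalar_form \<sigma> U W + d * scalar_form \<sigma> V W" .
  have "vector_form \<sigma> (\<lambda>x. c * U x + d * V x) W = (LINT x|lebesgue_on (dom3 \<sigma>).
      c * (partial 1 U x * partial 1 W x + partial 2 U x * partial 2 W x) + d * (partial 1 V x * partial 1 W x + partial 2 V x * partial 2 W x))"
    unfolding vector_form_def by (rule Bochner_Integration.integral_cong) (simp_all add: space_restrict_space p algebra_simps)
  also have "\<dots> = c * vector_form \<sigma> U W + d * vector_form \<sigma> V W"
    unfolding vector_form_def using int by simp
  finally show "vector_form \<sigma> (\<lambda>x. c * U x + d * V x) W = c * vector_form \<sigma> U W + d * vector_form \<sigma> V W" .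
qed

lemma forms_sym: "scalar_form \<sigma> U V = scalar_form \<sigma> V U" "vector_form \<sigma> U V = vector_form \<sigma> V U"
  unfolding scalar_form_def vector_form_def by (simp_all add: mult.commute)

lemma homog_lincomb:
  assumes "homog \<sigma> n U" "homog \<sigma> n V" shows "homog \<sigma> n (\<lambda>x. c * U x + d * V x)"
  using assms by (auto simp: homog_def algebra_simps intro!: smooth_on_add smooth_on_cmult open_cone_dom)

text \<open>
  Reflection separates the parities, rotations separate the orders, and Green's identity the degrees.
  Only invariance, bilinearity and symmetry of a form enter into the first two arguments.
\<close>

lemma solid_forms_orthogonal:
  assumes v: "valid_index \<sigma> n m" "valid_index \<sigma> n' m'" and ne: "(n, m, s) \<noteq> (n', m', s')"
  shows "scalar_form \<sigma> (solid_harmonic (n + 1) m s) (solid_harmonic (n' + 1) m' s') = 0"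
    "vector_form \<sigma> (solid_harmonic (n + 1) m s) (solid_harmonic (n' + 1) m' s') = 0"
proof -
  have n: "n \<in> degree_set \<sigma>" "n' \<in> degree_set \<sigma>" using v by (auto simp: valid_index_def)
  have ml: "m \<le> leg_degree (n + 1)" "m' \<le> leg_degree (n' + 1)" and nz: "n + 1 \<noteq> 0" "n' + 1 \<noteq> 0"
    using v by (cases \<sigma>; auto simp: valid_index_def leg_degree_def)+
  let ?U = "solid_harmonic (n + 1) m" and ?V = "solid_harmonic (n' + 1) m'"
  note hU = valid_solid[OF v(1)] and hV = valid_solid[OF v(2)]
  have key: "F (?U s) (?V s') = 0"
    if inv: "\<And>c k e U V. c\<^sup>2 + k\<^sup>2 = 1 \<Longrightarrow> e\<^sup>2 = 1 \<Longrightarrow> smooth_on (cone_dom \<sigma>) U \<Longrightarrow> smooth_on (cone_dom \<sigma>) V \<Longrightarrow>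
        F (\<lambda>x. U (axis_isometry c k e x)) (\<lambda>x. V (axis_isometry c k e x)) = F U V"
      and bil: "\<And>U V W c d k k'. homog \<sigma> (k + 1) U \<Longrightarrow> homog \<sigma> (k + 1) V \<Longrightarrow> homog \<sigma> (k' + 1) W \<Longrightarrow>
        k \<in> degree_set \<sigma> \<Longrightarrow> k' \<in> degree_set \<sigma> \<Longrightarrow> F (\<lambda>x. c * U x + d * V x) W = c * F U W + d * F V W"
      and sym: "\<And>U V. F U V = F V U"
      and deg: "n \<noteq> n' \<Longrightarrow> F (?U s) (?V s') = 0"
    for F :: "(real^3 \<Rightarrow> real) \<Rightarrow> (real^3 \<Rightarrow> real) \<Rightarrow> real"
  proof -
    have sU: "smooth_on (cone_dom \<sigma>) (?U s)" and sV: "smooth_on (cone_dom \<sigma>) (?V s)" for s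
      using hU(1) hV(1) by (auto intro: harm_smooth)
    have bil2: "F (\<lambda>x. c * ?U s x + d * ?U t x) (\<lambda>x. c' * ?V s' x + d' * ?V t' x) =
        c * (c' * F (?U s) (?V s') + d' * F (?U s) (?V t')) + d * (c' * F (?U t) (?V s') + d' * F (?U t) (?V t'))" for c d c' d' s t s' t'
    proof -
      have 1: "F W (\<lambda>x. c' * ?V s' x + d' * ?V t' x) = c' * F W (?V s') + d' * F W (?V t')" if "homog \<sigma> (n + 1) W" for W
        unfolding sym[of W] by (rule bil[OF hV(2) hV(2) that n(2,1)])
      show ?thesis
        unfolding bil[OF hU(2) hU(2) homog_lincomb[OF hV(2) hV(2)] n] 1[OF hU(2)] ..
    qed
    \<comment> \<open>the reflection fixes one factor and negates the other\<close>
    have cross: "F (?U Plus) (?V Minus) = 0" "F (?U Minus) (?V Plus) = 0"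
    proof -
      have R: "(\<lambda>x. ?U Plus (axis_isometry 1 0 (-1) x)) = (\<lambda>x. 1 * ?U Plus x + 0 * ?U Plus x)"
        "(\<lambda>x. ?U Minus (axis_isometry 1 0 (-1) x)) = (\<lambda>x. (-1) * ?U Minus x + 0 * ?U Minus x)"
        "(\<lambda>x. ?V Plus (axis_isometry 1 0 (-1) x)) = (\<lambda>x. 1 * ?V Plus x + 0 * ?V Plus x)"
        "(\<lambda>x. ?V Minus (axis_isometry 1 0 (-1) x)) = (\<lambda>x. (-1) * ?V Minus x + 0 * ?V Minus x)"
        using solid_harmonic_rotation(3,4)[OF ml(1)] solid_harmonic_rotation(3,4)[OF ml(2)] nz by auto
      have "F (?U Plus) (?V Minus) = - F (?U Plus) (?V Minus)"
        using inv[of 1 0 "-1", OF _ _ sU[of Plus] sV[of Minus]] unfolding R bil2 by simp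
      then show "F (?U Plus) (?V Minus) = 0" by simp
      have "F (?U Minus) (?V Plus) = - F (?U Minus) (?V Plus)"
        using inv[of 1 0 "-1", OF _ _ sU[of Minus] sV[of Plus]] unfolding R bil2 by simp
      then show "F (?U Minus) (?V Plus) = 0" by simp
    qed
    consider "s \<noteq> s'" | "s = s'" "n \<noteq> n'" | "s = s'" "m \<noteq> m'" using ne by auto
    then show ?thesis
    proof cases
      case 1 then show ?thesis using cross by (cases s; cases s') auto
    next
      case 2 then show ?thesis using deg by simp
    next
      case 3
      have R: "(\<lambda>x. ?U Plus (axis_isometry (cos t) (sin t) 1 x)) = (\<lambda>x. cos (real m * t) * ?U Plus x + (- sin (real m * t)) * ?U Minus x)"
        "(\<lambda>x. ?U Minus (axis_isometry (cos t) (sin t) 1 x)) = (\<lambda>x. sin (real m * t) * ?U Plus x + cos (real m * t) * ?U Minus x)"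
        "(\<lambda>x. ?V Plus (axis_isometry (cos t) (sin t) 1 x)) = (\<lambda>x. cos (real m' * t) * ?V Plus x + (- sin (real m' * t)) * ?V Minus x)"
        "(\<lambda>x. ?V Minus (axis_isometry (cos t) (sin t) 1 x)) = (\<lambda>x. sin (real m' * t) * ?V Plus x + cos (real m' * t) * ?V Minus x)" for t
        using solid_harmonic_rotation(1,2)[OF ml(1)] solid_harmonic_rotation(1,2)[OF ml(2)] nz by auto
      have "F (?U Plus) (?V Plus) = cos (real m * t) * cos (real m' * t) * F (?U Plus) (?V Plus)
          + sin (real m * t) * sin (real m' * t) * F (?U Minus) (?V Minus)" for t
        using inv[of "cos t" "sin t" 1, OF _ _ sU[of Plus] sV[of Plus]] unfolding R bil2 cross by simp
      moreover have "F (?U Minus) (?V Minus) = sin (real m * t) * sin (real m' * t) * F (?U Plus) (?V Plus)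
          + cos (real m * t) * cos (real m' * t) * F (?U Minus) (?V Minus)" for t
        using inv[of "cos t" "sin t" 1, OF _ _ sU[of Minus] sV[of Minus]] unfolding R bil2 cross by simp
      ultimately have "F (?U Plus) (?V Plus) = 0" "F (?U Minus) (?V Minus) = 0"
        using rotation_algebra[OF _ _ 3(2)] by blast+
      then show ?thesis using 3(1) by (cases s) auto
    qed
  qed
  have h: "homog \<sigma> n (partial i (?U s))" "smooth_harmonic (cone_dom \<sigma>) (partial i (?U s))"
     "homog \<sigma> n' (partial i (?V s'))" "smooth_harmonic (cone_dom \<sigma>) (partial i (?V s'))" for i
    using homog_partial[OF hU(2), of i] homog_partial[OF hV(2), of i] harm_partial[OF open_cone_dom hU(1)] harm_partial[OF open_cone_dom hV(1)] by auto
  have deg: "(LINT x|lebesgue_on (dom3 \<sigma>). partial i (?U s) x * partial i (?V s') x) = 0" if "n \<noteq> n'" for i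
    by (rule homogeneous_harmonic_orthogonal[OF h n that])
  have dom: "dominated \<sigma> (partial i (?U s))" "dominated \<sigma> (partial i (?V s'))" for i
    using homog_dominated[OF h(1)] homog_dominated[OF h(3)] n by (cases \<sigma>; auto)+
  have int: "integrable (lebesgue_on (dom3 \<sigma>)) (\<lambda>x. partial i (?U s) x * partial i (?V s') x)" for i
    by (intro dominated_mult_integrable dom)
  show "scalar_form \<sigma> (?U s) (?V s') = 0"
  proof (rule key[where F = "scalar_form \<sigma>"])
    show "scalar_form \<sigma> (?U s) (?V s') = 0" if "n \<noteq> n'" unfolding scalar_form_def by (rule deg[OF that])
  qed (rule forms_axis_isometry forms_bilinear forms_sym; assumption)+
  show "vector_form \<sigma> (?U s) (?V s') = 0"
  proof (rule key[where F = "vector_form \<sigma>"])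
    show "vector_form \<sigma> (?U s) (?V s') = 0" if "n \<noteq> n'" unfolding vector_form_def using deg[OF that] int by simp
  qed (rule forms_axis_isometry forms_bilinear forms_sym; assumption)+
qed

section \<open>Density of the solid harmonics on spheres\<close>

inductive lincomb :: "(real^3 \<Rightarrow> real) set \<Rightarrow> (real^3 \<Rightarrow> real) \<Rightarrow> bool" for B where
  lincomb_zero: "lincomb B (\<lambda>x. 0)"
| lincomb_step: "lincomb B f \<Longrightarrow> b \<in> B \<Longrightarrow> lincomb B (\<lambda>x. f x + c * b x)"

lemma lincomb_base: "b \<in> B \<Longrightarrow> lincomb B b"
  using lincomb_step[OF lincomb_zero, of b B 1] by simp

lemma lincomb_add:
  assumes "lincomb B f" "lincomb B g" shows "lincomb B (\<lambda>x. f x + g x)"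
  using assms(2)
proof (induction g rule: lincomb.induct)
  case (lincomb_step g b c)
  have "lincomb B (\<lambda>x. (f x + g x) + c * b x)" by (rule lincomb.lincomb_step) (use lincomb_step in auto)
  then show ?case by (simp add: add.assoc)
qed (simp add: assms(1))

lemma lincomb_cmult: "lincomb B f \<Longrightarrow> lincomb B (\<lambda>x. d * f x)"
proof (induction f rule: lincomb.induct)
  case lincomb_zero then show ?case using lincomb.lincomb_zero by simp
next
  case (lincomb_step f b c)
  have "lincomb B (\<lambda>x. d * f x + (d * c) * b x)" by (rule lincomb.lincomb_step) (use lincomb_step in auto)
  then show ?case by (simp add: algebra_simps)
qed

definition restr_lincomb :: "(real^3) set \<Rightarrow> (real^3 \<Rightarrow> real) set \<Rightarrow> (real^3 \<Rightarrow> real) \<Rightarrow> bool" where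
  "restr_lincomb S B f \<longleftrightarrow> (\<exists>p. lincomb B p \<and> (\<forall>x\<in>S. f x = p x))"

lemma restr_lincombI: "lincomb B f \<Longrightarrow> restr_lincomb S B f" by (auto simp: restr_lincomb_def)

lemma restr_lincomb_cong: "restr_lincomb S B f \<Longrightarrow> (\<And>x. x \<in> S \<Longrightarrow> g x = f x) \<Longrightarrow> restr_lincomb S B g"
  by (auto simp: restr_lincomb_def)

lemma restr_lincomb_add: "restr_lincomb S B f \<Longrightarrow> restr_lincomb S B g \<Longrightarrow> restr_lincomb S B (\<lambda>x. f x + g x)"
  unfolding restr_lincomb_def by (metis lincomb_add)

lemma restr_lincomb_cmult: "restr_lincomb S B f \<Longrightarrow> restr_lincomb S B (\<lambda>x. d * f x)"
  unfolding restr_lincomb_def by (metis lincomb_cmult)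

lemma restr_lincomb_sum: "(\<And>a. a \<in> A \<Longrightarrow> restr_lincomb S B (f a)) \<Longrightarrow> restr_lincomb S B (\<lambda>x. \<Sum>a\<in>A. f a x)"
  by (induction A rule: infinite_finite_induct) (auto intro: restr_lincombI lincomb_zero restr_lincomb_add)

lemma restr_lincomb_trans:
  assumes "lincomb B f" "\<And>b. b \<in> B \<Longrightarrow> restr_lincomb S B' b" shows "restr_lincomb S B' f"
  using assms(1)
proof (induction f rule: lincomb.induct)
  case lincomb_zero then show ?case by (intro restr_lincombI lincomb.lincomb_zero)
next
  case (lincomb_step f b c)
  show ?case by (rule restr_lincomb_add[OF lincomb_step(3) restr_lincomb_cmult[OF assms(2)[OF lincomb_step(2)]]])
qed

definition axial_monomials :: "(real^3 \<Rightarrow> real) set" where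
  "axial_monomials = {\<lambda>x. (x $ 0) ^ a * az_poly m s x | a m s. True}"

lemma axial_monomialsI: "(\<lambda>x. (x $ 0) ^ a * az_poly m s x) \<in> axial_monomials"
  by (auto simp: axial_monomials_def)

lemma az_poly_coord_mult:
  defines "q \<equiv> \<lambda>x::real^3. (x $ 1)\<^sup>2 + (x $ 2)\<^sup>2"
  shows "x $ 1 * az_poly (Suc m) s x = (az_poly (Suc (Suc m)) s x + q x * az_poly m s x) / 2"
    "x $ 2 * az_poly (Suc m) Plus x = (az_poly (Suc (Suc m)) Minus x - q x * az_poly m Minus x) / 2"
    "x $ 2 * az_poly (Suc m) Minus x = (- az_poly (Suc (Suc m)) Plus x + q x * az_poly m Plus x) / 2"
  by (cases s; simp add: q_def algebra_simps power2_eq_square)+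

text \<open>
  On the sphere \<open>x\<^sub>1\<^sup>2 + x\<^sub>2\<^sup>2 = R\<^sup>2 - x\<^sub>0\<^sup>2\<close>, so the span of the axial monomials is closed under multiplication
  by coordinates; \<open>az_poly_coord_mult\<close> is the rule for \<open>x\<^sub>1\<close> and \<open>x\<^sub>2\<close>.
\<close>

lemma axial_mult_coord:
  assumes b: "b \<in> axial_monomials" and R: "R > 0"
  shows "restr_lincomb (sphere 0 R) axial_monomials (\<lambda>x. x $ i * b x)"
proof -
  obtain a m s where b_eq: "b = (\<lambda>x. (x $ 0) ^ a * az_poly m s x)" using b by (auto simp: axial_monomials_def)
  let ?P = "restr_lincomb (sphere (0::real^3) R) axial_monomials"
  have mono: "?P (\<lambda>x. (x $ 0) ^ a * az_poly m s x)" for a m s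
    by (intro restr_lincombI lincomb_base axial_monomialsI)
  have q: "(x $ 1)\<^sup>2 + (x $ 2)\<^sup>2 = R\<^sup>2 - (x $ 0)\<^sup>2" if "x \<in> sphere 0 R" for x :: "real^3"
  proof -
    have "norm x = R" using that by simp
    then have "R\<^sup>2 = (norm x)\<^sup>2" by simp
    also have "\<dots> = (x $ 0)\<^sup>2 + (x $ 1)\<^sup>2 + (x $ 2)\<^sup>2" by (simp add: norm_real3)
    finally show ?thesis by simp
  qed
  have qm: "?P (\<lambda>x. (x $ 0) ^ a * ((x $ 1)\<^sup>2 + (x $ 2)\<^sup>2) * az_poly m s x)" for m s
  proof (rule restr_lincomb_cong)
    show "?P (\<lambda>x. R\<^sup>2 * ((x $ 0) ^ a * az_poly m s x) + (-1) * ((x $ 0) ^ (a + 2) * az_poly m s x))"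
      by (intro restr_lincomb_add restr_lincomb_cmult mono)
  next
    fix x :: "real^3" assume x: "x \<in> sphere 0 R"
    show "(x $ 0) ^ a * ((x $ 1)\<^sup>2 + (x $ 2)\<^sup>2) * az_poly m s x =
        R\<^sup>2 * ((x $ 0) ^ a * az_poly m s x) + (-1) * ((x $ 0) ^ (a + 2) * az_poly m s x)"
      unfolding q[OF x] by (simp add: algebra_simps power_add power2_eq_square)
  qed
  have i: "i = 0 \<or> i = 1 \<or> i = 2" by (rule exhaust_directions)
  consider "i = 0" | "i = 1" "m = 0" | "i = 2" "m = 0" | k where "i = 1" "m = Suc k" | k where "i = 2" "m = Suc k" "s = Plus" | k where "i = 2" "m = Suc k" "s = Minus"
    using i by (cases m; cases s) auto
  then show ?thesis
  proof cases
    case 1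
    show ?thesis by (rule restr_lincomb_cong[OF mono[of "Suc a" m s]]) (simp add: b_eq 1)
  next
    case 2
    show ?thesis
    proof (cases s)
      case Plus then show ?thesis by (intro restr_lincomb_cong[OF mono[of a 1 Plus]]) (simp add: b_eq 2)
    next
      case Minus then show ?thesis by (intro restr_lincomb_cong[OF restr_lincombI[OF lincomb_zero]]) (simp add: b_eq 2)
    qed
  next
    case 3
    show ?thesis
    proof (cases s)
      case Plus then show ?thesis by (intro restr_lincomb_cong[OF mono[of a 1 Minus]]) (simp add: b_eq 3)
    next
      case Minus then show ?thesis by (intro restr_lincomb_cong[OF restr_lincombI[OF lincomb_zero]]) (simp add: b_eq 3)
    qed
  next
    case (4 k)
    have "?P (\<lambda>x. (1/2) * ((x $ 0) ^ a * az_poly (Suc (Suc k)) s x) + (1/2) * ((x $ 0) ^ a * ((x $ 1)\<^sup>2 + (x $ 2)\<^sup>2) * az_poly k s x))"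
      by (intro restr_lincomb_add restr_lincomb_cmult mono qm)
    then show ?thesis
    proof (rule restr_lincomb_cong)
      fix x :: "real^3"
      have "x $ i * b x = (x $ 0) ^ a * (x $ 1 * az_poly (Suc k) s x)" by (simp add: b_eq 4 del: az_poly.simps)
      then show "x $ i * b x = (1/2) * ((x $ 0) ^ a * az_poly (Suc (Suc k)) s x) + (1/2) * ((x $ 0) ^ a * ((x $ 1)\<^sup>2 + (x $ 2)\<^sup>2) * az_poly k s x)"
        unfolding az_poly_coord_mult(1) by (simp add: algebra_simps add_divide_distrib del: az_poly.simps)
    qed
  next
    case (5 k)
    have "?P (\<lambda>x. (1/2) * ((x $ 0) ^ a * az_poly (Suc (Suc k)) Minus x) + (-1/2) * ((x $ 0) ^ a * ((x $ 1)\<^sup>2 + (x $ 2)\<^sup>2) * az_poly k Minus x))"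
      by (intro restr_lincomb_add restr_lincomb_cmult mono qm)
    then show ?thesis
    proof (rule restr_lincomb_cong)
      fix x :: "real^3"
      have "x $ i * b x = (x $ 0) ^ a * (x $ 2 * az_poly (Suc k) Plus x)" by (simp add: b_eq 5 del: az_poly.simps)
      then show "x $ i * b x = (1/2) * ((x $ 0) ^ a * az_poly (Suc (Suc k)) Minus x) + (-1/2) * ((x $ 0) ^ a * ((x $ 1)\<^sup>2 + (x $ 2)\<^sup>2) * az_poly k Minus x)"
        unfolding az_poly_coord_mult(2) by (simp only: right_diff_distrib diff_divide_distrib mult_ac times_divide_eq_right times_divide_eq_left)
    qed
  next
    case (6 k)
    have "?P (\<lambda>x. (-1/2) * ((x $ 0) ^ a * az_poly (Suc (Suc k)) Plus x) + (1/2) * ((x $ 0) ^ a * ((x $ 1)\<^sup>2 + (x $ 2)\<^sup>2) * az_poly k Plus x))"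
      by (intro restr_lincomb_add restr_lincomb_cmult mono qm)
    then show ?thesis
    proof (rule restr_lincomb_cong)
      fix x :: "real^3"
      have "x $ i * b x = (x $ 0) ^ a * (x $ 2 * az_poly (Suc k) Minus x)" by (simp add: b_eq 6 del: az_poly.simps)
      then show "x $ i * b x = (-1/2) * ((x $ 0) ^ a * az_poly (Suc (Suc k)) Plus x) + (1/2) * ((x $ 0) ^ a * ((x $ 1)\<^sup>2 + (x $ 2)\<^sup>2) * az_poly k Plus x)"
        unfolding az_poly_coord_mult(3) by (simp add: algebra_simps add_divide_distrib diff_divide_distrib del: az_poly.simps)
    qed
  qed
qed

text \<open>
  The induction shows that multiplication by \<open>f\<close> preserves the span; a mere membership statement would not
  survive products.
\<close>

lemma polynomial_on_sphere:
  assumes R: "R > 0" and f: "real_polynomial_function (f :: real^3 \<Rightarrow> real)"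
  shows "restr_lincomb (sphere 0 R) axial_monomials f"
proof -
  let ?P = "restr_lincomb (sphere (0::real^3) R) axial_monomials"
  have coord: "?P (\<lambda>x. x $ i * g x)" if g: "?P g" for g i
  proof -
    obtain p where p: "lincomb axial_monomials p" "\<forall>x\<in>sphere 0 R. g x = p x" using g by (auto simp: restr_lincomb_def)
    have "?P (\<lambda>x. x $ i * p x)"
      using p(1)
    proof (induction p rule: lincomb.induct)
      case lincomb_zero then show ?case using restr_lincombI[OF lincomb.lincomb_zero] by simp
    next
      case (lincomb_step f b c)
      have "?P (\<lambda>x. x $ i * f x + c * (x $ i * b x))"
        by (intro restr_lincomb_add restr_lincomb_cmult axial_mult_coord R lincomb_step)
      then show ?case by (rule restr_lincomb_cong) (simp add: algebra_simps)
    qed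
    then show ?thesis by (rule restr_lincomb_cong) (use p(2) in simp)
  qed
  have "\<forall>g. ?P g \<longrightarrow> ?P (\<lambda>x. f x * g x)"
    using f
  proof (induction f rule: real_polynomial_function.induct)
    case (linear f)
    have lin: "linear f" using linear by (rule bounded_linear.linear)
    have fe: "f x = (\<Sum>i\<in>UNIV. x $ i * f (axis i 1))" for x
    proof -
      have "x = (\<Sum>i\<in>UNIV. x $ i *\<^sub>R axis i 1)" using basis_expansion[of x] by (simp add: scalar_mult_eq_scaleR)
      then have "f x = f (\<Sum>i\<in>UNIV. x $ i *\<^sub>R axis i 1)" by simp
      also have "\<dots> = (\<Sum>i\<in>UNIV. x $ i * f (axis i 1))" by (simp add: linear_sum[OF lin] linear_scale[OF lin])
      finally show ?thesis .
    qed
    show ?case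
    proof (intro allI impI)
      fix g assume "?P g"
      then have "?P (\<lambda>x. \<Sum>i\<in>UNIV. f (axis i 1) * (x $ i * g x))"
        by (intro restr_lincomb_sum restr_lincomb_cmult coord)
      then show "?P (\<lambda>x. f x * g x)"
        by (rule restr_lincomb_cong) (subst fe, simp add: sum_distrib_right sum_distrib_left mult_ac)
    qed
  next
    case (const c) then show ?case using restr_lincomb_cmult by blast
  next
    case (add f1 f2)
    then show ?case by (auto simp: distrib_right intro!: restr_lincomb_add)
  next
    case (mult f1 f2)
    show ?case
    proof (intro allI impI)
      fix g assume "?P g"
      then have "?P (\<lambda>x. f1 x * (f2 x * g x))" using mult by blast
      then show "?P (\<lambda>x. f1 x * f2 x * g x)" by (simp add: mult.assoc)
    qed
  qed
  moreover have "?P (\<lambda>x. 1)"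
    by (rule restr_lincomb_cong[OF restr_lincombI[OF lincomb_base[OF axial_monomialsI[of 0 0 Plus]]]]) simp
  ultimately have "?P (\<lambda>x. f x * 1)" by blast
  then show ?thesis by simp
qed

definition solid_basis :: "side \<Rightarrow> (real^3 \<Rightarrow> real) set" where
  "solid_basis \<sigma> = {solid_harmonic N m s | N m s. (N \<ge> 0 \<longleftrightarrow> \<sigma> = Interior) \<and> m \<le> leg_degree N}"

text \<open>
  On a sphere the solid harmonic of order \<open>m\<close> with \<open>leg_degree = m + a\<close> is, up to a nonzero factor,
  \<open>x\<^sub>0\<^sup>a az_poly m s\<close> plus terms with lower powers of \<open>x\<^sub>0\<close>: a triangular system. This works for positive and
  for negative degrees, hence for both domains.
\<close>

lemma axial_monomial_on_sphere:
  assumes R: "R > 0"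
  shows "restr_lincomb (sphere 0 R) (solid_basis \<sigma>) (\<lambda>x. (x $ 0) ^ a * az_poly m s x)"
proof (induction a rule: less_induct)
  case (less a)
  let ?P = "restr_lincomb (sphere (0::real^3) R) (solid_basis \<sigma>)"
  define l where "l = m + a"
  define N where "N = (if \<sigma> = Interior then int l else - int l - 1)"
  have lN: "leg_degree N = l" by (simp add: leg_degree_def N_def)
  have N: "N \<ge> 0 \<longleftrightarrow> \<sigma> = Interior" by (simp add: N_def)
  have ml: "m \<le> leg_degree N" and lm: "l - m = a" by (simp_all add: lN l_def)
  have B: "solid_harmonic N m s \<in> solid_basis \<sigma>" using N ml by (auto simp: solid_basis_def)
  define c where "c j = (-1) ^ m * leg_coeff l m j * R powi (N - int m - int j)" for j
  have ca: "c a \<noteq> 0" using leg_coeff_top[of m l] R by (auto simp: c_def l_def)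
  have exp: "solid_harmonic N m s x = c a * ((x $ 0) ^ a * az_poly m s x) + (\<Sum>j<a. c j * ((x $ 0) ^ j * az_poly m s x))"
    if "x \<in> sphere 0 R" for x
  proof -
    have n: "norm x = R" "x \<noteq> 0" using that R by auto
    have "solid_harmonic N m s x = (\<Sum>j\<le>a. c j * ((x $ 0) ^ j * az_poly m s x))"
      unfolding solid_harmonic_axial[OF n(2) ml] lN lm axial_monomial_def n(1) c_def by (simp add: mult_ac)
    also have "{..a} = insert a {..<a}" by auto
    finally show ?thesis by simp
  qed
  have "?P (\<lambda>x. (1 / c a) * (solid_harmonic N m s x + (-1) * (\<Sum>j<a. c j * ((x $ 0) ^ j * az_poly m s x))))"
    by (intro restr_lincomb_cmult restr_lincomb_add restr_lincomb_sum restr_lincombI[OF lincomb_base[OF B]] less.IH) auto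
  then show ?case
    by (rule restr_lincomb_cong) (use ca in \<open>simp add: exp\<close>)
qed

lemma solid_harmonics_dense_on_sphere:
  assumes R: "R > 0" and u: "continuous_on (sphere 0 R) u" and e: "e > 0"
  obtains p where "lincomb (solid_basis \<sigma>) p" "\<And>x. x \<in> sphere 0 R \<Longrightarrow> \<bar>u x - p x\<bar> < e"
proof -
  obtain g where g: "real_polynomial_function g" "\<And>x. x \<in> sphere 0 R \<Longrightarrow> \<bar>u x - g x\<bar> < e"
    using Stone_Weierstrass_real_polynomial_function[OF compact_sphere u e] by blast
  obtain q where q: "lincomb axial_monomials q" "\<forall>x\<in>sphere 0 R. g x = q x"
    using polynomial_on_sphere[OF R g(1)] by (auto simp: restr_lincomb_def)
  have "restr_lincomb (sphere 0 R) (solid_basis \<sigma>) q"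
    by (rule restr_lincomb_trans[OF q(1)]) (use axial_monomial_on_sphere[OF R] in \<open>auto simp: axial_monomials_def\<close>)
  then obtain p where "lincomb (solid_basis \<sigma>) p" "\<forall>x\<in>sphere 0 R. q x = p x" by (auto simp: restr_lincomb_def)
  then show ?thesis using q g by (intro that[of p]) auto
qed

section \<open>Approximation of harmonic gradients\<close>

lemma solid_basis_harm: "b \<in> solid_basis \<sigma> \<Longrightarrow> smooth_harmonic (cone_dom \<sigma>) b"
  using harm_solid_harmonic by (cases \<sigma>) (fastforce simp: solid_basis_def cone_dom_def solid_dom_def)+

lemma lincomb_harm: "lincomb (solid_basis \<sigma>) p \<Longrightarrow> smooth_harmonic (cone_dom \<sigma>) p"
proof (induction p rule: lincomb.induct)
  case (lincomb_step f b c)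
  show ?case by (intro harm_add harm_cmult open_cone_dom solid_basis_harm lincomb_step)
qed (rule harm_const[OF open_cone_dom])

lemma solid_harmonic_vanishes:
  assumes "N < 0" "m \<le> leg_degree N" shows "(solid_harmonic N m s \<longlongrightarrow> 0) at_infinity"
proof -
  let ?f = "solid_harmonic N m s"
  have "continuous_on (- {0}) ?f"
    using harm_solid_harmonic[OF assms(2), of s] assms(1) by (auto simp: solid_dom_def intro: smooth_on_continuous harm_smooth)
  then have "compact (?f ` sphere 0 1)" by (intro compact_continuous_image) (auto intro: continuous_on_subset)
  then obtain C where C: "\<forall>x\<in>sphere 0 1. \<bar>?f x\<bar> \<le> C" by (auto dest!: compact_imp_bounded simp: bounded_iff)
  show ?thesis
  proof (rule Lim_null_comparison)
    show "\<forall>\<^sub>F x in at_infinity. norm (?f x) \<le> C * inverse (norm x)"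
      unfolding eventually_at_infinity
    proof (intro exI[of _ 1] allI impI)
      fix x :: "real^3" assume x: "1 \<le> norm x"
      then have x0: "x \<noteq> 0" by auto
      let ?u = "(1 / norm x) *\<^sub>R x"
      have u: "?u \<in> sphere 0 1" using x0 by simp
      have "?f x = ?f (norm x *\<^sub>R ?u)" using x0 by simp
      also have "\<dots> = norm x powi N * ?f ?u" by (rule solid_harmonic_homogeneous) (use x0 in simp)
      finally have "\<bar>?f x\<bar> = norm x powi N * \<bar>?f ?u\<bar>" by (simp add: abs_mult)
      also have "\<dots> \<le> norm x powi (-1) * C"
        using assms(1) x C u by (intro mult_mono power_int_increasing) auto
      finally show "norm (?f x) \<le> C * inverse (norm x)" by (simp add: power_int_minus mult.commute)
    qed
    have "((\<lambda>x::real^3. inverse (norm x)) \<longlongrightarrow> 0) at_infinity"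
      by (rule tendsto_inverse_0_at_top[OF filterlim_norm_at_top])
    then show "((\<lambda>x::real^3. C * inverse (norm x)) \<longlongrightarrow> 0) at_infinity" by (rule tendsto_mult_right_zero)
  qed
qed

lemma lincomb_vanishes:
  "lincomb (solid_basis Exterior) p \<Longrightarrow> (p \<longlongrightarrow> 0) at_infinity"
proof (induction p rule: lincomb.induct)
  case (lincomb_step f b c)
  then have "(b \<longlongrightarrow> 0) at_infinity" using solid_harmonic_vanishes by (auto simp: solid_basis_def)
  then have "((\<lambda>x. f x + c * b x) \<longlongrightarrow> 0 + c * 0) at_infinity" by (intro tendsto_intros lincomb_step)
  then show ?case by simp
qed simp

lemma harm_inverse_norm: "smooth_harmonic (- {0}) (\<lambda>x. norm x powi (-1))"
  unfolding harm_iff_lap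
proof
  show "smooth_on (- {0}) (\<lambda>x::real^3. norm x powi (-1))" by (rule smooth_norm_powi)
  show "\<forall>x\<in>- {0}. lap (\<lambda>x. norm x powi (-1)) x = 0" using lap_norm_powi[of _ "-1"] by simp
qed

text \<open>
  The maximum principle on large shells for \<open>h - e R / |x|\<close>, which is at most \<open>0\<close> on the inner sphere and
  small on the outer one.
\<close>

lemma exterior_upper_bound:
  assumes R: "R > 0" and h: "smooth_harmonic S h" "{x. norm x \<ge> R} \<subseteq> S" "open S" and v: "(h \<longlongrightarrow> 0) at_infinity"
    and b: "\<And>x. norm x = R \<Longrightarrow> h x \<le> e" and x: "norm x \<ge> R"
  shows "h x \<le> e * R / norm x"
proof (rule field_le_epsilon)
  fix d :: real assume d: "d > 0"
  define u where "u y = h y - (e * R) * norm y powi (-1)" for y :: "real^3"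
  have uv: "(u \<longlongrightarrow> 0) at_infinity"
  proof -
    have "((\<lambda>x::real^3. inverse (norm x)) \<longlongrightarrow> 0) at_infinity"
      by (rule tendsto_inverse_0_at_top[OF filterlim_norm_at_top])
    then have "(u \<longlongrightarrow> 0 - (e * R) * 0) at_infinity" unfolding u_def
      by (intro tendsto_intros v) (simp add: power_int_minus)
    then show ?thesis by simp
  qed
  have "\<forall>\<^sub>F y in at_infinity. \<bar>u y\<bar> < d" using tendstoD[OF uv d] by (simp add: dist_real_def)
  then obtain b0 where b0: "\<And>y. norm y \<ge> b0 \<Longrightarrow> \<bar>u y\<bar> < d" by (auto simp: eventually_at_infinity)
  \<comment> \<open>the radius of an outer sphere beyond \<open>x\<close>, on which \<open>u\<close> is below \<open>d\<close>\<close>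
  define L where "L = max (norm x) b0 + R"
  have L: "L > norm x" "L \<ge> b0" "L > R" using R x by (auto simp: L_def)
  define K where "K = cball (0::real^3) L - ball 0 R"
  have K: "compact K" unfolding K_def by (intro compact_diff compact_cball open_ball)
  have Ko: "interior K \<subseteq> {y. R \<le> norm y \<and> norm y \<le> L}" using interior_subset[of K] by (auto simp: K_def)
  have KS: "K \<subseteq> S" using h(2) by (auto simp: K_def)
  have K0: "K \<subseteq> - {0}" using R by (auto simp: K_def)
  have fr: "norm y = R \<or> norm y = L" if "y \<in> frontier K" for y
  proof (rule ccontr)
    assume a: "\<not> (norm y = R \<or> norm y = L)"
    have "y \<in> K" using that compact_imp_closed[OF K] frontier_subset_closed by blast
    then have "y \<in> ball 0 L - cball 0 R" using a by (auto simp: K_def)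
    moreover have "ball 0 L - cball 0 R \<subseteq> interior K" by (rule interior_maximal) (auto simp: K_def open_Diff)
    ultimately show False using that by (auto simp: frontier_def)
  qed
  have "smooth_harmonic (S \<inter> - {0}) (\<lambda>y. h y - (e * R) * norm y powi (-1))"
    by (intro harm_diff harm_cmult open_Int open_punctured h(3) harm_subset[OF h(1)] harm_subset[OF harm_inverse_norm]) auto
  then have hu: "smooth_harmonic (S \<inter> - {0}) u" by (simp add: u_def[abs_def])
  have "u x \<le> d"
  proof (rule weak_maximum_principle[OF K])
    show "continuous_on K u"
      by (rule continuous_on_subset[OF smooth_on_continuous[OF harm_smooth[OF hu]]]) (use KS K0 in auto)
    show "smooth_harmonic (interior K) u" by (rule harm_subset[OF hu]) (use KS K0 interior_subset[of K] in auto)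
    show "x \<in> K" using x L by (auto simp: K_def)
    fix y assume "y \<in> frontier K"
    from fr[OF this] show "u y \<le> d"
    proof
      assume y: "norm y = R"
      then have "u y = h y - e" using R by (simp add: u_def power_int_minus)
      then show ?thesis using b[OF y] d by simp
    next
      assume "norm y = L"
      then show ?thesis using b0[of y] L by auto
    qed
  qed
  then show "h x \<le> e * R / norm x + d" by (simp add: u_def power_int_minus divide_inverse)
qed

text \<open>
  A neighbourhood of the closure of the domain, for \<open>\<rho>\<close> as in \<open>larger_param\<close>.
\<close>

fun larger_dom :: "side \<Rightarrow> real \<Rightarrow> (real^3) set" where
  "larger_dom Interior \<rho> = {x. norm x < \<rho>}"
| "larger_dom Exterior \<rho> = {x. norm x > \<rho>}"

fun larger_param :: "side \<Rightarrow> real \<Rightarrow> bool" where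
  "larger_param Interior \<rho> \<longleftrightarrow> 1 < \<rho>"
| "larger_param Exterior \<rho> \<longleftrightarrow> 0 < \<rho> \<and> \<rho> < 1"

lemma open_larger_dom: "open (larger_dom \<sigma> \<rho>)"
proof -
  have "open {x::real^3. norm x < \<rho>}" "open {x::real^3. norm x > \<rho>}"
    by (auto intro!: open_Collect_less continuous_intros)
  then show ?thesis by (cases \<sigma>) auto
qed

text \<open>
  A combination of solid harmonics approximates \<open>U\<close> on a sphere strictly between the two domains. The
  maximum principle extends this to the smaller domain and the interior estimate to the gradients. On the
  exterior the difference decays like \<open>1/|x|\<close> and the balls used in the estimate have radii proportional to
  \<open>|x|\<close>, which yields the decay \<open>1/|x|\<^sup>2\<close>.
\<close>

lemma gradient_approximation:
  assumes \<rho>: "larger_param \<sigma> \<rho>" and U: "smooth_harmonic (larger_dom \<sigma> \<rho>) U"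
    and v: "\<sigma> = Exterior \<Longrightarrow> (U \<longlongrightarrow> 0) at_infinity" and e: "e > 0"
  obtains p where "lincomb (solid_basis \<sigma>) p" "\<And>x j. x \<in> dom3 \<sigma> \<Longrightarrow> \<bar>partial j U x - partial j p x\<bar> \<le> e * weight \<sigma> x"
proof -
  \<comment> \<open>the radius of the intermediate sphere; \<open>d\<close> is its distance from the unit sphere\<close>
  define R where "R = (1 + \<rho>) / 2"
  define d where "d = \<bar>R - 1\<bar>"
  have R: "R > 0" and d: "d > 0" using \<rho> by (cases \<sigma>; simp add: R_def d_def)+
  define \<epsilon> where "\<epsilon> = e * d / (grad_const + 1)"
  have \<epsilon>: "\<epsilon> > 0" using e d grad_const_nonneg by (simp add: \<epsilon>_def)
  have g: "grad_const * \<epsilon> / d \<le> e"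
  proof -
    have "grad_const * \<epsilon> / d = e * (grad_const / (grad_const + 1))" using d by (simp add: \<epsilon>_def)
    also have "\<dots> \<le> e * 1" using e grad_const_nonneg by (intro mult_left_mono) auto
    finally show ?thesis by simp
  qed
  have sph: "sphere 0 R \<subseteq> larger_dom \<sigma> \<rho>" using \<rho> by (cases \<sigma>) (auto simp: R_def)
  have o: "open (larger_dom \<sigma> \<rho>)" by (rule open_larger_dom)
  obtain p where p: "lincomb (solid_basis \<sigma>) p" "\<And>x. x \<in> sphere 0 R \<Longrightarrow> \<bar>U x - p x\<bar> < \<epsilon>"
    using solid_harmonics_dense_on_sphere[OF R continuous_on_subset[OF smooth_on_continuous[OF harm_smooth[OF U]] sph] \<epsilon>] by blast
  define h where "h x = U x - p x" for x
  have sub: "larger_dom \<sigma> \<rho> \<subseteq> cone_dom \<sigma>" using \<rho> by (cases \<sigma>) (auto simp: cone_dom_def)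
  have hp: "smooth_harmonic (larger_dom \<sigma> \<rho>) p" by (rule harm_subset[OF lincomb_harm[OF p(1)] sub])
  have hh: "smooth_harmonic (larger_dom \<sigma> \<rho>) h" unfolding h_def[abs_def] by (rule harm_diff[OF o U hp])
  have part: "partial j h x = partial j U x - partial j p x" if "x \<in> larger_dom \<sigma> \<rho>" for j x
    unfolding h_def[abs_def] by (rule partial_diff[OF harm_smooth[OF U] harm_smooth[OF hp] that])
  have dom: "dom3 \<sigma> \<subseteq> larger_dom \<sigma> \<rho>" using \<rho> by (cases \<sigma>) auto
  have "\<bar>partial j h x\<bar> \<le> e * weight \<sigma> x" if x: "x \<in> dom3 \<sigma>" for j x
  proof (cases \<sigma>)
    case Interior
    have dR: "d = R - 1" using \<rho> Interior by (simp add: d_def R_def)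
    have sub1: "cball 0 R \<subseteq> larger_dom \<sigma> \<rho>" using \<rho> Interior by (auto simp: R_def)
    have hb: "\<bar>h y\<bar> \<le> \<epsilon>" if "y \<in> cball 0 R" for y
    proof (rule maximum_principle[OF compact_cball _ _ _ that])
      show "continuous_on (cball 0 R) h" by (rule continuous_on_subset[OF smooth_on_continuous[OF harm_smooth[OF hh]] sub1])
      show "smooth_harmonic (interior (cball 0 R)) h" by (rule harm_subset[OF hh]) (use sub1 interior_subset in blast)
      show "\<bar>h y\<bar> \<le> \<epsilon>" if "y \<in> frontier (cball 0 R)" for y
        using p(2)[of y] that R by (auto simp: h_def intro: less_imp_le)
    qed
    have cb: "cball x d \<subseteq> cball 0 R"
    proof
      fix y assume "y \<in> cball x d"
      then have "norm (y - x) \<le> d" by (simp add: dist_norm norm_minus_commute)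
      moreover have "norm y \<le> norm (y - x) + norm x" by (metis diff_add_cancel norm_triangle_ineq)
      ultimately show "y \<in> cball 0 R" using x Interior dR by simp
    qed
    have "\<bar>partial j h x\<bar> \<le> grad_const / d * \<epsilon>"
      by (rule harm_gradient_bound[OF o _ d hh]) (use cb sub1 hb in auto)
    then show ?thesis using g Interior by simp
  next
    case Exterior
    have dR1: "R < 1" using \<rho> Exterior by (auto simp: R_def)
    then have dR: "d = 1 - R" by (simp add: d_def)
    have sub1: "{x. norm x \<ge> R} \<subseteq> larger_dom \<sigma> \<rho>" using \<rho> Exterior by (auto simp: R_def)
    have hv: "(h \<longlongrightarrow> 0) at_infinity"
      using tendsto_diff[OF v[OF Exterior] lincomb_vanishes, of p] p(1) Exterior by (simp add: h_def[abs_def])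
    have up: "h y \<le> \<epsilon> * R / norm y" if "norm y \<ge> R" for y
      by (rule exterior_upper_bound[OF R hh sub1 o hv _ that]) (use p(2) in \<open>auto simp: h_def abs_less_iff intro: less_imp_le\<close>)
    have lo: "- h y \<le> \<epsilon> * R / norm y" if "norm y \<ge> R" for y
    proof (rule exterior_upper_bound[OF R _ sub1 o _ _ that])
      show "smooth_harmonic (larger_dom \<sigma> \<rho>) (\<lambda>y. - h y)" using harm_cmult[OF o hh, of "-1"] by simp
      show "((\<lambda>y. - h y) \<longlongrightarrow> 0) at_infinity" using tendsto_minus[OF hv] by simp
      show "- h y \<le> \<epsilon>" if "norm y = R" for y using p(2)[of y] that by (auto simp: h_def abs_less_iff intro: less_imp_le)
    qed
    have nx: "norm x > 1" using x Exterior by simp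
    have big: "norm y \<ge> R * norm x" if "y \<in> cball x (d * norm x)" for y
    proof -
      have "norm (x - y) \<le> d * norm x" using that by (simp add: dist_norm)
      moreover have "norm x \<le> norm (x - y) + norm y" by (metis diff_add_cancel norm_triangle_ineq)
      ultimately show ?thesis unfolding dR by (simp add: algebra_simps)
    qed
    have Rx: "R * norm x \<ge> R" using R nx by simp
    have bnd: "\<bar>h y\<bar> \<le> \<epsilon> / norm x" if "y \<in> cball x (d * norm x)" for y
    proof -
      have y: "norm y \<ge> R * norm x" "norm y \<ge> R" using big[OF that] Rx by auto
      have "\<bar>h y\<bar> \<le> \<epsilon> * R / norm y" using up[OF y(2)] lo[OF y(2)] by (simp add: abs_le_iff)
      also have "\<dots> \<le> \<epsilon> * R / (R * norm x)" using y R nx \<epsilon> by (intro divide_left_mono mult_pos_pos) auto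
      also have "\<dots> = \<epsilon> / norm x" using R by simp
      finally show ?thesis .
    qed
    have "cball x (d * norm x) \<subseteq> larger_dom \<sigma> \<rho>"
    proof
      fix y assume "y \<in> cball x (d * norm x)"
      then have "norm y \<ge> R" using big[of y] Rx by linarith
      then show "y \<in> larger_dom \<sigma> \<rho>" using sub1 by blast
    qed
    moreover have "0 < d * norm x" by (rule mult_pos_pos[OF d]) (use nx in linarith)
    ultimately have "\<bar>partial j h x\<bar> \<le> grad_const / (d * norm x) * (\<epsilon> / norm x)"
      by (rule harm_gradient_bound[OF o _ _ hh]) (rule bnd)
    also have "\<dots> = (grad_const * \<epsilon> / d) / (norm x)\<^sup>2" by (simp add: power2_eq_square)
    also have "\<dots> \<le> e / (norm x)\<^sup>2" by (rule divide_right_mono[OF g]) simp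
    finally show ?thesis using Exterior by simp
  qed
  then have "\<bar>partial j U x - partial j p x\<bar> \<le> e * weight \<sigma> x" if "x \<in> dom3 \<sigma>" for j x
    using part[of x j] dom that by (metis subsetD)
  then show ?thesis by (rule that[OF p(1)])
qed

section \<open>Gradient fields and their potentials\<close>

text \<open>The Riesz system: curl and divergence vanish. Every component is then harmonic.\<close>

definition grad_field :: "(real^3) set \<Rightarrow> (3 \<Rightarrow> real^3 \<Rightarrow> real) \<Rightarrow> bool" where
  "grad_field S F \<longleftrightarrow> (\<forall>i. smooth_on S (F i)) \<and> (\<forall>x\<in>S. \<forall>i j. partial i (F j) x = partial j (F i) x)
     \<and> (\<forall>x\<in>S. (\<Sum>i\<in>UNIV. partial i (F i) x) = 0)"

lemma grad_field_smooth: "grad_field S F \<Longrightarrow> smooth_on S (F i)" by (simp add: grad_field_def)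

lemma grad_field_harm:
  assumes o: "open S" and F: "grad_field S F" shows "smooth_harmonic S (F i)"
  unfolding smooth_harmonic_def
proof (intro conjI ballI)
  have s: "smooth_on S (F i)" for i by (rule grad_field_smooth[OF F])
  show "smooth_on S (F i)" by (rule s)
  fix x assume x: "x \<in> S"
  have "partial j (partial j (F i)) x = partial i (partial j (F j)) x" for j
  proof -
    have "partial j (partial j (F i)) x = partial j (partial i (F j)) x"
      by (rule partial_cong_open[OF o x]) (use F in \<open>auto simp: grad_field_def\<close>)
    also have "\<dots> = partial i (partial j (F j)) x"
      by (rule partial_commute[OF o x smooth_on_cont_diff[OF s]])
    finally show ?thesis .
  qed
  then have "(\<Sum>j\<in>UNIV. partial j (partial j (F i)) x) = (\<Sum>j\<in>UNIV. partial i (partial j (F j)) x)" by simp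
  also have "\<dots> = partial i (\<lambda>x. \<Sum>j\<in>UNIV. partial j (F j) x) x"
    by (rule partial_sum[symmetric, OF _ x]) (intro smooth_on_partial s)
  also have "\<dots> = partial i (\<lambda>x. 0) x"
    by (rule partial_cong_open[OF o x]) (use F in \<open>auto simp: grad_field_def\<close>)
  also have "\<dots> = 0" by (rule has_partial_imp[OF has_partial_const])
  finally show "(\<Sum>j\<in>UNIV. partial j (partial j (F i)) x) = 0" .
qed

lemma grad_field_dilate:
  assumes o: "open S" and F: "grad_field S F"
  shows "grad_field {x. c *\<^sub>R x \<in> S} (\<lambda>i x. F i (c *\<^sub>R x))"
  unfolding grad_field_def
proof (intro conjI allI ballI)
  have s: "smooth_on S (F i)" for i by (rule grad_field_smooth[OF F])
  show "smooth_on {x. c *\<^sub>R x \<in> S} (\<lambda>x. F i (c *\<^sub>R x))" for i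
    using smooth_on_affine[OF o s, of 0 c i] by simp
  fix x assume x: "x \<in> {x. c *\<^sub>R x \<in> S}"
  have p: "partial i (\<lambda>x. F j (c *\<^sub>R x)) x = c * partial i (F j) (c *\<^sub>R x)" for i j
    using partial_affine[OF s, of 0 c x i j] x by simp
  show "partial i (\<lambda>x. F j (c *\<^sub>R x)) x = partial j (\<lambda>x. F i (c *\<^sub>R x)) x" for i j
    unfolding p using F x by (auto simp: grad_field_def)
  show "(\<Sum>i\<in>UNIV. partial i (\<lambda>x. F i (c *\<^sub>R x)) x) = 0"
    unfolding p using F x by (auto simp: grad_field_def sum_distrib_left[symmetric])
qed

lemma has_derivative_along_ray:
  fixes g :: "real^3 \<Rightarrow> real"
  assumes o: "open S" and s: "smooth_on S g" and x: "x + t *\<^sub>R y \<in> S"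
  shows "((\<lambda>t. g (x + t *\<^sub>R y)) has_real_derivative (\<Sum>i\<in>UNIV. y $ i * partial i g (x + t *\<^sub>R y))) (at t within A)"
proof -
  have D: "(g has_derivative (\<lambda>v. \<Sum>i\<in>UNIV. v $ i * partial i g (x + t *\<^sub>R y))) (at (x + t *\<^sub>R y))"
    by (rule C1_has_derivative[OF o x smooth_on_cont_diff[OF s]])
  have "((\<lambda>t. x + t *\<^sub>R y) has_derivative (\<lambda>s. s *\<^sub>R y)) (at t within A)"
    by (auto intro!: derivative_eq_intros)
  from has_derivative_compose[OF this D]
  have "((\<lambda>t. g (x + t *\<^sub>R y)) has_derivative (\<lambda>s. \<Sum>i\<in>UNIV. (s *\<^sub>R y) $ i * partial i g (x + t *\<^sub>R y))) (at t within A)" .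
  moreover have "(\<lambda>s. \<Sum>i\<in>UNIV. (s *\<^sub>R y) $ i * partial i g (x + t *\<^sub>R y)) = (*) (\<Sum>i\<in>UNIV. y $ i * partial i g (x + t *\<^sub>R y))"
    by (rule ext) (simp add: sum_UNIV_3 algebra_simps)
  ultimately show ?thesis by (simp add: has_field_derivative_def)
qed

text \<open>
  For \<open>a = 0\<close>, \<open>b = 1\<close> this is the usual potential on a star-shaped domain. The exterior domain is closed
  only under multiplication by \<open>t \<ge> 1\<close>, where one gets a potential of a difference of dilations instead.
\<close>

definition ray_potential :: "real \<Rightarrow> real \<Rightarrow> (3 \<Rightarrow> real^3 \<Rightarrow> real) \<Rightarrow> real^3 \<Rightarrow> real" where
  "ray_potential a b F x = integral (cbox a b) (\<lambda>t. \<Sum>i\<in>UNIV. x $ i * F i (t *\<^sub>R x))"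

text \<open>
  For a curl-free field the derivative of the integrand in direction \<open>j\<close> equals \<open>d/dt (t F\<^sub>j (t x))\<close>.
\<close>

lemma ray_potential_partial:
  assumes o: "open S" and F: "grad_field S F" and ab: "a \<le> b"
    and star: "\<And>x t. x \<in> S \<Longrightarrow> a \<le> t \<Longrightarrow> t \<le> b \<Longrightarrow> t *\<^sub>R x \<in> S" and x: "x \<in> S"
  shows "has_partial j (ray_potential a b F) (b * F j (b *\<^sub>R x) - a * F j (a *\<^sub>R x)) x"
proof -
  have s: "smooth_on S (F i)" for i by (rule grad_field_smooth[OF F])
  have curl: "partial i (F k) y = partial k (F i) y" if "y \<in> S" for y i k using F that by (auto simp: grad_field_def)
  obtain d where d: "d > 0" "\<And>t. \<bar>t\<bar> < d \<Longrightarrow> x + t *\<^sub>R axis j 1 \<in> S"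
    using eventually_line_in_open[OF o x, of j] by (auto simp: eventually_nhds_metric dist_real_def)
  let ?e = "axis j (1::real) :: real^3"
  define f where "f u t = (\<Sum>i\<in>UNIV. (x + u *\<^sub>R ?e) $ i * F i (t *\<^sub>R (x + u *\<^sub>R ?e)))" for u t
  define f' where "f' u t = F j (t *\<^sub>R (x + u *\<^sub>R ?e)) + (\<Sum>i\<in>UNIV. (x + u *\<^sub>R ?e) $ i * (t * partial j (F i) (t *\<^sub>R (x + u *\<^sub>R ?e))))" for u t
  have inS: "t *\<^sub>R (x + u *\<^sub>R ?e) \<in> S" if "u \<in> {-d<..<d}" "t \<in> cbox a b" for u t
    using that d(2)[of u] star by auto
  have "((\<lambda>u. integral (cbox a b) (f u)) has_vector_derivative integral (cbox a b) (f' 0)) (at 0 within {-d<..<d})"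
  proof (rule leibniz_rule_vector_derivative)
    fix u t assume u: "u \<in> {-d<..<d}" and t: "t \<in> cbox a b"
    have "has_partial j (\<lambda>y. \<Sum>i\<in>UNIV. y $ i * F i (t *\<^sub>R y))
       (\<Sum>i\<in>UNIV. (if j = i then 1 else 0) * F i (t *\<^sub>R (x + u *\<^sub>R ?e)) + (x + u *\<^sub>R ?e) $ i * (t *\<^sub>R partial j (F i) (t *\<^sub>R (x + u *\<^sub>R ?e)))) (x + u *\<^sub>R ?e)"
    proof (intro has_partial_sum has_partial_mult has_partial_coord)
      fix i
      show "has_partial j (\<lambda>y. F i (t *\<^sub>R y)) (t *\<^sub>R partial j (F i) (t *\<^sub>R (x + u *\<^sub>R ?e))) (x + u *\<^sub>R ?e)"
        using has_partial_affine[of j "F i" _ 0 t "x + u *\<^sub>R ?e"] smooth_on_has_partial[OF s inS[OF u t]] by simp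
    qed
    moreover have "(\<Sum>i\<in>UNIV. (if j = i then 1 else 0) * F i (t *\<^sub>R (x + u *\<^sub>R ?e)) + (x + u *\<^sub>R ?e) $ i * (t *\<^sub>R partial j (F i) (t *\<^sub>R (x + u *\<^sub>R ?e)))) = f' u t"
    proof -
      have "(\<Sum>i\<in>UNIV. (if j = i then 1 else 0) * F i (t *\<^sub>R (x + u *\<^sub>R ?e))) = (\<Sum>i\<in>UNIV. if i = j then F i (t *\<^sub>R (x + u *\<^sub>R ?e)) else 0)"
        by (rule sum.cong) auto
      also have "\<dots> = F j (t *\<^sub>R (x + u *\<^sub>R ?e))" by (subst sum.delta) auto
      finally show ?thesis unfolding f'_def sum.distrib by simp
    qed
    ultimately have "has_partial j (\<lambda>y. \<Sum>i\<in>UNIV. y $ i * F i (t *\<^sub>R y)) (f' u t) (x + u *\<^sub>R ?e)" by simp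
    from has_partial_line[OF this]
    show "((\<lambda>u. f u t) has_vector_derivative f' u t) (at u within {-d<..<d})"
      unfolding f_def by (rule has_vector_derivative_at_within)
  next
    fix u assume u: "u \<in> {-d<..<d}"
    show "f u integrable_on cbox a b"
    proof (rule integrable_continuous)
      show "continuous_on (cbox a b) (f u)" unfolding f_def
        by (intro continuous_intros continuous_on_compose2[OF smooth_on_continuous[OF s]]) (use inS[OF u] in auto)
    qed
  next
    have "continuous_on ({-d<..<d} \<times> cbox a b) (\<lambda>p. f' (fst p) (snd p))"
      unfolding f'_def
      by (intro continuous_intros continuous_on_compose2[OF smooth_on_continuous[OF s]]
          continuous_on_compose2[OF smooth_on_continuous[OF smooth_on_partial[OF s]]])
        (use inS in auto)
    then show "continuous_on ({-d<..<d} \<times> cbox a b) (\<lambda>(u, t). f' u t)" by (simp add: case_prod_beta)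
  qed (use d(1) in auto)
  moreover have "integral (cbox a b) (f' 0) = b * F j (b *\<^sub>R x) - a * F j (a *\<^sub>R x)"
  proof -
    have "((\<lambda>t. f' 0 t) has_integral (b * F j (b *\<^sub>R x) - a * F j (a *\<^sub>R x))) {a..b}"
    proof (rule fundamental_theorem_of_calculus[OF ab])
      fix t assume t: "t \<in> {a..b}"
      have tS: "t *\<^sub>R x \<in> S" using star[OF x, of t] t by auto
      have "((\<lambda>t. F j (0 + t *\<^sub>R x)) has_real_derivative (\<Sum>i\<in>UNIV. x $ i * partial i (F j) (0 + t *\<^sub>R x))) (at t within {a..b})"
        by (rule has_derivative_along_ray[OF o s]) (use tS in simp)
      from DERIV_mult[OF DERIV_ident this]
      have "((\<lambda>t. t * F j (t *\<^sub>R x)) has_real_derivative (t * (\<Sum>i\<in>UNIV. x $ i * partial i (F j) (t *\<^sub>R x)) + F j (t *\<^sub>R x))) (at t within {a..b})"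
        by (simp add: algebra_simps)
      moreover have "t * (\<Sum>i\<in>UNIV. x $ i * partial i (F j) (t *\<^sub>R x)) + F j (t *\<^sub>R x) = f' 0 t"
        unfolding f'_def by (simp add: sum_distrib_left curl[OF tS, of j] mult_ac)
      ultimately show "((\<lambda>t. t * F j (t *\<^sub>R x)) has_vector_derivative f' 0 t) (at t within {a..b})"
        by (simp add: has_real_derivative_iff_has_vector_derivative)
    qed
    then show ?thesis by (simp add: integral_unique)
  qed
  moreover have "(at 0 within {-d<..<d}) = at (0::real)" by (rule at_within_open) (use d(1) in auto)
  ultimately have "((\<lambda>u. integral (cbox a b) (f u)) has_vector_derivative (b * F j (b *\<^sub>R x) - a * F j (a *\<^sub>R x))) (at 0)" by simp
  then show ?thesis unfolding has_partial_def ray_potential_def f_def .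
qed

lemma ray_potential_harm:
  assumes o: "open S" and F: "grad_field S F" and ab: "a \<le> b"
    and star: "\<And>x t. x \<in> S \<Longrightarrow> a \<le> t \<Longrightarrow> t \<le> b \<Longrightarrow> t *\<^sub>R x \<in> S"
  shows "smooth_harmonic S (ray_potential a b F)"
proof -
  have s: "smooth_on S (F i)" for i by (rule grad_field_smooth[OF F])
  define g where "g j x = b * F j (b *\<^sub>R x) - a * F j (a *\<^sub>R x)" for j x
  have hp: "has_partial j (ray_potential a b F) (g j x) x" if "x \<in> S" for j x
    unfolding g_def by (rule ray_potential_partial[OF o F ab star that])
  have sd: "smooth_on S (\<lambda>x. F j (c *\<^sub>R x))" if "a \<le> c" "c \<le> b" for c j
    using smooth_on_subset[OF smooth_on_affine[OF o s, of 0 c j], of S] star that by auto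
  have sg: "smooth_on S (g j)" for j unfolding g_def[abs_def]
    by (intro smooth_on_diff smooth_on_cmult sd o) (use ab in auto)
  have cont: "continuous_on S (ray_potential a b F)"
    unfolding ray_potential_def
  proof (rule integral_continuous_on_param)
    have "continuous_on (S \<times> cbox a b) (\<lambda>p. \<Sum>i\<in>UNIV. fst p $ i * F i (snd p *\<^sub>R fst p))"
      by (intro continuous_intros continuous_on_compose2[OF smooth_on_continuous[OF s]]) (use star in auto)
    then show "continuous_on (S \<times> cbox a b) (\<lambda>(x, t). \<Sum>i\<in>UNIV. x $ i * F i (t *\<^sub>R x))" by (simp add: case_prod_beta)
  qed
  have sm: "smooth_on S (ray_potential a b F)" by (rule smooth_onI[OF o cont hp sg])
  show ?thesis unfolding smooth_harmonic_def
  proof (intro conjI ballI sm)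
    fix x assume x: "x \<in> S"
    have pd: "has_partial i (\<lambda>x. F i (c *\<^sub>R x)) (c *\<^sub>R partial i (F i) (c *\<^sub>R x)) x" if "a \<le> c" "c \<le> b" for c i
      using has_partial_affine[of i "F i" _ 0 c x] smooth_on_has_partial[OF s star[OF x that]] by simp
    have "partial i (partial i (ray_potential a b F)) x = b * (b *\<^sub>R partial i (F i) (b *\<^sub>R x)) - a * (a *\<^sub>R partial i (F i) (a *\<^sub>R x))" for i
    proof -
      have "partial i (partial i (ray_potential a b F)) x = partial i (g i) x"
        by (rule partial_cong_open[OF o x]) (rule has_partial_imp[OF hp])
      also have "\<dots> = b * (b *\<^sub>R partial i (F i) (b *\<^sub>R x)) - a * (a *\<^sub>R partial i (F i) (a *\<^sub>R x))"
        unfolding g_def[abs_def] by (intro has_partial_imp has_partial_diff has_partial_cmult pd) (use ab in auto)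
      finally show ?thesis .
    qed
    then have "(\<Sum>i\<in>UNIV. partial i (partial i (ray_potential a b F)) x) =
        b * (b * (\<Sum>i\<in>UNIV. partial i (F i) (b *\<^sub>R x))) - a * (a * (\<Sum>i\<in>UNIV. partial i (F i) (a *\<^sub>R x)))"
      by (simp add: sum_subtractf sum_distrib_left)
    then show "(\<Sum>i\<in>UNIV. partial i (partial i (ray_potential a b F)) x) = 0"
      using F star[OF x, of a] star[OF x, of b] ab by (auto simp: grad_field_def)
  qed
qed

section \<open>Completeness of the gradients of solid harmonics\<close>

fun dilation_param :: "side \<Rightarrow> real \<Rightarrow> bool" where
  "dilation_param Interior r \<longleftrightarrow> 0 < r \<and> r < 1"
| "dilation_param Exterior r \<longleftrightarrow> 1 < r"

lemma dilation_pos: "dilation_param \<sigma> r \<Longrightarrow> r > 0" by (cases \<sigma>) auto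

lemma dilation_dom3: "dilation_param \<sigma> r \<Longrightarrow> x \<in> dom3 \<sigma> \<Longrightarrow> r *\<^sub>R x \<in> dom3 \<sigma>"
proof (cases \<sigma>)
  case Interior
  assume a: "dilation_param \<sigma> r" "x \<in> dom3 \<sigma>"
  then have "r * norm x \<le> 1 * norm x" using Interior by (intro mult_right_mono) auto
  then show ?thesis using a Interior by auto
next
  case Exterior
  assume a: "dilation_param \<sigma> r" "x \<in> dom3 \<sigma>"
  then have "1 * norm x \<le> r * norm x" using Exterior by (intro mult_right_mono) auto
  then show ?thesis using a Exterior by auto
qed

lemma dilation_larger: "dilation_param \<sigma> r \<Longrightarrow> {x. r *\<^sub>R x \<in> dom3 \<sigma>} = larger_dom \<sigma> (1 / r)"
  "dilation_param \<sigma> r \<Longrightarrow> larger_param \<sigma> (1 / r)"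
  by (cases \<sigma>; auto simp: field_simps)+

lemma dilation_continuous:
  assumes "dilation_param \<sigma> r" "continuous_on (dom3 \<sigma>) f" shows "continuous_on (dom3 \<sigma>) (\<lambda>x. f (r *\<^sub>R x))"
  by (rule continuous_on_compose2[OF assms(2)]) (use dilation_dom3[OF assms(1)] in \<open>auto intro!: continuous_intros\<close>)

lemma L2_dilation:
  fixes f :: "real^3 \<Rightarrow> real"
  assumes r: "dilation_param \<sigma> r" and f: "continuous_on (dom3 \<sigma>) f" and int: "integrable (lebesgue_on (dom3 \<sigma>)) (\<lambda>x. (f x)\<^sup>2)"
  shows "integrable (lebesgue_on (dom3 \<sigma>)) (\<lambda>x. (f (r *\<^sub>R x))\<^sup>2)"
    "(LINT x|lebesgue_on (dom3 \<sigma>). (f (r *\<^sub>R x))\<^sup>2) \<le> (LINT x|lebesgue_on (dom3 \<sigma>). (f x)\<^sup>2) / r ^ 3"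
proof -
  define G where "G x = indicator (dom3 \<sigma>) x * (f x)\<^sup>2" for x
  have Gm: "G \<in> borel_measurable borel"
    using borel_measurable_continuous_on_indicator[OF dom3_borel, of \<sigma> "\<lambda>x. (f x)\<^sup>2"] f
    by (simp add: G_def[abs_def] continuous_on_power)
  have Gi: "integrable lborel G" using int Gm unfolding integrable_dom3_iff
    by (subst (asm) integrable_completion) (auto simp: G_def[abs_def])
  have "integrable lborel (\<lambda>x. G (0 + r *\<^sub>R x))" "(LINT x|lborel. G (0 + r *\<^sub>R x)) = (LINT x|lborel. G x) / r ^ 3"
    by (rule lborel_affine_integral[OF Gi dilation_pos[OF r]])+
  moreover have Gm': "(\<lambda>x. G (r *\<^sub>R x)) \<in> borel_measurable lborel"
    by (rule measurable_compose[OF _ Gm]) simp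
  ultimately have A: "integrable lebesgue (\<lambda>x. G (r *\<^sub>R x))" "(LINT x|lebesgue. G (r *\<^sub>R x)) = (LINT x|lborel. G x) / r ^ 3"
    by (simp_all add: integrable_completion integral_completion)
  have B: "(LINT x|lborel. G x) = (LINT x|lebesgue_on (dom3 \<sigma>). (f x)\<^sup>2)"
    unfolding integral_dom3_eq G_def[symmetric] using Gm by (subst integral_completion) auto
  have le: "indicator (dom3 \<sigma>) x * (f (r *\<^sub>R x))\<^sup>2 \<le> G (r *\<^sub>R x)" for x
    using dilation_dom3[OF r, of x] by (auto simp: G_def indicator_def)
  have m: "(\<lambda>x. indicator (dom3 \<sigma>) x * (f (r *\<^sub>R x))\<^sup>2) \<in> borel_measurable lebesgue"
    using borel_measurable_continuous_on_indicator[OF dom3_borel, of \<sigma> "\<lambda>x. (f (r *\<^sub>R x))\<^sup>2"] dilation_continuous[OF r f]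
    by (auto simp: continuous_on_power intro!: measurable_completion)
  have I: "integrable lebesgue (\<lambda>x. indicator (dom3 \<sigma>) x * (f (r *\<^sub>R x))\<^sup>2)"
  proof (rule Bochner_Integration.integrable_bound[OF A(1) m], rule AE_I2)
    fix x show "norm (indicator (dom3 \<sigma>) x * (f (r *\<^sub>R x))\<^sup>2) \<le> norm (G (r *\<^sub>R x))"
      using le[of x] by (simp add: G_def)
  qed
  then show "integrable (lebesgue_on (dom3 \<sigma>)) (\<lambda>x. (f (r *\<^sub>R x))\<^sup>2)" by (simp add: integrable_dom3_iff)
  show "(LINT x|lebesgue_on (dom3 \<sigma>). (f (r *\<^sub>R x))\<^sup>2) \<le> (LINT x|lebesgue_on (dom3 \<sigma>). (f x)\<^sup>2) / r ^ 3"
    unfolding integral_dom3_eq[of \<sigma> "\<lambda>x. (f (r *\<^sub>R x))\<^sup>2"] B[symmetric] A(2)[symmetric]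
    by (rule integral_mono[OF I A(1) le])
qed

lemma weight_nonneg: "weight \<sigma> x \<ge> 0" by (cases \<sigma>) auto

lemma dominated_add: assumes "dominated \<sigma> f" "dominated \<sigma> g" shows "dominated \<sigma> (\<lambda>x. f x + g x)"
proof -
  obtain C D where "\<forall>x\<in>dom3 \<sigma>. \<bar>f x\<bar> \<le> C * weight \<sigma> x" "\<forall>x\<in>dom3 \<sigma>. \<bar>g x\<bar> \<le> D * weight \<sigma> x"
    using assms by (auto simp: dominated_def)
  then have "\<forall>x\<in>dom3 \<sigma>. \<bar>f x + g x\<bar> \<le> (C + D) * weight \<sigma> x"
    by (auto simp: distrib_right intro: order_trans[OF abs_triangle_ineq add_mono])
  then show ?thesis using assms by (auto simp: dominated_def intro!: continuous_intros)
qed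

lemma dominated_cmult: assumes "dominated \<sigma> f" shows "dominated \<sigma> (\<lambda>x. c * f x)"
proof -
  obtain C where "\<forall>x\<in>dom3 \<sigma>. \<bar>f x\<bar> \<le> C * weight \<sigma> x" using assms by (auto simp: dominated_def)
  then have "\<forall>x\<in>dom3 \<sigma>. \<bar>c * f x\<bar> \<le> (\<bar>c\<bar> * C) * weight \<sigma> x"
    by (auto simp: abs_mult mult.assoc intro: mult_left_mono)
  then show ?thesis using assms by (auto simp: dominated_def intro!: continuous_intros)
qed

lemma dominated_cong: assumes "dominated \<sigma> f" "\<And>x. x \<in> dom3 \<sigma> \<Longrightarrow> g x = f x" shows "dominated \<sigma> g"
  using assms by (auto simp: dominated_def cong: continuous_on_cong)

lemma dominated_zero: "dominated \<sigma> (\<lambda>x. 0)"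
  by (auto simp: dominated_def intro!: exI[of _ 0])

lemma dominated_weight: "dominated \<sigma> (weight \<sigma>)"
proof -
  have "continuous_on (dom3 \<sigma>) (weight \<sigma>)"
    by (cases \<sigma>) (auto intro!: continuous_intros)
  then show ?thesis by (auto simp: dominated_def intro!: exI[of _ 1] weight_nonneg)
qed

lemma dominated_L2:
  assumes "dominated \<sigma> f" shows "f \<in> borel_measurable (lebesgue_on (dom3 \<sigma>))" "integrable (lebesgue_on (dom3 \<sigma>)) (\<lambda>x. (f x)\<^sup>2)"
  using assms dominated_mult_integrable[OF assms assms] by (auto simp: dominated_def borel_dom3_continuous power2_eq_square)

lemma solid_basis_dominated: assumes "b \<in> solid_basis \<sigma>" shows "dominated \<sigma> (partial i b)"
proof -
  obtain N m s where b: "b = solid_harmonic N m s" "(N \<ge> 0 \<longleftrightarrow> \<sigma> = Interior)" "m \<le> leg_degree N"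
    using assms by (auto simp: solid_basis_def)
  have h: "smooth_harmonic (cone_dom \<sigma>) b" by (rule solid_basis_harm[OF assms])
  have "homog \<sigma> N b" unfolding homog_def b(1)
    using harm_smooth[OF h] solid_harmonic_homogeneous by (auto simp: b(1))
  from homog_partial[OF this, of i] show ?thesis
    by (rule homog_dominated) (use b(2) in auto)
qed

lemma lincomb_dominated: "lincomb (solid_basis \<sigma>) p \<Longrightarrow> dominated \<sigma> (partial i p)"
proof (induction p rule: lincomb.induct)
  case lincomb_zero
  have "partial i (\<lambda>x. 0::real) = (\<lambda>x. 0)" by (rule ext, rule has_partial_imp, rule has_partial_const)
  then show ?case by (simp add: dominated_zero)
next
  case (lincomb_step f b c)
  have s: "smooth_on (dom3 \<sigma>) f" "smooth_on (dom3 \<sigma>) b"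
    by (rule smooth_on_subset[OF harm_smooth dom3_subset_cone],
        rule lincomb_harm[OF lincomb_step(1)] solid_basis_harm[OF lincomb_step(2)])+
  show ?case
  proof (rule dominated_cong[OF dominated_add[OF lincomb_step(3) dominated_cmult[OF solid_basis_dominated[OF lincomb_step(2)]]]])
    show "partial i (\<lambda>x. f x + c * b x) x = partial i f x + c * partial i b x" if "x \<in> dom3 \<sigma>" for x
      by (intro has_partial_imp has_partial_add has_partial_cmult smooth_on_has_partial[OF _ that] s)
  qed
qed

lemma dom3_subset_larger: "larger_param \<sigma> \<rho> \<Longrightarrow> dom3 \<sigma> \<subseteq> larger_dom \<sigma> \<rho>"
  by (cases \<sigma>) auto

text \<open>
  Orthogonality passes to linear combinations by linearity, integrability being supplied by the decay
  of the solid harmonics.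
\<close>

lemma lincomb_pairing_zero:
  assumes F: "\<And>j. F j \<in> borel_measurable (lebesgue_on (dom3 \<sigma>))" "\<And>j. integrable (lebesgue_on (dom3 \<sigma>)) (\<lambda>x. (F j x)\<^sup>2)"
    and orth: "\<And>b. b \<in> solid_basis \<sigma> \<Longrightarrow> (LINT x|lebesgue_on (dom3 \<sigma>). F 1 x * partial 1 b x + F 2 x * partial 2 b x) = 0"
    and p: "lincomb (solid_basis \<sigma>) p"
  shows "(LINT x|lebesgue_on (dom3 \<sigma>). F (1::3) x * partial 1 p x + F 2 x * partial 2 p x) = 0"
  using p
proof (induction p rule: lincomb.induct)
  case lincomb_zero
  have "partial i (\<lambda>x. 0::real) = (\<lambda>x. 0)" for i by (rule ext, rule has_partial_imp, rule has_partial_const)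
  then show ?case by simp
next
  case (lincomb_step f b c)
  let ?M = "lebesgue_on (dom3 \<sigma>)"
  have s: "smooth_on (dom3 \<sigma>) f" "smooth_on (dom3 \<sigma>) b"
    by (rule smooth_on_subset[OF harm_smooth dom3_subset_cone],
        rule lincomb_harm[OF lincomb_step(1)] solid_basis_harm[OF lincomb_step(2)])+
  have int: "integrable ?M (\<lambda>x. F j x * g x)" if "dominated \<sigma> g" for j g
    by (rule integrable_product_L2[OF F(1) dominated_L2(1)[OF that] F(2) dominated_L2(2)[OF that]])
  have i1: "integrable ?M (\<lambda>x. F 1 x * partial 1 f x + F 2 x * partial 2 f x)"
    and i2: "integrable ?M (\<lambda>x. F 1 x * partial 1 b x + F 2 x * partial 2 b x)"
    by (intro Bochner_Integration.integrable_add int lincomb_dominated solid_basis_dominated lincomb_step)+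
  have "(LINT x|?M. F 1 x * partial 1 (\<lambda>x. f x + c * b x) x + F 2 x * partial 2 (\<lambda>x. f x + c * b x) x)
     = (LINT x|?M. (F 1 x * partial 1 f x + F 2 x * partial 2 f x) + c * (F 1 x * partial 1 b x + F 2 x * partial 2 b x))"
  proof (rule Bochner_Integration.integral_cong[OF refl])
    fix x assume "x \<in> space ?M"
    then have x: "x \<in> dom3 \<sigma>" by (simp add: space_restrict_space)
    have p: "partial i (\<lambda>x. f x + c * b x) x = partial i f x + c * partial i b x" for i
      by (intro has_partial_imp has_partial_add has_partial_cmult smooth_on_has_partial[OF _ x] s)
    show "F 1 x * partial 1 (\<lambda>x. f x + c * b x) x + F 2 x * partial 2 (\<lambda>x. f x + c * b x) x
      = (F 1 x * partial 1 f x + F 2 x * partial 2 f x) + c * (F 1 x * partial 1 b x + F 2 x * partial 2 b x)"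
      unfolding p by (simp add: algebra_simps)
  qed
  also have "\<dots> = (LINT x|?M. F 1 x * partial 1 f x + F 2 x * partial 2 f x) + c * (LINT x|?M. F 1 x * partial 1 b x + F 2 x * partial 2 b x)"
    by (subst Bochner_Integration.integral_add[OF i1 integrable_mult_right[OF i2]]) simp
  finally show ?case using lincomb_step(3) orth[OF lincomb_step(2)] by simp
qed

text \<open>Approximation of \<open>\<nabla>U\<close> by gradients of combinations of solid harmonics.\<close>

lemma larger_dom_pairing_zero:
  assumes F: "\<And>j. F j \<in> borel_measurable (lebesgue_on (dom3 \<sigma>))" "\<And>j. integrable (lebesgue_on (dom3 \<sigma>)) (\<lambda>x. (F j x)\<^sup>2)"
    and orth: "\<And>b. b \<in> solid_basis \<sigma> \<Longrightarrow> (LINT x|lebesgue_on (dom3 \<sigma>). F 1 x * partial 1 b x + F 2 x * partial 2 b x) = 0"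
    and \<rho>: "larger_param \<sigma> \<rho>" and U: "smooth_harmonic (larger_dom \<sigma> \<rho>) U"
    and v: "\<sigma> = Exterior \<Longrightarrow> (U \<longlongrightarrow> 0) at_infinity"
  shows "(LINT x|lebesgue_on (dom3 \<sigma>). F (1::3) x * partial 1 U x + F 2 x * partial 2 U x) = 0" (is "?I = 0")
proof -
  let ?M = "lebesgue_on (dom3 \<sigma>)"
  have dom: "dom3 \<sigma> \<subseteq> larger_dom \<sigma> \<rho>" using \<rho> by (cases \<sigma>) auto
  have int: "integrable ?M (\<lambda>x. F j x * g x)" if "dominated \<sigma> g" for j g
    by (rule integrable_product_L2[OF F(1) dominated_L2(1)[OF that] F(2) dominated_L2(2)[OF that]])
  define K where "K = (LINT x|?M. (\<bar>F 1 x\<bar> + \<bar>F 2 x\<bar>) * weight \<sigma> x)"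
  have intK: "integrable ?M (\<lambda>x. (\<bar>F 1 x\<bar> + \<bar>F 2 x\<bar>) * weight \<sigma> x)"
  proof -
    have "integrable ?M (\<lambda>x. \<bar>F 1 x * weight \<sigma> x\<bar> + \<bar>F 2 x * weight \<sigma> x\<bar>)"
      by (intro Bochner_Integration.integrable_add integrable_abs int dominated_weight)
    then show ?thesis by (simp add: abs_mult weight_nonneg distrib_right)
  qed
  have "\<bar>?I\<bar> \<le> e * K" if e: "e > 0" for e
  proof -
    obtain p where p: "lincomb (solid_basis \<sigma>) p" "\<And>x j. x \<in> dom3 \<sigma> \<Longrightarrow> \<bar>partial j U x - partial j p x\<bar> \<le> e * weight \<sigma> x"
      using gradient_approximation[OF \<rho> U v e] by blast
    define D where "D j x = partial j U x - partial j p x" for j x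
    have cU: "continuous_on (dom3 \<sigma>) (partial j U)" for j
      by (rule continuous_on_subset[OF smooth_on_continuous[OF smooth_on_partial[OF harm_smooth[OF U]]] dom])
    have dp: "dominated \<sigma> (partial j p)" for j by (rule lincomb_dominated[OF p(1)])
    have dD: "dominated \<sigma> (D j)" for j
      unfolding dominated_def
    proof
      show "continuous_on (dom3 \<sigma>) (D j)" unfolding D_def using cU dp by (auto simp: dominated_def intro!: continuous_intros)
      show "\<exists>C. \<forall>x\<in>dom3 \<sigma>. \<bar>D j x\<bar> \<le> C * weight \<sigma> x" using p(2) unfolding D_def by blast
    qed
    have i1: "integrable ?M (\<lambda>x. F 1 x * partial 1 p x + F 2 x * partial 2 p x)"
      and i2: "integrable ?M (\<lambda>x. F 1 x * D 1 x + F 2 x * D 2 x)"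
      by (intro Bochner_Integration.integrable_add int dp dD)+
    have "?I = (LINT x|?M. (F 1 x * partial 1 p x + F 2 x * partial 2 p x) + (F 1 x * D 1 x + F 2 x * D 2 x))"
      by (simp add: D_def algebra_simps)
    also have "\<dots> = (LINT x|?M. F 1 x * D 1 x + F 2 x * D 2 x)"
      using lincomb_pairing_zero[OF F orth p(1)] by (simp add: Bochner_Integration.integral_add[OF i1 i2])
    also have "\<bar>\<dots>\<bar> \<le> (LINT x|?M. e * ((\<bar>F 1 x\<bar> + \<bar>F 2 x\<bar>) * weight \<sigma> x))"
    proof (rule order_trans[OF integral_abs_bound], rule integral_mono)
      show "integrable ?M (\<lambda>x. \<bar>F 1 x * D 1 x + F 2 x * D 2 x\<bar>)" by (rule integrable_abs[OF i2])
      show "integrable ?M (\<lambda>x. e * ((\<bar>F 1 x\<bar> + \<bar>F 2 x\<bar>) * weight \<sigma> x))" by (rule integrable_mult_right) (rule intK)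
      fix x assume "x \<in> space ?M"
      then have x: "x \<in> dom3 \<sigma>" by (simp add: space_restrict_space)
      have "\<bar>F 1 x * D 1 x + F 2 x * D 2 x\<bar> \<le> \<bar>F 1 x\<bar> * \<bar>D 1 x\<bar> + \<bar>F 2 x\<bar> * \<bar>D 2 x\<bar>"
        using abs_triangle_ineq[of "F 1 x * D 1 x" "F 2 x * D 2 x"] by (simp add: abs_mult)
      also have "\<dots> \<le> \<bar>F 1 x\<bar> * (e * weight \<sigma> x) + \<bar>F 2 x\<bar> * (e * weight \<sigma> x)"
        using p(2)[OF x] unfolding D_def by (intro add_mono mult_left_mono) auto
      finally show "\<bar>F 1 x * D 1 x + F 2 x * D 2 x\<bar> \<le> e * ((\<bar>F 1 x\<bar> + \<bar>F 2 x\<bar>) * weight \<sigma> x)"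
        by (simp add: algebra_simps)
    qed
    also have "\<dots> = e * K" by (simp add: K_def)
    finally show ?thesis .
  qed
  then have "\<bar>?I\<bar> \<le> 0 + d" if "d > 0" for d
  proof -
    have K0: "K \<ge> 0" unfolding K_def by (rule Bochner_Integration.integral_nonneg) (simp add: weight_nonneg)
    have "\<bar>?I\<bar> \<le> d / (K + 1) * K" using \<open>\<And>e. 0 < e \<Longrightarrow> \<bar>?I\<bar> \<le> e * K\<close>[of "d / (K + 1)"] that K0 by simp
    also have "\<dots> \<le> d" using that K0 by (simp add: field_simps)
    finally show ?thesis by simp
  qed
  then have "\<bar>?I\<bar> \<le> 0" by (rule field_le_epsilon)
  then show ?thesis by simp
qed

text \<open>The interior estimate on the ball of radius \<open>|y| / 2\<close> about \<open>y\<close>.\<close>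

lemma L2_harm_decay:
  assumes h: "smooth_harmonic (dom3 Exterior) h" and int: "integrable (lebesgue_on (dom3 Exterior)) (\<lambda>x. (h x)\<^sup>2)"
  obtains K where "K \<ge> 0" "\<And>y. norm y \<ge> 4 \<Longrightarrow> (h y)\<^sup>2 \<le> K / norm y ^ 3"
proof -
  define I where "I = (LINT y|lebesgue. indicator (dom3 Exterior) y * (h y)\<^sup>2)"
  have I: "I \<ge> 0" unfolding I_def by (rule Bochner_Integration.integral_nonneg) simp
  have "(h y)\<^sup>2 \<le> (8 * sup_const * I) / norm y ^ 3" if y: "norm y \<ge> 4" for y
  proof -
    have sub: "cball y (norm y / 2) \<subseteq> dom3 Exterior"
    proof
      fix z assume "z \<in> cball y (norm y / 2)"
      then have "norm (y - z) \<le> norm y / 2" by (simp add: dist_norm)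
      moreover have "norm y \<le> norm (y - z) + norm z" by (metis diff_add_cancel norm_triangle_ineq)
      ultimately show "z \<in> dom3 Exterior" using y by simp
    qed
    have "(h y)\<^sup>2 \<le> sup_const / (norm y / 2) ^ 3 * I"
      unfolding I_def by (rule harm_sup_L2[OF open_dom3 sub _ h integrable_dom3_iff[THEN iffD1, OF int]]) (use y in linarith)
    then show ?thesis by (simp add: power_divide mult_ac)
  qed
  then show ?thesis using I sup_const_nonneg by (intro that[of "8 * sup_const * I"]) auto
qed

text \<open>The integrand is of order \<open>|x| |x|\<^sup>-\<^sup>3\<^sup>/\<^sup>2\<close>.\<close>

lemma ray_potential_vanishes:
  assumes b: "1 \<le> b" and F: "\<And>i. continuous_on {x. norm x \<ge> 4} (F i)"
    and K: "K \<ge> 0" "\<And>i y. norm y \<ge> 4 \<Longrightarrow> (F i y)\<^sup>2 \<le> K / norm y ^ 3"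
  shows "(ray_potential 1 b F \<longlongrightarrow> 0) at_infinity"
proof (rule Lim_null_comparison)
  show "\<forall>\<^sub>F x in at_infinity. norm (ray_potential 1 b F x) \<le> 3 * (b - 1) * sqrt (K * inverse (norm x))"
    unfolding eventually_at_infinity
  proof (intro exI[of _ 4] allI impI)
    fix x :: "real^3" assume x: "4 \<le> norm x"
    have big: "norm (t *\<^sub>R x) \<ge> norm x" if "t \<in> {1..b}" for t
    proof -
      have "1 * norm x \<le> t * norm x" using that by (intro mult_right_mono) auto
      then show ?thesis using that by simp
    qed
    have tm: "\<bar>x $ i * F i (t *\<^sub>R x)\<bar> \<le> sqrt (K * inverse (norm x))" if t: "t \<in> {1..b}" for t i
    proof (rule real_le_rsqrt)
      have "(F i (t *\<^sub>R x))\<^sup>2 \<le> K / norm (t *\<^sub>R x) ^ 3" by (rule K(2)) (use big[OF t] x in linarith)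
      also have "\<dots> \<le> K / norm x ^ 3"
        using big[OF t] x K(1) by (intro divide_left_mono power_mono mult_pos_pos zero_less_power) auto
      finally have 1: "(F i (t *\<^sub>R x))\<^sup>2 \<le> K / norm x ^ 3" .
      have "\<bar>x $ i\<bar> \<le> norm x" by (rule component_le_norm_cart)
      then have 2: "(x $ i)\<^sup>2 \<le> (norm x)\<^sup>2" by (metis abs_ge_zero power2_abs power_mono)
      have "\<bar>x $ i * F i (t *\<^sub>R x)\<bar>\<^sup>2 = (x $ i)\<^sup>2 * (F i (t *\<^sub>R x))\<^sup>2" by (simp add: power_mult_distrib)
      also have "\<dots> \<le> (norm x)\<^sup>2 * (K / norm x ^ 3)" using 1 2 by (intro mult_mono) auto
      also have "\<dots> = K * inverse (norm x)"
        using x by (cases "norm x = 0") (auto simp: power2_eq_square power3_eq_cube field_simps)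
      finally show "\<bar>x $ i * F i (t *\<^sub>R x)\<bar>\<^sup>2 \<le> K * inverse (norm x)" .
    qed
    have "norm (integral (cbox 1 b) (\<lambda>t. \<Sum>i\<in>UNIV. x $ i * F i (t *\<^sub>R x))) \<le> (3 * sqrt (K * inverse (norm x))) * measure lborel (cbox 1 b)"
    proof (rule Henstock_Kurzweil_Integration.integrable_bound)
      show "0 \<le> 3 * sqrt (K * inverse (norm x))" using K(1) by simp
      show "(\<lambda>t. \<Sum>i\<in>UNIV. x $ i * F i (t *\<^sub>R x)) integrable_on cbox 1 b"
      proof (rule integrable_continuous)
        show "continuous_on (cbox 1 b) (\<lambda>t. \<Sum>i\<in>UNIV. x $ i * F i (t *\<^sub>R x))"
        proof (intro continuous_intros continuous_on_compose2[OF F])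
          show "(\<lambda>t. t *\<^sub>R x) ` cbox 1 b \<subseteq> {x. 4 \<le> norm x}"
            using big x by (force simp del: norm_scaleR)
        qed
      qed
      fix t assume "t \<in> cbox 1 b"
      then have t: "t \<in> {1..b}" by simp
      have "norm (\<Sum>i\<in>UNIV. x $ i * F i (t *\<^sub>R x)) \<le> (\<Sum>i\<in>(UNIV::3 set). sqrt (K * inverse (norm x)))"
        by (rule sum_norm_le) (use tm[OF t] in simp)
      then show "norm (\<Sum>i\<in>UNIV. x $ i * F i (t *\<^sub>R x)) \<le> 3 * sqrt (K * inverse (norm x))" by simp
    qed
    then show "norm (ray_potential 1 b F x) \<le> 3 * (b - 1) * sqrt (K * inverse (norm x))"
      using b by (simp add: ray_potential_def algebra_simps)
  qed
  have "((\<lambda>x::real^3. inverse (norm x)) \<longlongrightarrow> 0) at_infinity"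
    by (rule tendsto_inverse_0_at_top[OF filterlim_norm_at_top])
  then have "((\<lambda>x::real^3. 3 * (b - 1) * sqrt (K * inverse (norm x))) \<longlongrightarrow> 3 * (b - 1) * sqrt (K * 0)) at_infinity"
    by (intro tendsto_intros)
  then show "((\<lambda>x::real^3. 3 * (b - 1) * sqrt (K * inverse (norm x))) \<longlongrightarrow> 0) at_infinity" by simp
qed

definition dilation_pairing :: "side \<Rightarrow> (3 \<Rightarrow> real^3 \<Rightarrow> real) \<Rightarrow> real \<Rightarrow> real" where
  "dilation_pairing \<sigma> F r = (LINT x|lebesgue_on (dom3 \<sigma>). F 1 x * F 1 (r *\<^sub>R x) + F 2 x * F 2 (r *\<^sub>R x))"

text \<open>
  On the ball, \<open>F(r \<cdot>)\<close> is itself the gradient of a harmonic function near the closed ball. On the exterior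
  only \<open>m F(r m \<cdot>) - F(r \<cdot>)\<close> is seen to be such a gradient, so the pairing with \<open>F(r \<cdot>)\<close> equals \<open>m\<close> times
  the pairing with \<open>F(r m \<cdot>)\<close>. The norm of \<open>F(r m \<cdot>)\<close> is at most of order \<open>m\<^sup>-\<^sup>3\<^sup>/\<^sup>2\<close>, and \<open>m\<close> may tend to infinity.
\<close>

lemma dilation_pairing_zero:
  assumes F: "grad_field (dom3 \<sigma>) F" and L2: "\<And>j. integrable (lebesgue_on (dom3 \<sigma>)) (\<lambda>x. (F j x)\<^sup>2)"
    and orth: "\<And>b. b \<in> solid_basis \<sigma> \<Longrightarrow> (LINT x|lebesgue_on (dom3 \<sigma>). F 1 x * partial 1 b x + F 2 x * partial 2 b x) = 0"
    and r: "dilation_param \<sigma> r"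
  shows "dilation_pairing \<sigma> F r = 0"
proof -
  let ?M = "lebesgue_on (dom3 \<sigma>)"
  have cF: "continuous_on (dom3 \<sigma>) (F j)" for j by (rule smooth_on_continuous[OF grad_field_smooth[OF F]])
  have mF: "F j \<in> borel_measurable ?M" for j by (rule borel_dom3_continuous[OF cF])
  let ?\<rho> = "1 / r"
  define G where "G i x = F i (r *\<^sub>R x)" for i x
  have G: "grad_field (larger_dom \<sigma> ?\<rho>) G"
    using grad_field_dilate[OF open_dom3 F, of r] unfolding dilation_larger(1)[OF r] G_def[abs_def] .
  have \<rho>: "larger_param \<sigma> ?\<rho>" by (rule dilation_larger(2)[OF r])
  have o: "open (larger_dom \<sigma> ?\<rho>)" by (rule open_larger_dom)
  have dom: "dom3 \<sigma> \<subseteq> larger_dom \<sigma> ?\<rho>" by (rule dom3_subset_larger[OF \<rho>])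
  have iF: "integrable ?M (\<lambda>x. F j x * F j (s *\<^sub>R x))" if "dilation_param \<sigma> s" for j s
    by (rule integrable_product_L2[OF mF borel_dom3_continuous[OF dilation_continuous[OF that cF]] L2 L2_dilation(1)[OF that cF L2]])
  show ?thesis
  proof (cases \<sigma>)
    case Interior
    have star: "t *\<^sub>R x \<in> larger_dom \<sigma> ?\<rho>" if "x \<in> larger_dom \<sigma> ?\<rho>" "0 \<le> t" "t \<le> 1" for x t
    proof -
      have "t * norm x \<le> 1 * norm x" using that by (intro mult_right_mono) auto
      then show ?thesis using that Interior by auto
    qed
    have pU: "partial j (ray_potential 0 1 G) x = G j x" if "x \<in> dom3 \<sigma>" for j x
      using has_partial_imp[OF ray_potential_partial[OF o G zero_le_one star, of x j]] that dom by auto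
    have "dilation_pairing \<sigma> F r = (LINT x|?M. F 1 x * partial 1 (ray_potential 0 1 G) x + F 2 x * partial 2 (ray_potential 0 1 G) x)"
      unfolding dilation_pairing_def
      by (rule Bochner_Integration.integral_cong) (auto simp: space_restrict_space pU G_def)
    also have "\<dots> = 0"
      by (rule larger_dom_pairing_zero[OF mF L2 orth \<rho> ray_potential_harm[OF o G zero_le_one star]]) (use Interior in auto)
    finally show ?thesis .
  next
    case Exterior
    have r1: "r > 1" using r Exterior by simp
    have dp: "dilation_param \<sigma> (r * m)" if "m > 1" for m
    proof -
      have "1 * 1 < r * m" using r1 that by (intro mult_strict_mono) auto
      then show ?thesis using Exterior by simp
    qed
    have star: "t *\<^sub>R x \<in> larger_dom \<sigma> ?\<rho>" if "x \<in> larger_dom \<sigma> ?\<rho>" "1 \<le> t" for x t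
    proof -
      have "1 * norm x \<le> t * norm x" using that by (intro mult_right_mono) auto
      then show ?thesis using that Exterior by auto
    qed
    have decay: "\<exists>K. K \<ge> 0 \<and> (\<forall>y. norm y \<ge> 4 \<longrightarrow> (F i y)\<^sup>2 \<le> K / norm y ^ 3)" for i
      using L2_harm_decay[of "F i"] grad_field_harm[OF open_dom3 F, of i] L2[of i] Exterior by metis
    then obtain Kf where Kf: "\<And>i. Kf i \<ge> 0" "\<And>i y. norm y \<ge> 4 \<Longrightarrow> (F i y)\<^sup>2 \<le> Kf i / norm y ^ 3" by metis
    define K where "K = (\<Sum>i\<in>UNIV. Kf i)"
    have KK: "Kf i \<le> K" for i unfolding K_def by (rule member_le_sum) (use Kf in auto)
    have K0: "K \<ge> 0" using KK[of 0] Kf(1)[of 0] by linarith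
    have GK: "(G i y)\<^sup>2 \<le> K / norm y ^ 3" if "norm y \<ge> 4" for i y
    proof -
      have "1 * norm y \<le> r * norm y" using r1 by (intro mult_right_mono) auto
      then have ry: "norm y \<le> norm (r *\<^sub>R y)" using r1 by simp
      have "(G i y)\<^sup>2 \<le> Kf i / norm (r *\<^sub>R y) ^ 3" unfolding G_def by (rule Kf(2)) (use ry that in linarith)
      also have "\<dots> \<le> K / norm y ^ 3"
        using ry that KK[of i] K0 by (intro frac_le power_mono) auto
      finally show ?thesis .
    qed
    have cG: "continuous_on {x. norm x \<ge> 4} (G i)" for i
    proof (rule continuous_on_subset[OF smooth_on_continuous[OF grad_field_smooth[OF G]]])
      have "1 / r < 4" using r1 by (simp add: field_simps)
      then show "{x. 4 \<le> norm x} \<subseteq> larger_dom \<sigma> ?\<rho>" using Exterior by auto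
    qed
    \<comment> \<open>the ray potential over \<open>{1..m}\<close> of \<open>F(r x)\<close> has gradient \<open>m F(r m x) - F(r x)\<close>\<close>
    have key: "dilation_pairing \<sigma> F r = m * dilation_pairing \<sigma> F (r * m)" if m: "m > 1" for m
    proof -
      have pU: "partial j (ray_potential 1 m G) x = m * F j ((r * m) *\<^sub>R x) - F j (r *\<^sub>R x)" if "x \<in> dom3 \<sigma>" for j x
        using has_partial_imp[OF ray_potential_partial[OF o G _ star, of 1 m x j]] m that dom by (auto simp: G_def mult.commute)
      have "0 = (LINT x|?M. F 1 x * partial 1 (ray_potential 1 m G) x + F 2 x * partial 2 (ray_potential 1 m G) x)"
        using larger_dom_pairing_zero[OF mF L2 orth \<rho> ray_potential_harm[OF o G _ star]] m
          ray_potential_vanishes[OF _ cG K0 GK, of m] by simp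
      also have "\<dots> = (LINT x|?M. m * (F 1 x * F 1 ((r * m) *\<^sub>R x) + F 2 x * F 2 ((r * m) *\<^sub>R x)) - (F 1 x * F 1 (r *\<^sub>R x) + F 2 x * F 2 (r *\<^sub>R x)))"
        by (rule Bochner_Integration.integral_cong) (auto simp: space_restrict_space pU algebra_simps)
      also have "\<dots> = m * dilation_pairing \<sigma> F (r * m) - dilation_pairing \<sigma> F r"
        unfolding dilation_pairing_def using iF[OF r] iF[OF dp[OF m]] by simp
      finally show ?thesis by simp
    qed
    define A where "A = (\<Sum>j\<in>{1,2::3}. (LINT x|?M. (F j x)\<^sup>2)\<^sup>2)"
    \<comment> \<open>Cauchy-Schwarz; a dilation by \<open>s\<close> divides the squared norm by at least \<open>s\<^sup>3\<close>\<close>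
    have bound: "(dilation_pairing \<sigma> F r)\<^sup>2 \<le> 2 * A / m" if m: "m > 1" for m
    proof -
      let ?s = "r * m"
      define J where "J j = (LINT x|?M. F j x * F j (?s *\<^sub>R x))" for j
      have s1: "?s > m" using r1 m by simp
      have CS: "(J j)\<^sup>2 \<le> (LINT x|?M. (F j x)\<^sup>2)\<^sup>2 / m ^ 3" for j
      proof -
        have n: "0 \<le> (LINT x|?M. (F j x)\<^sup>2)" by simp
        have "(J j)\<^sup>2 \<le> (LINT x|?M. (F j x)\<^sup>2) * (LINT x|?M. (F j (?s *\<^sub>R x))\<^sup>2)"
          unfolding J_def by (rule Cauchy_Schwarz_integral[OF mF borel_dom3_continuous[OF dilation_continuous[OF dp[OF m] cF]] L2 L2_dilation(1)[OF dp[OF m] cF L2]])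
        also have "\<dots> \<le> (LINT x|?M. (F j x)\<^sup>2) * ((LINT x|?M. (F j x)\<^sup>2) / ?s ^ 3)"
          by (rule mult_left_mono[OF L2_dilation(2)[OF dp[OF m] cF L2] n])
        also have "\<dots> \<le> (LINT x|?M. (F j x)\<^sup>2) * ((LINT x|?M. (F j x)\<^sup>2) / m ^ 3)"
          using s1 m n by (intro mult_left_mono divide_left_mono power_mono mult_pos_pos zero_less_power) auto
        finally show ?thesis by (simp add: power2_eq_square)
      qed
      have "dilation_pairing \<sigma> F ?s = J 1 + J 2"
        unfolding dilation_pairing_def J_def using iF[OF dp[OF m]] by simp
      then have "(dilation_pairing \<sigma> F r)\<^sup>2 = m\<^sup>2 * (J 1 + J 2)\<^sup>2" unfolding key[OF m] by (simp add: power_mult_distrib)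
      also have "\<dots> \<le> m\<^sup>2 * (2 * ((J 1)\<^sup>2 + (J 2)\<^sup>2))"
        using zero_le_power2[of "J 1 - J 2"] by (intro mult_left_mono) (auto simp: power2_eq_square algebra_simps)
      also have "\<dots> \<le> m\<^sup>2 * (2 * (A / m ^ 3))"
        using CS[of 1] CS[of 2] by (intro mult_left_mono) (auto simp: A_def add_divide_distrib)
      also have "\<dots> = 2 * A / m" using m by (simp add: power2_eq_square power3_eq_cube)
      finally show ?thesis .
    qed
    have A0: "A \<ge> 0" unfolding A_def by (rule sum_nonneg) simp
    have "(dilation_pairing \<sigma> F r)\<^sup>2 \<le> 0 + e" if e: "e > 0" for e
    proof -
      define m where "m = 2 * A / e + 2"
      have "2 * A / e \<ge> 0" using A0 e by simp
      then have m: "m > 1" by (simp add: m_def)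
      have "2 * A \<le> e * m" using e by (simp add: m_def field_simps)
      then have "2 * A / m \<le> e" using m by (simp add: pos_divide_le_eq)
      then show ?thesis using bound[OF m] by simp
    qed
    then have "(dilation_pairing \<sigma> F r)\<^sup>2 \<le> 0" by (rule field_le_epsilon)
    then show ?thesis by simp
  qed
qed

text \<open>
  With \<open>v = (F\<^sub>1, F\<^sub>2)\<close> and its dilations \<open>v\<^sub>r\<close>, orthogonality gives
  \<open>\<parallel>v + v\<^sub>r\<parallel>\<^sup>2 = \<parallel>v\<parallel>\<^sup>2 + \<parallel>v\<^sub>r\<parallel>\<^sup>2 \<le> (1 + r\<^sup>-\<^sup>3) \<parallel>v\<parallel>\<^sup>2\<close>. As \<open>r\<close> tends to \<open>1\<close> the functions converge pointwise to \<open>2 v\<close>,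
  and Fatou's lemma yields \<open>4 \<parallel>v\<parallel>\<^sup>2 \<le> 2 \<parallel>v\<parallel>\<^sup>2\<close>. No convergence of the dilations in \<open>L\<^sup>2\<close> has to be shown.
\<close>

theorem gradient_field_complete:
  assumes F: "grad_field (dom3 \<sigma>) F" and L2: "\<And>j. integrable (lebesgue_on (dom3 \<sigma>)) (\<lambda>x. (F j x)\<^sup>2)"
    and orth: "\<And>b. b \<in> solid_basis \<sigma> \<Longrightarrow> (LINT x|lebesgue_on (dom3 \<sigma>). F 1 x * partial 1 b x + F 2 x * partial 2 b x) = 0"
    and x: "x \<in> dom3 \<sigma>"
  shows "F 1 x = 0" "F 2 x = 0"
proof -
  let ?M = "lebesgue_on (dom3 \<sigma>)"
  have cF: "continuous_on (dom3 \<sigma>) (F j)" for j by (rule smooth_on_continuous[OF grad_field_smooth[OF F]])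
  have mF: "F j \<in> borel_measurable ?M" for j by (rule borel_dom3_continuous[OF cF])
  \<comment> \<open>shifted indices keep the dilations admissible from \<open>n = 0\<close> on\<close>
  define r where "r n = (case \<sigma> of Interior \<Rightarrow> 1 - inverse (real (Suc (Suc n))) | Exterior \<Rightarrow> 1 + inverse (real (Suc n)))" for n
  have r: "dilation_param \<sigma> (r n)" for n
    by (cases \<sigma>) (auto simp: r_def field_simps)
  have rlim: "r \<longlonglongrightarrow> 1"
  proof -
    have 1: "(\<lambda>n. inverse (real (Suc n))) \<longlonglongrightarrow> 0" by (rule LIMSEQ_inverse_real_of_nat)
    have 2: "(\<lambda>n. inverse (real (Suc (Suc n)))) \<longlonglongrightarrow> 0" using LIMSEQ_Suc[OF 1] .
    show ?thesis
      using tendsto_diff[OF tendsto_const 2, of 1] tendsto_add[OF tendsto_const 1, of 1]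
      by (cases \<sigma>) (simp_all add: r_def[abs_def])
  qed
  define V where "V = (LINT x|?M. (F 1 x)\<^sup>2) + (LINT x|?M. (F 2 x)\<^sup>2)"
  have V0: "V \<ge> 0" unfolding V_def by simp
  define u where "u n x = (F 1 x + F 1 (r n *\<^sub>R x))\<^sup>2 + (F 2 x + F 2 (r n *\<^sub>R x))\<^sup>2" for n x
  have cd: "continuous_on (dom3 \<sigma>) (\<lambda>x. F j (r n *\<^sub>R x))" for j n by (rule dilation_continuous[OF r cF])
  have d2: "integrable ?M (\<lambda>x. (F j (r n *\<^sub>R x))\<^sup>2)" for j n by (rule L2_dilation(1)[OF r cF L2])
  have dF: "integrable ?M (\<lambda>x. F j x * F j (r n *\<^sub>R x))" for j n
    by (rule integrable_product_L2[OF mF borel_dom3_continuous[OF cd] L2 d2])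
  have u_eq: "u n = (\<lambda>x. ((F 1 x)\<^sup>2 + (F 2 x)\<^sup>2) + 2 * (F 1 x * F 1 (r n *\<^sub>R x) + F 2 x * F 2 (r n *\<^sub>R x))
      + ((F 1 (r n *\<^sub>R x))\<^sup>2 + (F 2 (r n *\<^sub>R x))\<^sup>2))" for n
    by (rule ext) (simp add: u_def power2_eq_square algebra_simps)
  have ui: "integrable ?M (u n)" for n
    unfolding u_eq by (intro Bochner_Integration.integrable_add integrable_mult_right L2 d2 dF)
  have uI: "(LINT x|?M. u n x) \<le> V + V / r n ^ 3" for n
  proof -
    have "(LINT x|?M. u n x) = V + 2 * dilation_pairing \<sigma> F (r n) + ((LINT x|?M. (F 1 (r n *\<^sub>R x))\<^sup>2) + (LINT x|?M. (F 2 (r n *\<^sub>R x))\<^sup>2))"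
      unfolding u_eq V_def dilation_pairing_def using L2 d2 dF by simp
    also have "\<dots> \<le> V + V / r n ^ 3"
      using dilation_pairing_zero[OF F L2 orth r] L2_dilation(2)[OF r cF L2, of 1 n] L2_dilation(2)[OF r cF L2, of 2 n]
      by (simp add: V_def add_divide_distrib)
    finally show ?thesis .
  qed
  have lim: "(\<lambda>n. u n y) \<longlonglongrightarrow> 4 * ((F 1 y)\<^sup>2 + (F 2 y)\<^sup>2)" if y: "y \<in> dom3 \<sigma>" for y
  proof -
    have c: "isCont (F j) y" for j using continuous_on_eq_continuous_at[OF open_dom3] cF y by metis
    have "(\<lambda>n. r n *\<^sub>R y) \<longlonglongrightarrow> 1 *\<^sub>R y" by (intro tendsto_intros rlim)
    then have rl: "(\<lambda>n. r n *\<^sub>R y) \<longlonglongrightarrow> y" by simp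
    have "(\<lambda>n. F j (r n *\<^sub>R y)) \<longlonglongrightarrow> F j y" for j by (rule isCont_tendsto_compose[OF c rl])
    then have "(\<lambda>n. u n y) \<longlonglongrightarrow> (F 1 y + F 1 y)\<^sup>2 + (F 2 y + F 2 y)\<^sup>2" unfolding u_def by (intro tendsto_intros)
    then show ?thesis by (simp add: power2_eq_square algebra_simps)
  qed
  have "ennreal (4 * V) = (\<integral>\<^sup>+ y. ennreal (4 * ((F 1 y)\<^sup>2 + (F 2 y)\<^sup>2)) \<partial>?M)"
  proof (subst nn_integral_eq_integral)
    show "integrable ?M (\<lambda>y. 4 * ((F 1 y)\<^sup>2 + (F 2 y)\<^sup>2))" using L2 by simp
    show "ennreal (4 * V) = ennreal (LINT y|?M. 4 * ((F 1 y)\<^sup>2 + (F 2 y)\<^sup>2))"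
      using L2 by (simp add: V_def)
  qed auto
  also have "\<dots> = (\<integral>\<^sup>+ y. liminf (\<lambda>n. ennreal (u n y)) \<partial>?M)"
  proof (rule nn_integral_cong)
    fix y assume "y \<in> space ?M"
    then have "y \<in> dom3 \<sigma>" by (simp add: space_restrict_space)
    then have "(\<lambda>n. ennreal (u n y)) \<longlonglongrightarrow> ennreal (4 * ((F 1 y)\<^sup>2 + (F 2 y)\<^sup>2))" by (intro tendsto_ennrealI lim)
    then show "ennreal (4 * ((F 1 y)\<^sup>2 + (F 2 y)\<^sup>2)) = liminf (\<lambda>n. ennreal (u n y))"
      by (intro lim_imp_Liminf[symmetric]) auto
  qed
  also have "\<dots> \<le> liminf (\<lambda>n. \<integral>\<^sup>+ y. ennreal (u n y) \<partial>?M)"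
    by (rule nn_integral_liminf) (use ui in auto)
  also have "\<dots> \<le> liminf (\<lambda>n. ennreal (V + V / r n ^ 3))"
  proof (rule Liminf_mono, rule always_eventually, rule allI)
    fix n
    have "(\<integral>\<^sup>+ y. ennreal (u n y) \<partial>?M) = ennreal (LINT y|?M. u n y)"
      by (rule nn_integral_eq_integral[OF ui]) (simp add: u_def)
    then show "(\<integral>\<^sup>+ y. ennreal (u n y) \<partial>?M) \<le> ennreal (V + V / r n ^ 3)"
      using uI[of n] by (simp add: ennreal_leI)
  qed
  also have "\<dots> = ennreal (V + V / 1 ^ 3)"
  proof (rule lim_imp_Liminf)
    show "(\<lambda>n. ennreal (V + V / r n ^ 3)) \<longlonglongrightarrow> ennreal (V + V / 1 ^ 3)"
      by (intro tendsto_ennrealI tendsto_intros rlim) simp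
  qed simp
  finally have "4 * V \<le> V + V" using V0 by (simp add: ennreal_le_iff)
  then have V: "V = 0" using V0 by simp
  have L20: "(LINT x|?M. (F j x)\<^sup>2) = 0" if "j = 1 \<or> j = 2" for j
  proof -
    have "0 \<le> (LINT x|?M. (F 1 x)\<^sup>2)" "0 \<le> (LINT x|?M. (F 2 x)\<^sup>2)" by simp_all
    then have "(LINT x|?M. (F 1 x)\<^sup>2) = 0" "(LINT x|?M. (F 2 x)\<^sup>2) = 0" using V unfolding V_def by linarith+
    then show ?thesis using that by auto
  qed
  obtain d where d: "d > 0" "cball x d \<subseteq> dom3 \<sigma>" using open_dom3 x open_contains_cball by blast
  have "(F j x)\<^sup>2 \<le> sup_const / d ^ 3 * 0" if "j = 1 \<or> j = 2" for j
    using harm_sup_L2[OF open_dom3 d(2,1) grad_field_harm[OF open_dom3 F, of j] integrable_dom3_iff[THEN iffD1, OF L2]]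
      L20[OF that] unfolding integral_dom3_eq by simp
  then show "F 1 x = 0" "F 2 x = 0" by auto
qed

section \<open>Square-summable series of harmonic functions\<close>

lemma l2_product:
  fixes a b :: "'k \<Rightarrow> real"
  assumes a: "(\<lambda>k. (a k)\<^sup>2) summable_on I" and b: "\<And>J. finite J \<Longrightarrow> J \<subseteq> I \<Longrightarrow> (\<Sum>k\<in>J. (b k)\<^sup>2) \<le> C"
  shows "(\<lambda>k. a k * b k) summable_on I" "\<bar>\<Sum>\<^sub>\<infinity>k\<in>I. a k * b k\<bar> \<le> sqrt C * sqrt (\<Sum>\<^sub>\<infinity>k\<in>I. (a k)\<^sup>2)"
proof -
  have bs: "(\<lambda>k. (b k)\<^sup>2) summable_on I"
    by (rule nonneg_bdd_above_summable_on) (use b in \<open>auto intro!: bdd_aboveI2[where M = C]\<close>)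
  have "(\<lambda>k. norm (a k * b k)) summable_on I"
  proof (rule summable_on_comparison_test)
    show "(\<lambda>k. (a k)\<^sup>2 + (b k)\<^sup>2) summable_on I" by (rule summable_on_add[OF a bs])
    show "norm (a k * b k) \<le> (a k)\<^sup>2 + (b k)\<^sup>2" for k
    proof -
      have "0 \<le> (\<bar>a k\<bar> - \<bar>b k\<bar>)\<^sup>2" by simp
      then have "2 * (\<bar>a k\<bar> * \<bar>b k\<bar>) \<le> (a k)\<^sup>2 + (b k)\<^sup>2" by (simp add: power2_diff)
      moreover have "0 \<le> \<bar>a k\<bar> * \<bar>b k\<bar>" by (rule mult_nonneg_nonneg) auto
      ultimately have "\<bar>a k\<bar> * \<bar>b k\<bar> \<le> (a k)\<^sup>2 + (b k)\<^sup>2" by linarith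
      then show ?thesis by (simp add: abs_mult)
    qed
  qed auto
  then show s: "(\<lambda>k. a k * b k) summable_on I" by (rule abs_summable_summable)
  have fin: "\<bar>\<Sum>k\<in>J. a k * b k\<bar> \<le> sqrt C * sqrt (\<Sum>\<^sub>\<infinity>k\<in>I. (a k)\<^sup>2)" if J: "finite J" "J \<subseteq> I" for J
  proof -
    have "\<bar>\<Sum>k\<in>J. a k * b k\<bar> = sqrt ((\<Sum>k\<in>J. a k * b k)\<^sup>2)" by simp
    also have "\<dots> \<le> sqrt ((\<Sum>k\<in>J. (a k)\<^sup>2) * (\<Sum>k\<in>J. (b k)\<^sup>2))"
      by (rule real_sqrt_le_mono[OF Cauchy_Schwarz_ineq_sum])
    also have "\<dots> \<le> sqrt ((\<Sum>\<^sub>\<infinity>k\<in>I. (a k)\<^sup>2) * C)"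
      using finite_sum_le_infsum[OF a J] b[OF J] by (intro real_sqrt_le_mono mult_mono) (auto intro: infsum_nonneg sum_nonneg)
    finally show ?thesis by (simp add: real_sqrt_mult mult.commute)
  qed
  have "((\<lambda>J. \<bar>\<Sum>k\<in>J. a k * b k\<bar>) \<longlongrightarrow> \<bar>\<Sum>\<^sub>\<infinity>k\<in>I. a k * b k\<bar>) (finite_subsets_at_top I)"
    by (intro tendsto_rabs) (rule infsum_tendsto[OF s])
  then show "\<bar>\<Sum>\<^sub>\<infinity>k\<in>I. a k * b k\<bar> \<le> sqrt C * sqrt (\<Sum>\<^sub>\<infinity>k\<in>I. (a k)\<^sup>2)"
    by (rule tendsto_upperbound) (auto intro!: eventually_finite_subsets_at_top_weakI fin)
qed

lemma l2_tail:
  fixes a :: "'k \<Rightarrow> real"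
  assumes a: "(\<lambda>k. (a k)\<^sup>2) summable_on I" and J: "finite J" "J \<subseteq> I"
  shows "(\<lambda>k. (a k)\<^sup>2) summable_on (I - J)" "(\<Sum>\<^sub>\<infinity>k\<in>I - J. (a k)\<^sup>2) = (\<Sum>\<^sub>\<infinity>k\<in>I. (a k)\<^sup>2) - (\<Sum>k\<in>J. (a k)\<^sup>2)"
  using infsum_Diff[OF a summable_on_finite[OF J(1)] J(2)] summable_on_Diff[OF a summable_on_finite[OF J(1)] J(2)] J(1)
  by (auto simp: infsum_finite)

lemma l2_tail_tendsto:
  fixes a :: "'k \<Rightarrow> real"
  assumes a: "(\<lambda>k. (a k)\<^sup>2) summable_on I"
  shows "((\<lambda>J. B * sqrt ((\<Sum>\<^sub>\<infinity>k\<in>I. (a k)\<^sup>2) - (\<Sum>k\<in>J. (a k)\<^sup>2))) \<longlongrightarrow> 0) (finite_subsets_at_top I)"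
proof -
  have "((\<lambda>J. B * sqrt ((\<Sum>\<^sub>\<infinity>k\<in>I. (a k)\<^sup>2) - (\<Sum>k\<in>J. (a k)\<^sup>2))) \<longlongrightarrow>
      B * sqrt ((\<Sum>\<^sub>\<infinity>k\<in>I. (a k)\<^sup>2) - (\<Sum>\<^sub>\<infinity>k\<in>I. (a k)\<^sup>2))) (finite_subsets_at_top I)"
    by (intro tendsto_intros infsum_tendsto[OF a])
  then show ?thesis by simp
qed

text \<open>
  Locally uniform bounds for the sums of squares. For an orthonormal family they express that point
  evaluation is a bounded functional, locally uniformly; they are what makes series with square-summable
  coefficients converge locally uniformly.
\<close>

definition locally_l2 :: "'k set \<Rightarrow> (real^3) set \<Rightarrow> ('k \<Rightarrow> real^3 \<Rightarrow> real) \<Rightarrow> bool" where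
  "locally_l2 I S g \<longleftrightarrow> (\<forall>x\<in>S. \<exists>r>0. \<exists>C. cball x r \<subseteq> S \<and>
     (\<forall>y\<in>cball x r. \<forall>J. finite J \<and> J \<subseteq> I \<longrightarrow> (\<Sum>k\<in>J. (g k y)\<^sup>2) \<le> C))"

lemma locally_l2E:
  assumes "locally_l2 I S g" "x \<in> S"
  obtains r C where "r > 0" "cball x r \<subseteq> S" "C \<ge> 0" "\<And>y J. y \<in> cball x r \<Longrightarrow> finite J \<Longrightarrow> J \<subseteq> I \<Longrightarrow> (\<Sum>k\<in>J. (g k y)\<^sup>2) \<le> C"
proof -
  obtain r C where *: "r > 0" "cball x r \<subseteq> S" "\<And>y J. y \<in> cball x r \<Longrightarrow> finite J \<Longrightarrow> J \<subseteq> I \<Longrightarrow> (\<Sum>k\<in>J. (g k y)\<^sup>2) \<le> C"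
    using assms unfolding locally_l2_def by meson
  have "C \<ge> 0" using *(3)[of x "{}"] *(1) by simp
  then show ?thesis using * that by blast
qed

lemma partial_finite_combination:
  fixes g :: "'k \<Rightarrow> real^3 \<Rightarrow> real"
  assumes "\<And>k. k \<in> J \<Longrightarrow> smooth_on S (g k)" "x \<in> S"
  shows "has_partial i (\<lambda>y. \<Sum>k\<in>J. a k * g k y) (\<Sum>k\<in>J. a k * partial i (g k) x) x"
  by (intro has_partial_sum has_partial_cmult smooth_on_has_partial[OF assms(1) assms(2)])

text \<open>
  Duality: for fixed \<open>y\<close> and \<open>J\<close>, the harmonic function \<open>G z = \<Sum>\<^sub>k \<partial>\<^sub>i g\<^sub>k(y) g\<^sub>k(z)\<close> is bounded by \<open>sqrt (A C)\<close>, where \<open>A\<close> is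
  the sum to be estimated. Since \<open>\<partial>\<^sub>i G (y) = A\<close>, the gradient estimate gives \<open>A \<le> K sqrt (A C)\<close>, hence \<open>A \<le> K\<^sup>2 C\<close>.
\<close>

lemma locally_l2_partial:
  assumes o: "open S" and h: "\<And>k. k \<in> I \<Longrightarrow> smooth_harmonic S (g k)" and l: "locally_l2 I S g"
  shows "locally_l2 I S (\<lambda>k. partial i (g k))"
  unfolding locally_l2_def
proof
  fix x assume x: "x \<in> S"
  obtain r C where r: "r > 0" "cball x r \<subseteq> S" "C \<ge> 0" "\<And>y J. y \<in> cball x r \<Longrightarrow> finite J \<Longrightarrow> J \<subseteq> I \<Longrightarrow> (\<Sum>k\<in>J. (g k y)\<^sup>2) \<le> C"
    by (rule locally_l2E[OF l x]) blast
  define D where "D = (grad_const / (r/2))\<^sup>2 * C"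
  have "(\<Sum>k\<in>J. (partial i (g k) y)\<^sup>2) \<le> D" if y: "y \<in> cball x (r/2)" and J: "finite J" "J \<subseteq> I" for y J
  proof -
    define A where "A = (\<Sum>k\<in>J. (partial i (g k) y)\<^sup>2)"
    have A0: "A \<ge> 0" unfolding A_def by (rule sum_nonneg) simp
    \<comment> \<open>the test function with \<open>partial i G y = A\<close>\<close>
    define G where "G z = (\<Sum>k\<in>J. partial i (g k) y * g k z)" for z
    have sub: "cball y (r/2) \<subseteq> cball x r"
    proof
      fix z assume "z \<in> cball y (r/2)"
      then show "z \<in> cball x r" using y dist_triangle[of x z y] by (simp add: mem_cball)
    qed
    have yS: "y \<in> S" using y r(1,2) by auto
    have hG: "smooth_harmonic S G" unfolding G_def by (intro harm_sum harm_cmult o h) (use J in auto)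
    have "\<bar>G z\<bar> \<le> sqrt (A * C)" if z: "z \<in> cball y (r/2)" for z
    proof -
      have "(G z)\<^sup>2 \<le> A * (\<Sum>k\<in>J. (g k z)\<^sup>2)" unfolding G_def A_def by (rule Cauchy_Schwarz_ineq_sum)
      also have "\<dots> \<le> A * C" using r(4)[OF _ J] z sub A0 by (intro mult_left_mono) auto
      finally show ?thesis by (intro real_le_rsqrt) simp
    qed
    then have "\<bar>partial i G y\<bar> \<le> grad_const / (r/2) * sqrt (A * C)"
      by (intro harm_gradient_bound[OF o _ _ hG]) (use sub r in auto)
    moreover have "partial i G y = A"
      unfolding G_def A_def using has_partial_imp[OF partial_finite_combination[of J S g y i "\<lambda>k. partial i (g k) y"]] h J yS
      by (auto simp: power2_eq_square dest: harm_smooth)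
    ultimately have "A \<le> grad_const / (r/2) * sqrt (A * C)" using A0 by simp
    then have "A\<^sup>2 \<le> (grad_const / (r/2) * sqrt (A * C))\<^sup>2" using A0 by (intro power_mono)
    also have "\<dots> = (grad_const / (r/2))\<^sup>2 * (A * C)"
      using mult_nonneg_nonneg[OF A0 r(3)] by (simp only: power_mult_distrib real_sqrt_pow2)
    also have "\<dots> = D * A" unfolding D_def by (simp only: mult_ac)
    finally have "A * A \<le> D * A" by (simp add: power2_eq_square)
    moreover have "D \<ge> 0" unfolding D_def using r(3) by simp
    ultimately show ?thesis unfolding A_def[symmetric] using A0 by (cases "A = 0") (auto simp: mult_le_cancel_right)
  qed
  moreover have "r / 2 > 0" "cball x (r/2) \<subseteq> S" using r(1,2) by auto
  ultimately show "\<exists>r>0. \<exists>C. cball x r \<subseteq> S \<and> (\<forall>y\<in>cball x r. \<forall>J. finite J \<and> J \<subseteq> I \<longrightarrow> (\<Sum>k\<in>J. (partial i (g k) y)\<^sup>2) \<le> C)"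
    by blast
qed

definition series :: "'k set \<Rightarrow> ('k \<Rightarrow> real) \<Rightarrow> ('k \<Rightarrow> real^3 \<Rightarrow> real) \<Rightarrow> real^3 \<Rightarrow> real" where
  "series I a g x = (\<Sum>\<^sub>\<infinity>k\<in>I. a k * g k x)"

lemma series_summable:
  assumes a: "(\<lambda>k. (a k)\<^sup>2) summable_on I" and l: "locally_l2 I S g" and x: "x \<in> S"
  shows "(\<lambda>k. a k * g k x) summable_on I"
proof -
  obtain r C where r: "r > 0" "cball x r \<subseteq> S" "C \<ge> 0" "\<And>y J. y \<in> cball x r \<Longrightarrow> finite J \<Longrightarrow> J \<subseteq> I \<Longrightarrow> (\<Sum>k\<in>J. (g k y)\<^sup>2) \<le> C"
    by (rule locally_l2E[OF l x]) blast
  show ?thesis by (rule l2_product(1)[OF a, of _ C]) (use r in auto)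
qed

lemma series_continuous:
  assumes o: "open S" and a: "(\<lambda>k. (a k)\<^sup>2) summable_on I" and l: "locally_l2 I S g"
    and c: "\<And>k. k \<in> I \<Longrightarrow> continuous_on S (g k)"
  shows "continuous_on S (series I a g)"
proof -
  have "isCont (series I a g) x" if x: "x \<in> S" for x
  proof -
    obtain r C where r: "r > 0" "cball x r \<subseteq> S" "C \<ge> 0" "\<And>y J. y \<in> cball x r \<Longrightarrow> finite J \<Longrightarrow> J \<subseteq> I \<Longrightarrow> (\<Sum>k\<in>J. (g k y)\<^sup>2) \<le> C"
      by (rule locally_l2E[OF l x]) blast
    have tail: "\<bar>(\<Sum>k\<in>J. a k * g k y) - series I a g y\<bar> \<le> sqrt C * sqrt ((\<Sum>\<^sub>\<infinity>k\<in>I. (a k)\<^sup>2) - (\<Sum>k\<in>J. (a k)\<^sup>2))"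
      if y: "y \<in> cball x r" and J: "finite J" "J \<subseteq> I" for y J
    proof -
      have s: "(\<lambda>k. a k * g k y) summable_on I" by (rule l2_product(1)[OF a, of _ C]) (use r y in auto)
      have "(\<Sum>\<^sub>\<infinity>k\<in>I - J. a k * g k y) = series I a g y - (\<Sum>k\<in>J. a k * g k y)"
        unfolding series_def using infsum_Diff[OF s summable_on_finite[OF J(1)] J(2)] J(1) by simp
      moreover have "\<bar>\<Sum>\<^sub>\<infinity>k\<in>I - J. a k * g k y\<bar> \<le> sqrt C * sqrt (\<Sum>\<^sub>\<infinity>k\<in>I - J. (a k)\<^sup>2)"
        by (rule l2_product(2)[OF l2_tail(1)[OF a J] r(4)[OF y]]) auto
      ultimately show ?thesis unfolding l2_tail(2)[OF a J] by (simp add: abs_minus_commute)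
    qed
    have "continuous_on (cball x r) (series I a g)"
    proof (rule uniform_limit_theorem)
      show "\<forall>\<^sub>F J in finite_subsets_at_top I. continuous_on (cball x r) (\<lambda>y. \<Sum>k\<in>J. a k * g k y)"
        by (rule eventually_finite_subsets_at_top_weakI)
          (use c r(2) in \<open>auto intro!: continuous_intros intro: continuous_on_subset\<close>)
      show "uniform_limit (cball x r) (\<lambda>J y. \<Sum>k\<in>J. a k * g k y) (series I a g) (finite_subsets_at_top I)"
      proof (rule uniform_limitI)
        fix e :: real assume e: "e > 0"
        have "\<forall>\<^sub>F J in finite_subsets_at_top I. \<bar>sqrt C * sqrt ((\<Sum>\<^sub>\<infinity>k\<in>I. (a k)\<^sup>2) - (\<Sum>k\<in>J. (a k)\<^sup>2))\<bar> < e"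
          using tendstoD[OF l2_tail_tendsto[OF a] e] by (simp add: dist_real_def)
        moreover have "\<forall>\<^sub>F J in finite_subsets_at_top I. finite J \<and> J \<subseteq> I"
          by (rule eventually_finite_subsets_at_top_weakI) auto
        ultimately show "\<forall>\<^sub>F J in finite_subsets_at_top I. \<forall>y\<in>cball x r. dist (\<Sum>k\<in>J. a k * g k y) (series I a g y) < e"
        proof eventually_elim
          case (elim J)
          show ?case
          proof
            fix y assume "y \<in> cball x r"
            from tail[OF this, of J] elim show "dist (\<Sum>k\<in>J. a k * g k y) (series I a g y) < e"
              unfolding dist_real_def by linarith
          qed
        qed
      qed
    qed simp
    then have "continuous_on (ball x r) (series I a g)" by (rule continuous_on_subset) auto
    then show ?thesis using r(1) by (simp add: continuous_on_eq_continuous_at)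
  qed
  then show ?thesis using o by (simp add: continuous_on_eq_continuous_at)
qed

text \<open>
  The second derivatives of the finite sums are bounded by one constant \<open>K\<close>, so the remainder of their
  first-order expansion is at most \<open>K t\<^sup>2\<close>; this bound survives the passage to the limit.
\<close>

lemma series_has_partial:
  assumes o: "open S" and a: "(\<lambda>k. (a k)\<^sup>2) summable_on I" and l: "locally_l2 I S g"
    and h: "\<And>k. k \<in> I \<Longrightarrow> smooth_harmonic S (g k)" and x: "x \<in> S"
  shows "has_partial i (series I a g) (series I a (\<lambda>k. partial i (g k)) x) x"
proof -
  let ?g1 = "\<lambda>k. partial i (g k)" and ?g2 = "\<lambda>k. partial i (partial i (g k))"
  have h1: "smooth_harmonic S (?g1 k)" if "k \<in> I" for k by (rule harm_partial[OF o h[OF that]])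
  have l1: "locally_l2 I S ?g1" by (rule locally_l2_partial[OF o h l])
  have l2: "locally_l2 I S ?g2" by (rule locally_l2_partial[OF o h1 l1])
  obtain r C where r: "r > 0" "cball x r \<subseteq> S" "C \<ge> 0" "\<And>y J. y \<in> cball x r \<Longrightarrow> finite J \<Longrightarrow> J \<subseteq> I \<Longrightarrow> (\<Sum>k\<in>J. (?g2 k y)\<^sup>2) \<le> C"
    by (rule locally_l2E[OF l2 x]) blast
  define K where "K = sqrt C * sqrt (\<Sum>\<^sub>\<infinity>k\<in>I. (a k)\<^sup>2)"
  let ?e = "axis i (1::real) :: real^3"
  have near: "x + t *\<^sub>R ?e \<in> cball x r" if "\<bar>t\<bar> \<le> r" for t using that by (simp add: dist_norm)
  have fin: "\<bar>(\<Sum>k\<in>J. a k * g k (x + t *\<^sub>R ?e)) - (\<Sum>k\<in>J. a k * g k x) - t * (\<Sum>k\<in>J. a k * ?g1 k x)\<bar> \<le> K * t\<^sup>2"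
    if J: "finite J" "J \<subseteq> I" and t: "\<bar>t\<bar> \<le> r" for J t
  proof -
    let ?G = "\<lambda>y. \<Sum>k\<in>J. a k * g k y" and ?G1 = "\<lambda>y. \<Sum>k\<in>J. a k * ?g1 k y" and ?G2 = "\<lambda>y. \<Sum>k\<in>J. a k * ?g2 k y"
    have inS: "x + s *\<^sub>R ?e \<in> S" if "\<bar>s\<bar> \<le> \<bar>t\<bar>" for s using near[of s] that t r(2) by auto
    have pG: "has_partial i ?G (?G1 y) y" if "y \<in> S" for y
      by (rule partial_finite_combination[OF harm_smooth[OF h] that]) (use J(2) in auto)
    have pG1: "has_partial i ?G1 (?G2 y) y" if "y \<in> S" for y
      by (rule partial_finite_combination[OF harm_smooth[OF h1] that]) (use J(2) in auto)
    obtain u where u: "\<bar>u\<bar> \<le> \<bar>t\<bar>" "?G (x + t *\<^sub>R ?e) - ?G x = t * ?G1 (x + u *\<^sub>R ?e)"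
      using mvt_line[where h = t and i = i and f = ?G and g = ?G1 and x = x, OF pG[OF inS]] by blast
    obtain w where w: "\<bar>w\<bar> \<le> \<bar>u\<bar>" "?G1 (x + u *\<^sub>R ?e) - ?G1 x = u * ?G2 (x + w *\<^sub>R ?e)"
      using mvt_line[where h = u and i = i and f = ?G1 and g = ?G2 and x = x, OF pG1[OF inS[OF order_trans[OF _ u(1)]]]] by blast
    have "\<bar>?G2 (x + w *\<^sub>R ?e)\<bar> = sqrt ((?G2 (x + w *\<^sub>R ?e))\<^sup>2)" by simp
    also have "\<dots> \<le> sqrt ((\<Sum>k\<in>J. (a k)\<^sup>2) * (\<Sum>k\<in>J. (?g2 k (x + w *\<^sub>R ?e))\<^sup>2))"
      by (rule real_sqrt_le_mono[OF Cauchy_Schwarz_ineq_sum])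
    also have "\<dots> \<le> sqrt ((\<Sum>\<^sub>\<infinity>k\<in>I. (a k)\<^sup>2) * C)"
      using finite_sum_le_infsum[OF a J] r(4)[OF near J, of w] u(1) w(1) t
      by (intro real_sqrt_le_mono mult_mono) (auto intro: infsum_nonneg sum_nonneg)
    finally have G2: "\<bar>?G2 (x + w *\<^sub>R ?e)\<bar> \<le> K" by (simp add: K_def real_sqrt_mult mult.commute)
    have "?G (x + t *\<^sub>R ?e) - ?G x - t * ?G1 x = t * (?G1 (x + u *\<^sub>R ?e) - ?G1 x)" unfolding u(2) by (simp add: right_diff_distrib)
    also have "\<bar>\<dots>\<bar> = \<bar>t\<bar> * (\<bar>u\<bar> * \<bar>?G2 (x + w *\<^sub>R ?e)\<bar>)" unfolding w(2) by (simp add: abs_mult)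
    also have "\<dots> \<le> \<bar>t\<bar> * (\<bar>t\<bar> * K)" using G2 u(1) by (intro mult_left_mono mult_mono) auto
    finally show ?thesis by (simp add: power2_eq_square mult_ac abs_mult_self_eq flip: abs_mult)
  qed
  have inS: "x + t *\<^sub>R ?e \<in> S" if "\<bar>t\<bar> \<le> r" for t using near[OF that] r(2) by blast
  have lim: "\<bar>series I a g (x + t *\<^sub>R ?e) - series I a g x - t * series I a ?g1 x\<bar> \<le> K * t\<^sup>2" if t: "\<bar>t\<bar> \<le> r" for t
  proof -
    have "((\<lambda>J. \<bar>(\<Sum>k\<in>J. a k * g k (x + t *\<^sub>R ?e)) - (\<Sum>k\<in>J. a k * g k x) - t * (\<Sum>k\<in>J. a k * ?g1 k x)\<bar>)
        \<longlongrightarrow> \<bar>series I a g (x + t *\<^sub>R ?e) - series I a g x - t * series I a ?g1 x\<bar>) (finite_subsets_at_top I)"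
      unfolding series_def
      by (intro tendsto_intros infsum_tendsto series_summable[OF a l] series_summable[OF a l1] inS[OF t] x)
    then show ?thesis
      by (rule tendsto_upperbound) (auto intro!: eventually_finite_subsets_at_top_weakI fin t)
  qed
  have "((\<lambda>t. (series I a g (x + t *\<^sub>R ?e) - series I a g x) / t) \<longlongrightarrow> series I a ?g1 x) (at 0)"
  proof (rule LIM_zero_cancel, rule Lim_null_comparison)
    have "\<forall>\<^sub>F t in at 0. \<bar>t\<bar> < r" using eventually_at[of "\<lambda>t. \<bar>t\<bar> < r" 0 UNIV] r(1) by (auto simp: dist_real_def)
    moreover have "\<forall>\<^sub>F t in at 0. t \<noteq> (0::real)" by (simp add: eventually_at_filter)
    ultimately show "\<forall>\<^sub>F t in at 0. norm ((series I a g (x + t *\<^sub>R ?e) - series I a g x) / t - series I a ?g1 x) \<le> K * \<bar>t\<bar>"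
    proof eventually_elim
      case (elim t)
      have "(series I a g (x + t *\<^sub>R ?e) - series I a g x) / t - series I a ?g1 x
          = (series I a g (x + t *\<^sub>R ?e) - series I a g x - t * series I a ?g1 x) / t"
        using elim by (simp add: field_simps)
      then have "norm ((series I a g (x + t *\<^sub>R ?e) - series I a g x) / t - series I a ?g1 x)
          = \<bar>series I a g (x + t *\<^sub>R ?e) - series I a g x - t * series I a ?g1 x\<bar> / \<bar>t\<bar>" by simp
      also have "\<dots> \<le> K * t\<^sup>2 / \<bar>t\<bar>" by (intro divide_right_mono lim) (use elim in auto)
      also have "t\<^sup>2 = \<bar>t\<bar> * \<bar>t\<bar>" by (simp add: power2_eq_square)
      also have "K * (\<bar>t\<bar> * \<bar>t\<bar>) / \<bar>t\<bar> = K * \<bar>t\<bar>"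
        using elim nonzero_mult_div_cancel_right[of "\<bar>t\<bar>" "K * \<bar>t\<bar>"] by (simp only: mult.assoc abs_eq_0 simp_thms)
      finally show ?case .
    qed
    show "((\<lambda>t. K * \<bar>t\<bar>) \<longlongrightarrow> 0) (at 0)" by (auto intro!: tendsto_eq_intros)
  qed
  then have "((\<lambda>t. series I a g (x + t *\<^sub>R ?e)) has_real_derivative series I a ?g1 x) (at 0)"
    by (simp add: DERIV_def)
  then show ?thesis by (simp add: has_partial_def has_real_derivative_iff_has_vector_derivative)
qed

lemma series_smooth:
  assumes o: "open S" and a: "(\<lambda>k. (a k)\<^sup>2) summable_on I" and l: "locally_l2 I S g"
    and h: "\<And>k. k \<in> I \<Longrightarrow> smooth_harmonic S (g k)"
  shows "smooth_on S (series I a g)"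
proof -
  have "cont_diff_on n S (series I a g)" if "locally_l2 I S g" "\<And>k. k \<in> I \<Longrightarrow> smooth_harmonic S (g k)" for n g
    using that
  proof (induction n arbitrary: g)
    case 0
    then show ?case
      by (simp, intro series_continuous[OF o a]) (auto intro: smooth_on_continuous harm_smooth)
  next
    case (Suc n)
    show ?case
    proof (rule cont_diff_on_SucI[OF o])
      show "continuous_on S (series I a g)"
        by (rule series_continuous[OF o a Suc.prems(1)]) (use Suc.prems(2) in \<open>auto intro: smooth_on_continuous harm_smooth\<close>)
      show "has_partial i (series I a g) (series I a (\<lambda>k. partial i (g k)) x) x" if "x \<in> S" for i x
        by (rule series_has_partial[OF o a Suc.prems that])
      show "cont_diff_on n S (series I a (\<lambda>k. partial i (g k)))" for i
        by (rule Suc.IH) (use Suc.prems in \<open>auto intro: locally_l2_partial harm_partial o\<close>)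
    qed
  qed
  then show ?thesis using l h by (auto simp: smooth_on_def)
qed

section \<open>Orthogonal series in \<open>L\<^sup>2\<close>\<close>

definition L2fun :: "'x measure \<Rightarrow> ('x \<Rightarrow> 'b::euclidean_space) \<Rightarrow> bool" where
  "L2fun M f \<longleftrightarrow> f \<in> borel_measurable M \<and> integrable M (\<lambda>x. (norm (f x))\<^sup>2)"

lemma L2fun_inner_integrable:
  assumes "L2fun M f" "L2fun M g" shows "integrable M (\<lambda>x. f x \<bullet> g x)"
proof (rule Bochner_Integration.integrable_bound)
  have m: "f \<in> borel_measurable M" "g \<in> borel_measurable M" using assms by (auto simp: L2fun_def)
  show "integrable M (\<lambda>x. norm (f x) * norm (g x))"
    by (rule integrable_product_L2) (use assms in \<open>auto simp: L2fun_def\<close>)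
  show "(\<lambda>x. f x \<bullet> g x) \<in> borel_measurable M" using m by (rule borel_measurable_inner)
qed (auto intro!: AE_I2 Cauchy_Schwarz_ineq2)

lemma L2fun_Cauchy_Schwarz:
  assumes "L2fun M f" "L2fun M g"
  shows "(LINT x|M. f x \<bullet> g x)\<^sup>2 \<le> (LINT x|M. (norm (f x))\<^sup>2) * (LINT x|M. (norm (g x))\<^sup>2)"
proof -
  have i: "integrable M (\<lambda>x. norm (f x) * norm (g x))"
    by (rule integrable_product_L2) (use assms in \<open>auto simp: L2fun_def\<close>)
  have "\<bar>LINT x|M. f x \<bullet> g x\<bar> \<le> (LINT x|M. norm (f x) * norm (g x))"
    by (rule order_trans[OF integral_abs_bound], rule integral_mono)
      (auto intro!: integrable_abs L2fun_inner_integrable assms i Cauchy_Schwarz_ineq2)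
  then have "(LINT x|M. f x \<bullet> g x)\<^sup>2 \<le> (LINT x|M. norm (f x) * norm (g x))\<^sup>2"
    by (metis abs_ge_zero power2_abs power_mono)
  also have "\<dots> \<le> (LINT x|M. (norm (f x))\<^sup>2) * (LINT x|M. (norm (g x))\<^sup>2)"
    by (rule Cauchy_Schwarz_integral) (use assms in \<open>auto simp: L2fun_def\<close>)
  finally show ?thesis .
qed

lemma L2fun_scaleR: "L2fun M f \<Longrightarrow> L2fun M (\<lambda>x. c *\<^sub>R f x)"
  by (auto simp: L2fun_def power_mult_distrib)

lemma L2fun_add:
  assumes "L2fun M f" "L2fun M g" shows "L2fun M (\<lambda>x. f x + g x)"
proof -
  have "(norm (f x + g x))\<^sup>2 = (norm (f x))\<^sup>2 + 2 * (f x \<bullet> g x) + (norm (g x))\<^sup>2" for x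
    by (simp add: power2_norm_eq_inner inner_add_left inner_add_right inner_commute)
  moreover have "integrable M (\<lambda>x. (norm (f x))\<^sup>2 + 2 * (f x \<bullet> g x) + (norm (g x))\<^sup>2)"
    using assms L2fun_inner_integrable[OF assms] by (auto simp: L2fun_def)
  ultimately show ?thesis using assms by (auto simp: L2fun_def)
qed

lemma L2fun_diff: "L2fun M f \<Longrightarrow> L2fun M g \<Longrightarrow> L2fun M (\<lambda>x. f x - g x)"
  using L2fun_add[of M f "\<lambda>x. -1 *\<^sub>R g x"] L2fun_scaleR[of M g "-1"] by simp

lemma L2fun_sum: "(\<And>k. k \<in> J \<Longrightarrow> L2fun M (f k)) \<Longrightarrow> L2fun M (\<lambda>x. \<Sum>k\<in>J. f k x)"
proof (induction J rule: infinite_finite_induct)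
  case (insert k J) then show ?case by (auto intro!: L2fun_add)
qed (auto simp: L2fun_def)

lemma integral_inner_sum:
  assumes "L2fun M f" "\<And>k. k \<in> J \<Longrightarrow> L2fun M (e k)"
  shows "(LINT x|M. f x \<bullet> (\<Sum>k\<in>J. a k *\<^sub>R e k x)) = (\<Sum>k\<in>J. a k * (LINT x|M. f x \<bullet> e k x))"
proof -
  have "(LINT x|M. f x \<bullet> (\<Sum>k\<in>J. a k *\<^sub>R e k x)) = (LINT x|M. (\<Sum>k\<in>J. a k * (f x \<bullet> e k x)))"
    by (simp add: inner_sum_right)
  also have "\<dots> = (\<Sum>k\<in>J. a k * (LINT x|M. f x \<bullet> e k x))"
    by (subst Bochner_Integration.integral_sum) (auto intro!: L2fun_inner_integrable assms)
  finally show ?thesis .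
qed

lemma orthogonal_sum_norm:
  assumes J: "finite J" and e: "\<And>k. k \<in> J \<Longrightarrow> L2fun M (e k)"
    and orth: "\<And>k l. k \<in> J \<Longrightarrow> l \<in> J \<Longrightarrow> k \<noteq> l \<Longrightarrow> (LINT x|M. e k x \<bullet> e l x) = 0"
  shows "(LINT x|M. (norm (\<Sum>k\<in>J. a k *\<^sub>R e k x))\<^sup>2) = (\<Sum>k\<in>J. (a k)\<^sup>2 * (LINT x|M. (norm (e k x))\<^sup>2))"
proof -
  have S: "L2fun M (\<lambda>x. \<Sum>k\<in>J. a k *\<^sub>R e k x)" by (intro L2fun_sum L2fun_scaleR e)
  have "(LINT x|M. (norm (\<Sum>k\<in>J. a k *\<^sub>R e k x))\<^sup>2) = (LINT x|M. (\<Sum>k\<in>J. a k *\<^sub>R e k x) \<bullet> (\<Sum>k\<in>J. a k *\<^sub>R e k x))"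
    by (simp add: power2_norm_eq_inner)
  also have "\<dots> = (\<Sum>k\<in>J. a k * (LINT x|M. (\<Sum>l\<in>J. a l *\<^sub>R e l x) \<bullet> e k x))"
    by (rule integral_inner_sum[OF S e])
  also have "\<dots> = (\<Sum>k\<in>J. a k * (\<Sum>l\<in>J. a l * (LINT x|M. e k x \<bullet> e l x)))"
    using integral_inner_sum[OF e e, where J = J and a = a] by (intro sum.cong refl) (simp add: inner_commute)
  also have "\<dots> = (\<Sum>k\<in>J. (a k)\<^sup>2 * (LINT x|M. (norm (e k x))\<^sup>2))"
  proof (rule sum.cong[OF refl])
    fix k assume k: "k \<in> J"
    have "(\<Sum>l\<in>J. a l * (LINT x|M. e k x \<bullet> e l x)) = (\<Sum>l\<in>J. if l = k then a l * (LINT x|M. e k x \<bullet> e l x) else 0)"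
      by (rule sum.cong) (use orth k in auto)
    also have "\<dots> = a k * (LINT x|M. e k x \<bullet> e k x)" using J k by simp
    finally show "a k * (\<Sum>l\<in>J. a l * (LINT x|M. e k x \<bullet> e l x)) = (a k)\<^sup>2 * (LINT x|M. (norm (e k x))\<^sup>2)"
      by (simp add: power2_eq_square dot_square_norm)
  qed
  finally show ?thesis .
qed

lemma Bessel_finite:
  assumes J: "finite J" and f: "L2fun M f" and e: "\<And>k. k \<in> J \<Longrightarrow> L2fun M (e k)"
    and orth: "\<And>k l. k \<in> J \<Longrightarrow> l \<in> J \<Longrightarrow> k \<noteq> l \<Longrightarrow> (LINT x|M. e k x \<bullet> e l x) = 0"
    and norm1: "\<And>k. k \<in> J \<Longrightarrow> (LINT x|M. (norm (e k x))\<^sup>2) = 1"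
  shows "(\<Sum>k\<in>J. (LINT x|M. f x \<bullet> e k x)\<^sup>2) \<le> (LINT x|M. (norm (f x))\<^sup>2)"
proof -
  define c where "c k = (LINT x|M. f x \<bullet> e k x)" for k
  let ?S = "\<lambda>x. \<Sum>k\<in>J. c k *\<^sub>R e k x"
  have S: "L2fun M ?S" by (intro L2fun_sum L2fun_scaleR e)
  have SS: "(LINT x|M. (norm (?S x))\<^sup>2) = (\<Sum>k\<in>J. (c k)\<^sup>2)"
    using orthogonal_sum_norm[OF J e orth] norm1 by simp
  have fS: "(LINT x|M. f x \<bullet> ?S x) = (\<Sum>k\<in>J. (c k)\<^sup>2)"
    using integral_inner_sum[OF f e, where J = J and a = c] by (simp add: c_def power2_eq_square)
  have "(\<Sum>k\<in>J. (c k)\<^sup>2)\<^sup>2 \<le> (LINT x|M. (norm (f x))\<^sup>2) * (\<Sum>k\<in>J. (c k)\<^sup>2)"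
    using L2fun_Cauchy_Schwarz[OF f S] unfolding SS fS .
  moreover have "0 \<le> (\<Sum>k\<in>J. (c k)\<^sup>2)" by (rule sum_nonneg) simp
  moreover have "0 \<le> (LINT x|M. (norm (f x))\<^sup>2)" by simp
  ultimately have "(\<Sum>k\<in>J. (c k)\<^sup>2) \<le> (LINT x|M. (norm (f x))\<^sup>2)"
    by (cases "(\<Sum>k\<in>J. (c k)\<^sup>2) = 0") (auto simp: power2_eq_square mult_le_cancel_right)
  then show ?thesis by (simp add: c_def)
qed

lemma countable_exhaustion:
  assumes "countable I"
  obtains J :: "nat \<Rightarrow> 'k set" where "filterlim J (finite_subsets_at_top I) sequentially" "\<And>n. finite (J n)" "\<And>n. J n \<subseteq> I"
proof -
  define J where "J n = {k \<in> I. to_nat_on I k \<le> n}" for n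
  have inj: "inj_on (to_nat_on I) I" using assms by (rule inj_on_to_nat_on)
  have fin: "finite (J n)" for n
  proof (rule finite_imageD)
    show "finite (to_nat_on I ` J n)" by (rule finite_subset[of _ "{..n}"]) (auto simp: J_def)
    show "inj_on (to_nat_on I) (J n)" by (rule inj_on_subset[OF inj]) (auto simp: J_def)
  qed
  have "filterlim J (finite_subsets_at_top I) sequentially"
    unfolding filterlim_finite_subsets_at_top
  proof (intro allI impI)
    fix X assume X: "finite X \<and> X \<subseteq> I"
    show "\<forall>\<^sub>F n in sequentially. finite (J n) \<and> X \<subseteq> J n \<and> J n \<subseteq> I"
    proof (rule eventually_sequentiallyI[of "Max (insert 0 (to_nat_on I ` X))"])
      fix n assume n: "Max (insert 0 (to_nat_on I ` X)) \<le> n"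
      then have "to_nat_on I k \<le> n" if "k \<in> X" for k using X that by auto
      then show "finite (J n) \<and> X \<subseteq> J n \<and> J n \<subseteq> I" using fin X by (auto simp: J_def)
    qed
  qed
  then show ?thesis by (rule that) (use fin in \<open>auto simp: J_def\<close>)
qed

text \<open>
  The sum is given pointwise, not as a limit in the norm, so Fatou's lemma replaces completeness of \<open>L\<^sup>2\<close>.
  Fatou needs a sequence of partial sums, which is why the index set is countable.
\<close>

lemma orthogonal_series_L2:
  assumes I: "countable I" and e: "\<And>k. k \<in> I \<Longrightarrow> L2fun M (e k)"
    and orth: "\<And>k l. k \<in> I \<Longrightarrow> l \<in> I \<Longrightarrow> k \<noteq> l \<Longrightarrow> (LINT x|M. e k x \<bullet> e l x) = 0"
    and B: "\<And>k. k \<in> I \<Longrightarrow> (LINT x|M. (norm (e k x))\<^sup>2) \<le> B" "B \<ge> 0"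
    and a: "(\<lambda>k. (a k)\<^sup>2) summable_on I"
    and G: "\<And>x. x \<in> space M \<Longrightarrow> ((\<lambda>k. a k *\<^sub>R e k x) has_sum G x) I" "G \<in> borel_measurable M"
  shows "L2fun M G" "(LINT x|M. (norm (G x))\<^sup>2) \<le> B * (\<Sum>\<^sub>\<infinity>k\<in>I. (a k)\<^sup>2)"
proof -
  define A where "A = (\<Sum>\<^sub>\<infinity>k\<in>I. (a k)\<^sup>2)"
  have A0: "A \<ge> 0" unfolding A_def by (rule infsum_nonneg) simp
  obtain J where J: "filterlim J (finite_subsets_at_top I) sequentially" "\<And>n. finite (J n)" "\<And>n. J n \<subseteq> I"
    using countable_exhaustion[OF I] by metis
  define S where "S n x = (\<Sum>k\<in>J n. a k *\<^sub>R e k x)" for n x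
  have SL: "L2fun M (S n)" for n unfolding S_def using J(3) by (intro L2fun_sum L2fun_scaleR e) auto
  have Sn: "(LINT x|M. (norm (S n x))\<^sup>2) \<le> B * A" for n
  proof -
    have "(LINT x|M. (norm (S n x))\<^sup>2) = (\<Sum>k\<in>J n. (a k)\<^sup>2 * (LINT x|M. (norm (e k x))\<^sup>2))"
      unfolding S_def by (rule orthogonal_sum_norm[OF J(2)]) (use e orth J(3) in blast)+
    also have "\<dots> \<le> (\<Sum>k\<in>J n. (a k)\<^sup>2 * B)" using B J(3) by (intro sum_mono mult_left_mono) auto
    also have "\<dots> = B * (\<Sum>k\<in>J n. (a k)\<^sup>2)" by (simp add: sum_distrib_left mult.commute)
    also have "\<dots> \<le> B * A" unfolding A_def using B(2) by (intro mult_left_mono finite_sum_le_infsum[OF a J(2,3)]) auto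
    finally show ?thesis .
  qed
  have lim: "(\<lambda>n. S n x) \<longlonglongrightarrow> G x" if "x \<in> space M" for x
    using filterlim_compose[OF G(1)[OF that, unfolded has_sum_def] J(1)] by (simp add: S_def)
  have "(\<integral>\<^sup>+ x. ennreal ((norm (G x))\<^sup>2) \<partial>M) = (\<integral>\<^sup>+ x. liminf (\<lambda>n. ennreal ((norm (S n x))\<^sup>2)) \<partial>M)"
  proof (rule nn_integral_cong)
    fix x assume "x \<in> space M"
    then have "(\<lambda>n. ennreal ((norm (S n x))\<^sup>2)) \<longlonglongrightarrow> ennreal ((norm (G x))\<^sup>2)" by (intro tendsto_ennrealI tendsto_intros lim)
    then show "ennreal ((norm (G x))\<^sup>2) = liminf (\<lambda>n. ennreal ((norm (S n x))\<^sup>2))"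
      by (intro lim_imp_Liminf[symmetric]) auto
  qed
  also have "\<dots> \<le> liminf (\<lambda>n. \<integral>\<^sup>+ x. ennreal ((norm (S n x))\<^sup>2) \<partial>M)"
    by (rule nn_integral_liminf) (use SL in \<open>auto simp: L2fun_def\<close>)
  also have "\<dots> \<le> liminf (\<lambda>n::nat. ennreal (B * A))"
  proof (rule Liminf_mono, rule always_eventually, rule allI)
    fix n
    have "(\<integral>\<^sup>+ x. ennreal ((norm (S n x))\<^sup>2) \<partial>M) = ennreal (LINT x|M. (norm (S n x))\<^sup>2)"
      by (rule nn_integral_eq_integral) (use SL in \<open>auto simp: L2fun_def\<close>)
    then show "(\<integral>\<^sup>+ x. ennreal ((norm (S n x))\<^sup>2) \<partial>M) \<le> ennreal (B * A)" using Sn[of n] by (simp add: ennreal_leI)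
  qed
  also have "\<dots> = ennreal (B * A)" by (simp add: Liminf_const)
  finally have nn: "(\<integral>\<^sup>+ x. ennreal ((norm (G x))\<^sup>2) \<partial>M) \<le> ennreal (B * A)" .
  have int: "integrable M (\<lambda>x. (norm (G x))\<^sup>2)"
  proof (rule integrableI_bounded)
    show "(\<integral>\<^sup>+ x. ennreal (norm ((norm (G x))\<^sup>2)) \<partial>M) < \<infinity>"
      using nn by (simp add: order_le_less_trans)
  qed (use G(2) in auto)
  then show "L2fun M G" using G(2) by (simp add: L2fun_def)
  have "ennreal (LINT x|M. (norm (G x))\<^sup>2) \<le> ennreal (B * A)"
    using nn nn_integral_eq_integral[OF int] by simp
  then show "(LINT x|M. (norm (G x))\<^sup>2) \<le> B * (\<Sum>\<^sub>\<infinity>k\<in>I. (a k)\<^sup>2)"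
    using B(2) A0 by (simp add: A_def[symmetric] ennreal_le_iff)
qed

text \<open>
  The norm bound, applied to the tails of the series, shows that the scalar products with the partial
  sums converge.
\<close>

lemma orthogonal_series_inner:
  assumes I: "countable I" and e: "\<And>k. k \<in> I \<Longrightarrow> L2fun M (e k)"
    and orth: "\<And>k l. k \<in> I \<Longrightarrow> l \<in> I \<Longrightarrow> k \<noteq> l \<Longrightarrow> (LINT x|M. e k x \<bullet> e l x) = 0"
    and B: "\<And>k. k \<in> I \<Longrightarrow> (LINT x|M. (norm (e k x))\<^sup>2) \<le> B" "B \<ge> 0"
    and a: "(\<lambda>k. (a k)\<^sup>2) summable_on I"
    and G: "\<And>x. x \<in> space M \<Longrightarrow> ((\<lambda>k. a k *\<^sub>R e k x) has_sum G x) I" "G \<in> borel_measurable M"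
    and f: "L2fun M f"
  shows "((\<lambda>k. a k * (LINT x|M. f x \<bullet> e k x)) has_sum (LINT x|M. f x \<bullet> G x)) I"
proof -
  define N where "N = sqrt (LINT x|M. (norm (f x))\<^sup>2) * sqrt B"
  have GL: "L2fun M G" by (rule orthogonal_series_L2(1)[OF assms(1-8)])
  have bound: "\<bar>(\<Sum>k\<in>J. a k * (LINT x|M. f x \<bullet> e k x)) - (LINT x|M. f x \<bullet> G x)\<bar>
      \<le> N * sqrt ((\<Sum>\<^sub>\<infinity>k\<in>I. (a k)\<^sup>2) - (\<Sum>k\<in>J. (a k)\<^sup>2))" if J: "finite J" "J \<subseteq> I" for J
  proof -
    let ?S = "\<lambda>x. \<Sum>k\<in>J. a k *\<^sub>R e k x"
    have S: "L2fun M ?S" using J by (intro L2fun_sum L2fun_scaleR e) auto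
    have D: "((\<lambda>k. a k *\<^sub>R e k x) has_sum (G x - ?S x)) (I - J)" if "x \<in> space M" for x
      by (rule has_sum_Diff[OF G(1)[OF that] has_sum_finite[OF J(1)] J(2)])
    have GS: "L2fun M (\<lambda>x. G x - ?S x)" by (rule L2fun_diff[OF GL S])
    have n: "(LINT x|M. (norm (G x - ?S x))\<^sup>2) \<le> B * (\<Sum>\<^sub>\<infinity>k\<in>I - J. (a k)\<^sup>2)"
      by (rule orthogonal_series_L2(2)[where e = e and M = M])
        (use I e orth B l2_tail(1)[OF a J] D GS in \<open>auto simp: L2fun_def\<close>)
    have "(LINT x|M. f x \<bullet> G x) - (\<Sum>k\<in>J. a k * (LINT x|M. f x \<bullet> e k x)) = (LINT x|M. f x \<bullet> (G x - ?S x))"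
      using integral_inner_sum[OF f e, where J = J and a = a] J(2) L2fun_inner_integrable[OF f GL] L2fun_inner_integrable[OF f S]
      by (simp add: inner_diff_right subset_iff)
    then have "\<bar>(\<Sum>k\<in>J. a k * (LINT x|M. f x \<bullet> e k x)) - (LINT x|M. f x \<bullet> G x)\<bar> = sqrt ((LINT x|M. f x \<bullet> (G x - ?S x))\<^sup>2)"
      by (simp add: abs_minus_commute)
    also have "\<dots> \<le> sqrt ((LINT x|M. (norm (f x))\<^sup>2) * (LINT x|M. (norm (G x - ?S x))\<^sup>2))"
      by (rule real_sqrt_le_mono[OF L2fun_Cauchy_Schwarz[OF f GS]])
    also have "\<dots> \<le> sqrt ((LINT x|M. (norm (f x))\<^sup>2) * (B * (\<Sum>\<^sub>\<infinity>k\<in>I - J. (a k)\<^sup>2)))"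
      by (intro real_sqrt_le_mono mult_left_mono n) simp
    finally show ?thesis unfolding l2_tail(2)[OF a J] N_def by (simp add: real_sqrt_mult mult.assoc)
  qed
  show ?thesis unfolding has_sum_def
  proof (rule LIM_zero_cancel, rule Lim_null_comparison)
    show "\<forall>\<^sub>F J in finite_subsets_at_top I. norm ((\<Sum>k\<in>J. a k * (LINT x|M. f x \<bullet> e k x)) - (LINT x|M. f x \<bullet> G x))
        \<le> N * sqrt ((\<Sum>\<^sub>\<infinity>k\<in>I. (a k)\<^sup>2) - (\<Sum>k\<in>J. (a k)\<^sup>2))"
      by (rule eventually_finite_subsets_at_top_weakI) (use bound in auto)
  qed (rule l2_tail_tendsto[OF a])
qed

section \<open>Monogenic functions as gradient fields\<close>

lemma sum_UNIV_4: "(\<Sum>i\<in>(UNIV::4 set). f i) = f 0 + f 1 + f 2 + (f 3 :: 'a::comm_monoid_add)"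
proof -
  have "f 4 = f 0" by (rule arg_cong[where f = f]) simp
  then show ?thesis unfolding sum_4 by (simp add: add_ac)
qed

lemma inner_quat: "p \<bullet> q = p $ 0 * q $ 0 + p $ 1 * q $ 1 + p $ 2 * q $ 2 + p $ 3 * q $ 3" for p q :: quat
  by (simp add: inner_vec_def sum_UNIV_4)

lemma qvec_nth [simp]: "qvec q $ 0 = 0" "qvec q $ 1 = q $ 1" "qvec q $ 2 = q $ 2" "qvec q $ 3 = 0"
  by (simp_all add: qvec_def axis_def)

lemma reduced_vec_iff: "q \<in> reduced_vec \<longleftrightarrow> q $ 0 = 0 \<and> q $ 3 = 0"
proof
  assume "q \<in> reduced_vec" then show "q $ 0 = 0 \<and> q $ 3 = 0" by (auto simp: reduced_vec_def axis_def)
next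
  assume "q $ 0 = 0 \<and> q $ 3 = 0"
  then have "q = q $ 1 *\<^sub>R unitq 1 + q $ 2 *\<^sub>R unitq 2" by (simp add: quat_eq_iff axis_def)
  then show "q \<in> reduced_vec" unfolding reduced_vec_def by blast
qed

lemma qvec_reduced: "qvec q \<in> reduced_vec" by (simp add: reduced_vec_iff)

lemma norm_qvec_le: "norm (qvec q) \<le> norm q"
  by (simp add: norm_eq_sqrt_inner inner_quat)

lemma bounded_linear_qvec: "bounded_linear qvec"
  by (rule bounded_linear_intro[where K = 1]) (auto simp: quat_eq_iff norm_qvec_le)

lemma qvec_linear: "qvec (a *\<^sub>R p + b *\<^sub>R q) = a *\<^sub>R qvec p + b *\<^sub>R qvec q"
  by (simp add: quat_eq_iff)

lemma smooth_on_nth: "open S \<Longrightarrow> smooth_on S f \<Longrightarrow> smooth_on S (\<lambda>x. f x $ j)" for f :: "real^3 \<Rightarrow> quat"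
  by (rule smooth_on_bounded_linear[OF _ bounded_linear_vec_nth])

lemma partial_nth: "smooth_on S f \<Longrightarrow> x \<in> S \<Longrightarrow> partial i (\<lambda>x. f x $ j) x = partial i f x $ j" for f :: "real^3 \<Rightarrow> quat"
  by (rule partial_bounded_linear[OF bounded_linear_vec_nth])

lemma smooth_on_quat:
  assumes "open S" "smooth_on S a" "smooth_on S b" "smooth_on S c" "smooth_on S d"
  shows "smooth_on S (\<lambda>x. quat (a x) (b x) (c x) (d x))"
  unfolding quat_def
  by (intro smooth_on_add assms(1) smooth_on_bounded_linear[OF assms(1) bounded_linear_scaleR_left] assms)

text \<open>The sign change turns \<open>\<partial> U\<close> into \<open>\<nabla>U\<close>.\<close>

definition vec_field :: "(real^3 \<Rightarrow> quat) \<Rightarrow> 3 \<Rightarrow> real^3 \<Rightarrow> real" where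
  "vec_field f i x = (if i = 0 then f x $ 0 else if i = 1 then - f x $ 1 else - f x $ 2)"

lemma vec_field_simps: "vec_field f 0 x = f x $ 0" "vec_field f 1 x = - f x $ 1" "vec_field f 2 x = - f x $ 2"
  using distinct_3 by (auto simp: vec_field_def)

text \<open>
  The four components of \<open>dbar f\<close> are the divergence and, up to sign, the curl of the field.
\<close>

lemma monogenic_iff_grad_field:
  assumes o: "open S" and s: "smooth_on S f" and r: "\<And>x. x \<in> S \<Longrightarrow> f x $ 3 = 0"
  shows "(\<forall>x\<in>S. dbar f x = 0) \<longleftrightarrow> grad_field S (vec_field f)"
proof -
  have sf: "smooth_on S (\<lambda>x. f x $ j)" for j by (rule smooth_on_nth[OF o s])
  have sv: "smooth_on S (vec_field f i)" for i
    unfolding vec_field_def[abs_def] using sf smooth_on_cmult[OF o sf, of "-1"] by (cases "i = 0"; cases "i = 1") simp_all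
  have p: "partial i (vec_field f 0) x = partial i f x $ 0" "partial i (vec_field f 1) x = - partial i f x $ 1"
    "partial i (vec_field f 2) x = - partial i f x $ 2" if x: "x \<in> S" for i x
    using partial_cmult[OF sf x, of i "-1"] partial_nth[OF s x, of i] unfolding vec_field_simps[abs_def] by simp_all
  have p3: "partial i f x $ 3 = 0" if x: "x \<in> S" for i x
  proof -
    have "partial i (\<lambda>x. f x $ 3) x = partial i (\<lambda>x. 0) x" by (rule partial_cong_open[OF o x]) (rule r)
    then show ?thesis using partial_nth[OF s x, of i 3] has_partial_imp[OF has_partial_const] by metis
  qed
  have "dbar f x = 0 \<longleftrightarrow> (\<forall>i j. partial i (vec_field f j) x = partial j (vec_field f i) x) \<and> (\<Sum>i\<in>UNIV. partial i (vec_field f i) x) = 0"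
    if x: "x \<in> S" for x
  proof -
    have all: "(\<forall>i j. P i j) \<longleftrightarrow> P 0 0 \<and> P 0 1 \<and> P 0 2 \<and> P 1 0 \<and> P 1 1 \<and> P 1 2 \<and> P 2 0 \<and> P 2 1 \<and> P 2 2" for P :: "3 \<Rightarrow> 3 \<Rightarrow> bool"
    proof -
      have "(\<forall>i. Q i) \<longleftrightarrow> Q 0 \<and> Q 1 \<and> Q 2" for Q :: "3 \<Rightarrow> bool"
        using UNIV_3' by (metis UNIV_I insert_iff singletonD)
      then show ?thesis by simp
    qed
    have "dbar f x = 0 \<longleftrightarrow> partial 0 f x $ 0 - partial 1 f x $ 1 - partial 2 f x $ 2 = 0 \<and> partial 0 f x $ 1 + partial 1 f x $ 0 = 0
       \<and> partial 0 f x $ 2 + partial 2 f x $ 0 = 0 \<and> partial 1 f x $ 2 - partial 2 f x $ 1 = 0"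
      by (simp add: dbar_def qmult_def quat_eq_iff p3[OF x]) (simp add: axis_def)
    then show ?thesis unfolding all sum_UNIV_3 p[OF x] by (simp only:) (rule iffI; elim conjE; intro conjI; linarith)
  qed
  then show ?thesis unfolding grad_field_def using sv by auto
qed

lemma monogenic_space_grad_field:
  assumes "f \<in> monogenic_space \<sigma>" shows "grad_field (dom3 \<sigma>) (vec_field f)"
  using assms monogenic_iff_grad_field[OF open_dom3, of \<sigma> f]
  by (auto simp: monogenic_space_def monogenic_on_def reduced_quat_def)

lemma L2_space_L2fun:
  assumes "f \<in> L2_space \<sigma> A" shows "L2fun (lebesgue_on (dom3 \<sigma>)) f"
  using assms by (auto simp: L2_space_def L2fun_def)

lemma space_dom3: "space (lebesgue_on (dom3 \<sigma>)) = dom3 \<sigma>" by (simp add: space_restrict_space)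

lemma L2fun_cong:
  assumes "\<And>x. x \<in> space M \<Longrightarrow> f x = g x" shows "L2fun M f \<longleftrightarrow> L2fun M g"
  unfolding L2fun_def using assms
  by (intro conj_cong measurable_cong Bochner_Integration.integrable_cong) auto

lemma L2fun_nth:
  fixes f :: "'x \<Rightarrow> quat"
  assumes "L2fun M f" shows "f \<in> borel_measurable M" "(\<lambda>x. f x $ j) \<in> borel_measurable M" "integrable M (\<lambda>x. (f x $ j)\<^sup>2)"
proof -
  show m: "f \<in> borel_measurable M" using assms by (simp add: L2fun_def)
  have c: "continuous_on UNIV (\<lambda>q::quat. q $ j)" by (intro continuous_intros)
  show mj: "(\<lambda>x. f x $ j) \<in> borel_measurable M" by (rule borel_measurable_continuous_on[OF c m])
  show "integrable M (\<lambda>x. (f x $ j)\<^sup>2)"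
  proof (rule Bochner_Integration.integrable_bound)
    show "integrable M (\<lambda>x. (norm (f x))\<^sup>2)" using assms by (simp add: L2fun_def)
    show "AE x in M. norm ((f x $ j)\<^sup>2) \<le> norm ((norm (f x))\<^sup>2)"
      using component_le_norm_cart by (auto intro!: AE_I2 simp: abs_le_square_iff[symmetric])
  qed (use mj in auto)
qed

lemma L2fun_qvec: assumes "L2fun M f" shows "L2fun M (\<lambda>x. qvec (f x))"
proof -
  have c: "continuous_on UNIV qvec" using bounded_linear_qvec by (rule linear_continuous_on)
  have m: "(\<lambda>x. qvec (f x)) \<in> borel_measurable M" by (rule borel_measurable_continuous_on[OF c]) (use assms in \<open>simp add: L2fun_def\<close>)
  have "integrable M (\<lambda>x. (norm (qvec (f x)))\<^sup>2)"
  proof (rule Bochner_Integration.integrable_bound)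
    show "integrable M (\<lambda>x. (norm (f x))\<^sup>2)" using assms by (simp add: L2fun_def)
    show "AE x in M. norm ((norm (qvec (f x)))\<^sup>2) \<le> norm ((norm (f x))\<^sup>2)"
      by (auto intro!: AE_I2 power_mono norm_qvec_le)
  qed (use m in auto)
  then show ?thesis using m by (simp add: L2fun_def)
qed

lemma inner_L2_eq:
  assumes "\<And>x. x \<in> dom3 \<sigma> \<Longrightarrow> u x $ 3 = 0 \<or> v x $ 3 = 0"
  shows "inner_L2 \<sigma> u v = (LINT x|lebesgue_on (dom3 \<sigma>). u x \<bullet> v x)"
  unfolding inner_L2_def by (rule Bochner_Integration.integral_cong) (use assms in \<open>auto simp: space_dom3 inner_quat\<close>)

section \<open>The normalized monogenic basis\<close>

fun vec_norm :: "side \<Rightarrow> int \<times> nat \<times> parity \<Rightarrow> real" where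
  "vec_norm \<sigma> (n, m, s) = norm_L2 \<sigma> (\<lambda>y. qvec (monogenic_basis n m s y))"

text \<open>
  A partial derivative of \<open>U\<close>, divided by the norm of the vector part of \<open>\<partial> U\<close>. The scalar part is divided by
  the same number, so that expansions of vector parts lift to expansions of monogenic functions.
\<close>

fun npartial :: "side \<Rightarrow> 3 \<Rightarrow> int \<times> nat \<times> parity \<Rightarrow> real^3 \<Rightarrow> real" where
  "npartial \<sigma> i (n, m, s) x = (1 / vec_norm \<sigma> (n, m, s)) * partial i (solid_harmonic (n + 1) m s) x"

definition mono_elem :: "side \<Rightarrow> int \<times> nat \<times> parity \<Rightarrow> real^3 \<Rightarrow> quat" where
  "mono_elem \<sigma> k x = quat (npartial \<sigma> 0 k x) (- npartial \<sigma> 1 k x) (- npartial \<sigma> 2 k x) 0"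

lemma basis_index_valid: "(n, m, s) \<in> basis_index \<sigma> \<Longrightarrow> valid_index \<sigma> n m"
  by (auto simp: basis_index_def valid_index_def)

lemma countable_basis_index: "countable (basis_index \<sigma>)"
proof (rule countable_subset)
  have "(UNIV :: parity set) = {Plus, Minus}" using parity.exhaust by auto
  then have "countable (UNIV :: parity set)" by (metis countable_empty countable_insert)
  then show "countable (UNIV \<times> UNIV \<times> UNIV :: (int \<times> nat \<times> parity) set)" by (intro countable_SIGMA) auto
qed auto

lemma monogenic_basis_eq:
  fixes s :: parity
  assumes v: "valid_index \<sigma> n m" and x: "x \<in> dom3 \<sigma>"
  defines "U \<equiv> solid_harmonic (n + 1) m s"
  shows "monogenic_basis n m s x = quat (partial 0 U x) (- partial 1 U x) (- partial 2 U x) 0"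
proof -
  have sU: "smooth_on (cone_dom \<sigma>) U" unfolding U_def by (rule harm_smooth[OF valid_solid(1)[OF v]])
  have xc: "x \<in> cone_dom \<sigma>" using x dom3_subset_cone by blast
  have "partial i (\<lambda>x. U x *\<^sub>R unitq 0) x = partial i U x *\<^sub>R unitq 0" for i
    by (rule partial_bounded_linear[OF bounded_linear_scaleR_left sU xc])
  then show ?thesis
    unfolding monogenic_basis_def dconj_def U_def[symmetric]
    by (simp add: qmult_def quat_eq_iff) (simp add: axis_def)
qed

lemma valid_dominated:
  assumes v: "valid_index \<sigma> n m" shows "dominated \<sigma> (partial i (solid_harmonic (n + 1) m s))"
proof -
  have "homog \<sigma> n (partial i (solid_harmonic (n + 1) m s))" using homog_partial[OF valid_solid(2)[OF v]] by simp
  then show ?thesis by (rule homog_dominated) (use v in \<open>auto simp: valid_index_def\<close>)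
qed

lemma vec_norm_sq:
  assumes v: "valid_index \<sigma> n m"
  shows "(vec_norm \<sigma> (n, m, s))\<^sup>2 = vector_form \<sigma> (solid_harmonic (n + 1) m s) (solid_harmonic (n + 1) m s)"
    "vec_norm \<sigma> (n, m, s) \<ge> 0"
proof -
  have eq: "inner_L2 \<sigma> (\<lambda>y. qvec (monogenic_basis n m s y)) (\<lambda>y. qvec (monogenic_basis n m s y))
      = vector_form \<sigma> (solid_harmonic (n + 1) m s) (solid_harmonic (n + 1) m s)"
    unfolding inner_L2_def vector_form_def
    by (rule Bochner_Integration.integral_cong) (auto simp: space_dom3 monogenic_basis_eq[OF v])
  have "vector_form \<sigma> (solid_harmonic (n + 1) m s) (solid_harmonic (n + 1) m s) \<ge> 0"
    unfolding vector_form_def by (rule Bochner_Integration.integral_nonneg) simp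
  then show "(vec_norm \<sigma> (n, m, s))\<^sup>2 = vector_form \<sigma> (solid_harmonic (n + 1) m s) (solid_harmonic (n + 1) m s)" "vec_norm \<sigma> (n, m, s) \<ge> 0"
    unfolding vec_norm.simps norm_L2_def eq by simp_all
qed

text \<open>
  By the interior estimate, a vector part with norm zero would vanish identically, and such indices are
  excluded from \<open>basis_index\<close>.
\<close>

lemma vec_norm_pos:
  assumes k: "k \<in> basis_index \<sigma>" shows "vec_norm \<sigma> k > 0"
proof -
  obtain n m s where k_eq: "k = (n, m, s)" by (cases k)
  have v: "valid_index \<sigma> n m" using k basis_index_valid k_eq by blast
  obtain x where x: "x \<in> dom3 \<sigma>" "qvec (monogenic_basis n m s x) \<noteq> 0" using k by (auto simp: k_eq basis_index_def)
  let ?U = "solid_harmonic (n + 1) m s"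
  have ne: "partial 1 ?U x \<noteq> 0 \<or> partial 2 ?U x \<noteq> 0"
    using x(2) unfolding monogenic_basis_eq[OF v x(1)] by (auto simp: quat_eq_iff)
  have h: "smooth_harmonic (dom3 \<sigma>) (partial i ?U)" for i
    by (rule harm_subset[OF harm_partial[OF open_cone_dom valid_solid(1)[OF v]] dom3_subset_cone])
  have int: "integrable (lebesgue_on (dom3 \<sigma>)) (\<lambda>x. (partial i ?U x)\<^sup>2)" for i
    by (rule dominated_L2(2)[OF valid_dominated[OF v]])
  obtain d where d: "d > 0" "cball x d \<subseteq> dom3 \<sigma>" using open_dom3 x(1) open_contains_cball by blast
  have sup: "(partial i ?U x)\<^sup>2 \<le> sup_const / d ^ 3 * (LINT y|lebesgue_on (dom3 \<sigma>). (partial i ?U y)\<^sup>2)" for i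
    using harm_sup_L2[OF open_dom3 d(2,1) h integrable_dom3_iff[THEN iffD1, OF int], of i] unfolding integral_dom3_eq .
  have vf: "vector_form \<sigma> ?U ?U = (LINT y|lebesgue_on (dom3 \<sigma>). (partial 1 ?U y)\<^sup>2) + (LINT y|lebesgue_on (dom3 \<sigma>). (partial 2 ?U y)\<^sup>2)"
    unfolding vector_form_def using int by (simp flip: power2_eq_square)
  have "vec_norm \<sigma> k \<noteq> 0"
  proof
    assume "vec_norm \<sigma> k = 0"
    then have "vector_form \<sigma> ?U ?U = 0" using vec_norm_sq(1)[OF v, of s] by (simp add: k_eq)
    moreover have "0 \<le> (LINT y|lebesgue_on (dom3 \<sigma>). (partial 1 ?U y)\<^sup>2)" "0 \<le> (LINT y|lebesgue_on (dom3 \<sigma>). (partial 2 ?U y)\<^sup>2)" by simp_all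
    ultimately have "(LINT y|lebesgue_on (dom3 \<sigma>). (partial 1 ?U y)\<^sup>2) = 0" "(LINT y|lebesgue_on (dom3 \<sigma>). (partial 2 ?U y)\<^sup>2) = 0"
      unfolding vf by linarith+
    then show False using sup[of 1] sup[of 2] ne by simp
  qed
  then show ?thesis using vec_norm_sq(2)[OF v, of s] unfolding k_eq by linarith
qed

lemma vec_basis_eq:
  assumes k: "k \<in> basis_index \<sigma>" and x: "x \<in> dom3 \<sigma>"
  shows "vec_basis \<sigma> k x = qvec (mono_elem \<sigma> k x)"
proof -
  obtain n m s where k_eq: "k = (n, m, s)" by (cases k)
  have v: "valid_index \<sigma> n m" using k basis_index_valid k_eq by blast
  show ?thesis
    unfolding k_eq mono_elem_def vec_basis.simps vec_norm.simps[symmetric] monogenic_basis_eq[OF v x]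
    by (simp add: quat_eq_iff)
qed

lemma npartial_facts:
  assumes k: "k \<in> basis_index \<sigma>"
  shows "smooth_harmonic (dom3 \<sigma>) (npartial \<sigma> i k)" "dominated \<sigma> (npartial \<sigma> i k)"
    "x \<in> dom3 \<sigma> \<Longrightarrow> partial j (npartial \<sigma> i k) x = partial i (npartial \<sigma> j k) x"
    "x \<in> dom3 \<sigma> \<Longrightarrow> (\<Sum>i\<in>UNIV. partial i (npartial \<sigma> i k) x) = 0"
proof -
  obtain n m s where k_eq: "k = (n, m, s)" by (cases k)
  have v: "valid_index \<sigma> n m" using k basis_index_valid k_eq by blast
  let ?U = "solid_harmonic (n + 1) m s" and ?c = "1 / vec_norm \<sigma> (n, m, s)"
  have eq: "npartial \<sigma> i k = (\<lambda>x. ?c * partial i ?U x)" for i by (rule ext) (simp add: k_eq del: vec_norm.simps)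
  have hU: "smooth_harmonic (dom3 \<sigma>) ?U" by (rule harm_subset[OF valid_solid(1)[OF v] dom3_subset_cone])
  show "smooth_harmonic (dom3 \<sigma>) (npartial \<sigma> i k)" unfolding eq by (intro harm_cmult harm_partial open_dom3 hU)
  show "dominated \<sigma> (npartial \<sigma> i k)" unfolding eq by (rule dominated_cmult[OF valid_dominated[OF v]])
  have p: "partial j (npartial \<sigma> i k) x = ?c * partial j (partial i ?U) x" if "x \<in> dom3 \<sigma>" for i j x
    unfolding eq by (rule partial_cmult[OF smooth_on_partial[OF harm_smooth[OF hU]] that])
  show "partial j (npartial \<sigma> i k) x = partial i (npartial \<sigma> j k) x" if x: "x \<in> dom3 \<sigma>"
    unfolding p[OF x] partial_commute[OF open_dom3 x smooth_on_cont_diff[OF harm_smooth[OF hU]], of j i] ..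
  show "(\<Sum>i\<in>UNIV. partial i (npartial \<sigma> i k) x) = 0" if x: "x \<in> dom3 \<sigma>"
    unfolding p[OF x] sum_distrib_left[symmetric] harm_laplace[OF hU x] by simp
qed

lemma mono_elem_L2: assumes k: "k \<in> basis_index \<sigma>" shows "L2fun (lebesgue_on (dom3 \<sigma>)) (mono_elem \<sigma> k)"
proof -
  have c: "continuous_on (dom3 \<sigma>) (npartial \<sigma> i k)" for i using npartial_facts(2)[OF k] by (simp add: dominated_def)
  have "continuous_on (dom3 \<sigma>) (mono_elem \<sigma> k)" unfolding mono_elem_def[abs_def] quat_def by (intro continuous_intros c)
  then have "mono_elem \<sigma> k \<in> borel_measurable (lebesgue_on (dom3 \<sigma>))" by (rule borel_dom3_continuous)
  moreover have "(norm (mono_elem \<sigma> k x))\<^sup>2 = (npartial \<sigma> 0 k x)\<^sup>2 + (npartial \<sigma> 1 k x)\<^sup>2 + (npartial \<sigma> 2 k x)\<^sup>2" for x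
    unfolding power2_norm_eq_inner inner_quat by (simp add: mono_elem_def power2_eq_square)
  ultimately show ?thesis
    unfolding L2fun_def by (simp add: dominated_L2(2)[OF npartial_facts(2)[OF k]])
qed

text \<open>
  The bound for the full functions is \<open>\<parallel>Sc X\<parallel>\<^sup>2 + \<parallel>Vec X\<parallel>\<^sup>2 \<le> 3 \<parallel>Vec X\<parallel>\<^sup>2\<close>. Degree \<open>0\<close>, where \<open>scalar_part_bound\<close> does
  not apply, is treated by hand: the functions \<open>\<partial> U\<close> are constants, and they have a vector part only for \<open>m = 1\<close>,
  in which case the scalar part is zero.
\<close>

lemma mono_elem_gram:
  assumes k: "k \<in> basis_index \<sigma>" and l: "l \<in> basis_index \<sigma>"
  shows "(LINT x|lebesgue_on (dom3 \<sigma>). qvec (mono_elem \<sigma> k x) \<bullet> qvec (mono_elem \<sigma> l x)) = (if k = l then 1 else 0)"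
    "k \<noteq> l \<Longrightarrow> (LINT x|lebesgue_on (dom3 \<sigma>). mono_elem \<sigma> k x \<bullet> mono_elem \<sigma> l x) = 0"
    "(LINT x|lebesgue_on (dom3 \<sigma>). (norm (mono_elem \<sigma> k x))\<^sup>2) \<le> 3"
proof -
  let ?M = "lebesgue_on (dom3 \<sigma>)"
  obtain n m s where k_eq: "k = (n, m, s)" by (cases k)
  obtain n' m' s' where l_eq: "l = (n', m', s')" by (cases l)
  have v: "valid_index \<sigma> n m" and v': "valid_index \<sigma> n' m'" using k l basis_index_valid k_eq l_eq by blast+
  let ?U = "solid_harmonic (n + 1) m s" and ?V = "solid_harmonic (n' + 1) m' s'"
  let ?c = "1 / vec_norm \<sigma> k" and ?d = "1 / vec_norm \<sigma> l"
  have np: "npartial \<sigma> i k = (\<lambda>x. ?c * partial i ?U x)" "npartial \<sigma> i l = (\<lambda>x. ?d * partial i ?V x)" for i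
    by (auto simp: k_eq l_eq simp del: vec_norm.simps)
  have pos: "vec_norm \<sigma> k > 0" "vec_norm \<sigma> l > 0" using vec_norm_pos k l by auto
  have vec: "(LINT x|?M. qvec (mono_elem \<sigma> k x) \<bullet> qvec (mono_elem \<sigma> l x)) = ?c * ?d * vector_form \<sigma> ?U ?V"
    unfolding vector_form_def integral_mult_right_zero[symmetric] mono_elem_def np
    by (rule Bochner_Integration.integral_cong) (simp_all add: inner_quat algebra_simps)
  show "(LINT x|?M. qvec (mono_elem \<sigma> k x) \<bullet> qvec (mono_elem \<sigma> l x)) = (if k = l then 1 else 0)"
  proof (cases "k = l")
    case True
    then have "vector_form \<sigma> ?U ?V = (vec_norm \<sigma> k)\<^sup>2" using vec_norm_sq(1)[OF v, of s] by (simp add: k_eq l_eq)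
    then show ?thesis unfolding vec using True pos by (simp add: power2_eq_square)
  next
    case False
    then have "vector_form \<sigma> ?U ?V = 0" using solid_forms_orthogonal(2)[OF v v', of s s'] k_eq l_eq by auto
    then show ?thesis unfolding vec using False by simp
  qed
  have iU: "integrable ?M (\<lambda>x. partial i ?U x * partial j ?V x)" for i j
    by (rule dominated_mult_integrable[OF valid_dominated[OF v] valid_dominated[OF v']])
  have full: "(LINT x|?M. mono_elem \<sigma> k x \<bullet> mono_elem \<sigma> l x) = ?c * ?d * (scalar_form \<sigma> ?U ?V + vector_form \<sigma> ?U ?V)"
  proof -
    have "scalar_form \<sigma> ?U ?V + vector_form \<sigma> ?U ?V = (LINT x|?M. partial 0 ?U x * partial 0 ?V x + (partial 1 ?U x * partial 1 ?V x + partial 2 ?U x * partial 2 ?V x))"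
      unfolding scalar_form_def vector_form_def
      by (rule Bochner_Integration.integral_add[symmetric]) (intro Bochner_Integration.integrable_add iU)+
    then show ?thesis
      by (simp only: integral_mult_right_zero[symmetric] mono_elem_def np)
        (rule Bochner_Integration.integral_cong, simp_all add: inner_quat algebra_simps)
  qed
  show "(LINT x|?M. mono_elem \<sigma> k x \<bullet> mono_elem \<sigma> l x) = 0" if "k \<noteq> l"
    unfolding full using solid_forms_orthogonal[OF v v', of s s'] that k_eq l_eq by auto
  have iUU: "integrable ?M (\<lambda>x. partial i ?U x * partial j ?U x)" for i j
    by (rule dominated_mult_integrable[OF valid_dominated[OF v] valid_dominated[OF v]])
  have sc: "scalar_form \<sigma> ?U ?U \<le> 2 * vector_form \<sigma> ?U ?U"
  proof (cases "n = 0")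
    case False
    have nd: "n \<in> degree_set \<sigma>" using v by (simp add: valid_index_def)
    show ?thesis
      using scalar_part_bound[OF valid_solid(2)[OF v] valid_solid(1)[OF v] nd False]
      unfolding scalar_form_def vector_form_def power2_eq_square .
  next
    case True
    then have \<sigma>: "\<sigma> = Interior" using v by (cases \<sigma>) (auto simp: valid_index_def)
    then have m1: "m \<le> 1" using v True by (simp add: valid_index_def)
    have vec0: "vector_form \<sigma> ?U ?U \<ge> 0" unfolding vector_form_def by (rule Bochner_Integration.integral_nonneg) simp
    have axial: "solid_harmonic 1 m s x = (\<Sum>j\<le>1 - m. ((-1) ^ m * leg_coeff 1 m j) * ((x $ 0) ^ j * ((norm x)\<^sup>2) ^ ((1 - m - j) div 2) * az_poly m s x))" for x
      using solid_harmonic_polynomial[OF m1, of s x] by simp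
    show ?thesis
    proof (cases "m = 0")
      case m0: True
      have "leg_coeff 1 0 0 = 0" using leg_coeff_zero[of 0 1 0] by simp
      then have U: "?U = (\<lambda>x. leg_coeff 1 0 1 * (x $ 0) * az_poly 0 s x)"
        unfolding True m0 using axial by (auto simp: m0 True)
      have U2: "?U = (\<lambda>x. (leg_coeff 1 0 1 * (if s = Plus then 1 else 0)) * x $ 0)"
        unfolding U by (cases s) auto
      have "partial i ?U x = (leg_coeff 1 0 1 * (if s = Plus then 1 else 0)) * (if i = 0 then 1 else 0)" for i x
        unfolding U2 by (rule has_partial_imp[OF has_partial_cmult[OF has_partial_coord]])
      then have "vector_form \<sigma> ?U ?U = 0" unfolding vector_form_def using distinct_3 by simp
      then show ?thesis using vec_norm_sq(1)[OF v, of s] pos by (simp add: k_eq)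
    next
      case False
      then have m: "m = 1" using m1 by simp
      have "?U = (\<lambda>x. (- leg_coeff 1 1 0) * az_poly 1 s x)"
        unfolding True using axial by (auto simp: m)
      then have "partial 0 ?U x = (- leg_coeff 1 1 0) * az_partial 0 1 s x" for x
        using has_partial_imp[OF has_partial_cmult[OF az_poly_has_partial]] by metis
      then have "scalar_form \<sigma> ?U ?U = 0" unfolding scalar_form_def az_partial_0 by simp
      then show ?thesis using vec0 by simp
    qed
  qed
  have "(LINT x|?M. (norm (mono_elem \<sigma> k x))\<^sup>2) = ?c * ?c * (scalar_form \<sigma> ?U ?U + vector_form \<sigma> ?U ?U)"
  proof -
    have "scalar_form \<sigma> ?U ?U + vector_form \<sigma> ?U ?U = (LINT x|?M. partial 0 ?U x * partial 0 ?U x + (partial 1 ?U x * partial 1 ?U x + partial 2 ?U x * partial 2 ?U x))"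
      unfolding scalar_form_def vector_form_def
      by (rule Bochner_Integration.integral_add[symmetric]) (intro Bochner_Integration.integrable_add iUU)+
    then show ?thesis
      by (simp only: integral_mult_right_zero[symmetric] mono_elem_def np power2_norm_eq_inner)
        (rule Bochner_Integration.integral_cong, simp_all add: inner_quat algebra_simps)
  qed
  also have "\<dots> \<le> ?c * ?c * (3 * vector_form \<sigma> ?U ?U)"
    using sc by (intro mult_left_mono) auto
  also have "\<dots> = 3" using vec_norm_sq(1)[OF v, of s, symmetric] pos by (simp add: k_eq[symmetric] power2_eq_square)
  finally show "(LINT x|?M. (norm (mono_elem \<sigma> k x))\<^sup>2) \<le> 3" .
qed

text \<open>
  The same duality as in \<open>locally_l2_partial\<close>, now with the estimate of point values by the \<open>L\<^sup>2\<close> norm and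
  with the orthogonality of the full basis functions.
\<close>

lemma npartial_locally_l2: "locally_l2 (basis_index \<sigma>) (dom3 \<sigma>) (npartial \<sigma> i)"
  unfolding locally_l2_def
proof
  let ?M = "lebesgue_on (dom3 \<sigma>)"
  fix x assume x: "x \<in> dom3 \<sigma>"
  obtain d where d: "d > 0" "cball x d \<subseteq> dom3 \<sigma>" using open_dom3 x open_contains_cball by blast
  define C where "C = sup_const / (d/2) ^ 3 * 3"
  have C0: "C \<ge> 0" using sup_const_nonneg d(1) by (simp add: C_def)
  have "(\<Sum>k\<in>J. (npartial \<sigma> i k y)\<^sup>2) \<le> C" if y: "y \<in> cball x (d/2)" and J: "finite J" "J \<subseteq> basis_index \<sigma>" for y J
  proof -
    define a where "a k = npartial \<sigma> i k y" for k
    define A where "A = (\<Sum>k\<in>J. (a k)\<^sup>2)"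
    have A0: "A \<ge> 0" unfolding A_def by (rule sum_nonneg) simp
    \<comment> \<open>the test function with \<open>G y = A\<close>; up to sign it is a component of \<open>E\<close>, which is monogenic\<close>
    define G where "G z = (\<Sum>k\<in>J. a k * npartial \<sigma> i k z)" for z
    define E where "E z = (\<Sum>k\<in>J. a k *\<^sub>R mono_elem \<sigma> k z)" for z
    have EL: "L2fun ?M E" unfolding E_def by (intro L2fun_sum L2fun_scaleR mono_elem_L2) (use J in auto)
    have E3: "(LINT z|?M. (norm (E z))\<^sup>2) \<le> 3 * A"
    proof -
      have "(LINT z|?M. (norm (E z))\<^sup>2) = (\<Sum>k\<in>J. (a k)\<^sup>2 * (LINT z|?M. (norm (mono_elem \<sigma> k z))\<^sup>2))"
        unfolding E_def by (rule orthogonal_sum_norm[OF J(1)]) (use J mono_elem_L2 mono_elem_gram(2) in blast)+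
      also have "\<dots> \<le> (\<Sum>k\<in>J. (a k)\<^sup>2 * 3)" by (intro sum_mono mult_left_mono mono_elem_gram(3)) (use J in auto)
      finally show ?thesis by (simp add: A_def sum_distrib_right[symmetric])
    qed
    have GE: "(G z)\<^sup>2 \<le> (norm (E z))\<^sup>2" for z
    proof -
      have "G z = E z $ 0 \<or> G z = - E z $ 1 \<or> G z = - E z $ 2"
      proof -
        have "i = 0 \<or> i = 1 \<or> i = 2" by (rule exhaust_directions)
        then show ?thesis unfolding G_def E_def mono_elem_def by (auto simp: sum_negf)
      qed
      then have "\<bar>G z\<bar> \<le> norm (E z)" using component_le_norm_cart[of "E z"] by auto
      then show ?thesis by (metis abs_ge_zero power2_abs power_mono)
    qed
    have hG: "smooth_harmonic (dom3 \<sigma>) G" unfolding G_def by (intro harm_sum harm_cmult open_dom3 npartial_facts(1)) (use J in auto)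
    have iG: "integrable ?M (\<lambda>z. (G z)\<^sup>2)"
    proof (rule Bochner_Integration.integrable_bound)
      show "integrable ?M (\<lambda>z. (norm (E z))\<^sup>2)" using EL by (simp add: L2fun_def)
      show "(\<lambda>z. (G z)\<^sup>2) \<in> borel_measurable ?M"
        by (intro borel_dom3_continuous continuous_intros smooth_on_continuous harm_smooth hG)
    qed (use GE in auto)
    have sub: "cball y (d/2) \<subseteq> dom3 \<sigma>"
    proof
      fix z assume "z \<in> cball y (d/2)"
      then have "z \<in> cball x d" using y dist_triangle[of x z y] by (simp add: mem_cball)
      then show "z \<in> dom3 \<sigma>" using d(2) by blast
    qed
    have "(G y)\<^sup>2 \<le> sup_const / (d/2) ^ 3 * (LINT z|?M. (G z)\<^sup>2)"
      using harm_sup_L2[OF open_dom3 sub _ hG integrable_dom3_iff[THEN iffD1, OF iG]] d(1) unfolding integral_dom3_eq by simp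
    also have "\<dots> \<le> sup_const / (d/2) ^ 3 * (3 * A)"
    proof (rule mult_left_mono)
      have "(LINT z|?M. (G z)\<^sup>2) \<le> (LINT z|?M. (norm (E z))\<^sup>2)"
        by (rule integral_mono[OF iG _ GE]) (use EL in \<open>simp add: L2fun_def\<close>)
      then show "(LINT z|?M. (G z)\<^sup>2) \<le> 3 * A" using E3 by linarith
      show "0 \<le> sup_const / (d/2) ^ 3" using sup_const_nonneg d(1) by simp
    qed
    also have "G y = A" by (simp add: G_def A_def a_def power2_eq_square)
    finally have "A * A \<le> C * A" by (simp add: C_def power2_eq_square mult_ac)
    then have "A \<le> C" using A0 C0 by (cases "A = 0") (auto simp: mult_le_cancel_right)
    then show ?thesis by (simp add: A_def a_def)
  qed
  moreover have "d / 2 > 0" "cball x (d/2) \<subseteq> dom3 \<sigma>" using d by auto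
  ultimately show "\<exists>r>0. \<exists>C. cball x r \<subseteq> dom3 \<sigma> \<and> (\<forall>y\<in>cball x r. \<forall>J. finite J \<and> J \<subseteq> basis_index \<sigma> \<longrightarrow> (\<Sum>k\<in>J. (npartial \<sigma> i k y)\<^sup>2) \<le> C)"
    by blast
qed

section \<open>Expansions with square-summable coefficients\<close>

text \<open>
  The monogenic function with coefficients \<open>a\<close>. It is written with scalar series so that the results on
  termwise differentiation apply.
\<close>

definition synthesis :: "side \<Rightarrow> (int \<times> nat \<times> parity \<Rightarrow> real) \<Rightarrow> real^3 \<Rightarrow> quat" where
  "synthesis \<sigma> a x = quat (series (basis_index \<sigma>) a (npartial \<sigma> 0) x)
     (- series (basis_index \<sigma>) a (npartial \<sigma> 1) x) (- series (basis_index \<sigma>) a (npartial \<sigma> 2) x) 0"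

definition coeff_L2 :: "side \<Rightarrow> (real^3 \<Rightarrow> quat) \<Rightarrow> int \<times> nat \<times> parity \<Rightarrow> real" where
  "coeff_L2 \<sigma> f k = (LINT x|lebesgue_on (dom3 \<sigma>). f x \<bullet> qvec (mono_elem \<sigma> k x))"

lemma has_sum_quat:
  assumes "(a has_sum A) I" "(b has_sum B) I" "(c has_sum C) I" "(d has_sum D) I"
  shows "((\<lambda>k. quat (a k) (b k) (c k) (d k)) has_sum quat A B C D) I"
  unfolding quat_def
  by (intro has_sum_add has_sum_bounded_linear[OF bounded_linear_scaleR_left, unfolded o_def] assms)

lemma synthesis_has_sum:
  assumes a: "(\<lambda>k. (a k)\<^sup>2) summable_on basis_index \<sigma>" and x: "x \<in> dom3 \<sigma>"
  shows "((\<lambda>k. a k *\<^sub>R mono_elem \<sigma> k x) has_sum synthesis \<sigma> a x) (basis_index \<sigma>)"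
proof -
  have h: "((\<lambda>k. a k * npartial \<sigma> i k x) has_sum series (basis_index \<sigma>) a (npartial \<sigma> i) x) (basis_index \<sigma>)" for i
    unfolding series_def by (rule has_sum_infsum[OF series_summable[OF a npartial_locally_l2 x]])
  have "((\<lambda>k. quat (a k * npartial \<sigma> 0 k x) (- (a k * npartial \<sigma> 1 k x)) (- (a k * npartial \<sigma> 2 k x)) 0)
      has_sum synthesis \<sigma> a x) (basis_index \<sigma>)"
    unfolding synthesis_def by (intro has_sum_quat h has_sum_0) (auto simp: has_sum_uminus h)
  moreover have "quat (a k * npartial \<sigma> 0 k x) (- (a k * npartial \<sigma> 1 k x)) (- (a k * npartial \<sigma> 2 k x)) 0 = a k *\<^sub>R mono_elem \<sigma> k x" for k
    by (simp add: mono_elem_def quat_eq_iff)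
  ultimately show ?thesis by simp
qed

lemma qvec_synthesis_has_sum:
  assumes a: "(\<lambda>k. (a k)\<^sup>2) summable_on basis_index \<sigma>" and x: "x \<in> dom3 \<sigma>"
  shows "((\<lambda>k. a k *\<^sub>R qvec (mono_elem \<sigma> k x)) has_sum qvec (synthesis \<sigma> a x)) (basis_index \<sigma>)"
proof -
  have "((\<lambda>k. qvec (a k *\<^sub>R mono_elem \<sigma> k x)) has_sum qvec (synthesis \<sigma> a x)) (basis_index \<sigma>)"
    by (rule has_sum_bounded_linear[OF bounded_linear_qvec synthesis_has_sum[OF a x], unfolded o_def])
  moreover have "qvec (c *\<^sub>R p) = c *\<^sub>R qvec p" for c p by (simp add: quat_eq_iff)
  ultimately show ?thesis by simp
qed

lemma synthesis_grad_field:
  assumes a: "(\<lambda>k. (a k)\<^sup>2) summable_on basis_index \<sigma>"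
  shows "grad_field (dom3 \<sigma>) (\<lambda>i. series (basis_index \<sigma>) a (npartial \<sigma> i))"
  unfolding grad_field_def
proof (intro conjI allI ballI)
  let ?I = "basis_index \<sigma>"
  note h = npartial_facts(1) and ll = npartial_locally_l2
  show "smooth_on (dom3 \<sigma>) (series ?I a (npartial \<sigma> i))" for i
    by (rule series_smooth[OF open_dom3 a ll h])
  fix x assume x: "x \<in> dom3 \<sigma>"
  have p: "partial i (series ?I a (npartial \<sigma> j)) x = series ?I a (\<lambda>k. partial i (npartial \<sigma> j k)) x" for i j
    by (rule has_partial_imp[OF series_has_partial[OF open_dom3 a ll h x]])
  show "partial i (series ?I a (npartial \<sigma> j)) x = partial j (series ?I a (npartial \<sigma> i)) x" for i j
    unfolding p series_def by (rule infsum_cong) (simp only: npartial_facts(3)[OF _ x])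
  have s: "(\<lambda>k. a k * partial i (npartial \<sigma> i k) x) summable_on ?I" for i
    by (rule series_summable[OF a locally_l2_partial[OF open_dom3 h ll] x])
  have "(\<Sum>i\<in>UNIV. \<Sum>\<^sub>\<infinity>k\<in>?I. a k * partial i (npartial \<sigma> i k) x) = (\<Sum>\<^sub>\<infinity>k\<in>?I. \<Sum>i\<in>UNIV. a k * partial i (npartial \<sigma> i k) x)"
    unfolding sum_UNIV_3 by (simp only: infsum_add s summable_on_add)
  also have "\<dots> = (\<Sum>\<^sub>\<infinity>k\<in>?I. 0)"
    unfolding sum_distrib_left[symmetric] by (rule infsum_cong) (simp only: npartial_facts(4)[OF _ x] mult_zero_right)
  finally show "(\<Sum>i\<in>UNIV. partial i (series ?I a (npartial \<sigma> i)) x) = 0" unfolding p series_def by simp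
qed

lemma synthesis_monogenic:
  assumes a: "(\<lambda>k. (a k)\<^sup>2) summable_on basis_index \<sigma>"
  shows "synthesis \<sigma> a \<in> monogenic_space \<sigma>"
proof -
  let ?M = "lebesgue_on (dom3 \<sigma>)"
  note gf = synthesis_grad_field[OF a]
  have sm: "smooth_on (dom3 \<sigma>) (synthesis \<sigma> a)"
    unfolding synthesis_def[abs_def]
    by (intro smooth_on_quat open_dom3 smooth_on_const grad_field_smooth[OF gf] smooth_on_bounded_linear[OF open_dom3 bounded_linear_minus[OF bounded_linear_ident]])
  have "vec_field (synthesis \<sigma> a) = (\<lambda>i. series (basis_index \<sigma>) a (npartial \<sigma> i))"
  proof
    fix i :: 3
    have "i = 0 \<or> i = 1 \<or> i = 2" by (rule exhaust_directions)
    then show "vec_field (synthesis \<sigma> a) i = series (basis_index \<sigma>) a (npartial \<sigma> i)"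
      by (auto simp: vec_field_simps synthesis_def fun_eq_iff)
  qed
  then have "\<forall>x\<in>dom3 \<sigma>. dbar (synthesis \<sigma> a) x = 0"
    using monogenic_iff_grad_field[OF open_dom3 sm] gf by (simp add: synthesis_def)
  moreover have "L2fun ?M (synthesis \<sigma> a)"
  proof (rule orthogonal_series_L2(1)[OF countable_basis_index _ _ _ _ a])
    show "synthesis \<sigma> a \<in> borel_measurable ?M" by (rule borel_dom3_continuous[OF smooth_on_continuous[OF sm]])
    show "((\<lambda>k. a k *\<^sub>R mono_elem \<sigma> k x) has_sum synthesis \<sigma> a x) (basis_index \<sigma>)" if "x \<in> space ?M" for x
      using synthesis_has_sum[OF a] that by (simp add: space_dom3)
    show "(LINT x|?M. (norm (mono_elem \<sigma> k x))\<^sup>2) \<le> 3" if "k \<in> basis_index \<sigma>" for k by (rule mono_elem_gram(3)[OF that that])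
  qed (use mono_elem_L2 mono_elem_gram(2) in auto)
  ultimately show ?thesis
    using sm by (simp add: monogenic_space_def monogenic_on_def L2_space_def L2fun_def reduced_quat_def synthesis_def)
qed

lemma monogenic_L2fun: "w \<in> monogenic_space \<sigma> \<Longrightarrow> L2fun (lebesgue_on (dom3 \<sigma>)) w"
  by (rule L2_space_L2fun[of _ _ reduced_quat]) (simp add: monogenic_space_def)

lemma vec_elem_L2: "k \<in> basis_index \<sigma> \<Longrightarrow> L2fun (lebesgue_on (dom3 \<sigma>)) (\<lambda>x. qvec (mono_elem \<sigma> k x))"
  by (rule L2fun_qvec[OF mono_elem_L2])

lemma vec_elem_orthonormal:
  assumes "k \<in> basis_index \<sigma>"
  shows "l \<in> basis_index \<sigma> \<Longrightarrow> k \<noteq> l \<Longrightarrow> (LINT x|lebesgue_on (dom3 \<sigma>). qvec (mono_elem \<sigma> k x) \<bullet> qvec (mono_elem \<sigma> l x)) = 0"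
    "(LINT x|lebesgue_on (dom3 \<sigma>). (norm (qvec (mono_elem \<sigma> k x)))\<^sup>2) = 1"
  using mono_elem_gram(1)[OF assms] assms by (simp_all add: power2_norm_eq_inner)

lemma qvec_synthesis_inner:
  assumes a: "(\<lambda>k. (a k)\<^sup>2) summable_on basis_index \<sigma>" and f: "L2fun (lebesgue_on (dom3 \<sigma>)) f"
  shows "((\<lambda>k. a k * coeff_L2 \<sigma> f k) has_sum (LINT x|lebesgue_on (dom3 \<sigma>). f x \<bullet> qvec (synthesis \<sigma> a x))) (basis_index \<sigma>)"
  unfolding coeff_L2_def
proof (rule orthogonal_series_inner[OF countable_basis_index vec_elem_L2 vec_elem_orthonormal(1) _ _ a _ _ f])
  let ?M = "lebesgue_on (dom3 \<sigma>)"
  show "((\<lambda>k. a k *\<^sub>R qvec (mono_elem \<sigma> k x)) has_sum qvec (synthesis \<sigma> a x)) (basis_index \<sigma>)" if "x \<in> space ?M" for x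
    using qvec_synthesis_has_sum[OF a] that by (simp add: space_dom3)
  show "(\<lambda>x. qvec (synthesis \<sigma> a x)) \<in> borel_measurable ?M"
    using L2fun_qvec[OF monogenic_L2fun[OF synthesis_monogenic[OF a]]] by (simp add: L2fun_def)
  show "(LINT x|?M. (norm (qvec (mono_elem \<sigma> k x)))\<^sup>2) \<le> 1" if "k \<in> basis_index \<sigma>" for k
    using vec_elem_orthonormal(2)[OF that] by simp
qed auto

lemma coeff_L2_summable:
  assumes f: "L2fun (lebesgue_on (dom3 \<sigma>)) f"
  shows "(\<lambda>k. (coeff_L2 \<sigma> f k)\<^sup>2) summable_on basis_index \<sigma>"
proof (rule nonneg_bdd_above_summable_on)
  show "bdd_above (sum (\<lambda>k. (coeff_L2 \<sigma> f k)\<^sup>2) ` {F. F \<subseteq> basis_index \<sigma> \<and> finite F})"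
  proof (rule bdd_aboveI2)
    fix F assume F: "F \<in> {F. F \<subseteq> basis_index \<sigma> \<and> finite F}"
    show "(\<Sum>k\<in>F. (coeff_L2 \<sigma> f k)\<^sup>2) \<le> (LINT x|lebesgue_on (dom3 \<sigma>). (norm (f x))\<^sup>2)"
      unfolding coeff_L2_def
      by (rule Bessel_finite[OF _ f]) (use F vec_elem_L2 vec_elem_orthonormal in blast)+
  qed
qed auto

lemma coeff_L2_synthesis:
  assumes a: "(\<lambda>k. (a k)\<^sup>2) summable_on basis_index \<sigma>" and l: "l \<in> basis_index \<sigma>"
  shows "coeff_L2 \<sigma> (\<lambda>x. qvec (synthesis \<sigma> a x)) l = a l"
proof -
  have "((\<lambda>k. a k * coeff_L2 \<sigma> (\<lambda>x. qvec (mono_elem \<sigma> l x)) k) has_sum coeff_L2 \<sigma> (\<lambda>x. qvec (synthesis \<sigma> a x)) l) (basis_index \<sigma>)"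
    using qvec_synthesis_inner[OF a vec_elem_L2[OF l]] by (simp add: coeff_L2_def inner_commute)
  moreover have "a k * coeff_L2 \<sigma> (\<lambda>x. qvec (mono_elem \<sigma> l x)) k = (if k = l then a l else 0)" if "k \<in> basis_index \<sigma>" for k
    using mono_elem_gram(1)[OF l that] by (simp add: coeff_L2_def)
  ultimately have "((\<lambda>k. if k = l then a l else 0) has_sum coeff_L2 \<sigma> (\<lambda>x. qvec (synthesis \<sigma> a x)) l) (basis_index \<sigma>)"
    by (rule has_sum_cong[THEN iffD1, rotated])
  moreover have "((\<lambda>k. if k = l then a l else 0) has_sum a l) (basis_index \<sigma>)"
    using has_sum_finite_neutralI[of "{l}" "basis_index \<sigma>" "\<lambda>k. if k = l then a l else 0"] l by auto
  ultimately show ?thesis by (rule has_sum_unique)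
qed

lemma coeff_L2_cong:
  assumes "eq_L2 \<sigma> f g" "k \<in> basis_index \<sigma>" "L2fun (lebesgue_on (dom3 \<sigma>)) f" "L2fun (lebesgue_on (dom3 \<sigma>)) g"
  shows "coeff_L2 \<sigma> f k = coeff_L2 \<sigma> g k"
  unfolding coeff_L2_def
proof (rule integral_cong_AE)
  show "AE x in lebesgue_on (dom3 \<sigma>). f x \<bullet> qvec (mono_elem \<sigma> k x) = g x \<bullet> qvec (mono_elem \<sigma> k x)"
    using assms(1) unfolding eq_L2_def by eventually_elim simp
qed (use assms vec_elem_L2[OF assms(2)] L2fun_inner_integrable borel_measurable_integrable in blast)+

section \<open>The Bergman operator\<close>

text \<open>
  By this, \<open>y \<mapsto> B\<^sub>i\<^sub>j(x, y)\<close> is, for fixed \<open>x\<close>, the expansion whose coefficients are the values of the basis at \<open>x\<close>.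
\<close>

lemma vec_basis_l2:
  assumes x: "x \<in> dom3 \<sigma>" and i: "i = 1 \<or> i = 2"
  shows "(\<lambda>k. (qvec (mono_elem \<sigma> k x) $ i)\<^sup>2) summable_on basis_index \<sigma>"
proof -
  obtain i' where i': "\<And>k. (qvec (mono_elem \<sigma> k x) $ i)\<^sup>2 = (npartial \<sigma> i' k x)\<^sup>2"
    using i by (auto simp: mono_elem_def)
  obtain r C where "r > 0" "\<And>y J. y \<in> cball x r \<Longrightarrow> finite J \<Longrightarrow> J \<subseteq> basis_index \<sigma> \<Longrightarrow> (\<Sum>k\<in>J. (npartial \<sigma> i' k y)\<^sup>2) \<le> C"
    using locally_l2E[OF npartial_locally_l2 x] by metis
  then have "(\<Sum>k\<in>J. (npartial \<sigma> i' k x)\<^sup>2) \<le> C" if "finite J" "J \<subseteq> basis_index \<sigma>" for J using that by simp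
  then show ?thesis unfolding i' by (intro nonneg_bdd_above_summable_on bdd_aboveI2[where M = C]) auto
qed

lemma bergman_kernel_eq:
  assumes x: "x \<in> dom3 \<sigma>" and i: "i = 1 \<or> i = 2" and y: "y \<in> dom3 \<sigma>"
  shows "((\<lambda>k. vec_basis \<sigma> k x $ i * vec_basis \<sigma> k y $ j) has_sum
      qvec (synthesis \<sigma> (\<lambda>k. qvec (mono_elem \<sigma> k x) $ i) y) $ j) (basis_index \<sigma>)"
proof -
  have "((\<lambda>k. (qvec (mono_elem \<sigma> k x) $ i *\<^sub>R qvec (mono_elem \<sigma> k y)) $ j) has_sum
      qvec (synthesis \<sigma> (\<lambda>k. qvec (mono_elem \<sigma> k x) $ i) y) $ j) (basis_index \<sigma>)"
    by (rule has_sum_bounded_linear[OF bounded_linear_vec_nth qvec_synthesis_has_sum[OF vec_basis_l2[OF x i] y], unfolded o_def])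
  then show ?thesis
    by (rule has_sum_cong[THEN iffD1, rotated]) (simp add: vec_basis_eq x y)
qed

lemma bergman_integrand:
  assumes x: "x \<in> dom3 \<sigma>" and i: "i = 1 \<or> i = 2" and f: "f \<in> L2_space \<sigma> reduced_vec" and y: "y \<in> dom3 \<sigma>"
  shows "(\<Sum>j\<in>{1, 2}. bergman_kernel \<sigma> i j x y * f y $ j) = f y \<bullet> qvec (synthesis \<sigma> (\<lambda>k. qvec (mono_elem \<sigma> k x) $ i) y)"
proof -
  have "bergman_kernel \<sigma> i j x y = qvec (synthesis \<sigma> (\<lambda>k. qvec (mono_elem \<sigma> k x) $ i) y) $ j" for j
    unfolding bergman_kernel_def by (rule infsumI[OF bergman_kernel_eq[OF x i y]])
  then show ?thesis
    unfolding inner_quat by (simp add: mult.commute)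
qed

lemma bergman_op_well_defined: "bergman_well_defined \<sigma>"
  unfolding bergman_well_defined_def
proof (intro ballI conjI)
  fix x i assume x: "x \<in> dom3 \<sigma>" and "i \<in> {1::4, 2}"
  then have i: "i = 1 \<or> i = 2" by simp
  show "(\<lambda>k. vec_basis \<sigma> k x $ i * vec_basis \<sigma> k y $ j) summable_on basis_index \<sigma>" if "y \<in> dom3 \<sigma>" for y j
    using bergman_kernel_eq[OF x i that] by (rule has_sum_imp_summable)
  fix f assume f: "f \<in> L2_space \<sigma> reduced_vec"
  have "integrable (lebesgue_on (dom3 \<sigma>)) (\<lambda>y. f y \<bullet> qvec (synthesis \<sigma> (\<lambda>k. qvec (mono_elem \<sigma> k x) $ i) y))"
    by (rule L2fun_inner_integrable[OF L2_space_L2fun[OF f] L2fun_qvec[OF monogenic_L2fun[OF synthesis_monogenic[OF vec_basis_l2[OF x i]]]]])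
  then show "integrable (lebesgue_on (dom3 \<sigma>)) (\<lambda>y. \<Sum>j\<in>{1, 2}. bergman_kernel \<sigma> i j x y * f y $ j)"
    by (rule Bochner_Integration.integrable_cong[THEN iffD1, rotated -1])
      (use bergman_integrand[OF x i f] in \<open>simp_all add: space_dom3\<close>)
qed

text \<open>
  Parseval: the coefficients of the kernel are the values of the basis at \<open>x\<close>, so pairing the kernel with \<open>f\<close>
  gives \<open>\<Sum>\<^sub>k \<psi>\<^sub>k(x) \<langle>f, \<psi>\<^sub>k\<rangle>\<close>.
\<close>

lemma bergman_op_eq:
  assumes x: "x \<in> dom3 \<sigma>" and f: "f \<in> L2_space \<sigma> reduced_vec"
  shows "bergman_op \<sigma> f x = qvec (synthesis \<sigma> (coeff_L2 \<sigma> f) x)"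
proof -
  let ?M = "lebesgue_on (dom3 \<sigma>)"
  note fL = L2_space_L2fun[OF f]
  have "(LINT y|?M. (\<Sum>j\<in>{1, 2}. bergman_kernel \<sigma> i j x y * f y $ j)) = qvec (synthesis \<sigma> (coeff_L2 \<sigma> f) x) $ i"
    if i: "i = 1 \<or> i = 2" for i
  proof -
    let ?a = "\<lambda>k. qvec (mono_elem \<sigma> k x) $ i"
    have eq: "(LINT y|?M. (\<Sum>j\<in>{1, 2}. bergman_kernel \<sigma> i j x y * f y $ j)) = (LINT y|?M. f y \<bullet> qvec (synthesis \<sigma> ?a y))"
      by (rule Bochner_Integration.integral_cong) (use bergman_integrand[OF x i f] in \<open>simp_all add: space_dom3\<close>)
    have one: "((\<lambda>k. ?a k * coeff_L2 \<sigma> f k) has_sum (LINT y|?M. f y \<bullet> qvec (synthesis \<sigma> ?a y))) (basis_index \<sigma>)"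
      by (rule qvec_synthesis_inner[OF vec_basis_l2[OF x i] fL])
    have "((\<lambda>k. (coeff_L2 \<sigma> f k *\<^sub>R qvec (mono_elem \<sigma> k x)) $ i) has_sum qvec (synthesis \<sigma> (coeff_L2 \<sigma> f) x) $ i) (basis_index \<sigma>)"
      by (rule has_sum_bounded_linear[OF bounded_linear_vec_nth qvec_synthesis_has_sum[OF coeff_L2_summable[OF fL] x], unfolded o_def])
    then have two: "((\<lambda>k. ?a k * coeff_L2 \<sigma> f k) has_sum qvec (synthesis \<sigma> (coeff_L2 \<sigma> f) x) $ i) (basis_index \<sigma>)"
      by (simp only: vector_scaleR_component real_scaleR_def mult.commute)
    show ?thesis unfolding eq by (rule has_sum_unique[OF one two])
  qed
  then have "bergman_op \<sigma> f x = (\<Sum>i\<in>{1, 2}. synthesis \<sigma> (coeff_L2 \<sigma> f) x $ i *\<^sub>R unitq i)"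
    unfolding bergman_op_def by (intro sum.cong refl arg_cong2[where f = scaleR]) auto
  then show ?thesis by (simp add: qvec_def)
qed

lemma solid_harmonic_degree_0: "solid_harmonic 0 0 s x = solid_harmonic 0 0 s 0"
  using solid_harmonic_polynomial[of 0 0 s x] solid_harmonic_polynomial[of 0 0 s 0] by (cases s) auto

lemma solid_harmonic_Minus_0: "solid_harmonic N 0 Minus x = 0"
  by (simp add: solid_harmonic_def)

text \<open>
  A solid harmonic that gives no basis function either is constant or has a gradient whose last two
  components vanish on the domain, so the orthogonality required by \<open>gradient_field_complete\<close> holds trivially for it.
\<close>

lemma monogenic_vec_complete:
  assumes w: "w \<in> monogenic_space \<sigma>" and c: "\<And>k. k \<in> basis_index \<sigma> \<Longrightarrow> coeff_L2 \<sigma> (\<lambda>x. qvec (w x)) k = 0"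
    and x: "x \<in> dom3 \<sigma>"
  shows "qvec (w x) = 0"
proof -
  let ?M = "lebesgue_on (dom3 \<sigma>)"
  have orth: "(LINT x|?M. vec_field w 1 x * partial 1 b x + vec_field w 2 x * partial 2 b x) = 0" if "b \<in> solid_basis \<sigma>" for b
  proof -
    obtain N m s where b: "b = solid_harmonic N m s" and N: "N \<ge> 0 \<longleftrightarrow> \<sigma> = Interior" "m \<le> leg_degree N"
      using \<open>b \<in> solid_basis \<sigma>\<close> unfolding solid_basis_def by blast
    have const: ?thesis if "\<And>x. b x = b 0"
    proof -
      have "partial i b x = 0" for i x
        using has_partial_imp[OF has_partial_const[of i "b 0" x]] that by (metis ext)
      then show ?thesis by simp
    qed
    show ?thesis
    proof (cases "N = 0 \<or> m = 0 \<and> s = Minus")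
      case True
      moreover have "m = 0" if "N = 0" using N(2) that by (simp add: leg_degree_def)
      ultimately have "b x = b 0" for x
        unfolding b using solid_harmonic_degree_0[of s x] solid_harmonic_Minus_0 by (metis)
      then show ?thesis by (rule const)
    next
      case False
      define k where "k = (N - 1, m, s)"
      have v: "valid_index \<sigma> (N - 1) m"
        using N False unfolding valid_index_def leg_degree_def by (cases \<sigma>) auto
      have eq: "monogenic_basis (N - 1) m s x = quat (partial 0 b x) (- partial 1 b x) (- partial 2 b x) 0" if "x \<in> dom3 \<sigma>" for x
        using monogenic_basis_eq[OF v that, of s] by (simp add: b)
      show ?thesis
      proof (cases "k \<in> basis_index \<sigma>")
        case True
        have "vec_field w 1 x * partial 1 b x + vec_field w 2 x * partial 2 b x = vec_norm \<sigma> k * (qvec (w x) \<bullet> qvec (mono_elem \<sigma> k x))" for x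
          using vec_norm_pos[OF True]
          by (simp add: inner_quat vec_field_simps mono_elem_def k_def b del: vec_norm.simps) (simp add: field_simps del: vec_norm.simps)
        then show ?thesis using c[OF True] by (simp add: coeff_L2_def del: vec_norm.simps)
      next
        case nk: False
        have "qvec (monogenic_basis (N - 1) m s x) = 0" if "x \<in> dom3 \<sigma>" for x
          using nk False v that by (auto simp: k_def basis_index_def valid_index_def)
        then have "partial 1 b x = 0 \<and> partial 2 b x = 0" if "x \<in> dom3 \<sigma>" for x
          using eq[OF that] that by (simp add: quat_eq_iff)
        then have "(LINT x|?M. vec_field w 1 x * partial 1 b x + vec_field w 2 x * partial 2 b x) = (LINT x|?M. 0)"
          by (intro Bochner_Integration.integral_cong) (auto simp: space_dom3)
        then show ?thesis by simp
      qed
    qed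
  qed
  have "integrable ?M (\<lambda>x. (vec_field w j x)\<^sup>2)" for j
    using L2fun_nth(3)[OF monogenic_L2fun[OF w]] by (cases "j = 0"; cases "j = 1") (simp_all add: vec_field_def)
  note * = gradient_field_complete[OF monogenic_space_grad_field[OF w] this orth x]
  show ?thesis using *[unfolded vec_field_simps] by (simp add: quat_eq_iff)
qed

lemma monogenic_space_linear:
  assumes u: "u \<in> monogenic_space \<sigma>" and v: "v \<in> monogenic_space \<sigma>"
  shows "(\<lambda>x. a *\<^sub>R u x + b *\<^sub>R v x) \<in> monogenic_space \<sigma>"
proof -
  let ?w = "\<lambda>x. a *\<^sub>R u x + b *\<^sub>R v x"
  have L: "L2fun (lebesgue_on (dom3 \<sigma>)) ?w" by (intro L2fun_add L2fun_scaleR monogenic_L2fun u v)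
  have s: "smooth_on (dom3 \<sigma>) u" "smooth_on (dom3 \<sigma>) v" and r: "\<And>x. x \<in> dom3 \<sigma> \<Longrightarrow> u x $ 3 = 0 \<and> v x $ 3 = 0"
    and d: "\<And>x. x \<in> dom3 \<sigma> \<Longrightarrow> dbar u x = 0 \<and> dbar v x = 0"
    using u v by (auto simp: monogenic_space_def monogenic_on_def reduced_quat_def)
  have s': "smooth_on (dom3 \<sigma>) (\<lambda>x. a *\<^sub>R u x)" "smooth_on (dom3 \<sigma>) (\<lambda>x. b *\<^sub>R v x)"
    by (intro smooth_on_bounded_linear[OF open_dom3 bounded_linear_scaleR_right] s)+
  have p: "partial i ?w x = a *\<^sub>R partial i u x + b *\<^sub>R partial i v x" if "x \<in> dom3 \<sigma>" for i x
    using partial_add[OF s' that] partial_bounded_linear[OF bounded_linear_scaleR_right s(1) that]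
      partial_bounded_linear[OF bounded_linear_scaleR_right s(2) that] by metis
  have "dbar ?w x = a *\<^sub>R dbar u x + b *\<^sub>R dbar v x" if "x \<in> dom3 \<sigma>" for x
    unfolding dbar_def p[OF that] by (simp add: qmult_def quat_eq_iff algebra_simps)
  then show ?thesis
    using L r d smooth_on_add[OF open_dom3 s']
    by (auto simp: monogenic_space_def monogenic_on_def L2_space_def L2fun_def reduced_quat_def)
qed

text \<open>
  The difference of both sides is the vector part of a monogenic function with zero coefficients.
\<close>

lemma vec_monogenic_reproduce:
  assumes w: "w \<in> monogenic_space \<sigma>" and x: "x \<in> dom3 \<sigma>"
  shows "qvec (synthesis \<sigma> (coeff_L2 \<sigma> (\<lambda>x. qvec (w x))) x) = qvec (w x)"
proof -
  let ?M = "lebesgue_on (dom3 \<sigma>)"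
  define d where "d = coeff_L2 \<sigma> (\<lambda>x. qvec (w x))"
  have Lw: "L2fun ?M (\<lambda>x. qvec (w x))" by (rule L2fun_qvec[OF monogenic_L2fun[OF w]])
  have d2: "(\<lambda>k. (d k)\<^sup>2) summable_on basis_index \<sigma>" unfolding d_def by (rule coeff_L2_summable[OF Lw])
  have Ls: "L2fun ?M (\<lambda>x. qvec (synthesis \<sigma> d x))" by (rule L2fun_qvec[OF monogenic_L2fun[OF synthesis_monogenic[OF d2]]])
  let ?u = "\<lambda>x. 1 *\<^sub>R w x + (-1) *\<^sub>R synthesis \<sigma> d x"
  have u: "?u \<in> monogenic_space \<sigma>" by (rule monogenic_space_linear[OF w synthesis_monogenic[OF d2]])
  have qu: "qvec (?u x) = qvec (w x) - qvec (synthesis \<sigma> d x)" for x by (simp add: quat_eq_iff)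
  have "coeff_L2 \<sigma> (\<lambda>x. qvec (?u x)) k = 0" if k: "k \<in> basis_index \<sigma>" for k
  proof -
    have "coeff_L2 \<sigma> (\<lambda>x. qvec (?u x)) k = coeff_L2 \<sigma> (\<lambda>x. qvec (w x)) k - coeff_L2 \<sigma> (\<lambda>x. qvec (synthesis \<sigma> d x)) k"
      unfolding qu coeff_L2_def inner_diff_left
      by (rule Bochner_Integration.integral_diff) (intro L2fun_inner_integrable Lw Ls vec_elem_L2[OF k])+
    then show ?thesis using coeff_L2_synthesis[OF d2 k] by (simp add: d_def)
  qed
  from monogenic_vec_complete[OF u this x] show ?thesis unfolding qu by (simp add: d_def)
qed

lemma bergman_op_L2:
  assumes f: "f \<in> L2_space \<sigma> reduced_vec"
  shows "bergman_op \<sigma> f \<in> L2_space \<sigma> reduced_vec"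
proof -
  have "L2fun (lebesgue_on (dom3 \<sigma>)) (\<lambda>x. qvec (synthesis \<sigma> (coeff_L2 \<sigma> f) x))"
    by (rule L2fun_qvec[OF monogenic_L2fun[OF synthesis_monogenic[OF coeff_L2_summable[OF L2_space_L2fun[OF f]]]]])
  then have "L2fun (lebesgue_on (dom3 \<sigma>)) (bergman_op \<sigma> f)"
    by (rule L2fun_cong[THEN iffD1, rotated]) (simp add: space_dom3 bergman_op_eq[OF _ f])
  then show ?thesis using bergman_op_eq[OF _ f] by (simp add: L2_space_def L2fun_def qvec_reduced)
qed

lemma bergman_op_mem:
  assumes f: "f \<in> L2_space \<sigma> reduced_vec"
  shows "mem_L2 \<sigma> (bergman_op \<sigma> f) (vec_monogenic_space \<sigma>)"
proof -
  have "synthesis \<sigma> (coeff_L2 \<sigma> f) \<in> monogenic_space \<sigma>" by (rule synthesis_monogenic[OF coeff_L2_summable[OF L2_space_L2fun[OF f]]])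
  moreover have "eq_L2 \<sigma> (bergman_op \<sigma> f) (\<lambda>x. qvec (synthesis \<sigma> (coeff_L2 \<sigma> f) x))"
    unfolding eq_L2_def by (rule AE_I2) (simp add: space_dom3 bergman_op_eq[OF _ f])
  ultimately show ?thesis unfolding mem_L2_def vec_monogenic_space_def by blast
qed

lemma vec_monogenic_L2:
  assumes "v \<in> vec_monogenic_space \<sigma>" shows "v \<in> L2_space \<sigma> reduced_vec"
  using assms L2fun_qvec[OF monogenic_L2fun] by (auto simp: vec_monogenic_space_def L2_space_def L2fun_def qvec_reduced)

lemma reduced_vec_3: "f \<in> L2_space \<sigma> reduced_vec \<Longrightarrow> x \<in> dom3 \<sigma> \<Longrightarrow> f x $ 0 = 0 \<and> f x $ 3 = 0"
  by (auto simp: L2_space_def reduced_vec_iff)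

lemma bergman_op_orthogonal:
  assumes f: "f \<in> L2_space \<sigma> reduced_vec" and w: "w \<in> monogenic_space \<sigma>"
  shows "inner_L2 \<sigma> (\<lambda>x. f x - bergman_op \<sigma> f x) (\<lambda>x. qvec (w x)) = 0"
proof -
  let ?M = "lebesgue_on (dom3 \<sigma>)"
  define g where "g x = f x - bergman_op \<sigma> f x" for x
  define d where "d = coeff_L2 \<sigma> (\<lambda>x. qvec (w x))"
  note fL = L2_space_L2fun[OF f] and BL = L2_space_L2fun[OF bergman_op_L2[OF f]]
  have gL: "L2fun ?M g" unfolding g_def by (rule L2fun_diff[OF fL BL])
  have d2: "(\<lambda>k. (d k)\<^sup>2) summable_on basis_index \<sigma>" unfolding d_def by (rule coeff_L2_summable[OF L2fun_qvec[OF monogenic_L2fun[OF w]]])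
  have g0: "coeff_L2 \<sigma> g k = 0" if k: "k \<in> basis_index \<sigma>" for k
  proof -
    have "coeff_L2 \<sigma> g k = coeff_L2 \<sigma> f k - coeff_L2 \<sigma> (bergman_op \<sigma> f) k"
      unfolding g_def coeff_L2_def inner_diff_left
      by (rule Bochner_Integration.integral_diff) (intro L2fun_inner_integrable fL BL vec_elem_L2[OF k])+
    also have "coeff_L2 \<sigma> (bergman_op \<sigma> f) k = coeff_L2 \<sigma> (\<lambda>x. qvec (synthesis \<sigma> (coeff_L2 \<sigma> f) x)) k"
      unfolding coeff_L2_def[of \<sigma> "bergman_op \<sigma> f"] coeff_L2_def[of \<sigma> "\<lambda>x. qvec (synthesis \<sigma> (coeff_L2 \<sigma> f) x)"]
      by (rule Bochner_Integration.integral_cong) (simp_all add: space_dom3 bergman_op_eq[OF _ f])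
    also have "\<dots> = coeff_L2 \<sigma> f k" by (rule coeff_L2_synthesis[OF coeff_L2_summable[OF fL] k])
    finally show ?thesis by simp
  qed
  have "((\<lambda>k. d k * coeff_L2 \<sigma> g k) has_sum (LINT x|?M. g x \<bullet> qvec (synthesis \<sigma> d x))) (basis_index \<sigma>)"
    by (rule qvec_synthesis_inner[OF d2 gL])
  moreover have "((\<lambda>k. d k * coeff_L2 \<sigma> g k) has_sum 0) (basis_index \<sigma>)" by (rule has_sum_0) (simp add: g0)
  ultimately have "(LINT x|?M. g x \<bullet> qvec (synthesis \<sigma> d x)) = 0" by (rule has_sum_unique)
  moreover have "(LINT x|?M. g x \<bullet> qvec (synthesis \<sigma> d x)) = (LINT x|?M. g x \<bullet> qvec (w x))"
    by (rule Bochner_Integration.integral_cong) (simp_all add: space_dom3 d_def vec_monogenic_reproduce[OF w])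
  ultimately show ?thesis unfolding g_def by (subst inner_L2_eq) auto
qed

text \<open>
  The coefficients depend only on the class of \<open>f\<close> in \<open>L\<^sup>2\<close>, so the equation holds at every point of the domain
  although the hypothesis holds almost everywhere.
\<close>

lemma bergman_op_vec_monogenic:
  assumes w: "w \<in> monogenic_space \<sigma>" and f: "f \<in> L2_space \<sigma> reduced_vec" and e: "eq_L2 \<sigma> f (\<lambda>x. qvec (w x))" and x: "x \<in> dom3 \<sigma>"
  shows "bergman_op \<sigma> f x = qvec (w x)"
proof -
  have "coeff_L2 \<sigma> f k = coeff_L2 \<sigma> (\<lambda>x. qvec (w x)) k" if "k \<in> basis_index \<sigma>" for k
    by (rule coeff_L2_cong[OF e that L2_space_L2fun[OF f] L2fun_qvec[OF monogenic_L2fun[OF w]]])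
  then have "series (basis_index \<sigma>) (coeff_L2 \<sigma> f) g = series (basis_index \<sigma>) (coeff_L2 \<sigma> (\<lambda>x. qvec (w x))) g" for g
    unfolding series_def fun_eq_iff by (intro allI infsum_cong) simp
  then have "synthesis \<sigma> (coeff_L2 \<sigma> f) = synthesis \<sigma> (coeff_L2 \<sigma> (\<lambda>x. qvec (w x)))" unfolding synthesis_def fun_eq_iff by simp
  then show ?thesis using bergman_op_eq[OF x f] vec_monogenic_reproduce[OF w x] by simp
qed

lemma bergman_op_fixed_iff:
  assumes f: "f \<in> L2_space \<sigma> reduced_vec"
  shows "eq_L2 \<sigma> (bergman_op \<sigma> f) f \<longleftrightarrow> mem_L2 \<sigma> f (vec_monogenic_space \<sigma>)"
proof
  assume e: "eq_L2 \<sigma> (bergman_op \<sigma> f) f"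
  obtain v where v: "v \<in> vec_monogenic_space \<sigma>" "eq_L2 \<sigma> (bergman_op \<sigma> f) v" using bergman_op_mem[OF f] by (auto simp: mem_L2_def)
  have "eq_L2 \<sigma> f v" using e v(2) unfolding eq_L2_def by eventually_elim simp
  then show "mem_L2 \<sigma> f (vec_monogenic_space \<sigma>)" using v(1) by (auto simp: mem_L2_def)
next
  assume "mem_L2 \<sigma> f (vec_monogenic_space \<sigma>)"
  then obtain w where w: "w \<in> monogenic_space \<sigma>" and e: "eq_L2 \<sigma> f (\<lambda>x. qvec (w x))"
    by (auto simp: mem_L2_def vec_monogenic_space_def)
  have "AE x in lebesgue_on (dom3 \<sigma>). bergman_op \<sigma> f x = qvec (w x)"
    by (rule AE_I2) (simp add: space_dom3 bergman_op_vec_monogenic[OF w f e])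
  then show "eq_L2 \<sigma> (bergman_op \<sigma> f) f" using e unfolding eq_L2_def by eventually_elim simp
qed

lemma bergman_op_projection:
  "orthogonal_projection_onto \<sigma> (L2_space \<sigma> reduced_vec) (vec_monogenic_space \<sigma>) (bergman_op \<sigma>)"
  unfolding orthogonal_projection_onto_def
proof (intro conjI ballI allI subsetI)
  fix u v :: "real^3 \<Rightarrow> quat" and a b :: real
  assume "u \<in> vec_monogenic_space \<sigma>" "v \<in> vec_monogenic_space \<sigma>"
  then obtain u' v' where *: "u = (\<lambda>x. qvec (u' x))" "v = (\<lambda>x. qvec (v' x))" "u' \<in> monogenic_space \<sigma>" "v' \<in> monogenic_space \<sigma>"
    by (auto simp: vec_monogenic_space_def)
  have "(\<lambda>x. a *\<^sub>R u x + b *\<^sub>R v x) = (\<lambda>x. qvec (a *\<^sub>R u' x + b *\<^sub>R v' x))" unfolding * qvec_linear ..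
  then show "(\<lambda>x. a *\<^sub>R u x + b *\<^sub>R v x) \<in> vec_monogenic_space \<sigma>"
    unfolding vec_monogenic_space_def
    by (intro CollectI exI[of _ "\<lambda>x. a *\<^sub>R u' x + b *\<^sub>R v' x"] conjI monogenic_space_linear[OF *(3,4)])
next
  fix v assume v: "v \<in> vec_monogenic_space \<sigma>"
  then show vL: "v \<in> L2_space \<sigma> reduced_vec" by (rule vec_monogenic_L2)
  have "mem_L2 \<sigma> v (vec_monogenic_space \<sigma>)" using v by (auto simp: mem_L2_def eq_L2_def)
  then show "\<exists>f\<in>L2_space \<sigma> reduced_vec. eq_L2 \<sigma> (bergman_op \<sigma> f) v" using bergman_op_fixed_iff[OF vL] vL by blast
next
  fix f v assume "f \<in> L2_space \<sigma> reduced_vec" "v \<in> vec_monogenic_space \<sigma>"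
  then show "inner_L2 \<sigma> (\<lambda>x. f x - bergman_op \<sigma> f x) v = 0"
    using bergman_op_orthogonal by (auto simp: vec_monogenic_space_def)
qed (auto intro: bergman_op_L2 bergman_op_mem)

text \<open>
  Against a conjugate of a monogenic function only the sign of the vector part changes, so for such \<open>f\<close> being
  contragenic means \<open>f \<bottom> V\<close>. One direction uses \<open>f - B f \<bottom> V\<close>; for the other, \<open>B f\<close> itself lies in \<open>V\<close>, so
  \<open>\<parallel>B f\<parallel>\<^sup>2 = \<langle>f, B f\<rangle> = 0\<close>.
\<close>

lemma bergman_op_kernel_iff:
  assumes f: "f \<in> L2_space \<sigma> reduced_vec" and h: "harmonic_on (dom3 \<sigma>) f"
  shows "eq_L2 \<sigma> (bergman_op \<sigma> f) (\<lambda>x. 0) \<longleftrightarrow> f \<in> contragenic_space \<sigma>"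
proof -
  let ?M = "lebesgue_on (dom3 \<sigma>)" and ?B = "bergman_op \<sigma> f"
  note fL = L2_space_L2fun[OF f] and BL = L2_space_L2fun[OF bergman_op_L2[OF f]]
  have split: "(LINT x|?M. f x \<bullet> qvec (w x)) = (LINT x|?M. ?B x \<bullet> qvec (w x))" if w: "w \<in> monogenic_space \<sigma>" for w
  proof -
    have wL: "L2fun ?M (\<lambda>x. qvec (w x))" by (rule L2fun_qvec[OF monogenic_L2fun[OF w]])
    have "0 = (LINT x|?M. (f x - ?B x) \<bullet> qvec (w x))"
      using bergman_op_orthogonal[OF f w] by (subst (asm) inner_L2_eq) auto
    also have "\<dots> = (LINT x|?M. f x \<bullet> qvec (w x)) - (LINT x|?M. ?B x \<bullet> qvec (w x))"
      unfolding inner_diff_left by (rule Bochner_Integration.integral_diff) (intro L2fun_inner_integrable fL BL wL)+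
    finally show ?thesis by simp
  qed
  have pair: "inner_L2 \<sigma> f (\<lambda>x. g x + qconj (w x)) = (LINT x|?M. f x \<bullet> qvec (g x)) - (LINT x|?M. f x \<bullet> qvec (w x))"
    if g: "g \<in> monogenic_space \<sigma>" and w: "w \<in> monogenic_space \<sigma>" for g w
  proof -
    have "inner_L2 \<sigma> f (\<lambda>x. g x + qconj (w x)) = (LINT x|?M. f x \<bullet> (g x + qconj (w x)))"
      by (rule inner_L2_eq) (use reduced_vec_3[OF f] in auto)
    also have "\<dots> = (LINT x|?M. f x \<bullet> qvec (g x) - f x \<bullet> qvec (w x))"
      by (rule Bochner_Integration.integral_cong)
        (use reduced_vec_3[OF f] in \<open>auto simp: space_dom3 inner_quat qconj_def algebra_simps\<close>)
    also have "\<dots> = (LINT x|?M. f x \<bullet> qvec (g x)) - (LINT x|?M. f x \<bullet> qvec (w x))"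
      by (rule Bochner_Integration.integral_diff)
        (intro L2fun_inner_integrable fL L2fun_qvec monogenic_L2fun g w)+
    finally show ?thesis .
  qed
  show ?thesis
  proof
    assume e: "eq_L2 \<sigma> ?B (\<lambda>x. 0)"
    have z: "(LINT x|?M. f x \<bullet> qvec (w x)) = 0" if w: "w \<in> monogenic_space \<sigma>" for w
    proof -
      have "AE x in ?M. ?B x \<bullet> qvec (w x) = 0" using e unfolding eq_L2_def by eventually_elim simp
      then show ?thesis unfolding split[OF w] by (rule integral_eq_zero_AE)
    qed
    have "f \<in> L2_space \<sigma> reduced_quat"
      using f by (auto simp: L2_space_def reduced_vec_iff reduced_quat_def)
    then show "f \<in> contragenic_space \<sigma>"
      using h pair z by (auto simp: contragenic_space_def conj_monogenic_space_def)
  next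
    assume c: "f \<in> contragenic_space \<sigma>"
    define w where "w = synthesis \<sigma> (coeff_L2 \<sigma> f)"
    have w: "w \<in> monogenic_space \<sigma>" unfolding w_def by (rule synthesis_monogenic[OF coeff_L2_summable[OF fL]])
    have 0: "(\<lambda>x. 0) \<in> monogenic_space \<sigma>" using monogenic_space_linear[OF w w, of 0 0] by simp
    have conj: "(\<lambda>x. qconj 0) \<in> conj_monogenic_space \<sigma>"
      unfolding conj_monogenic_space_def by (intro CollectI exI[of _ "\<lambda>x. 0"] conjI refl 0)
    have "\<forall>g\<in>monogenic_space \<sigma>. \<forall>h\<in>conj_monogenic_space \<sigma>. inner_L2 \<sigma> f (\<lambda>x. g x + h x) = 0"
      using c by (simp add: contragenic_space_def)
    from bspec[OF bspec[OF this w] conj] have "inner_L2 \<sigma> f (\<lambda>x. w x + qconj 0) = 0" .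
    moreover have "qvec 0 = 0" by (simp add: quat_eq_iff)
    ultimately have "(LINT x|?M. f x \<bullet> qvec (w x)) = 0" using pair[OF w 0] by simp
    then have "0 = (LINT x|?M. ?B x \<bullet> qvec (w x))" using split[OF w] by simp
    also have "\<dots> = (LINT x|?M. (norm (?B x))\<^sup>2)"
      by (rule Bochner_Integration.integral_cong) (simp_all add: space_dom3 w_def bergman_op_eq[OF _ f] power2_norm_eq_inner)
    finally have "AE x in ?M. (norm (?B x))\<^sup>2 = 0"
      using integral_nonneg_eq_0_iff_AE[of ?M "\<lambda>x. (norm (?B x))\<^sup>2"] BL by (simp add: L2fun_def)
    then show "eq_L2 \<sigma> ?B (\<lambda>x. 0)" unfolding eq_L2_def by eventually_elim simp
  qed
qed

theorem proposition9:
  fixes \<sigma> :: side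
  shows "bergman_well_defined \<sigma> \<and>
    orthogonal_projection_onto \<sigma> (L2_space \<sigma> reduced_vec) (vec_monogenic_space \<sigma>) (bergman_op \<sigma>) \<and>
    (\<forall>f\<in>L2_space \<sigma> reduced_vec.
       eq_L2 \<sigma> (bergman_op \<sigma> f) f \<longleftrightarrow> mem_L2 \<sigma> f (vec_monogenic_space \<sigma>)) \<and>
    (\<forall>f\<in>L2_space \<sigma> reduced_vec. harmonic_on (dom3 \<sigma>) f \<longrightarrow>
       (eq_L2 \<sigma> (bergman_op \<sigma> f) (\<lambda>x. 0) \<longleftrightarrow> f \<in> contragenic_space \<sigma>))"
  using bergman_op_well_defined bergman_op_projection bergman_op_fixed_iff bergman_op_kernel_iff by blast

end
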